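(* Let $A\in\mathrm{obj}(\mathcal C)$. The hypercohomology construction $(\widehat{\mathcal{E}xt}_{\mathcal C}^\bullet(A,-),\widehat\Delta^\bullet)$ forms a Mislin completion of $(\mathrm{Ext}_{\mathcal C}^\bullet(A,-),\delta^\bullet)$. More specifically, $$\sigma^\bullet=\vartheta^\bullet\circ\zeta^\bullet:\ (\widehat{\mathrm{Ext}}_{\mathcal C}^\bullet(A,-),\widehat\delta^\bullet)\to(\mathcal{E}xt_{Res,\mathcal C}^\bullet(A,-),\widetilde\Delta^\bullet)\to(\widehat{\mathcal{E}xt}_{\mathcal C}^\bullet(A,-),\widehat\Delta^\bullet)$$ is an isomorphism of cohomological functors.
   Context: $\mathcal C$ is an abelian category with enough projectives. A cohomological functor $(T^\bullet,\delta^\bullet):\mathcal C\to\mathbf{Ab}$ is a family of additive functors $(T^n)_{n\in\mathbb Z}$ with natural connecting homomorphisms for short exact sequences giving long exact sequences; morphisms are natural transformations commuting with connecting homomorphisms. A Mislin completion of $T^\bullet$ is a cohomological functor $\widehat T^\bullet$ with a morphism $\nu^\bullet:T^\bullet\to\widehat T^\bullet$ such that $\widehat T^\bullet$ vanishes on projectives in all degrees and every morphism from $T^\bullet$ to a cohomological functor vanishing on projectives factors uniquely through $\nu^\bullet$. $\mathrm{Ext}^n_{\mathcal C}=0$ for $n<0$. Each object $M$ has a projective resolution $(M_\bullet,\partial_\bullet)$, regarded as a complex with $M_k=0$ for $k<0$; syzygies $\widetilde M_0=M$, $\widetilde M_k=\mathrm{Ker}(M_{k-1}\to\widetilde M_{k-1})$.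 $M_\bullet^{+k}$ is the projective resolution of $\widetilde M_k$ with $M_m^{+k}=M_{m+k}$ for $m\ge0$ (and the differentials of $M_\bullet$). Constructions using different resolutions are identified through lifts of identities. Let $(A_\bullet,a_\bullet)$, $(B_\bullet,b_\bullet)$ be such resolutions, $n\in\mathbb Z$, and $A[n]_k=A_{k+n}$ with differential $(-1)^na_{k+n}$. A chain map (resp. almost chain map) $\varphi:A[n]_\bullet\to B_\bullet$ is a family $\varphi_j:A_{n+j}\to B_j$, $j\in\mathbb Z$, with $b_j\varphi_j=(-1)^n\varphi_{j-1}a_{n+j}$ for all (resp. all but finitely many) $j$. It is nullhomotopic (resp. nullhomotopic as an almost chain map) if there are $e_j:A_{n+j}\to B_{j+1}$ with $\varphi_j=e_{j-1}\circ(-1)^na_{n+j}+b_{j+1}\circ e_j$ for all (resp. all but finitely many) $j$. $\mathcal{E}xt_{\mathcal C}^n(A,B)$ (resp. $\widehat{\mathcal{E}xt}_{\mathcal C}^n(A,B)$) is the group of chain maps (resp. almost chain maps) $A[n]_\bullet\to B_\bullet$ modulo nullhomotopic ones. (Equivalently $\widehat{\mathcal{E}xt}^n_{\mathcal C}(A,B)$ is the $n$-th cohomology of the Vogel complex $\prod_k\mathrm{Hom}_{\mathcal C}(A_{k+n},B_k)/\bigoplus_k\mathrm{Hom}_{\mathcal C}(A_{k+n},B_k)$.) A morphism $f:B\to C$ induces homomorphisms by composing with a chain map $f_\bullet:B_\bullet\to C_\bullet$ lifting $f$. Connecting homomorphisms: for $0\to B\to C\to D\to0$ exact let $h:D_0\to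 C$ lift $\mathrm{id}_D$, $h^*:\widetilde D_1\to B$ the induced morphism, and $(h^*_m:D_{m+1}\to B_m)_{m\ge0}$ a chain map $D_\bullet^{+1}\to B_\bullet$ lifting $h^*$. $\Delta^n:\mathcal{E}xt_{\mathcal C}^n(A,D)\to\mathcal{E}xt_{\mathcal C}^{n+1}(A,B)$ sends the class of $\varphi$ to the class of the family with $m$-th component $(-1)^{n+m}h_m^*\circ\varphi_{m+1}:A_{n+1+m}\to B_m$ for $m\ge0$ and $0$ for $m<0$; $\widehat\Delta^n:\widehat{\mathcal{E}xt}_{\mathcal C}^n(A,D)\to\widehat{\mathcal{E}xt}_{\mathcal C}^{n+1}(A,B)$ is defined by the same formula. For $0\to\widetilde D_1\to D_0\to D\to0$ one takes $h^*=\mathrm{id}$. Resolution constructions: $\widehat{\mathrm{Ext}}_{\mathcal C}^n(A,B)=\varinjlim_{k\in\mathbb N_0}(\mathrm{Ext}_{\mathcal C}^{n+k}(A,\widetilde B_k),\delta^{n+k})$ and $\mathcal{E}xt_{Res,\mathcal C}^n(A,B)=\varinjlim_{k\in\mathbb N_0}(\mathcal{E}xt_{\mathcal C}^{n+k}(A,\widetilde B_k),\Delta^{n+k})$, using the sequences $0\to\widetilde B_{k+1}\to B_k\to\widetilde B_k\to0$; induced maps are the limits of those of lifts $\widetilde f_k:\widetilde B_k\to\widetilde C_k$; connecting homomorphisms are $\widehat\delta^n=\varinjlim_k(-1)^k\delta^{n+k}$ and $\widetilde\Delta^n=\varinjlim_k(-1)^k\Delta^{n+k}$ for the syzygy sequences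 $0\to\widetilde B_k\to\widetilde C_k\to\widetilde D_k\to0$ obtained from the Horseshoe Lemma. The former is a Mislin completion of $\mathrm{Ext}_{\mathcal C}^\bullet(A,-)$. $\zeta_n:\mathrm{Ext}_{\mathcal C}^n(A,B)\to\mathcal{E}xt_{\mathcal C}^n(A,B)$ ($n\ge0$; $\zeta_n=0$ for $n<0$) sends the class of $\varphi\in\mathrm{Ker}(\mathrm{Hom}_{\mathcal C}(a_{n+1},B))$ to the class of a chain map $\varphi[n]_\bullet:A[n]_\bullet\to B_\bullet$ (zero in negative degrees) with $b\circ\varphi[n]_0=\varphi$, where $b:B_0\to B$ is the augmentation. $\zeta^n=\varinjlim_k\zeta_{n+k}$. $\vartheta^n(B):\mathcal{E}xt_{Res,\mathcal C}^n(A,B)\to\widehat{\mathcal{E}xt}_{\mathcal C}^n(A,B)$ is the direct limit over the even indices $2k$ (with transition maps $\Delta^{n+2k+1}\circ\Delta^{n+2k}$) of the homomorphisms $\mathcal{E}xt_{\mathcal C}^{n+2k}(A,\widetilde B_{2k})\to\widehat{\mathcal{E}xt}_{\mathcal C}^n(A,B)$ sending the class of $\varphi:A[n+2k]_\bullet\to B_\bullet^{+2k}$ to the class of the almost chain map $\Phi$ with $\Phi_m=\varphi_{m-2k}:A_{n+m}\to B_m$ for $m\ge2k$ and $\Phi_m=0$ for $m<2k$. The morphism $\mathrm{Ext}_{\mathcal C}^\bullet(A,-)\to\widehat{\mathcal{E}xt}_{\mathcal C}^\bullet(A,-)$ of the Mislin completion is the composite of the canonical morphism to $\widehat{\mathrm{Ext}}_{\mathcal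 C}^\bullet(A,-)$ with $\sigma^\bullet$. *)

theory Defs
  imports "HOL-Algebra.Coset"
begin

text \<open>
  Throughout, a construction on equivalence classes that involves auxiliary choices
  (representatives, lifts, chain maps, horseshoe resolutions) is written as
  \<open>the_elem\<close> of the set of all results, over all admissible choices.  It is therefore the
  common value of all choices; no particular choice is built in.
\<close>

section \<open>Abelian categories\<close>

text \<open>
  Morphisms carry their domain and codomain, so the sets of morphisms between different
  pairs of objects are disjoint.  Composition \<open>g \<cdot> f\<close> means \<open>g\<close> after \<open>f\<close>.
\<close>

record ('o, 'm) category_data =
  Obj :: "'o set"
  Arr :: "'m set"
  Dom :: "'m \<Rightarrow> 'o"
  Cod :: "'m \<Rightarrow> 'o"
  ident :: "'o \<Rightarrow> 'm"
  compose :: "'m \<Rightarrow> 'm \<Rightarrow> 'm" (infixl "\<cdot>\<index>" 70)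
  madd :: "'m \<Rightarrow> 'm \<Rightarrow> 'm"
  mzero :: "'o \<Rightarrow> 'o \<Rightarrow> 'm"

definition Hom :: "('o, 'm) category_data \<Rightarrow> 'o \<Rightarrow> 'o \<Rightarrow> 'm set" where
  "Hom C a b = {f \<in> Arr C. Dom C f = a \<and> Cod C f = b}"

text \<open>Abelian groups are commutative groups of HOL-Algebra, hence in multiplicative notation.\<close>

definition Hom_grp :: "('o, 'm) category_data \<Rightarrow> 'o \<Rightarrow> 'o \<Rightarrow> 'm monoid" where
  "Hom_grp C a b = \<lparr>carrier = Hom C a b, mult = madd C, one = mzero C a b\<rparr>"

text \<open>\<open>msign C n f\<close> is \<open>(-1)\<^sup>n f\<close>.\<close>

definition msign :: "('o, 'm) category_data \<Rightarrow> int \<Rightarrow> 'm \<Rightarrow> 'm" where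
  "msign C n f = (if even n then f else inv\<^bsub>Hom_grp C (Dom C f) (Cod C f)\<^esub> f)"

definition zero_object :: "('o, 'm) category_data \<Rightarrow> 'o \<Rightarrow> bool" where
  "zero_object C z \<longleftrightarrow> z \<in> Obj C \<and>
     (\<forall>a\<in>Obj C. (\<exists>!f. f \<in> Hom C z a) \<and> (\<exists>!f. f \<in> Hom C a z))"

definition monic :: "('o, 'm) category_data \<Rightarrow> 'm \<Rightarrow> bool" where
  "monic C f \<longleftrightarrow> f \<in> Arr C \<and>
     (\<forall>x\<in>Obj C. \<forall>g\<in>Hom C x (Dom C f). \<forall>h\<in>Hom C x (Dom C f).
        f \<cdot>\<^bsub>C\<^esub> g = f \<cdot>\<^bsub>C\<^esub> h \<longrightarrow> g = h)"

definition epic :: "('o, 'm) category_data \<Rightarrow> 'm \<Rightarrow> bool" where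
  "epic C f \<longleftrightarrow> f \<in> Arr C \<and>
     (\<forall>x\<in>Obj C. \<forall>g\<in>Hom C (Cod C f) x. \<forall>h\<in>Hom C (Cod C f) x.
        g \<cdot>\<^bsub>C\<^esub> f = h \<cdot>\<^bsub>C\<^esub> f \<longrightarrow> g = h)"

definition is_kernel :: "('o, 'm) category_data \<Rightarrow> 'm \<Rightarrow> 'm \<Rightarrow> bool" where
  "is_kernel C f k \<longleftrightarrow> f \<in> Arr C \<and> k \<in> Arr C \<and> Cod C k = Dom C f \<and>
     f \<cdot>\<^bsub>C\<^esub> k = mzero C (Dom C k) (Cod C f) \<and>
     (\<forall>x\<in>Obj C. \<forall>h\<in>Hom C x (Dom C f). f \<cdot>\<^bsub>C\<^esub> h = mzero C x (Cod C f) \<longrightarrow>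
        (\<exists>!u. u \<in> Hom C x (Dom C k) \<and> k \<cdot>\<^bsub>C\<^esub> u = h))"

definition is_cokernel :: "('o, 'm) category_data \<Rightarrow> 'm \<Rightarrow> 'm \<Rightarrow> bool" where
  "is_cokernel C f q \<longleftrightarrow> f \<in> Arr C \<and> q \<in> Arr C \<and> Dom C q = Cod C f \<and>
     q \<cdot>\<^bsub>C\<^esub> f = mzero C (Dom C f) (Cod C q) \<and>
     (\<forall>x\<in>Obj C. \<forall>h\<in>Hom C (Cod C f) x. h \<cdot>\<^bsub>C\<^esub> f = mzero C (Dom C f) x \<longrightarrow>
        (\<exists>!u. u \<in> Hom C (Cod C q) x \<and> u \<cdot>\<^bsub>C\<^esub> q = h))"

locale abelian_category =
  fixes C :: "('o, 'm) category_data" (structure)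
  assumes Dom_Obj: "f \<in> Arr C \<Longrightarrow> Dom C f \<in> Obj C"
    and Cod_Obj: "f \<in> Arr C \<Longrightarrow> Cod C f \<in> Obj C"
    and ident_Hom: "a \<in> Obj C \<Longrightarrow> ident C a \<in> Hom C a a"
    and compose_Hom: "\<lbrakk>f \<in> Hom C a b; g \<in> Hom C b c\<rbrakk> \<Longrightarrow> g \<cdot> f \<in> Hom C a c"
    and compose_assoc: "\<lbrakk>f \<in> Hom C a b; g \<in> Hom C b c; h \<in> Hom C c d\<rbrakk>
          \<Longrightarrow> (h \<cdot> g) \<cdot> f = h \<cdot> (g \<cdot> f)"
    and ident_left: "f \<in> Hom C a b \<Longrightarrow> ident C b \<cdot> f = f"
    and ident_right: "f \<in> Hom C a b \<Longrightarrow> f \<cdot> ident C a = f"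
    and Hom_comm_group: "\<lbrakk>a \<in> Obj C; b \<in> Obj C\<rbrakk> \<Longrightarrow> comm_group (Hom_grp C a b)"
    and compose_madd: "\<lbrakk>f \<in> Hom C a b; f' \<in> Hom C a b; g \<in> Hom C b c\<rbrakk>
          \<Longrightarrow> g \<cdot> madd C f f' = madd C (g \<cdot> f) (g \<cdot> f')"
    and madd_compose: "\<lbrakk>f \<in> Hom C a b; g \<in> Hom C b c; g' \<in> Hom C b c\<rbrakk>
          \<Longrightarrow> madd C g g' \<cdot> f = madd C (g \<cdot> f) (g' \<cdot> f)"
    and ex_zero_object: "\<exists>z. zero_object C z"
    and ex_biproduct: "\<lbrakk>a \<in> Obj C; b \<in> Obj C\<rbrakk> \<Longrightarrow>
          \<exists>s\<in>Obj C. \<exists>i\<in>Hom C a s. \<exists>j\<in>Hom C b s. \<exists>p\<in>Hom C s a. \<exists>q\<in>Hom C s b.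
            p \<cdot> i = ident C a \<and> q \<cdot> j = ident C b \<and>
            p \<cdot> j = mzero C b a \<and> q \<cdot> i = mzero C a b \<and>
            madd C (i \<cdot> p) (j \<cdot> q) = ident C s"
    and ex_kernel: "f \<in> Arr C \<Longrightarrow> \<exists>k. is_kernel C f k"
    and ex_cokernel: "f \<in> Arr C \<Longrightarrow> \<exists>q. is_cokernel C f q"
    and monic_is_kernel: "monic C f \<Longrightarrow> \<exists>g. is_kernel C g f"
    and epic_is_cokernel: "epic C f \<Longrightarrow> \<exists>g. is_cokernel C g f"

definition short_exact :: "('o, 'm) category_data \<Rightarrow> 'm \<Rightarrow> 'm \<Rightarrow> bool" where
  "short_exact C f g \<longleftrightarrow> is_kernel C g f \<and> is_cokernel C f g"

definition projective :: "('o, 'm) category_data \<Rightarrow> 'o \<Rightarrow> bool" where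
  "projective C P \<longleftrightarrow> P \<in> Obj C \<and>
     (\<forall>e. epic C e \<longrightarrow>
        (\<forall>g\<in>Hom C P (Cod C e). \<exists>h\<in>Hom C P (Dom C e). e \<cdot>\<^bsub>C\<^esub> h = g))"

definition enough_projectives :: "('o, 'm) category_data \<Rightarrow> bool" where
  "enough_projectives C \<longleftrightarrow>
     (\<forall>a\<in>Obj C. \<exists>P e. projective C P \<and> epic C e \<and> e \<in> Hom C P a)"

section \<open>Cohomological functors and Mislin completions\<close>

text \<open>
  \<open>coh_conn T n f g\<close> is the connecting homomorphism \<open>T\<^sup>n(D) \<rightarrow> T\<^sup>n\<^sup>+\<^sup>1(B)\<close> of the short exact
  sequence given by \<open>f : B \<rightarrow> E\<close> and \<open>g : E \<rightarrow> D\<close>.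
\<close>

record ('o, 'm, 'g) coh_functor_data =
  coh_grp :: "int \<Rightarrow> 'o \<Rightarrow> 'g monoid"
  coh_map :: "int \<Rightarrow> 'm \<Rightarrow> 'g \<Rightarrow> 'g"
  coh_conn :: "int \<Rightarrow> 'm \<Rightarrow> 'm \<Rightarrow> 'g \<Rightarrow> 'g"

definition additive_functor ::
    "('o, 'm) category_data \<Rightarrow> ('o \<Rightarrow> 'g monoid) \<Rightarrow> ('m \<Rightarrow> 'g \<Rightarrow> 'g) \<Rightarrow> bool" where
  "additive_functor C G T \<longleftrightarrow>
     (\<forall>a\<in>Obj C. comm_group (G a)) \<and>
     (\<forall>f\<in>Arr C. T f \<in> hom (G (Dom C f)) (G (Cod C f))) \<and>
     (\<forall>a\<in>Obj C. \<forall>x\<in>carrier (G a). T (ident C a) x = x) \<and>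
     (\<forall>f\<in>Arr C. \<forall>g\<in>Arr C. Dom C g = Cod C f \<longrightarrow>
        (\<forall>x\<in>carrier (G (Dom C f)). T (g \<cdot>\<^bsub>C\<^esub> f) x = T g (T f x))) \<and>
     (\<forall>a\<in>Obj C. \<forall>b\<in>Obj C. \<forall>f\<in>Hom C a b. \<forall>g\<in>Hom C a b. \<forall>x\<in>carrier (G a).
        T (madd C f g) x = T f x \<otimes>\<^bsub>G b\<^esub> T g x)"

definition exact_at ::
    "'g monoid \<Rightarrow> ('g \<Rightarrow> 'g) \<Rightarrow> 'g monoid \<Rightarrow> ('g \<Rightarrow> 'g) \<Rightarrow> 'g monoid \<Rightarrow> bool" where
  "exact_at G u H v K \<longleftrightarrow> u ` carrier G = {y \<in> carrier H. v y = \<one>\<^bsub>K\<^esub>}"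

definition coh_functor ::
    "('o, 'm) category_data \<Rightarrow> ('o, 'm, 'g) coh_functor_data \<Rightarrow> bool" where
  "coh_functor C T \<longleftrightarrow>
     (\<forall>n. additive_functor C (coh_grp T n) (coh_map T n)) \<and>
     (\<forall>n f g. short_exact C f g \<longrightarrow>
        coh_conn T n f g \<in> hom (coh_grp T n (Cod C g)) (coh_grp T (n + 1) (Dom C f))) \<and>
     (\<forall>n f g f' g' a b c. short_exact C f g \<and> short_exact C f' g' \<and>
        a \<in> Hom C (Dom C f) (Dom C f') \<and> b \<in> Hom C (Cod C f) (Cod C f') \<and>
        c \<in> Hom C (Cod C g) (Cod C g') \<and>
        b \<cdot>\<^bsub>C\<^esub> f = f' \<cdot>\<^bsub>C\<^esub> a \<and> c \<cdot>\<^bsub>C\<^esub> g = g' \<cdot>\<^bsub>C\<^esub> b \<longrightarrow>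
        (\<forall>x\<in>carrier (coh_grp T n (Cod C g)).
           coh_map T (n + 1) a (coh_conn T n f g x) = coh_conn T n f' g' (coh_map T n c x))) \<and>
     (\<forall>n f g. short_exact C f g \<longrightarrow>
        exact_at (coh_grp T n (Dom C f)) (coh_map T n f) (coh_grp T n (Cod C f))
                 (coh_map T n g) (coh_grp T n (Cod C g)) \<and>
        exact_at (coh_grp T n (Cod C f)) (coh_map T n g) (coh_grp T n (Cod C g))
                 (coh_conn T n f g) (coh_grp T (n + 1) (Dom C f)) \<and>
        exact_at (coh_grp T n (Cod C g)) (coh_conn T n f g) (coh_grp T (n + 1) (Dom C f))
                 (coh_map T (n + 1) f) (coh_grp T (n + 1) (Cod C f)))"

definition coh_morphism ::
    "('o, 'm) category_data \<Rightarrow> ('o, 'm, 'g) coh_functor_data \<Rightarrow> ('o, 'm, 'h) coh_functor_data \<Rightarrow>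
     (int \<Rightarrow> 'o \<Rightarrow> 'g \<Rightarrow> 'h) \<Rightarrow> bool" where
  "coh_morphism C T U \<tau> \<longleftrightarrow>
     coh_functor C T \<and> coh_functor C U \<and>
     (\<forall>n. \<forall>a\<in>Obj C. \<tau> n a \<in> hom (coh_grp T n a) (coh_grp U n a)) \<and>
     (\<forall>n. \<forall>f\<in>Arr C. \<forall>x\<in>carrier (coh_grp T n (Dom C f)).
        \<tau> n (Cod C f) (coh_map T n f x) = coh_map U n f (\<tau> n (Dom C f) x)) \<and>
     (\<forall>n f g. short_exact C f g \<longrightarrow> (\<forall>x\<in>carrier (coh_grp T n (Cod C g)).
        \<tau> (n + 1) (Dom C f) (coh_conn T n f g x) = coh_conn U n f g (\<tau> n (Cod C g) x)))"

text \<open>Equality of morphisms: group elements outside the carriers are irrelevant.\<close>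

definition coh_eq ::
    "('o, 'm) category_data \<Rightarrow> ('o, 'm, 'g) coh_functor_data \<Rightarrow>
     (int \<Rightarrow> 'o \<Rightarrow> 'g \<Rightarrow> 'h) \<Rightarrow> (int \<Rightarrow> 'o \<Rightarrow> 'g \<Rightarrow> 'h) \<Rightarrow> bool" where
  "coh_eq C T \<sigma> \<tau> \<longleftrightarrow> (\<forall>n. \<forall>a\<in>Obj C. \<forall>x\<in>carrier (coh_grp T n a). \<sigma> n a x = \<tau> n a x)"

definition coh_comp ::
    "(int \<Rightarrow> 'o \<Rightarrow> 'h \<Rightarrow> 'k) \<Rightarrow> (int \<Rightarrow> 'o \<Rightarrow> 'g \<Rightarrow> 'h) \<Rightarrow> (int \<Rightarrow> 'o \<Rightarrow> 'g \<Rightarrow> 'k)" where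
  "coh_comp \<tau> \<sigma> = (\<lambda>n a x. \<tau> n a (\<sigma> n a x))"

definition coh_isomorphism ::
    "('o, 'm) category_data \<Rightarrow> ('o, 'm, 'g) coh_functor_data \<Rightarrow> ('o, 'm, 'h) coh_functor_data \<Rightarrow>
     (int \<Rightarrow> 'o \<Rightarrow> 'g \<Rightarrow> 'h) \<Rightarrow> bool" where
  "coh_isomorphism C T U \<tau> \<longleftrightarrow> coh_morphism C T U \<tau> \<and>
     (\<exists>\<rho>. coh_morphism C U T \<rho> \<and>
        coh_eq C T (coh_comp \<rho> \<tau>) (\<lambda>n a x. x) \<and> coh_eq C U (coh_comp \<tau> \<rho>) (\<lambda>n a x. x))"

definition vanishes_on_projectives ::
    "('o, 'm) category_data \<Rightarrow> ('o, 'm, 'g) coh_functor_data \<Rightarrow> bool" where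
  "vanishes_on_projectives C T \<longleftrightarrow>
     (\<forall>n P. projective C P \<longrightarrow> carrier (coh_grp T n P) = {\<one>\<^bsub>coh_grp T n P\<^esub>})"

text \<open>
  HOL cannot quantify over types inside a formula.  The type \<open>'u\<close> of the elements of the groups
  of the test functors is therefore a parameter; a statement that leaves it a type variable
  covers test functors with values in abelian groups over arbitrary types.
\<close>

definition mislin_completion ::
    "'u itself \<Rightarrow> ('o, 'm) category_data \<Rightarrow> ('o, 'm, 'g) coh_functor_data \<Rightarrow>
     ('o, 'm, 'h) coh_functor_data \<Rightarrow> (int \<Rightarrow> 'o \<Rightarrow> 'g \<Rightarrow> 'h) \<Rightarrow> bool" where
  "mislin_completion (_ :: 'u itself) C T T' \<nu> \<longleftrightarrow>
     coh_morphism C T T' \<nu> \<and> vanishes_on_projectives C T' \<and>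
     (\<forall>(U :: ('o, 'm, 'u) coh_functor_data) \<mu>.
        coh_morphism C T U \<mu> \<and> vanishes_on_projectives C U \<longrightarrow>
        (\<exists>\<tau>. coh_morphism C T' U \<tau> \<and> coh_eq C T (coh_comp \<tau> \<nu>) \<mu>) \<and>
        (\<forall>\<tau> \<tau>'. coh_morphism C T' U \<tau> \<and> coh_eq C T (coh_comp \<tau> \<nu>) \<mu> \<and>
                 coh_morphism C T' U \<tau>' \<and> coh_eq C T (coh_comp \<tau>' \<nu>) \<mu> \<longrightarrow>
                 coh_eq C T' \<tau> \<tau>'))"

section \<open>Projective resolutions and syzygies\<close>

text \<open>
  A resolution comes with its syzygies \<open>syz R k\<close>, the inclusions
  \<open>syz_in R k : syz R (k+1) \<rightarrow> M\<^sub>k\<close> and the projections \<open>syz_pr R k : M\<^sub>k \<rightarrow> syz R k\<close>;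
  \<open>syz_pr R 0\<close> is the augmentation.  Exactness of the augmented complex is expressed by the
  factorisation of each differential through short exact sequences
  \<open>0 \<rightarrow> syz R (k+1) \<rightarrow> M\<^sub>k \<rightarrow> syz R k \<rightarrow> 0\<close>.
\<close>

record ('o, 'm) resolution =
  cx :: "int \<Rightarrow> 'o"
  diff :: "int \<Rightarrow> 'm"
  syz :: "nat \<Rightarrow> 'o"
  syz_in :: "nat \<Rightarrow> 'm"
  syz_pr :: "nat \<Rightarrow> 'm"

definition proj_resolution ::
    "('o, 'm) category_data \<Rightarrow> 'o \<Rightarrow> ('o, 'm) resolution \<Rightarrow> bool" where
  "proj_resolution C M R \<longleftrightarrow>
     syz R 0 = M \<and>
     (\<forall>k<0. zero_object C (cx R k)) \<and>
     (\<forall>k\<ge>0. projective C (cx R k)) \<and>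
     (\<forall>k. diff R k \<in> Hom C (cx R k) (cx R (k - 1))) \<and>
     (\<forall>k. syz_in R k \<in> Hom C (syz R (Suc k)) (cx R (int k))) \<and>
     (\<forall>k. syz_pr R k \<in> Hom C (cx R (int k)) (syz R k)) \<and>
     (\<forall>k. short_exact C (syz_in R k) (syz_pr R k)) \<and>
     (\<forall>k. diff R (int (Suc k)) = syz_in R k \<cdot>\<^bsub>C\<^esub> syz_pr R (Suc k))"

text \<open>The resolution \<open>M\<^sup>+\<^sup>k\<close> of the syzygy \<open>syz R k\<close>.\<close>

definition shift_res ::
    "('o, 'm) category_data \<Rightarrow> nat \<Rightarrow> ('o, 'm) resolution \<Rightarrow> ('o, 'm) resolution" where
  "shift_res C k R =
     \<lparr>cx = (\<lambda>m. if m \<ge> 0 then cx R (m + int k) else cx R m),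
      diff = (\<lambda>m. if m \<ge> 1 then diff R (m + int k)
                  else if m = 0 then mzero C (cx R (int k)) (cx R (- 1)) else diff R m),
      syz = (\<lambda>j. syz R (j + k)),
      syz_in = (\<lambda>j. syz_in R (j + k)),
      syz_pr = (\<lambda>j. syz_pr R (j + k))\<rparr>"

definition lifts ::
    "('o, 'm) category_data \<Rightarrow> ('o, 'm) resolution \<Rightarrow> ('o, 'm) resolution \<Rightarrow> 'm \<Rightarrow>
     (int \<Rightarrow> 'm) \<Rightarrow> bool" where
  "lifts C R S f u \<longleftrightarrow>
     (\<forall>j. u j \<in> Hom C (cx R j) (cx S j)) \<and>
     (\<forall>j. diff S j \<cdot>\<^bsub>C\<^esub> u j = u (j - 1) \<cdot>\<^bsub>C\<^esub> diff R j) \<and>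
     syz_pr S 0 \<cdot>\<^bsub>C\<^esub> u 0 = f \<cdot>\<^bsub>C\<^esub> syz_pr R 0"

text \<open>\<open>v k : syz R k \<rightarrow> syz S k\<close> are the maps induced on syzygies by a chain map \<open>u\<close> lifting \<open>f\<close>.\<close>

definition syz_lifts ::
    "('o, 'm) category_data \<Rightarrow> ('o, 'm) resolution \<Rightarrow> ('o, 'm) resolution \<Rightarrow> 'm \<Rightarrow>
     (int \<Rightarrow> 'm) \<Rightarrow> (nat \<Rightarrow> 'm) \<Rightarrow> bool" where
  "syz_lifts C R S f u v \<longleftrightarrow> lifts C R S f u \<and> v 0 = f \<and>
     (\<forall>k. v (Suc k) \<in> Hom C (syz R (Suc k)) (syz S (Suc k)) \<and>
          syz_in S k \<cdot>\<^bsub>C\<^esub> v (Suc k) = u (int k) \<cdot>\<^bsub>C\<^esub> syz_in R k)"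

text \<open>
  \<open>i k\<close> and \<open>p k\<close> form a sequence \<open>0 \<rightarrow> syz R k \<rightarrow> syz H k \<rightarrow> syz S k \<rightarrow> 0\<close> obtained from the
  Horseshoe Lemma for the short exact sequence \<open>f, g\<close> and the resolutions \<open>R\<close>, \<open>S\<close> of its ends:
  \<open>H\<close> is a resolution of the middle term fitting into a degreewise short exact (hence split)
  sequence of complexes.
\<close>

definition horseshoe_syz ::
    "('o, 'm) category_data \<Rightarrow> ('o, 'm) resolution \<Rightarrow> ('o, 'm) resolution \<Rightarrow> 'm \<Rightarrow> 'm \<Rightarrow>
     (nat \<Rightarrow> 'm) \<Rightarrow> (nat \<Rightarrow> 'm) \<Rightarrow> bool" where
  "horseshoe_syz C R S f g i p \<longleftrightarrow>
     (\<exists>H u w. proj_resolution C (Cod C f) H \<and>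
        syz_lifts C R H f u i \<and> syz_lifts C H S g w p \<and>
        (\<forall>m\<ge>0. short_exact C (u m) (w m)))"

section \<open>Ext\<close>

text \<open>\<open>R\<close> is a projective resolution of the first argument.\<close>

definition Ext_cocycles ::
    "('o, 'm) category_data \<Rightarrow> ('o, 'm) resolution \<Rightarrow> int \<Rightarrow> 'o \<Rightarrow> 'm set" where
  "Ext_cocycles C R n B =
     {\<phi> \<in> Hom C (cx R n) B. \<phi> \<cdot>\<^bsub>C\<^esub> diff R (n + 1) = mzero C (cx R (n + 1)) B}"

definition Ext_coboundaries ::
    "('o, 'm) category_data \<Rightarrow> ('o, 'm) resolution \<Rightarrow> int \<Rightarrow> 'o \<Rightarrow> 'm set" where
  "Ext_coboundaries C R n B = (\<lambda>\<psi>. \<psi> \<cdot>\<^bsub>C\<^esub> diff R n) ` Hom C (cx R (n - 1)) B"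

text \<open>For \<open>n < 0\<close> this is the trivial group because \<open>cx R n\<close> is a zero object.\<close>

definition Ext_grp ::
    "('o, 'm) category_data \<Rightarrow> ('o, 'm) resolution \<Rightarrow> int \<Rightarrow> 'o \<Rightarrow> 'm set monoid" where
  "Ext_grp C R n B =
     (Hom_grp C (cx R n) B)\<lparr>carrier := Ext_cocycles C R n B\<rparr> Mod Ext_coboundaries C R n B"

definition Ext_class ::
    "('o, 'm) category_data \<Rightarrow> ('o, 'm) resolution \<Rightarrow> int \<Rightarrow> 'o \<Rightarrow> 'm \<Rightarrow> 'm set" where
  "Ext_class C R n B \<phi> = Ext_coboundaries C R n B #>\<^bsub>Hom_grp C (cx R n) B\<^esub> \<phi>"

definition Ext_map ::
    "('o, 'm) category_data \<Rightarrow> ('o, 'm) resolution \<Rightarrow> int \<Rightarrow> 'm \<Rightarrow> 'm set \<Rightarrow> 'm set" where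
  "Ext_map C R n f X = the_elem {Ext_class C R n (Cod C f) (f \<cdot>\<^bsub>C\<^esub> \<phi>) | \<phi>. \<phi> \<in> X}"

definition Ext_conn ::
    "('o, 'm) category_data \<Rightarrow> ('o, 'm) resolution \<Rightarrow> int \<Rightarrow> 'm \<Rightarrow> 'm \<Rightarrow> 'm set \<Rightarrow> 'm set" where
  "Ext_conn C R n f g X = the_elem {Ext_class C R (n + 1) (Dom C f) \<chi> | \<chi> \<psi> \<phi>.
     \<phi> \<in> X \<and> \<psi> \<in> Hom C (cx R n) (Dom C g) \<and> g \<cdot>\<^bsub>C\<^esub> \<psi> = \<phi> \<and>
     \<chi> \<in> Hom C (cx R (n + 1)) (Dom C f) \<and> f \<cdot>\<^bsub>C\<^esub> \<chi> = \<psi> \<cdot>\<^bsub>C\<^esub> diff R (n + 1)}"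

section \<open>Hypercohomology: chain maps and almost chain maps modulo homotopy\<close>

text \<open>
  The filter \<open>F\<close> on degrees distinguishes the two variants: \<open>F = every_degree\<close> means ``for all \<open>j\<close>''
  and gives chain maps, \<open>F = cofinite\<close> means ``for all but finitely many \<open>j\<close>'' and gives
  almost chain maps.  \<open>R\<close> and \<open>S\<close> are the resolutions of the two arguments.
\<close>

abbreviation every_degree :: "int filter" where
  "every_degree \<equiv> Orderings.top_class.top"

definition degree_maps ::
    "('o, 'm) category_data \<Rightarrow> int \<Rightarrow> ('o, 'm) resolution \<Rightarrow> ('o, 'm) resolution \<Rightarrow>
     (int \<Rightarrow> 'm) set" where
  "degree_maps C n R S = {\<phi>. \<forall>j. \<phi> j \<in> Hom C (cx R (n + j)) (cx S j)}"

definition degree_grp ::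
    "('o, 'm) category_data \<Rightarrow> int \<Rightarrow> ('o, 'm) resolution \<Rightarrow> ('o, 'm) resolution \<Rightarrow>
     (int \<Rightarrow> 'm) monoid" where
  "degree_grp C n R S =
     \<lparr>carrier = degree_maps C n R S,
      mult = (\<lambda>\<phi> \<psi> j. madd C (\<phi> j) (\<psi> j)),
      one = (\<lambda>j. mzero C (cx R (n + j)) (cx S j))\<rparr>"

definition chain_maps ::
    "('o, 'm) category_data \<Rightarrow> int filter \<Rightarrow> int \<Rightarrow> ('o, 'm) resolution \<Rightarrow> ('o, 'm) resolution \<Rightarrow>
     (int \<Rightarrow> 'm) set" where
  "chain_maps C F n R S = {\<phi> \<in> degree_maps C n R S.
     eventually (\<lambda>j. diff S j \<cdot>\<^bsub>C\<^esub> \<phi> j = msign C n (\<phi> (j - 1) \<cdot>\<^bsub>C\<^esub> diff R (n + j))) F}"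

definition null_maps ::
    "('o, 'm) category_data \<Rightarrow> int filter \<Rightarrow> int \<Rightarrow> ('o, 'm) resolution \<Rightarrow> ('o, 'm) resolution \<Rightarrow>
     (int \<Rightarrow> 'm) set" where
  "null_maps C F n R S = {\<phi> \<in> degree_maps C n R S.
     \<exists>e. (\<forall>j. e j \<in> Hom C (cx R (n + j)) (cx S (j + 1))) \<and>
         eventually (\<lambda>j. \<phi> j = madd C (e (j - 1) \<cdot>\<^bsub>C\<^esub> msign C n (diff R (n + j)))
                                      (diff S (j + 1) \<cdot>\<^bsub>C\<^esub> e j)) F}"

definition hyper_grp ::
    "('o, 'm) category_data \<Rightarrow> int filter \<Rightarrow> int \<Rightarrow> ('o, 'm) resolution \<Rightarrow> ('o, 'm) resolution \<Rightarrow>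
     (int \<Rightarrow> 'm) set monoid" where
  "hyper_grp C F n R S =
     (degree_grp C n R S)\<lparr>carrier := chain_maps C F n R S\<rparr> Mod null_maps C F n R S"

definition hyper_class ::
    "('o, 'm) category_data \<Rightarrow> int filter \<Rightarrow> int \<Rightarrow> ('o, 'm) resolution \<Rightarrow> ('o, 'm) resolution \<Rightarrow>
     (int \<Rightarrow> 'm) \<Rightarrow> (int \<Rightarrow> 'm) set" where
  "hyper_class C F n R S \<phi> = null_maps C F n R S #>\<^bsub>degree_grp C n R S\<^esub> \<phi>"

text \<open>The map induced by \<open>f\<close>, where \<open>S\<close> and \<open>S'\<close> resolve the domain and codomain of \<open>f\<close>.\<close>

definition hyper_map ::
    "('o, 'm) category_data \<Rightarrow> int filter \<Rightarrow> int \<Rightarrow> ('o, 'm) resolution \<Rightarrow> ('o, 'm) resolution \<Rightarrow>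
     ('o, 'm) resolution \<Rightarrow> 'm \<Rightarrow> (int \<Rightarrow> 'm) set \<Rightarrow> (int \<Rightarrow> 'm) set" where
  "hyper_map C F n R S S' f X =
     the_elem {hyper_class C F n R S' (\<lambda>j. u j \<cdot>\<^bsub>C\<^esub> \<phi> j) | u \<phi>. lifts C S S' f u \<and> \<phi> \<in> X}"

text \<open>
  The connecting homomorphism of the short exact sequence \<open>f, g\<close>; \<open>S\<close> resolves \<open>Dom C f\<close> and
  \<open>Q\<close> resolves \<open>Cod C g\<close>.  Here \<open>h : Q\<^sub>0 \<rightarrow> Dom C g\<close> lifts the identity, \<open>h1\<close> is the induced
  map on the first syzygy and \<open>hs\<close> is a chain map lifting \<open>h1\<close>.  Degree \<open>0\<close> of
  \<open>shift_res C 1 Q\<close> is degree \<open>1\<close> of \<open>Q\<close>, so \<open>hs m : Q\<^sub>m\<^sub>+\<^sub>1 \<rightarrow> S\<^sub>m\<close> for \<open>m \<ge> 0\<close>.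
\<close>

definition hyper_conn ::
    "('o, 'm) category_data \<Rightarrow> int filter \<Rightarrow> int \<Rightarrow> ('o, 'm) resolution \<Rightarrow> ('o, 'm) resolution \<Rightarrow>
     ('o, 'm) resolution \<Rightarrow> 'm \<Rightarrow> 'm \<Rightarrow> (int \<Rightarrow> 'm) set \<Rightarrow> (int \<Rightarrow> 'm) set" where
  "hyper_conn C F n R S Q f g X =
     the_elem {hyper_class C F (n + 1) R S
         (\<lambda>m. if m \<ge> 0 then msign C (n + m) (hs m \<cdot>\<^bsub>C\<^esub> \<phi> (m + 1))
              else mzero C (cx R (n + 1 + m)) (cx S m)) | \<phi> h h1 hs.
       \<phi> \<in> X \<and>
       h \<in> Hom C (cx Q 0) (Dom C g) \<and> g \<cdot>\<^bsub>C\<^esub> h = syz_pr Q 0 \<and>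
       h1 \<in> Hom C (syz Q 1) (Dom C f) \<and> f \<cdot>\<^bsub>C\<^esub> h1 = h \<cdot>\<^bsub>C\<^esub> syz_in Q 0 \<and>
       lifts C (shift_res C 1 Q) S h1 hs}"

section \<open>Direct limits of sequences of groups\<close>

definition transition :: "(nat \<Rightarrow> 'g \<Rightarrow> 'g) \<Rightarrow> nat \<Rightarrow> nat \<Rightarrow> 'g \<Rightarrow> 'g" where
  "transition t i k = fold t [i..<k]"

definition lim_class ::
    "(nat \<Rightarrow> 'g monoid) \<Rightarrow> (nat \<Rightarrow> 'g \<Rightarrow> 'g) \<Rightarrow> nat \<Rightarrow> 'g \<Rightarrow> (nat \<times> 'g) set" where
  "lim_class G t i x =
     {(j, y). y \<in> carrier (G j) \<and> (\<exists>k\<ge>max i j. transition t i k x = transition t j k y)}"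

definition lim_grp ::
    "(nat \<Rightarrow> 'g monoid) \<Rightarrow> (nat \<Rightarrow> 'g \<Rightarrow> 'g) \<Rightarrow> (nat \<times> 'g) set monoid" where
  "lim_grp G t =
     \<lparr>carrier = {lim_class G t i x | i x. x \<in> carrier (G i)},
      mult = (\<lambda>X Y. the_elem {lim_class G t k (x \<otimes>\<^bsub>G k\<^esub> y) | k x y. (k, x) \<in> X \<and> (k, y) \<in> Y}),
      one = lim_class G t 0 \<one>\<^bsub>G 0\<^esub>\<rparr>"

text \<open>The limit of maps \<open>r k\<close>; \<open>G\<close> and \<open>t\<close> describe the target system.\<close>

definition lim_map ::
    "(nat \<Rightarrow> 'h monoid) \<Rightarrow> (nat \<Rightarrow> 'h \<Rightarrow> 'h) \<Rightarrow> (nat \<Rightarrow> 'g \<Rightarrow> 'h) \<Rightarrow>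
     (nat \<times> 'g) set \<Rightarrow> (nat \<times> 'h) set" where
  "lim_map G t r X = the_elem {lim_class G t k (r k x) | k x. (k, x) \<in> X}"

text \<open>\<open>(-1)\<^sup>k y\<close> in a group.\<close>

definition gsign :: "'g monoid \<Rightarrow> nat \<Rightarrow> 'g \<Rightarrow> 'g" where
  "gsign G k y = (if even k then y else inv\<^bsub>G\<^esub> y)"

section \<open>The resolution constructions\<close>

text \<open>\<open>R\<close> is a resolution of the first argument, \<open>S\<close> one of the second.\<close>

definition ExtRes_sys ::
    "('o, 'm) category_data \<Rightarrow> ('o, 'm) resolution \<Rightarrow> int \<Rightarrow> ('o, 'm) resolution \<Rightarrow>
     nat \<Rightarrow> 'm set monoid" where
  "ExtRes_sys C R n S k = Ext_grp C R (n + int k) (syz S k)"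

definition ExtRes_trans ::
    "('o, 'm) category_data \<Rightarrow> ('o, 'm) resolution \<Rightarrow> int \<Rightarrow> ('o, 'm) resolution \<Rightarrow>
     nat \<Rightarrow> 'm set \<Rightarrow> 'm set" where
  "ExtRes_trans C R n S k = Ext_conn C R (n + int k) (syz_in S k) (syz_pr S k)"

definition hyperRes_sys ::
    "('o, 'm) category_data \<Rightarrow> ('o, 'm) resolution \<Rightarrow> int \<Rightarrow> ('o, 'm) resolution \<Rightarrow>
     nat \<Rightarrow> (int \<Rightarrow> 'm) set monoid" where
  "hyperRes_sys C R n S k = hyper_grp C every_degree (n + int k) R (shift_res C k S)"

definition hyperRes_trans ::
    "('o, 'm) category_data \<Rightarrow> ('o, 'm) resolution \<Rightarrow> int \<Rightarrow> ('o, 'm) resolution \<Rightarrow>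
     nat \<Rightarrow> (int \<Rightarrow> 'm) set \<Rightarrow> (int \<Rightarrow> 'm) set" where
  "hyperRes_trans C R n S k =
     hyper_conn C every_degree (n + int k) R (shift_res C (Suc k) S) (shift_res C k S)
       (syz_in S k) (syz_pr S k)"

section \<open>The four functors\<close>

text \<open>\<open>res\<close> assigns to each object its projective resolution.\<close>

definition Ext_functor ::
    "('o, 'm) category_data \<Rightarrow> ('o \<Rightarrow> ('o, 'm) resolution) \<Rightarrow> 'o \<Rightarrow>
     ('o, 'm, 'm set) coh_functor_data" where
  "Ext_functor C res A =
     \<lparr>coh_grp = Ext_grp C (res A), coh_map = Ext_map C (res A), coh_conn = Ext_conn C (res A)\<rparr>"

definition ExtRes_functor ::
    "('o, 'm) category_data \<Rightarrow> ('o \<Rightarrow> ('o, 'm) resolution) \<Rightarrow> 'o \<Rightarrow>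
     ('o, 'm, (nat \<times> 'm set) set) coh_functor_data" where
  "ExtRes_functor C res A =
     (let R = res A in
     \<lparr>coh_grp = (\<lambda>n B. lim_grp (ExtRes_sys C R n (res B)) (ExtRes_trans C R n (res B))),
      coh_map = (\<lambda>n f X. let S = res (Dom C f); S' = res (Cod C f) in
        the_elem {lim_map (ExtRes_sys C R n S') (ExtRes_trans C R n S')
                    (\<lambda>k. Ext_map C R (n + int k) (v k)) X | u v. syz_lifts C S S' f u v}),
      coh_conn = (\<lambda>n f g X. let S = res (Dom C f); Q = res (Cod C g) in
        the_elem {lim_map (ExtRes_sys C R (n + 1) S) (ExtRes_trans C R (n + 1) S)
                    (\<lambda>k x. gsign (ExtRes_sys C R (n + 1) S k) k
                             (Ext_conn C R (n + int k) (i k) (p k) x)) X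
                  | i p. horseshoe_syz C S Q f g i p})\<rparr>)"

definition hyperRes_functor ::
    "('o, 'm) category_data \<Rightarrow> ('o \<Rightarrow> ('o, 'm) resolution) \<Rightarrow> 'o \<Rightarrow>
     ('o, 'm, (nat \<times> (int \<Rightarrow> 'm) set) set) coh_functor_data" where
  "hyperRes_functor C res A =
     (let R = res A in
     \<lparr>coh_grp = (\<lambda>n B. lim_grp (hyperRes_sys C R n (res B)) (hyperRes_trans C R n (res B))),
      coh_map = (\<lambda>n f X. let S = res (Dom C f); S' = res (Cod C f) in
        the_elem {lim_map (hyperRes_sys C R n S') (hyperRes_trans C R n S')
                    (\<lambda>k. hyper_map C every_degree (n + int k) R (shift_res C k S) (shift_res C k S') (v k)) X
                  | u v. syz_lifts C S S' f u v}),
      coh_conn = (\<lambda>n f g X. let S = res (Dom C f); Q = res (Cod C g) in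
        the_elem {lim_map (hyperRes_sys C R (n + 1) S) (hyperRes_trans C R (n + 1) S)
                    (\<lambda>k x. gsign (hyperRes_sys C R (n + 1) S k) k
                             (hyper_conn C every_degree (n + int k) R (shift_res C k S) (shift_res C k Q)
                                (i k) (p k) x)) X
                  | i p. horseshoe_syz C S Q f g i p})\<rparr>)"

definition completed_hyper_functor ::
    "('o, 'm) category_data \<Rightarrow> ('o \<Rightarrow> ('o, 'm) resolution) \<Rightarrow> 'o \<Rightarrow>
     ('o, 'm, (int \<Rightarrow> 'm) set) coh_functor_data" where
  "completed_hyper_functor C res A =
     \<lparr>coh_grp = (\<lambda>n B. hyper_grp C cofinite n (res A) (res B)),
      coh_map = (\<lambda>n f. hyper_map C cofinite n (res A) (res (Dom C f)) (res (Cod C f)) f),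
      coh_conn = (\<lambda>n f g. hyper_conn C cofinite n (res A) (res (Dom C f)) (res (Cod C g)) f g)\<rparr>"

section \<open>The comparison morphisms\<close>

text \<open>The canonical morphism from Ext to its resolution construction.\<close>

definition canonical ::
    "('o, 'm) category_data \<Rightarrow> ('o \<Rightarrow> ('o, 'm) resolution) \<Rightarrow> 'o \<Rightarrow>
     int \<Rightarrow> 'o \<Rightarrow> 'm set \<Rightarrow> (nat \<times> 'm set) set" where
  "canonical C res A n B x =
     lim_class (ExtRes_sys C (res A) n (res B)) (ExtRes_trans C (res A) n (res B)) 0 x"

definition zeta_level ::
    "('o, 'm) category_data \<Rightarrow> ('o, 'm) resolution \<Rightarrow> ('o, 'm) resolution \<Rightarrow>
     int \<Rightarrow> 'm set \<Rightarrow> (int \<Rightarrow> 'm) set" where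
  "zeta_level C R S n X =
     (if n < 0 then \<one>\<^bsub>hyper_grp C every_degree n R S\<^esub>
      else the_elem {hyper_class C every_degree n R S \<Phi> | \<Phi>.
             \<Phi> \<in> chain_maps C every_degree n R S \<and> syz_pr S 0 \<cdot>\<^bsub>C\<^esub> \<Phi> 0 \<in> X})"

definition zeta ::
    "('o, 'm) category_data \<Rightarrow> ('o \<Rightarrow> ('o, 'm) resolution) \<Rightarrow> 'o \<Rightarrow>
     int \<Rightarrow> 'o \<Rightarrow> (nat \<times> 'm set) set \<Rightarrow> (nat \<times> (int \<Rightarrow> 'm) set) set" where
  "zeta C res A n B =
     lim_map (hyperRes_sys C (res A) n (res B)) (hyperRes_trans C (res A) n (res B))
       (\<lambda>k. zeta_level C (res A) (shift_res C k (res B)) (n + int k))"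

text \<open>
  Restricting to representatives \<open>(2 * k, x)\<close> at even indices identifies the limit with the
  one over the cofinal subsequence of even indices.
\<close>

definition vartheta ::
    "('o, 'm) category_data \<Rightarrow> ('o \<Rightarrow> ('o, 'm) resolution) \<Rightarrow> 'o \<Rightarrow>
     int \<Rightarrow> 'o \<Rightarrow> (nat \<times> (int \<Rightarrow> 'm) set) set \<Rightarrow> (int \<Rightarrow> 'm) set" where
  "vartheta C res A n B X =
     the_elem {hyper_class C cofinite n (res A) (res B)
         (\<lambda>m. if m \<ge> 2 * int k then \<phi> (m - 2 * int k)
              else mzero C (cx (res A) (n + m)) (cx (res B) m)) | k x \<phi>.
       (2 * k, x) \<in> X \<and> \<phi> \<in> x}"

definition sigma ::
    "('o, 'm) category_data \<Rightarrow> ('o \<Rightarrow> ('o, 'm) resolution) \<Rightarrow> 'o \<Rightarrow>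
     int \<Rightarrow> 'o \<Rightarrow> (nat \<times> 'm set) set \<Rightarrow> (int \<Rightarrow> 'm) set" where
  "sigma C res A = coh_comp (vartheta C res A) (zeta C res A)"

end

theory Submission
  imports Defs
begin

text \<open>
  Extension by zero, with the sign \<open>(-1) ^ (k * (n + m + 1))\<close> in degree \<open>m\<close>, turns chain maps into the
  \<open>k\<close>-th syzygy resolution into almost chain maps, compatibly with the connecting maps of the syzygy
  sequences; truncation inverts it, because an almost chain map and an almost homotopy become genuine ones
  far out.  Hence the completed hypercohomology groups are the direct limit of the groups of chain maps,
  and the latter agree with the Ext groups in all sufficiently high degrees.  By the Horseshoe Lemma a short
  exact sequence is resolved by degreewise split sequences; the failure of the splitting to be a chain map
  represents the connecting map, which gives the long exact sequences.  A morphism from Ext to a cohomological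
  functor vanishing on projectives extends uniquely, because the connecting maps of syzygy sequences are
  isomorphisms for both functors.
\<close>

text \<open>The connecting maps carry alternating signs: from level k to level k + 1 they contribute
  (-1)^(n+m-1) in degree m of the extended family. Compatible extensions by zero therefore need
  exponents that grow by n + m + 1 modulo 2 at each level, and starting from 0 at k = 0 this gives k
  * (n + m + 1). The sign (-1)^k in the connecting maps of the direct limits is absorbed by the same
  exponent. A filter on the degrees stays a parameter, so one argument gives the long exact
  sequences for chain maps and for almost chain maps; Ext inherits its own from the former. The
  direct limits are never shown to be exact directly: their elements are fibres over the groups of
  almost chain maps, and all structure is transported along this bijection. Two obstacles shape the
  statements. Every operation is the unique element of the set of its values, so independence of all
  choices has to be proved before anything can be computed. And inductions along syzygies run
  through shifted resolutions, which need not be the chosen resolutions of the syzygies, so nearly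
  everything is proved for arbitrary resolutions.\<close>

section \<open>Arrows of an abelian category\<close>

context abelian_category
begin

notation madd (infixl "\<boxplus>\<index>" 65)

text \<open>Domain and codomain are read off the arrow, so that negation becomes a unary operation
  like \<open>msign\<close>.\<close>

definition neg :: "'m \<Rightarrow> 'm" where
  "neg f = inv\<^bsub>Hom_grp C (Dom C f) (Cod C f)\<^esub> f"

section \<open>Additive calculus of arrows\<close>

lemma comp_arr [simp]:
  assumes "f \<in> Arr C" "g \<in> Arr C" "Dom C g = Cod C f"
  shows "g \<cdot> f \<in> Arr C" "Dom C (g \<cdot> f) = Dom C f" "Cod C (g \<cdot> f) = Cod C g"
  using compose_Hom[of f "Dom C f" "Cod C f" g "Cod C g"] assms by (auto simp: Hom_def)

lemma comp_assoc [simp]: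
  assumes "f \<in> Arr C" "g \<in> Arr C" "h \<in> Arr C" "Dom C g = Cod C f" "Dom C h = Cod C g"
  shows "(h \<cdot> g) \<cdot> f = h \<cdot> (g \<cdot> f)"
  using compose_assoc[of f "Dom C f" "Cod C f" g "Cod C g" h "Cod C h"] assms by (auto simp: Hom_def)

lemma Dom_Cod_Obj [simp]: "f \<in> Arr C \<Longrightarrow> Dom C f \<in> Obj C" "f \<in> Arr C \<Longrightarrow> Cod C f \<in> Obj C"
  by (auto simp: Dom_Obj Cod_Obj)

lemma ident_arr [simp]:
  assumes "a \<in> Obj C"
  shows "ident C a \<in> Arr C" "Dom C (ident C a) = a" "Cod C (ident C a) = a"
  using ident_Hom[OF assms] by (auto simp: Hom_def)

lemma comp_ident [simp]:
  "f \<in> Arr C \<Longrightarrow> Cod C f = b \<Longrightarrow> ident C b \<cdot> f = f"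
  "f \<in> Arr C \<Longrightarrow> Dom C f = a \<Longrightarrow> f \<cdot> ident C a = f"
  using ident_left[of f "Dom C f" b] ident_right[of f a "Cod C f"] by (auto simp: Hom_def)

lemma Hom_grp_simps [simp]:
  "carrier (Hom_grp C a b) = Hom C a b" "x \<otimes>\<^bsub>Hom_grp C a b\<^esub> y = x \<boxplus> y"
  "\<one>\<^bsub>Hom_grp C a b\<^esub> = mzero C a b"
  by (auto simp: Hom_grp_def)

lemma mzero_arr [simp]:
  assumes "a \<in> Obj C" "b \<in> Obj C"
  shows "mzero C a b \<in> Arr C" "Dom C (mzero C a b) = a" "Cod C (mzero C a b) = b"
proof -
  interpret G: comm_group "Hom_grp C a b" by (rule Hom_comm_group[OF assms])
  show "mzero C a b \<in> Arr C" "Dom C (mzero C a b) = a" "Cod C (mzero C a b) = b"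
    using G.one_closed by (auto simp: Hom_def)
qed

lemma madd_arr [simp]:
  assumes "f \<in> Arr C" "g \<in> Arr C" "Dom C f = Dom C g" "Cod C f = Cod C g"
  shows "f \<boxplus> g \<in> Arr C" "Dom C (f \<boxplus> g) = Dom C g" "Cod C (f \<boxplus> g) = Cod C g"
proof -
  interpret G: comm_group "Hom_grp C (Dom C g) (Cod C g)" using assms by (intro Hom_comm_group) auto
  show "f \<boxplus> g \<in> Arr C" "Dom C (f \<boxplus> g) = Dom C g" "Cod C (f \<boxplus> g) = Cod C g"
    using G.m_closed[of f g] assms by (auto simp: Hom_def)
qed

lemma neg_arr [simp]:
  assumes "f \<in> Arr C"
  shows "neg f \<in> Arr C" "Dom C (neg f) = Dom C f" "Cod C (neg f) = Cod C f"
proof -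
  interpret G: comm_group "Hom_grp C (Dom C f) (Cod C f)" using assms by (intro Hom_comm_group) auto
  show "neg f \<in> Arr C" "Dom C (neg f) = Dom C f" "Cod C (neg f) = Cod C f"
    using G.inv_closed[of f] assms by (auto simp: Hom_def neg_def)
qed

lemma madd_assoc:
  assumes "f \<in> Arr C" "g \<in> Arr C" "h \<in> Arr C" "Dom C f = Dom C g" "Cod C f = Cod C g"
    "Dom C g = Dom C h" "Cod C g = Cod C h"
  shows "f \<boxplus> g \<boxplus> h = f \<boxplus> (g \<boxplus> h)"
proof -
  interpret G: comm_group "Hom_grp C (Dom C g) (Cod C g)" using assms by (intro Hom_comm_group) auto
  show ?thesis using G.m_assoc[of f g h] assms by (auto simp: Hom_def)
qed

lemma madd_comm:
  assumes "f \<in> Arr C" "g \<in> Arr C" "Dom C f = Dom C g" "Cod C f = Cod C g"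
  shows "f \<boxplus> g = g \<boxplus> f"
proof -
  interpret G: comm_group "Hom_grp C (Dom C g) (Cod C g)" using assms by (intro Hom_comm_group) auto
  show ?thesis using G.m_comm[of f g] assms by (auto simp: Hom_def)
qed

lemma madd_lcomm:
  assumes "f \<in> Arr C" "g \<in> Arr C" "h \<in> Arr C" "Dom C f = Dom C g" "Cod C f = Cod C g"
    "Dom C g = Dom C h" "Cod C g = Cod C h"
  shows "f \<boxplus> (g \<boxplus> h) = g \<boxplus> (f \<boxplus> h)"
  using assms madd_assoc[of f g h] madd_assoc[of g f h] madd_comm[of f g] by simp

lemmas madd_ac = madd_assoc madd_comm madd_lcomm

lemma madd_zero [simp]:
  assumes "f \<in> Arr C" "Dom C f = a" "Cod C f = b"
  shows "mzero C a b \<boxplus> f = f" "f \<boxplus> mzero C a b = f"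
proof -
  interpret G: comm_group "Hom_grp C (Dom C f) (Cod C f)" using assms by (intro Hom_comm_group) auto
  show "mzero C a b \<boxplus> f = f" "f \<boxplus> mzero C a b = f"
    using G.l_one[of f] G.r_one[of f] assms by (auto simp: Hom_def)
qed

lemma madd_neg [simp]:
  assumes "f \<in> Arr C"
  shows "f \<boxplus> neg f = mzero C (Dom C f) (Cod C f)" "neg f \<boxplus> f = mzero C (Dom C f) (Cod C f)"
proof -
  interpret G: comm_group "Hom_grp C (Dom C f) (Cod C f)" using assms by (intro Hom_comm_group) auto
  show "f \<boxplus> neg f = mzero C (Dom C f) (Cod C f)" "neg f \<boxplus> f = mzero C (Dom C f) (Cod C f)"
    using G.l_inv[of f] G.r_inv[of f] assms by (auto simp: Hom_def neg_def)
qed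

lemma madd_neg_cancel [simp]:
  assumes "f \<in> Arr C" "g \<in> Arr C" "Dom C f = Dom C g" "Cod C f = Cod C g"
  shows "f \<boxplus> (neg f \<boxplus> g) = g" "neg f \<boxplus> (f \<boxplus> g) = g"
    "f \<boxplus> (g \<boxplus> neg f) = g" "neg f \<boxplus> (g \<boxplus> f) = g"
proof -
  show 1: "f \<boxplus> (neg f \<boxplus> g) = g" "neg f \<boxplus> (f \<boxplus> g) = g"
    using assms by (auto simp: madd_assoc[symmetric])
  show "f \<boxplus> (g \<boxplus> neg f) = g" "neg f \<boxplus> (g \<boxplus> f) = g"
    using 1 assms by (simp_all add: madd_comm[of g])
qed

lemma madd_left_cancel:
  assumes "f \<in> Arr C" "g \<in> Arr C" "h \<in> Arr C" "Dom C f = Dom C g" "Cod C f = Cod C g"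
    "Dom C f = Dom C h" "Cod C f = Cod C h"
  shows "f \<boxplus> g = f \<boxplus> h \<longleftrightarrow> g = h"
proof
  assume "f \<boxplus> g = f \<boxplus> h"
  hence "neg f \<boxplus> (f \<boxplus> g) = neg f \<boxplus> (f \<boxplus> h)" by (rule arg_cong)
  moreover have "neg f \<boxplus> (f \<boxplus> g) = g" by (rule madd_neg_cancel) (use assms in auto)
  moreover have "neg f \<boxplus> (f \<boxplus> h) = h" by (rule madd_neg_cancel) (use assms in auto)
  ultimately show "g = h" by simp
qed simp

lemma neg_unique:
  assumes "f \<in> Arr C" "g \<in> Arr C" "Dom C f = Dom C g" "Cod C f = Cod C g"
    "f \<boxplus> g = mzero C (Dom C g) (Cod C g)"
  shows "g = neg f"
proof -
  have "f \<boxplus> g = f \<boxplus> neg f" using assms by simp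
  moreover have "f \<boxplus> g = f \<boxplus> neg f \<longleftrightarrow> g = neg f"
    by (rule madd_left_cancel) (use assms in auto)
  ultimately show ?thesis by blast
qed

lemma neg_neg [simp]: "f \<in> Arr C \<Longrightarrow> neg (neg f) = f"
  by (rule neg_unique[symmetric]) auto

lemma neg_mzero [simp]: "a \<in> Obj C \<Longrightarrow> b \<in> Obj C \<Longrightarrow> neg (mzero C a b) = mzero C a b"
  by (rule neg_unique[symmetric]) auto

lemma neg_madd [simp]:
  assumes "f \<in> Arr C" "g \<in> Arr C" "Dom C f = Dom C g" "Cod C f = Cod C g"
  shows "neg (f \<boxplus> g) = neg f \<boxplus> neg g"
proof -
  have "f \<boxplus> g \<boxplus> (neg f \<boxplus> neg g) = f \<boxplus> (g \<boxplus> (neg f \<boxplus> neg g))"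
    by (rule madd_assoc) (use assms in auto)
  also have "g \<boxplus> (neg f \<boxplus> neg g) = neg f \<boxplus> (g \<boxplus> neg g)"
    by (rule madd_lcomm) (use assms in auto)
  also have "f \<boxplus> (neg f \<boxplus> (g \<boxplus> neg g)) = mzero C (Dom C g) (Cod C g)" using assms by simp
  finally have e: "f \<boxplus> g \<boxplus> (neg f \<boxplus> neg g) = mzero C (Dom C g) (Cod C g)" .
  show ?thesis by (rule neg_unique[symmetric]) (use e assms in simp_all)
qed

lemma comp_madd [simp]:
  assumes "f \<in> Arr C" "f' \<in> Arr C" "Dom C f = Dom C f'" "Cod C f = Cod C f'" "g \<in> Arr C" "Dom C g = Cod C f'"
  shows "g \<cdot> (f \<boxplus> f') = (g \<cdot> f) \<boxplus> (g \<cdot> f')"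
  using assms compose_madd[of f "Dom C f" "Cod C f" f' g "Cod C g"] by (auto simp: Hom_def)

lemma madd_comp [simp]:
  assumes "f \<in> Arr C" "g \<in> Arr C" "g' \<in> Arr C" "Dom C g = Dom C g'" "Cod C g = Cod C g'" "Cod C f = Dom C g'"
  shows "(g \<boxplus> g') \<cdot> f = (g \<cdot> f) \<boxplus> (g' \<cdot> f)"
  using assms madd_compose[of f "Dom C f" "Cod C f" g "Cod C g" g'] by (auto simp: Hom_def)

text \<open>The composite equals its own double and vanishes by cancellation.\<close>

lemma comp_mzero [simp]:
  assumes "g \<in> Arr C" "Dom C g = b" "a \<in> Obj C"
  shows "g \<cdot> mzero C a b = mzero C a (Cod C g)"
proof -
  have b: "b \<in> Obj C" using assms by auto
  have "(g \<cdot> mzero C a b) \<boxplus> (g \<cdot> mzero C a b) = g \<cdot> mzero C a b"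
    using assms b by (subst comp_madd[symmetric]) auto
  hence "(g \<cdot> mzero C a b) \<boxplus> (g \<cdot> mzero C a b) = (g \<cdot> mzero C a b) \<boxplus> mzero C a (Cod C g)"
    using assms b by simp
  thus ?thesis by (subst (asm) madd_left_cancel) (use assms b in auto)
qed

lemma mzero_comp [simp]:
  assumes "f \<in> Arr C" "Cod C f = a" "b \<in> Obj C"
  shows "mzero C a b \<cdot> f = mzero C (Dom C f) b"
proof -
  have a: "a \<in> Obj C" using assms by auto
  have "(mzero C a b \<cdot> f) \<boxplus> (mzero C a b \<cdot> f) = mzero C a b \<cdot> f"
    using assms a by (subst madd_comp[symmetric]) auto
  hence "(mzero C a b \<cdot> f) \<boxplus> (mzero C a b \<cdot> f) = (mzero C a b \<cdot> f) \<boxplus> mzero C (Dom C f) b"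
    using assms a by simp
  thus ?thesis by (subst (asm) madd_left_cancel) (use assms a in auto)
qed

lemma comp_neg [simp]:
  assumes "f \<in> Arr C" "g \<in> Arr C" "Dom C g = Cod C f"
  shows "g \<cdot> neg f = neg (g \<cdot> f)" "neg g \<cdot> f = neg (g \<cdot> f)"
proof -
  have "(g \<cdot> f) \<boxplus> (g \<cdot> neg f) = mzero C (Dom C f) (Cod C g)"
    using assms by (simp add: comp_madd[symmetric] del: comp_madd)
  thus "g \<cdot> neg f = neg (g \<cdot> f)" by (intro neg_unique) (use assms in simp_all)
  have "(g \<cdot> f) \<boxplus> (neg g \<cdot> f) = mzero C (Dom C f) (Cod C g)"
    using assms by (simp add: madd_comp[symmetric] del: madd_comp)
  thus "neg g \<cdot> f = neg (g \<cdot> f)" by (intro neg_unique) (use assms in simp_all)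
qed

section \<open>Signs\<close>

lemma msign_eq: "msign C n f = (if even n then f else neg f)"
  by (simp add: msign_def neg_def)

lemma msign_arr [simp]:
  assumes "f \<in> Arr C"
  shows "msign C n f \<in> Arr C" "Dom C (msign C n f) = Dom C f" "Cod C (msign C n f) = Cod C f"
  using assms by (auto simp: msign_eq)

lemma msign_msign [simp]: "f \<in> Arr C \<Longrightarrow> msign C n (msign C m f) = msign C (n + m) f"
  by (auto simp: msign_eq)

lemma msign_comp [simp]:
  assumes "f \<in> Arr C" "g \<in> Arr C" "Dom C g = Cod C f"
  shows "g \<cdot> msign C n f = msign C n (g \<cdot> f)" "msign C n g \<cdot> f = msign C n (g \<cdot> f)"
  using assms by (auto simp: msign_eq)

lemma msign_madd [simp]:
  assumes "f \<in> Arr C" "g \<in> Arr C" "Dom C f = Dom C g" "Cod C f = Cod C g"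
  shows "msign C n (f \<boxplus> g) = msign C n f \<boxplus> msign C n g"
  using assms by (auto simp: msign_eq)

lemma msign_mzero [simp]: "a \<in> Obj C \<Longrightarrow> b \<in> Obj C \<Longrightarrow> msign C n (mzero C a b) = mzero C a b"
  by (auto simp: msign_eq)

lemma msign_inj: "\<lbrakk>f \<in> Arr C; g \<in> Arr C; msign C n f = msign C n g\<rbrakk> \<Longrightarrow> f = g"
  by (metis msign_eq neg_neg)

text \<open>Later comparisons of signs are reduced by this to the evenness of a difference of
  exponents, which arithmetic decides.\<close>

lemma msign_cong: "even (n - m) \<Longrightarrow> msign C n f = msign C m f"
  by (auto simp: msign_eq)

section \<open>Zero objects, kernels, epimorphisms and projectives\<close>

lemma zero_object_unique:
  assumes "f \<in> Arr C" "g \<in> Arr C" "Dom C f = Dom C g" "Cod C f = Cod C g"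
    "zero_object C (Dom C g) \<or> zero_object C (Cod C g)"
  shows "f = g"
proof -
  have "\<exists>!h. h \<in> Hom C (Dom C g) (Cod C g)"
    using assms(5) Dom_Cod_Obj[OF assms(2)] by (auto simp: zero_object_def)
  moreover have "f \<in> Hom C (Dom C g) (Cod C g)" "g \<in> Hom C (Dom C g) (Cod C g)"
    using assms by (auto simp: Hom_def)
  ultimately show ?thesis by blast
qed

text \<open>Consequently all terms of a resolution are projective, those in negative degrees
  included, and lifting arguments need no case distinction on the degree.\<close>

lemma zero_object_projective:
  assumes "zero_object C z" shows "projective C z"
proof -
  have z: "z \<in> Obj C" using assms by (simp add: zero_object_def)
  { fix e g assume "epic C e" "g \<in> Hom C z (Cod C e)"
    hence eg: "e \<in> Arr C" "g \<in> Arr C" "Dom C g = z" "Cod C g = Cod C e" by (auto simp: epic_def Hom_def)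
    have "\<exists>h\<in>Hom C z (Dom C e). e \<cdot> h = g"
      using eg z assms by (intro bexI[of _ "mzero C z (Dom C e)"] zero_object_unique) (auto simp: Hom_def) }
  thus ?thesis using z by (auto simp: projective_def)
qed

lemma short_exactD:
  assumes "short_exact C f g"
  shows "f \<in> Arr C" "g \<in> Arr C" "Dom C g = Cod C f" "g \<cdot> f = mzero C (Dom C f) (Cod C g)"
  using assms by (auto simp: short_exact_def is_kernel_def)

lemma is_kernel_mono:
  assumes "is_kernel C g f" "f \<cdot> x = f \<cdot> y" "x \<in> Arr C" "y \<in> Arr C" "Dom C x = Dom C y"
    "Cod C x = Dom C f" "Cod C y = Dom C f"
  shows "x = y"
proof -
  have f: "f \<in> Arr C" "g \<in> Arr C" "Dom C g = Cod C f" "g \<cdot> f = mzero C (Dom C f) (Cod C g)"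
    using assms by (auto simp: is_kernel_def)
  have "g \<cdot> (f \<cdot> x) = mzero C (Dom C x) (Cod C g)"
    using f assms comp_assoc[of x f g] by simp
  hence "\<exists>!u. u \<in> Hom C (Dom C x) (Dom C f) \<and> f \<cdot> u = f \<cdot> x"
    using assms f unfolding is_kernel_def Hom_def by simp
  thus ?thesis using assms by (auto simp: Hom_def)
qed

lemma is_kernel_factor:
  assumes "is_kernel C g f" "g \<cdot> x = mzero C (Dom C x) (Cod C g)" "x \<in> Arr C" "Cod C x = Dom C g"
  obtains t where "t \<in> Arr C" "Dom C t = Dom C x" "Cod C t = Dom C f" "f \<cdot> t = x"
proof -
  have "\<exists>!u. u \<in> Hom C (Dom C x) (Dom C f) \<and> f \<cdot> u = x"
    using assms unfolding is_kernel_def Hom_def by simp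
  thus ?thesis using that by (auto simp: Hom_def)
qed

text \<open>The form in which exactness enters the diagram chases: the difference of
  \<open>x\<close> and \<open>y\<close> is killed by \<open>g\<close> and so factors through the
  kernel, and the additive shape is the one that homotopies have.\<close>

lemma is_kernel_diff:
  assumes k: "is_kernel C g f" and e: "g \<cdot> x = g \<cdot> y" and
    a: "x \<in> Arr C" "y \<in> Arr C" "Dom C x = Dom C y" "Cod C x = Dom C g" "Cod C y = Dom C g"
  obtains t where "t \<in> Arr C" "Dom C t = Dom C y" "Cod C t = Dom C f" "x = y \<boxplus> f \<cdot> t"
proof -
  have f: "f \<in> Arr C" "g \<in> Arr C" "Dom C g = Cod C f" using k by (auto simp: is_kernel_def)
  have z: "g \<cdot> (neg y \<boxplus> x) = mzero C (Dom C (neg y \<boxplus> x)) (Cod C g)"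
    and z1: "neg y \<boxplus> x \<in> Arr C" "Cod C (neg y \<boxplus> x) = Dom C g"
    using a f e by simp_all
  obtain t where t: "t \<in> Arr C" "Dom C t = Dom C (neg y \<boxplus> x)" "Cod C t = Dom C f" "f \<cdot> t = neg y \<boxplus> x"
    by (rule is_kernel_factor[OF k z z1])
  have "y \<boxplus> f \<cdot> t = x" unfolding t(4) by (rule madd_neg_cancel) (use a in auto)
  moreover have "Dom C t = Dom C y" using t(2) a by simp
  ultimately show ?thesis using that[OF t(1) _ t(3)] by blast
qed

lemma is_cokernel_epic:
  assumes "is_cokernel C f g" shows "epic C g"
  unfolding epic_def
proof (intro conjI ballI impI)
  have f: "f \<in> Arr C" "g \<in> Arr C" "Dom C g = Cod C f" "g \<cdot> f = mzero C (Dom C f) (Cod C g)"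
    using assms by (auto simp: is_cokernel_def)
  show "g \<in> Arr C" by fact
  fix x h h' assume x: "x \<in> Obj C" and h: "h \<in> Hom C (Cod C g) x" "h' \<in> Hom C (Cod C g) x" "h \<cdot> g = h' \<cdot> g"
  have "(h \<cdot> g) \<cdot> f = mzero C (Dom C f) x" using f h by (auto simp: Hom_def)
  moreover have "h \<cdot> g \<in> Hom C (Cod C f) x" using f h by (auto simp: Hom_def)
  ultimately have "\<exists>!u. u \<in> Hom C (Cod C g) x \<and> u \<cdot> g = h \<cdot> g"
    using assms x unfolding is_cokernel_def by blast
  thus "h = h'" using h by auto
qed

lemma short_exact_epic: "short_exact C f g \<Longrightarrow> epic C g"
  by (auto simp: short_exact_def intro: is_cokernel_epic)

lemma short_exact_kernel: "short_exact C f g \<Longrightarrow> is_kernel C g f"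
  by (auto simp: short_exact_def)

lemma epic_cancel:
  assumes "epic C e" "x \<cdot> e = y \<cdot> e" "x \<in> Arr C" "y \<in> Arr C" "Cod C x = Cod C y"
    "Dom C x = Cod C e" "Dom C y = Cod C e"
  shows "x = y"
proof -
  have "x \<in> Hom C (Cod C e) (Cod C y)" "y \<in> Hom C (Cod C e) (Cod C y)" "Cod C y \<in> Obj C"
    using assms by (auto simp: Hom_def)
  thus ?thesis using assms(1,2) unfolding epic_def by blast
qed

text \<open>An epimorphism is the cokernel of some \<open>h\<close>. Since \<open>h\<close> factors
  through the kernel \<open>f\<close>, an arrow that kills \<open>f\<close> also kills
  \<open>h\<close>, and the universal property of \<open>g\<close> passes from \<open>h\<close> to
  \<open>f\<close>.\<close>

lemma kernel_epic_short_exact: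
  assumes k: "is_kernel C g f" and e: "epic C g"
  shows "short_exact C f g"
proof -
  have f: "f \<in> Arr C" "g \<in> Arr C" "Dom C g = Cod C f" "g \<cdot> f = mzero C (Dom C f) (Cod C g)"
    using k by (auto simp: is_kernel_def)
  obtain h where h: "is_cokernel C h g" using epic_is_cokernel[OF e] by auto
  hence h1: "h \<in> Arr C" "Cod C h = Dom C g" "g \<cdot> h = mzero C (Dom C h) (Cod C g)"
    by (auto simp: is_cokernel_def)
  obtain t where t: "t \<in> Arr C" "Dom C t = Dom C h" "Cod C t = Dom C f" "f \<cdot> t = h"
    using is_kernel_factor[OF k h1(3) h1(1,2)] by blast
  have "\<exists>!u. u \<in> Hom C (Cod C g) x \<and> u \<cdot> g = y"
    if "x \<in> Obj C" "y \<in> Hom C (Cod C f) x" "y \<cdot> f = mzero C (Dom C f) x" for x y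
  proof -
    have "y \<cdot> h = (y \<cdot> f) \<cdot> t" using t f that by (subst comp_assoc) (auto simp: Hom_def)
    hence "y \<cdot> h = mzero C (Dom C h) x" using that t f by simp
    thus ?thesis using h that f h1 unfolding is_cokernel_def by simp
  qed
  thus ?thesis using f k by (auto simp: short_exact_def is_cokernel_def)
qed

lemma projective_lift:
  assumes "projective C P" "epic C e" "g \<in> Arr C" "Dom C g = P" "Cod C g = Cod C e"
  obtains h where "h \<in> Arr C" "Dom C h = P" "Cod C h = Dom C e" "e \<cdot> h = g"
proof -
  have "g \<in> Hom C P (Cod C e)" using assms by (simp add: Hom_def)
  hence "\<exists>h\<in>Hom C P (Dom C e). e \<cdot> h = g" using assms(1,2) by (auto simp: projective_def)
  thus ?thesis using that by (auto simp: Hom_def)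
qed

text \<open>Arrows out of projectives play the role of elements. An epimorphism \<open>e\<close>
  from a projective onto the codomain lifts through \<open>g\<close>, so arrows that agree after
  \<open>g\<close> agree after \<open>e\<close> and are equal.\<close>

lemma epicI_projective:
  assumes ep: "enough_projectives C" and g: "g \<in> Arr C" and
    l: "\<And>P x. \<lbrakk>projective C P; x \<in> Arr C; Dom C x = P; Cod C x = Cod C g\<rbrakk>
      \<Longrightarrow> \<exists>y. y \<in> Arr C \<and> Dom C y = P \<and> Cod C y = Dom C g \<and> g \<cdot> y = x"
  shows "epic C g"
proof -
  obtain P e where e: "projective C P" "epic C e" "e \<in> Hom C P (Cod C g)"
    using ep Dom_Cod_Obj(2)[OF g] unfolding enough_projectives_def by blast
  obtain y where y: "y \<in> Arr C" "Dom C y = P" "Cod C y = Dom C g" "g \<cdot> y = e"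
    using l[of P e] e by (auto simp: Hom_def)
  show ?thesis unfolding epic_def
  proof (intro conjI ballI impI)
    fix x h h' assume x: "x \<in> Obj C" and h: "h \<in> Hom C (Cod C g) x" "h' \<in> Hom C (Cod C g) x" "h \<cdot> g = h' \<cdot> g"
    have "h \<cdot> e = (h \<cdot> g) \<cdot> y" using y h g by (subst comp_assoc) (auto simp: Hom_def)
    also have "\<dots> = h' \<cdot> e" unfolding h(3) using y h g by (subst comp_assoc) (auto simp: Hom_def)
    finally have "h \<cdot> e = h' \<cdot> e" .
    thus "h = h'" by (rule epic_cancel[OF e(2)]) (use e(3) h(1,2) in \<open>simp_all add: Hom_def\<close>)
  qed (use g in simp)
qed

end

section \<open>Projective resolutions\<close>

context abelian_category
begin

text \<open>The resolved object is recovered as the zeroth syzygy, so a shifted resolution needs no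
  further parameter.\<close>

definition is_res :: "('o, 'm) resolution \<Rightarrow> bool" where
  "is_res S \<longleftrightarrow> proj_resolution C (syz S 0) S"

lemma proj_resolution_is_res: "proj_resolution C M S \<longleftrightarrow> is_res S \<and> syz S 0 = M"
  by (auto simp: is_res_def proj_resolution_def)

context
  fixes S assumes S: "is_res S"
begin

lemma res_zero: "j < 0 \<Longrightarrow> zero_object C (cx S j)"
  using S by (auto simp: is_res_def proj_resolution_def)

lemma res_proj [simp]: "projective C (cx S j)"
  using S zero_object_projective[of "cx S j"]
  by (cases "j < 0") (auto simp: is_res_def proj_resolution_def)

lemma res_cx [simp]: "cx S j \<in> Obj C"
  using res_proj by (simp add: projective_def)

lemma res_arr [simp]:
  "diff S j \<in> Arr C" "Dom C (diff S j) = cx S j" "Cod C (diff S j) = cx S (j - 1)"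
  "syz_in S k \<in> Arr C" "Dom C (syz_in S k) = syz S (Suc k)" "Cod C (syz_in S k) = cx S (int k)"
  "syz_pr S k \<in> Arr C" "Dom C (syz_pr S k) = cx S (int k)" "Cod C (syz_pr S k) = syz S k"
  using S by (auto simp: is_res_def proj_resolution_def Hom_def)

lemma res_syz [simp]: "syz S k \<in> Obj C"
  using Cod_Obj[of "syz_pr S k"] by simp

lemma res_exact: "short_exact C (syz_in S k) (syz_pr S k)"
  using S by (auto simp: is_res_def proj_resolution_def)

lemma res_epic: "epic C (syz_pr S k)"
  using res_exact by (rule short_exact_epic)

lemma res_kernel: "is_kernel C (syz_pr S k) (syz_in S k)"
  using res_exact by (rule short_exact_kernel)

lemma res_diff: "diff S (int k + 1) = syz_in S k \<cdot> syz_pr S (Suc k)"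
  using S by (simp add: is_res_def proj_resolution_def add.commute)

lemma syz_pr_in [simp]: "syz_pr S k \<cdot> syz_in S k = mzero C (syz S (Suc k)) (syz S k)"
  using short_exactD(4)[OF res_exact[of k]] by simp

lemma res_pr_diff [simp]: "syz_pr S k \<cdot> diff S (int k + 1) = mzero C (cx S (int k + 1)) (syz S k)"
proof -
  have "syz_pr S k \<cdot> diff S (int k + 1) = (syz_pr S k \<cdot> syz_in S k) \<cdot> syz_pr S (Suc k)"
    unfolding res_diff by (rule comp_assoc[symmetric]) auto
  thus ?thesis by (simp del: comp_assoc add: add.commute)
qed

lemma res_pr_diff0 [simp]: "syz_pr S 0 \<cdot> diff S 1 = mzero C (cx S 1) (syz S 0)"
  using res_pr_diff[of 0] by simp

text \<open>Terms in negative degrees are zero objects, so equations between arrows into them hold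
  for free. This disposes of the degrees below the range of interest in most case distinctions that
  follow.\<close>

lemma res_cx_unique:
  assumes "f \<in> Arr C" "g \<in> Arr C" "Dom C f = Dom C g" "Cod C f = cx S j" "Cod C g = cx S j" "j < 0"
  shows "f = g"
  using assms res_zero[of j] by (intro zero_object_unique) auto

lemma res_dd: "diff S (j - 1) \<cdot> diff S j = mzero C (cx S j) (cx S (j - 2))"
proof (cases "j \<ge> 2")
  case True
  define k where "k = nat (j - 2)"
  have k: "j = int (Suc k) + 1" using True by (simp add: k_def)
  have "diff S (int k + 1) \<cdot> diff S (int (Suc k) + 1)
      = syz_in S k \<cdot> (syz_pr S (Suc k) \<cdot> diff S (int (Suc k) + 1))"
    unfolding res_diff[of k] by (rule comp_assoc) auto
  also have "\<dots> = mzero C (cx S (int (Suc k) + 1)) (cx S (int k))"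
    unfolding res_pr_diff by simp
  finally show ?thesis unfolding k by (simp add: add.commute)
next
  case False
  thus ?thesis by (intro res_cx_unique[where j = "j - 2"]) auto
qed

lemma syz_in_mono:
  assumes "syz_in S k \<cdot> x = syz_in S k \<cdot> y" "x \<in> Arr C" "y \<in> Arr C" "Dom C x = Dom C y"
    "Cod C x = syz S (Suc k)" "Cod C y = syz S (Suc k)"
  shows "x = y"
  by (rule is_kernel_mono[OF res_kernel assms(1)]) (use assms in auto)

lemma syz_pr_lift:
  assumes "projective C P" "x \<in> Arr C" "Dom C x = P" "Cod C x = syz S k"
  obtains y where "y \<in> Arr C" "Dom C y = P" "Cod C y = cx S (int k)" "syz_pr S k \<cdot> y = x"
proof -
  have "Cod C x = Cod C (syz_pr S k)" using assms by simp
  from projective_lift[OF assms(1) res_epic assms(2,3) this] obtain h where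
    "h \<in> Arr C" "Dom C h = P" "Cod C h = Dom C (syz_pr S k)" "syz_pr S k \<cdot> h = x" .
  thus ?thesis using that by simp
qed

text \<open>Exactness of the resolution tested on a projective: the kernel property yields an arrow
  \<open>t\<close> into the next syzygy, and projectivity lifts \<open>t\<close> to the next term,
  where the inclusion becomes the differential.\<close>

lemma res_lift_diff:
  assumes P: "projective C P" and x: "x \<in> Arr C" "Dom C x = P" "Cod C x = cx S (int k)"
    and y: "y \<in> Arr C" "Dom C y = P" "Cod C y = cx S (int k)"
    and e: "syz_pr S k \<cdot> x = syz_pr S k \<cdot> y"
  obtains z where "z \<in> Arr C" "Dom C z = P" "Cod C z = cx S (int k + 1)"
    "x = y \<boxplus> diff S (int k + 1) \<cdot> z" "syz_pr S k \<cdot> x = syz_pr S k \<cdot> y"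
proof -
  obtain t where t: "t \<in> Arr C" "Dom C t = Dom C y" "Cod C t = Dom C (syz_in S k)" "x = y \<boxplus> syz_in S k \<cdot> t"
    by (rule is_kernel_diff[OF res_kernel e]) (use x y in auto)
  have t': "Dom C t = P" "Cod C t = syz S (Suc k)" using t y by auto
  obtain z where z: "z \<in> Arr C" "Dom C z = P" "Cod C z = cx S (int (Suc k))" "syz_pr S (Suc k) \<cdot> z = t"
    by (rule syz_pr_lift[OF P t(1) t'])
  have "diff S (int k + 1) \<cdot> z = syz_in S k \<cdot> t" unfolding z(4)[symmetric] res_diff
    using z by (intro comp_assoc) auto
  thus ?thesis using that[OF z(1,2)] z t e by (simp add: add.commute)
qed

end

section \<open>The comparison theorem for maps into a resolution\<close>

definition cpx :: "(int \<Rightarrow> 'o) \<Rightarrow> (int \<Rightarrow> 'm) \<Rightarrow> bool" where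
  "cpx P a \<longleftrightarrow> (\<forall>j. projective C (P j) \<and> a j \<in> Arr C \<and> Dom C (a j) = P j \<and> Cod C (a j) = P (j - 1) \<and>
     a (j - 1) \<cdot> a j = mzero C (P j) (P (j - 2)))"

lemma cpxD:
  assumes "cpx P a"
  shows "projective C (P j)" "P j \<in> Obj C" "a j \<in> Arr C" "Dom C (a j) = P j" "Cod C (a j) = P (j - 1)"
    "a (j - 1) \<cdot> a j = mzero C (P j) (P (j - 2))"
  using assms by (auto simp: cpx_def projective_def)

lemma cpx_aa: "cpx P a \<Longrightarrow> i = j - 1 \<Longrightarrow> l = j - 2 \<Longrightarrow> a i \<cdot> a j = mzero C (P j) (P l)"
  by (simp add: cpxD)

definition fam :: "(int \<Rightarrow> 'o) \<Rightarrow> (int \<Rightarrow> 'o) \<Rightarrow> (int \<Rightarrow> 'm) \<Rightarrow> bool" where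
  "fam P Q \<phi> \<longleftrightarrow> (\<forall>j. \<phi> j \<in> Arr C \<and> Dom C (\<phi> j) = P j \<and> Cod C (\<phi> j) = Q j)"

lemma famD: "fam P Q \<phi> \<Longrightarrow> \<phi> j \<in> Arr C" "fam P Q \<phi> \<Longrightarrow> Dom C (\<phi> j) = P j" "fam P Q \<phi> \<Longrightarrow> Cod C (\<phi> j) = Q j"
  by (auto simp: fam_def)

text \<open>Existence half of the comparison theorem. The source needs projective terms only, while
  exactness is used in the target; the source may have nonzero terms in negative degrees, as shifted
  complexes do, because the target has none.\<close>

lemma extend_chain_map:
  assumes S: "is_res S" and a: "cpx P a"
    and x: "x \<in> Arr C" "Dom C x = P 0" "Cod C x = cx S 0"
    and xa: "syz_pr S 0 \<cdot> (x \<cdot> a 1) = mzero C (P 1) (syz S 0)"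
  obtains \<phi> where "\<phi> 0 = x" "fam P (cx S) \<phi>" "\<And>j. diff S j \<cdot> \<phi> j = \<phi> (j - 1) \<cdot> a j"
proof -
  note [simp] = S a cpxD[OF a]
  \<comment> \<open>The last conjunct says that the composite with the next differential lands in
    the kernel of the projection, which is what the construction of the next component starts
    from.\<close>
  define I where "I k g \<longleftrightarrow> g \<in> Arr C \<and> Dom C g = P (int k) \<and> Cod C g = cx S (int k) \<and> (k = 0 \<longrightarrow> g = x) \<and>
    syz_pr S k \<cdot> (g \<cdot> a (int k + 1)) = mzero C (P (int k + 1)) (syz S k)" for k g
  have "\<exists>g. \<forall>k. I k (g k) \<and> diff S (int k + 1) \<cdot> g (Suc k) = g k \<cdot> a (int k + 1)"
  proof (rule dependent_nat_choice)
    show "\<exists>g. I 0 g" using x xa by (auto simp: I_def)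
    fix g k assume I: "I k g"
    hence g: "g \<in> Arr C" "Dom C g = P (int k)" "Cod C g = cx S (int k)"
      "syz_pr S k \<cdot> (g \<cdot> a (int k + 1)) = mzero C (P (int k + 1)) (syz S k)" by (auto simp: I_def)
    note [simp] = g
    let ?y = "g \<cdot> a (int k + 1)"
    obtain t where t: "t \<in> Arr C" "Dom C t = Dom C ?y" "Cod C t = Dom C (syz_in S k)" "syz_in S k \<cdot> t = ?y"
      by (rule is_kernel_factor[OF res_kernel[OF S, of k], of ?y]) auto
    have t': "Dom C t = P (int k + 1)" "Cod C t = syz S (Suc k)" using t by auto
    note [simp] = t(1) t'
    obtain h where h: "h \<in> Arr C" "Dom C h = P (int k + 1)" "Cod C h = cx S (int (Suc k))" "syz_pr S (Suc k) \<cdot> h = t"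
      by (rule syz_pr_lift[OF S _ t(1) t']) auto
    note [simp] = h(1-3)
    have 1: "diff S (int k + 1) \<cdot> h = ?y" unfolding res_diff[OF S] t(4)[symmetric] h(4)[symmetric]
      by (rule comp_assoc) auto
    have d: "Dom C t = Cod C (a (int k + 2))" unfolding t'(1) cpxD(5)[OF a] by (rule arg_cong[of _ _ P]) simp
    note ta = comp_arr[OF _ t(1) d]
    have "syz_in S k \<cdot> (t \<cdot> a (int k + 2)) = (syz_in S k \<cdot> t) \<cdot> a (int k + 2)"
      by (rule comp_assoc[symmetric, OF _ _ _ d]) auto
    also have "\<dots> = g \<cdot> (a (int k + 1) \<cdot> a (int k + 2))" unfolding t(4)
      by (rule comp_assoc[OF _ _ _ d[unfolded t'(1), folded cpxD(4)[OF a]]]) auto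
    also have "a (int k + 1) \<cdot> a (int k + 2) = mzero C (P (int k + 2)) (P (int k))"
      by (rule cpx_aa[OF a]) auto
    finally have 2: "syz_in S k \<cdot> (t \<cdot> a (int k + 2)) = syz_in S k \<cdot> mzero C (P (int k + 2)) (syz S (Suc k))"
      by simp
    have "t \<cdot> a (int k + 2) = mzero C (P (int k + 2)) (syz S (Suc k))"
      by (rule syz_in_mono[OF S 2]) (auto simp: ta)
    moreover have "syz_pr S (Suc k) \<cdot> (h \<cdot> a (int k + 2)) = t \<cdot> a (int k + 2)"
      unfolding h(4)[symmetric]
      by (rule comp_assoc[symmetric]) (use d in \<open>simp_all only: h t'\<close>, auto)
    ultimately have "I (Suc k) h" by (simp add: I_def add.commute)
    with 1 show "\<exists>h. I (Suc k) h \<and> diff S (int k + 1) \<cdot> h = ?y" by blast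
  qed
  then obtain g where g: "\<And>k. I k (g k)" "\<And>k. diff S (int k + 1) \<cdot> g (Suc k) = g k \<cdot> a (int k + 1)" by blast
  define \<phi> where "\<phi> j = (if j \<ge> 0 then g (nat j) else mzero C (P j) (cx S j))" for j
  have f: "fam P (cx S) \<phi>"
    using g(1) by (auto simp: fam_def \<phi>_def I_def)
  have "diff S j \<cdot> \<phi> j = \<phi> (j - 1) \<cdot> a j" for j
  proof (cases "j \<ge> 1")
    case True
    have "nat j = Suc (nat (j - 1))" using True by simp
    thus ?thesis using g(2)[of "nat (j - 1)"] True by (simp add: \<phi>_def)
  next
    case False
    show ?thesis
      by (rule res_cx_unique[OF S, where j = "j - 1"]) (use False in \<open>auto simp: famD[OF f]\<close>)
  qed
  moreover have "\<phi> 0 = x" using g(1)[of 0] by (simp add: \<phi>_def I_def)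
  ultimately show ?thesis using that f by blast
qed

text \<open>Uniqueness half, with a twist: the augmented maps need to agree only up to an arrow
  \<open>x\<close> that factors through degree -1 of the source. Coboundaries of Ext and the
  ambiguity of connecting maps both have this shape. The homotopy begins with a lift of
  \<open>x\<close>, and the chain condition enters in degrees at least 1.\<close>

lemma chain_homotopy:
  assumes S: "is_res S" and a: "cpx P a" and \<phi>: "fam P (cx S) \<phi>" and \<psi>: "fam P (cx S) \<psi>"
    and c\<phi>: "\<And>j. j \<ge> 1 \<Longrightarrow> diff S j \<cdot> \<phi> j = \<phi> (j - 1) \<cdot> a j"
    and c\<psi>: "\<And>j. j \<ge> 1 \<Longrightarrow> diff S j \<cdot> \<psi> j = \<psi> (j - 1) \<cdot> a j"
    and x: "x \<in> Arr C" "Dom C x = P (- 1)" "Cod C x = syz S 0"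
    and xa: "syz_pr S 0 \<cdot> \<phi> 0 = syz_pr S 0 \<cdot> \<psi> 0 \<boxplus> x \<cdot> a 0"
  obtains e where "fam P (\<lambda>j. cx S (j + 1)) e"
    "\<And>j. \<phi> j = \<psi> j \<boxplus> (e (j - 1) \<cdot> a j \<boxplus> diff S (j + 1) \<cdot> e j)"
proof -
  note [simp] = S a cpxD[OF a] famD[OF \<phi>] famD[OF \<psi>]
  \<comment> \<open>Here \<open>h\<close> is the component of the homotopy in degree
    \<open>int k - 1\<close>; after correction by it the two maps agree on projecting to the
    \<open>k\<close>-th syzygy.\<close>
  define I where "I k h \<longleftrightarrow> h \<in> Arr C \<and> Dom C h = P (int k - 1) \<and> Cod C h = cx S (int k) \<and>
    syz_pr S k \<cdot> \<phi> (int k) = syz_pr S k \<cdot> (\<psi> (int k) \<boxplus> h \<cdot> a (int k))" for k h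
  have "\<exists>g. \<forall>k. I k (g k) \<and> \<phi> (int k) = \<psi> (int k) \<boxplus> (g k \<cdot> a (int k) \<boxplus> diff S (int k + 1) \<cdot> g (Suc k))"
  proof (rule dependent_nat_choice)
    obtain y where y: "y \<in> Arr C" "Dom C y = P (- 1)" "Cod C y = cx S (int 0)" "syz_pr S 0 \<cdot> y = x"
      by (rule syz_pr_lift[OF S _ x]) auto
    have "syz_pr S 0 \<cdot> (y \<cdot> a 0) = x \<cdot> a 0"
      unfolding y(4)[symmetric] using y by (intro comp_assoc[symmetric]) auto
    hence "I 0 y" using y xa by (simp add: I_def)
    thus "\<exists>y. I 0 y" ..
    fix h k assume I: "I k h"
    hence h: "h \<in> Arr C" "Dom C h = P (int k - 1)" "Cod C h = cx S (int k)"
      "syz_pr S k \<cdot> \<phi> (int k) = syz_pr S k \<cdot> (\<psi> (int k) \<boxplus> h \<cdot> a (int k))" by (auto simp: I_def)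
    note [simp] = h(1-3)
    obtain z where z: "z \<in> Arr C" "Dom C z = P (int k)" "Cod C z = cx S (int k + 1)"
      "\<phi> (int k) = (\<psi> (int k) \<boxplus> h \<cdot> a (int k)) \<boxplus> diff S (int k + 1) \<cdot> z"
      by (rule res_lift_diff[OF S _ _ _ _ _ _ _ h(4), of "P (int k)"]) auto
    note [simp] = z(1-3)
    have 1: "\<phi> (int k) = \<psi> (int k) \<boxplus> (h \<cdot> a (int k) \<boxplus> diff S (int k + 1) \<cdot> z)"
      unfolding z(4) by (rule madd_assoc) auto
    have aa: "a (int k) \<cdot> a (int k + 1) = mzero C (P (int k + 1)) (P (int k - 1))"
      using cpxD(6)[OF a, of "int k + 1"] by simp
    have "diff S (int k + 1) \<cdot> \<phi> (int k + 1) = \<phi> (int k) \<cdot> a (int k + 1)"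
      using c\<phi>[of "int k + 1"] by simp
    also have "\<dots> = \<psi> (int k) \<cdot> a (int k + 1) \<boxplus> diff S (int k + 1) \<cdot> (z \<cdot> a (int k + 1))"
      unfolding 1 by (simp add: aa)
    also have "\<psi> (int k) \<cdot> a (int k + 1) = diff S (int k + 1) \<cdot> \<psi> (int k + 1)"
      using c\<psi>[of "int k + 1"] by simp
    also have "\<dots> \<boxplus> diff S (int k + 1) \<cdot> (z \<cdot> a (int k + 1)) = diff S (int k + 1) \<cdot> (\<psi> (int k + 1) \<boxplus> z \<cdot> a (int k + 1))"
      by simp
    finally have 2: "syz_in S k \<cdot> (syz_pr S (Suc k) \<cdot> \<phi> (int k + 1)) =
        syz_in S k \<cdot> (syz_pr S (Suc k) \<cdot> (\<psi> (int k + 1) \<boxplus> z \<cdot> a (int k + 1)))"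
      unfolding res_diff[OF S] by (simp add: add.commute)
    have "syz_pr S (Suc k) \<cdot> \<phi> (int k + 1) = syz_pr S (Suc k) \<cdot> (\<psi> (int k + 1) \<boxplus> z \<cdot> a (int k + 1))"
      by (rule syz_in_mono[OF S 2]) (auto simp: add.commute)
    hence "I (Suc k) z" by (simp add: I_def add.commute)
    with 1 show "\<exists>z. I (Suc k) z \<and> \<phi> (int k) = \<psi> (int k) \<boxplus> (h \<cdot> a (int k) \<boxplus> diff S (int k + 1) \<cdot> z)" by blast
  qed
  then obtain g where g: "\<And>k. I k (g k)"
    "\<And>k. \<phi> (int k) = \<psi> (int k) \<boxplus> (g k \<cdot> a (int k) \<boxplus> diff S (int k + 1) \<cdot> g (Suc k))" by blast
  \<comment> \<open>The \<open>k\<close>-th choice is the component in degree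
    \<open>int k - 1\<close>, so the homotopy starts in degree -1 and not in degree 0.\<close>
  define e where "e j = (if j \<ge> - 1 then g (nat (j + 1)) else mzero C (P j) (cx S (j + 1)))" for j
  have f: "fam P (\<lambda>j. cx S (j + 1)) e"
    using g(1) by (auto simp: fam_def e_def I_def)
  have "\<phi> j = \<psi> j \<boxplus> (e (j - 1) \<cdot> a j \<boxplus> diff S (j + 1) \<cdot> e j)" for j
  proof (cases "j \<ge> 0")
    case True
    have "nat (j + 1) = Suc (nat j)" using True by simp
    thus ?thesis using g(2)[of "nat j"] True by (simp add: e_def)
  next
    case False
    show ?thesis
      by (rule res_cx_unique[OF S, where j = "j"]) (use False in \<open>auto simp: famD[OF f]\<close>)
  qed
  thus ?thesis using that f by blast
qed

end

section \<open>Subquotients of abelian groups\<close>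

text \<open>Cycles modulo boundaries inside an ambient group; instantiated for Ext and for homotopy
  classes of both kinds.\<close>

locale subquotient = comm_group G for G (structure) +
  fixes K N
  assumes K: "subgroup K G" and N: "subgroup N G" and NK: "N \<subseteq> K"
begin

lemma K_closed [simp]: "x \<in> K \<Longrightarrow> x \<in> carrier G"
  using subgroup.mem_carrier[OF K] .

lemma coset_eq:
  assumes "x \<in> K" "y \<in> K"
  shows "N #> x = N #> y \<longleftrightarrow> (\<exists>n\<in>N. x = y \<otimes> n)"
proof
  assume "N #> x = N #> y"
  hence "x \<in> N #> y" using rcos_self[OF _ N, of x] assms by auto
  thus "\<exists>n\<in>N. x = y \<otimes> n" using subgroup.mem_carrier[OF N] assms m_comm by (auto simp: r_coset_def)
next
  assume "\<exists>n\<in>N. x = y \<otimes> n"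
  hence "x \<in> N #> y" using subgroup.mem_carrier[OF N] assms m_comm by (auto simp: r_coset_def)
  thus "N #> x = N #> y" using repr_independence[OF _ _ N, of x y] assms by auto
qed

text \<open>A class is literally the set of its representatives. The operations on classes quantify
  over members of a class, and this turns them into statements on representatives.\<close>

lemma coset_mem:
  assumes "x \<in> K"
  shows "y \<in> N #> x \<longleftrightarrow> y \<in> K \<and> N #> y = N #> x"
proof
  assume y: "y \<in> N #> x"
  then obtain n where "n \<in> N" "y = n \<otimes> x" by (auto simp: r_coset_def)
  hence "y \<in> K" using NK subgroup.m_closed[OF K] assms by blast
  thus "y \<in> K \<and> N #> y = N #> x" using repr_independence[OF y _ N] assms by auto
next
  assume "y \<in> K \<and> N #> y = N #> x"
  thus "y \<in> N #> x" using rcos_self[OF _ N, of y] by auto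
qed

abbreviation Quot where "Quot \<equiv> G\<lparr>carrier := K\<rparr> Mod N"

lemma quot_mult [simp]: "x \<in> K \<Longrightarrow> y \<in> K \<Longrightarrow> (N #> x) \<otimes>\<^bsub>Quot\<^esub> (N #> y) = N #> (x \<otimes> y)"
  using normal.rcos_sum[OF subgroup_imp_normal[OF N], of x y] by (simp add: FactGroup_def set_mult_def)

lemma quot_one: "\<one>\<^bsub>Quot\<^esub> = N #> \<one>"
  using coset_join2[OF _ N] subgroup.one_closed[OF N] by (simp add: FactGroup_def)

lemma quot_carrier: "carrier Quot = (\<lambda>x. N #> x) ` K"
  by (auto simp: FactGroup_def RCOSETS_def r_coset_def)

lemma quot_group: "comm_group Quot"
proof -
  have 1: "comm_group (G\<lparr>carrier := K\<rparr>)"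
    by (rule group.group_comm_groupI[OF subgroup_imp_group[OF K]]) (auto intro: m_comm)
  show ?thesis by (rule comm_group.abelian_FactGroup[OF 1 subgroup_incl[OF N K NK]])
qed

end

section \<open>Shifted resolutions\<close>

context abelian_category
begin

lemma shift_simps:
  "cx (shift_res C k S) j = (if j \<ge> 0 then cx S (j + int k) else cx S j)"
  "syz (shift_res C k S) i = syz S (i + k)"
  "syz_in (shift_res C k S) i = syz_in S (i + k)"
  "syz_pr (shift_res C k S) i = syz_pr S (i + k)"
  "j \<ge> 1 \<Longrightarrow> diff (shift_res C k S) j = diff S (j + int k)"
  by (auto simp: shift_res_def)

lemma is_res_shift [simp]:
  assumes S: "is_res S" shows "is_res (shift_res C k S)"
proof -
  note [simp] = S
  have 1: "diff (shift_res C k S) j \<in> Hom C (cx (shift_res C k S) j) (cx (shift_res C k S) (j - 1))" for j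
    by (auto simp: shift_res_def Hom_def algebra_simps)
  have 2: "diff S (1 + (int i + int k)) = syz_in S (i + k) \<cdot> syz_pr S (Suc (i + k))" for i
    using res_diff[OF S, of "i + k"] by (simp add: algebra_simps)
  show ?thesis unfolding is_res_def proj_resolution_def using 1 res_zero[OF S] res_exact[OF S]
    by (auto simp: shift_simps Hom_def algebra_simps 2)
qed

lemma shift_shift:
  assumes S: "is_res S" shows "shift_res C i (shift_res C k S) = shift_res C (i + k) S"
  by (rule resolution.equality) (auto simp: shift_res_def fun_eq_iff add.assoc)

text \<open>The shift puts a zero map in degree 0; for \<open>k = 0\<close> this agrees with the old
  differential, whose codomain is a zero object.\<close>

lemma shift_0:
  assumes S: "is_res S" shows "shift_res C 0 S = S"
proof -
  have "mzero C (cx S 0) (cx S (- 1)) = diff S 0"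
    by (rule res_cx_unique[OF S, where j = "- 1"]) (use S in auto)
  thus ?thesis by (intro resolution.equality) (auto simp: shift_res_def fun_eq_iff)
qed

end

section \<open>Homotopy classes of chain maps and almost chain maps\<close>

text \<open>Chain conditions and homotopy formulas involve neighbouring degrees at once, so an
  equation that holds eventually must still do so after translation.\<close>

definition shiftable :: "int filter \<Rightarrow> bool" where
  "shiftable F \<longleftrightarrow> (\<forall>P k. eventually P F \<longrightarrow> eventually (\<lambda>j. P (j + k)) F)"

lemma shiftable_every [simp]: "shiftable every_degree"
  by (auto simp: shiftable_def)

lemma shiftable_cofinite [simp]: "shiftable cofinite"
  unfolding shiftable_def eventually_cofinite
proof (intro allI impI)
  fix P :: "int \<Rightarrow> bool" and k :: int assume "finite {j. \<not> P j}"
  hence "finite ((\<lambda>j. j + k) -` {j. \<not> P j})" by (rule finite_vimageI) (auto simp: inj_def)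
  thus "finite {j. \<not> P (j + k)}" by (simp add: vimage_def)
qed

lemma eventually_pred: "shiftable F \<Longrightarrow> eventually P F \<Longrightarrow> eventually (\<lambda>j. P (j - 1)) F"
  unfolding shiftable_def by (drule spec[of _ P], drule spec[of _ "- 1"]) simp

lemma eventually_succ: "shiftable F \<Longrightarrow> eventually P F \<Longrightarrow> eventually (\<lambda>j. P (j + 1)) F"
  unfolding shiftable_def by blast

text \<open>Only the resolution of the first argument is fixed. The second argument ranges over all
  resolutions, as naturality and the passage to syzygies require.\<close>

locale resolved_object = abelian_category C for C :: "('o, 'm) category_data" (structure) +
  fixes R :: "('o, 'm) resolution"
  assumes R [simp]: "is_res R"
begin

text \<open>\<open>P n\<close> and \<open>\<partial> n\<close> are the terms and the differential of the shifted complex \<open>R[n]\<close>.\<close>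

abbreviation P :: "int \<Rightarrow> int \<Rightarrow> 'o" where "P n \<equiv> \<lambda>j. cx R (n + j)"

definition sd :: "int \<Rightarrow> int \<Rightarrow> 'm" ("\<partial>") where "\<partial> n j = msign C n (diff R (n + j))"

lemma sd_arr [simp]: "\<partial> n j \<in> Arr C" "Dom C (\<partial> n j) = cx R (n + j)" "Cod C (\<partial> n j) = cx R (n + j - 1)"
  by (auto simp: sd_def)

lemma sd_sd [simp]: "\<partial> n (j - 1) \<cdot> \<partial> n j = mzero C (cx R (n + j)) (cx R (n + j - 2))"
  using res_dd[OF R, of "n + j"] by (simp add: sd_def add_diff_eq)

lemma cpx_sd [simp]: "cpx (P n) (\<partial> n)"
  by (auto simp: cpx_def add_diff_eq)

text \<open>Raising \<open>n\<close> by one shifts the degree and also flips the sign; the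
  alternating sign of the connecting map compensates for this flip.\<close>

lemma sd_Suc: "\<partial> (n + 1) j = neg (\<partial> n (j + 1))"
  by (auto simp: sd_def msign_eq algebra_simps)

definition chain :: "int filter \<Rightarrow> int \<Rightarrow> ('o, 'm) resolution \<Rightarrow> (int \<Rightarrow> 'm) \<Rightarrow> bool" where
  "chain F n S \<phi> \<longleftrightarrow> fam (P n) (cx S) \<phi> \<and> (\<forall>\<^sub>F j in F. diff S j \<cdot> \<phi> j = \<phi> (j - 1) \<cdot> \<partial> n j)"

definition homotopic :: "int filter \<Rightarrow> int \<Rightarrow> ('o, 'm) resolution \<Rightarrow> (int \<Rightarrow> 'm) \<Rightarrow> (int \<Rightarrow> 'm) \<Rightarrow> bool" where
  "homotopic F n S \<phi> \<psi> \<longleftrightarrow> (\<exists>e. fam (P n) (\<lambda>j. cx S (j + 1)) e \<and>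
     (\<forall>\<^sub>F j in F. \<phi> j = \<psi> j \<boxplus> (e (j - 1) \<cdot> \<partial> n j \<boxplus> diff S (j + 1) \<cdot> e j)))"

abbreviation "cls F n S \<equiv> hyper_class C F n R S"

abbreviation zfam :: "int \<Rightarrow> ('o, 'm) resolution \<Rightarrow> int \<Rightarrow> 'm" where
  "zfam n S \<equiv> \<lambda>j. mzero C (cx R (n + j)) (cx S j)"

lemma chainD: "chain F n S \<phi> \<Longrightarrow> fam (P n) (cx S) \<phi>"
  "chain F n S \<phi> \<Longrightarrow> \<phi> j \<in> Arr C" "chain F n S \<phi> \<Longrightarrow> Dom C (\<phi> j) = cx R (n + j)"
  "chain F n S \<phi> \<Longrightarrow> Cod C (\<phi> j) = cx S j"
  "chain F n S \<phi> \<Longrightarrow> \<forall>\<^sub>F j in F. diff S j \<cdot> \<phi> j = \<phi> (j - 1) \<cdot> \<partial> n j"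
  by (auto simp: chain_def fam_def)

lemma degree_maps_fam: "degree_maps C n R S = {\<phi>. fam (P n) (cx S) \<phi>}"
  by (auto simp: degree_maps_def fam_def Hom_def)

lemma degree_grp_simps [simp]:
  "carrier (degree_grp C n R S) = {\<phi>. fam (P n) (cx S) \<phi>}"
  "\<phi> \<otimes>\<^bsub>degree_grp C n R S\<^esub> \<psi> = (\<lambda>j. \<phi> j \<boxplus> \<psi> j)"
  "\<one>\<^bsub>degree_grp C n R S\<^esub> = zfam n S"
  by (auto simp: degree_grp_def degree_maps_fam)

lemma degree_grp_group:
  assumes S: "is_res S" shows "comm_group (degree_grp C n R S)"
proof (rule comm_groupI)
  note [simp] = S
  fix x assume x: "x \<in> carrier (degree_grp C n R S)"
  note [simp] = famD[OF x[simplified]]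
  show "\<exists>y\<in>carrier (degree_grp C n R S). y \<otimes>\<^bsub>degree_grp C n R S\<^esub> x = \<one>\<^bsub>degree_grp C n R S\<^esub>"
    by (rule bexI[of _ "\<lambda>j. neg (x j)"]) (auto simp: fam_def)
qed (use S in \<open>auto simp: fam_def fun_eq_iff intro: madd_ac\<close>)

lemma degree_inv:
  assumes S: "is_res S" and x: "fam (P n) (cx S) x"
  shows "inv\<^bsub>degree_grp C n R S\<^esub> x = (\<lambda>j. neg (x j))"
proof -
  note [simp] = S famD[OF x]
  interpret G: comm_group "degree_grp C n R S" using S by (rule degree_grp_group)
  show ?thesis by (rule G.inv_equality) (use x in \<open>auto simp: fam_def\<close>)
qed

lemma chain_maps_chain:
  assumes S: "is_res S" shows "chain_maps C F n R S = {\<phi>. chain F n S \<phi>}"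
proof -
  note [simp] = S
  have "msign C n (\<phi> (j - 1) \<cdot> diff R (n + j)) = \<phi> (j - 1) \<cdot> \<partial> n j"
    if "fam (P n) (cx S) \<phi>" for \<phi> j
    using famD[OF that] by (simp add: sd_def add_diff_eq)
  thus ?thesis unfolding chain_maps_def chain_def degree_maps_fam by auto
qed

lemma null_maps_iff:
  assumes S: "is_res S"
  shows "\<phi> \<in> null_maps C F n R S \<longleftrightarrow> fam (P n) (cx S) \<phi> \<and> (\<exists>e. fam (P n) (\<lambda>j. cx S (j + 1)) e \<and>
     (\<forall>\<^sub>F j in F. \<phi> j = e (j - 1) \<cdot> \<partial> n j \<boxplus> diff S (j + 1) \<cdot> e j))"
  by (auto simp: null_maps_def degree_maps_fam sd_def fam_def Hom_def)

lemma null_mapsI: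
  assumes "is_res S" "fam (P n) (cx S) \<phi>" "fam (P n) (\<lambda>j. cx S (j + 1)) e"
    "\<forall>\<^sub>F j in F. \<phi> j = e (j - 1) \<cdot> \<partial> n j \<boxplus> diff S (j + 1) \<cdot> e j"
  shows "\<phi> \<in> null_maps C F n R S"
  using assms null_maps_iff by blast

lemma hyper_subquotient:
  assumes S: "is_res S" and F: "shiftable F"
  shows "subquotient (degree_grp C n R S) (chain_maps C F n R S) (null_maps C F n R S)"
proof -
  note [simp] = S
  interpret G: comm_group "degree_grp C n R S" using S by (rule degree_grp_group)
  have 1: "subgroup (chain_maps C F n R S) (degree_grp C n R S)"
    unfolding chain_maps_chain[OF S]
  proof (rule G.subgroupI)
    show "{\<phi>. chain F n S \<phi>} \<noteq> {}"
      by (auto simp: chain_def fam_def add_diff_eq intro!: exI[of _ "zfam n S"])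
    fix \<phi> assume "\<phi> \<in> {\<phi>. chain F n S \<phi>}"
    hence \<phi>: "chain F n S \<phi>" by simp
    note [simp] = chainD(2-4)[OF \<phi>]
    show "inv\<^bsub>degree_grp C n R S\<^esub> \<phi> \<in> {\<phi>. chain F n S \<phi>}"
      using chainD(5)[OF \<phi>] by (auto simp: chain_def degree_inv[OF S chainD(1)[OF \<phi>]] fam_def add_diff_eq elim!: eventually_mono)
    fix \<psi> assume "\<psi> \<in> {\<phi>. chain F n S \<phi>}"
    hence \<psi>: "chain F n S \<psi>" by simp
    note [simp] = chainD(2-4)[OF \<psi>]
    have "\<forall>\<^sub>F j in F. diff S j \<cdot> (\<phi> j \<boxplus> \<psi> j) = (\<phi> (j - 1) \<boxplus> \<psi> (j - 1)) \<cdot> \<partial> n j"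
      using chainD(5)[OF \<phi>] chainD(5)[OF \<psi>] by eventually_elim (simp add: add_diff_eq)
    thus "\<phi> \<otimes>\<^bsub>degree_grp C n R S\<^esub> \<psi> \<in> {\<phi>. chain F n S \<phi>}" by (auto simp: chain_def fam_def)
  qed (auto simp: chain_def)
  have 2: "subgroup (null_maps C F n R S) (degree_grp C n R S)"
  proof (rule G.subgroupI)
    have "zfam n S \<in> null_maps C F n R S" unfolding null_maps_iff[OF S]
      by (auto simp: fam_def add_diff_eq intro!: exI[of _ "\<lambda>j. mzero C (cx R (n + j)) (cx S (j + 1))"])
    thus "null_maps C F n R S \<noteq> {}" by blast
    fix \<phi> assume "\<phi> \<in> null_maps C F n R S"
    then obtain e where \<phi>: "fam (P n) (cx S) \<phi>" and e: "fam (P n) (\<lambda>j. cx S (j + 1)) e"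
      and \<phi>e: "\<forall>\<^sub>F j in F. \<phi> j = e (j - 1) \<cdot> \<partial> n j \<boxplus> diff S (j + 1) \<cdot> e j"
      unfolding null_maps_iff[OF S] by blast
    note [simp] = famD[OF \<phi>] famD[OF e]
    have ev: "\<forall>\<^sub>F j in F. neg (\<phi> j) = neg (e (j - 1)) \<cdot> \<partial> n j \<boxplus> diff S (j + 1) \<cdot> neg (e j)"
      using \<phi>e by eventually_elim (simp add: add_diff_eq)
    have fe: "fam (P n) (\<lambda>j. cx S (j + 1)) (\<lambda>j. neg (e j))" by (simp add: fam_def)
    show "inv\<^bsub>degree_grp C n R S\<^esub> \<phi> \<in> null_maps C F n R S"
      unfolding degree_inv[OF S \<phi>] by (rule null_mapsI[OF S _ fe ev]) (simp add: fam_def)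
    fix \<psi> assume "\<psi> \<in> null_maps C F n R S"
    then obtain f where \<psi>: "fam (P n) (cx S) \<psi>" and f: "fam (P n) (\<lambda>j. cx S (j + 1)) f"
      and \<psi>f: "\<forall>\<^sub>F j in F. \<psi> j = f (j - 1) \<cdot> \<partial> n j \<boxplus> diff S (j + 1) \<cdot> f j"
      unfolding null_maps_iff[OF S] by blast
    note [simp] = famD[OF \<psi>] famD[OF f]
    have ev: "\<forall>\<^sub>F j in F. \<phi> j \<boxplus> \<psi> j = (e (j - 1) \<boxplus> f (j - 1)) \<cdot> \<partial> n j \<boxplus> diff S (j + 1) \<cdot> (e j \<boxplus> f j)"
      using \<phi>e \<psi>f by eventually_elim (simp add: add_diff_eq madd_ac)
    have fe: "fam (P n) (\<lambda>j. cx S (j + 1)) (\<lambda>j. e j \<boxplus> f j)" by (simp add: fam_def)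
    show "\<phi> \<otimes>\<^bsub>degree_grp C n R S\<^esub> \<psi> \<in> null_maps C F n R S"
      unfolding degree_grp_simps by (rule null_mapsI[OF S _ fe ev]) (simp add: fam_def)
  qed (auto simp: null_maps_iff[OF S])
  have 3: "null_maps C F n R S \<subseteq> chain_maps C F n R S"
  proof
    fix \<phi> assume "\<phi> \<in> null_maps C F n R S"
    then obtain e where \<phi>: "fam (P n) (cx S) \<phi>" and e: "fam (P n) (\<lambda>j. cx S (j + 1)) e"
      and \<phi>e: "\<forall>\<^sub>F j in F. \<phi> j = e (j - 1) \<cdot> \<partial> n j \<boxplus> diff S (j + 1) \<cdot> e j"
      unfolding null_maps_iff[OF S] by blast
    note [simp] = famD[OF \<phi>] famD[OF e]
    have dd: "diff S j \<cdot> (diff S (j + 1) \<cdot> e j) = mzero C (cx R (n + j)) (cx S (j - 1))" for j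
    proof -
      have "diff S j \<cdot> (diff S (j + 1) \<cdot> e j) = (diff S j \<cdot> diff S (j + 1)) \<cdot> e j"
        by (rule comp_assoc[symmetric]) auto
      thus ?thesis using res_dd[OF S, of "j + 1"] by (simp del: comp_assoc)
    qed
    have ss: "e (j - 2) \<cdot> (\<partial> n (j - 1) \<cdot> \<partial> n j) = mzero C (cx R (n + j)) (cx S (j - 1))" for j
      by (simp add: add_diff_eq)
    have "\<forall>\<^sub>F j in F. diff S j \<cdot> \<phi> j = \<phi> (j - 1) \<cdot> \<partial> n j"
      using \<phi>e eventually_pred[OF F \<phi>e]
    proof eventually_elim
      \<comment> \<open>The homotopy formula is available in the degrees \<open>j\<close> and
        \<open>j - 1\<close> because the filter is translation invariant. The squares of the
        differentials vanish, and the same mixed term remains on both sides.\<close>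
      case (elim j)
      have "diff S j \<cdot> \<phi> j = diff S j \<cdot> (e (j - 1) \<cdot> \<partial> n j)" unfolding elim(1) by (simp add: add_diff_eq dd)
      moreover have "\<phi> (j - 1) \<cdot> \<partial> n j = diff S j \<cdot> (e (j - 1) \<cdot> \<partial> n j)"
        unfolding elim(2) using ss[of j] by (simp add: add_diff_eq del: sd_sd)
      ultimately show ?case by simp
    qed
    thus "\<phi> \<in> chain_maps C F n R S" using \<phi> by (simp add: chain_maps_chain chain_def)
  qed
  show ?thesis
    by (rule subquotient.intro[OF G.comm_group_axioms subquotient_axioms.intro[OF 1 2 3]])
qed

section \<open>The group of homotopy classes\<close>

context
  fixes S F assumes S: "is_res S" and F: "shiftable F"
begin

interpretation sq: subquotient "degree_grp C n R S" "chain_maps C F n R S" "null_maps C F n R S" for n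
  using hyper_subquotient[OF S F] .

lemma hyper_group: "comm_group (hyper_grp C F n R S)"
  using sq.quot_group[of n] by (simp add: hyper_grp_def)

lemma hyper_carrier: "carrier (hyper_grp C F n R S) = cls F n S ` {\<phi>. chain F n S \<phi>}"
  using sq.quot_carrier[of n] by (simp add: hyper_grp_def hyper_class_def chain_maps_chain[OF S])

lemma hyper_mult:
  "chain F n S \<phi> \<Longrightarrow> chain F n S \<psi> \<Longrightarrow>
    cls F n S \<phi> \<otimes>\<^bsub>hyper_grp C F n R S\<^esub> cls F n S \<psi> = cls F n S (\<lambda>j. \<phi> j \<boxplus> \<psi> j)"
  using sq.quot_mult[of \<phi> n \<psi>] by (simp add: hyper_grp_def hyper_class_def chain_maps_chain[OF S])

lemma hyper_one: "\<one>\<^bsub>hyper_grp C F n R S\<^esub> = cls F n S (zfam n S)"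
  using sq.quot_one[of n] by (simp add: hyper_grp_def hyper_class_def)

lemma chain_zfam [simp]: "chain F n S (zfam n S)"
  using subgroup.one_closed[OF sq.K, of n] by (simp add: chain_maps_chain[OF S])

lemma chain_add: "chain F n S \<phi> \<Longrightarrow> chain F n S \<psi> \<Longrightarrow> chain F n S (\<lambda>j. \<phi> j \<boxplus> \<psi> j)"
  using subgroup.m_closed[OF sq.K, of \<phi> n \<psi>] by (simp add: chain_maps_chain[OF S])

lemma cls_eq:
  assumes \<phi>: "chain F n S \<phi>" and \<psi>: "chain F n S \<psi>"
  shows "cls F n S \<phi> = cls F n S \<psi> \<longleftrightarrow> homotopic F n S \<phi> \<psi>"
proof -
  note [simp] = S chainD(2-4)[OF \<phi>] chainD(2-4)[OF \<psi>]
  have "cls F n S \<phi> = cls F n S \<psi> \<longleftrightarrow> (\<exists>\<nu>\<in>null_maps C F n R S. \<phi> = (\<lambda>j. \<psi> j \<boxplus> \<nu> j))"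
    using sq.coset_eq[of \<phi> n \<psi>] \<phi> \<psi> by (simp add: hyper_class_def chain_maps_chain)
  also have "\<dots> \<longleftrightarrow> homotopic F n S \<phi> \<psi>"
  proof
    assume "\<exists>\<nu>\<in>null_maps C F n R S. \<phi> = (\<lambda>j. \<psi> j \<boxplus> \<nu> j)"
    then obtain \<nu> where \<nu>: "\<nu> \<in> null_maps C F n R S" "\<phi> = (\<lambda>j. \<psi> j \<boxplus> \<nu> j)" ..
    then obtain e where e: "fam (P n) (\<lambda>j. cx S (j + 1)) e"
      "\<forall>\<^sub>F j in F. \<nu> j = e (j - 1) \<cdot> \<partial> n j \<boxplus> diff S (j + 1) \<cdot> e j"
      unfolding null_maps_iff[OF S] by blast
    show "homotopic F n S \<phi> \<psi>" unfolding homotopic_def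
      using e(1) eventually_mono[OF e(2)] \<nu>(2) by (intro exI[of _ e]) auto
  next
    assume "homotopic F n S \<phi> \<psi>"
    then obtain e where e: "fam (P n) (\<lambda>j. cx S (j + 1)) e"
      "\<forall>\<^sub>F j in F. \<phi> j = \<psi> j \<boxplus> (e (j - 1) \<cdot> \<partial> n j \<boxplus> diff S (j + 1) \<cdot> e j)"
      unfolding homotopic_def by blast
    note [simp] = famD[OF e(1)]
    have "\<forall>\<^sub>F j in F. neg (\<psi> j) \<boxplus> \<phi> j = e (j - 1) \<cdot> \<partial> n j \<boxplus> diff S (j + 1) \<cdot> e j"
      using e(2)
    proof eventually_elim
      case (elim j)
      show ?case unfolding elim by (rule madd_neg_cancel) (auto simp: add_diff_eq)
    qed
    hence "(\<lambda>j. neg (\<psi> j) \<boxplus> \<phi> j) \<in> null_maps C F n R S"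
      by (intro null_mapsI[OF S _ e(1)]) (simp add: fam_def)
    moreover have "\<phi> = (\<lambda>j. \<psi> j \<boxplus> (neg (\<psi> j) \<boxplus> \<phi> j))" by (auto simp: fun_eq_iff)
    ultimately show "\<exists>\<nu>\<in>null_maps C F n R S. \<phi> = (\<lambda>j. \<psi> j \<boxplus> \<nu> j)"
      by (intro bexI[of _ "\<lambda>j. neg (\<psi> j) \<boxplus> \<phi> j"])
  qed
  finally show ?thesis .
qed

lemma cls_mem: "chain F n S \<phi> \<Longrightarrow> \<psi> \<in> cls F n S \<phi> \<longleftrightarrow> chain F n S \<psi> \<and> cls F n S \<psi> = cls F n S \<phi>"
  using sq.coset_mem[of \<phi> n \<psi>] by (simp add: hyper_class_def chain_maps_chain[OF S])

end

end

section \<open>Induced maps\<close>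

lemma the_elem_eqI: "x \<in> A \<Longrightarrow> (\<And>y. y \<in> A \<Longrightarrow> y = x) \<Longrightarrow> the_elem A = x"
proof -
  assume "x \<in> A" "\<And>y. y \<in> A \<Longrightarrow> y = x"
  hence "A = {x}" by blast
  thus "the_elem A = x" by simp
qed

context abelian_category
begin

section \<open>Lifts of morphisms to chain maps\<close>

lemma cpx_res: "is_res S \<Longrightarrow> cpx (cx S) (diff S)"
  by (auto simp: cpx_def res_dd)

lemma liftsI:
  "\<lbrakk>fam (cx S) (cx S') u; \<And>j. diff S' j \<cdot> u j = u (j - 1) \<cdot> diff S j;
    syz_pr S' 0 \<cdot> u 0 = f \<cdot> syz_pr S 0\<rbrakk> \<Longrightarrow> lifts C S S' f u"
  by (auto simp: lifts_def fam_def Hom_def)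

lemma liftsD:
  assumes "lifts C S S' f u"
  shows "fam (cx S) (cx S') u" "u j \<in> Arr C" "Dom C (u j) = cx S j" "Cod C (u j) = cx S' j"
    "diff S' j \<cdot> u j = u (j - 1) \<cdot> diff S j" "syz_pr S' 0 \<cdot> u 0 = f \<cdot> syz_pr S 0"
  using assms by (auto simp: lifts_def fam_def Hom_def)

lemma lifts_exist:
  assumes S: "is_res S" and S': "is_res S'" and f: "f \<in> Arr C" "Dom C f = syz S 0" "Cod C f = syz S' 0"
  obtains u where "lifts C S S' f u"
proof -
  note [simp] = S S' f
  obtain x where x: "x \<in> Arr C" "Dom C x = cx S 0" "Cod C x = cx S' (int 0)" "syz_pr S' 0 \<cdot> x = f \<cdot> syz_pr S 0"
    by (rule syz_pr_lift[OF S', of "cx S 0" "f \<cdot> syz_pr S 0" 0]) auto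
  note [simp] = x(1-3)
  have "syz_pr S' 0 \<cdot> (x \<cdot> diff S 1) = (f \<cdot> syz_pr S 0) \<cdot> diff S 1"
    unfolding x(4)[symmetric] by (rule comp_assoc[symmetric]) auto
  hence xa: "syz_pr S' 0 \<cdot> (x \<cdot> diff S 1) = mzero C (cx S 1) (syz S' 0)" by simp
  obtain u where "u 0 = x" "fam (cx S) (cx S') u" "\<And>j. diff S' j \<cdot> u j = u (j - 1) \<cdot> diff S j"
    by (rule extend_chain_map[OF S' cpx_res[OF S] x(1,2) _ xa]) auto
  thus ?thesis using that[of u] x(4) by (simp add: liftsI)
qed

text \<open>Both chain maps cover the same \<open>f\<close>, so the comparison theorem applies with
  the zero arrow as correction in degree -1.\<close>

lemma lifts_homotopy:
  assumes S: "is_res S" and S': "is_res S'" and u: "lifts C S S' f u" and v: "lifts C S S' f v"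
  obtains e where "fam (cx S) (\<lambda>j. cx S' (j + 1)) e"
    "\<And>j. u j = v j \<boxplus> (e (j - 1) \<cdot> diff S j \<boxplus> diff S' (j + 1) \<cdot> e j)"
proof (rule chain_homotopy[OF S' cpx_res[OF S] liftsD(1)[OF u] liftsD(1)[OF v] liftsD(5)[OF u] liftsD(5)[OF v],
      of "mzero C (cx S (- 1)) (syz S' 0)"])
  note [simp] = S S' liftsD(2-4)[OF v]
  have "syz_pr S' 0 \<cdot> v 0 \<boxplus> mzero C (cx S (- 1)) (syz S' 0) \<cdot> diff S 0 = syz_pr S' 0 \<cdot> v 0"
    by simp
  thus "syz_pr S' 0 \<cdot> u 0 = syz_pr S' 0 \<cdot> v 0 \<boxplus> mzero C (cx S (- 1)) (syz S' 0) \<cdot> diff S 0"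
    unfolding liftsD(6)[OF u] liftsD(6)[OF v] by simp
qed (use S S' that in auto)

lemma lifts_ident:
  assumes S: "is_res S" shows "lifts C S S (ident C (syz S 0)) (\<lambda>j. ident C (cx S j))"
  using S by (intro liftsI) (auto simp: fam_def)

lemma lifts_comp:
  assumes S: "is_res S" "is_res S'" "is_res S''" and u: "lifts C S S' f u" and v: "lifts C S' S'' g v"
    and fg: "f \<in> Arr C" "g \<in> Arr C" "Dom C f = syz S 0" "Cod C f = syz S' 0" "Dom C g = syz S' 0"
  shows "lifts C S S'' (g \<cdot> f) (\<lambda>j. v j \<cdot> u j)"
proof (rule liftsI)
  note [simp] = S fg liftsD(2-4)[OF u] liftsD(2-4)[OF v]
  show "fam (cx S) (cx S'') (\<lambda>j. v j \<cdot> u j)" by (auto simp: fam_def)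
  fix j
  have "diff S'' j \<cdot> (v j \<cdot> u j) = (diff S'' j \<cdot> v j) \<cdot> u j" by simp
  also have "\<dots> = v (j - 1) \<cdot> (diff S' j \<cdot> u j)" unfolding liftsD(5)[OF v] by simp
  also have "\<dots> = (v (j - 1) \<cdot> u (j - 1)) \<cdot> diff S j" unfolding liftsD(5)[OF u] by simp
  finally show "diff S'' j \<cdot> (v j \<cdot> u j) = (v (j - 1) \<cdot> u (j - 1)) \<cdot> diff S j" .
  have "syz_pr S'' 0 \<cdot> (v 0 \<cdot> u 0) = (syz_pr S'' 0 \<cdot> v 0) \<cdot> u 0" by simp
  also have "\<dots> = g \<cdot> (syz_pr S' 0 \<cdot> u 0)" unfolding liftsD(6)[OF v] by simp
  also have "\<dots> = (g \<cdot> f) \<cdot> syz_pr S 0" unfolding liftsD(6)[OF u] by simp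
  finally show "syz_pr S'' 0 \<cdot> (v 0 \<cdot> u 0) = (g \<cdot> f) \<cdot> syz_pr S 0" .
qed

lemma lifts_add:
  assumes S: "is_res S" "is_res S'" and u: "lifts C S S' f u" and v: "lifts C S S' g v"
    and fg: "f \<in> Arr C" "g \<in> Arr C" "Dom C f = syz S 0" "Cod C f = syz S' 0" "Dom C g = syz S 0" "Cod C g = syz S' 0"
  shows "lifts C S S' (f \<boxplus> g) (\<lambda>j. u j \<boxplus> v j)"
  using S fg liftsD(2-4)[OF u] liftsD(2-4)[OF v]
  by (intro liftsI) (auto simp: fam_def liftsD(5)[OF u] liftsD(5)[OF v] liftsD(6)[OF u] liftsD(6)[OF v])

end

section \<open>Functoriality on homotopy classes\<close>

context resolved_object
begin

lemma chain_comp: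
  assumes S: "is_res S" "is_res S'" and u: "lifts C S S' f u" and \<phi>: "chain F n S \<phi>"
  shows "chain F n S' (\<lambda>j. u j \<cdot> \<phi> j)"
proof -
  note [simp] = S liftsD(2-4)[OF u] chainD(2-4)[OF \<phi>]
  have "\<forall>\<^sub>F j in F. diff S' j \<cdot> (u j \<cdot> \<phi> j) = (u (j - 1) \<cdot> \<phi> (j - 1)) \<cdot> \<partial> n j"
    using chainD(5)[OF \<phi>]
  proof eventually_elim
    case (elim j)
    have "diff S' j \<cdot> (u j \<cdot> \<phi> j) = (diff S' j \<cdot> u j) \<cdot> \<phi> j" by simp
    also have "\<dots> = u (j - 1) \<cdot> (diff S j \<cdot> \<phi> j)" unfolding liftsD(5)[OF u] by simp
    also have "\<dots> = (u (j - 1) \<cdot> \<phi> (j - 1)) \<cdot> \<partial> n j" unfolding elim by (simp add: add_diff_eq)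
    finally show ?case .
  qed
  thus ?thesis by (auto simp: chain_def fam_def)
qed

lemma homotopic_comp:
  assumes S: "is_res S" "is_res S'" and u: "lifts C S S' f u"
    and \<phi>: "chain F n S \<phi>" and \<psi>: "chain F n S \<psi>" and e: "homotopic F n S \<phi> \<psi>"
  shows "homotopic F n S' (\<lambda>j. u j \<cdot> \<phi> j) (\<lambda>j. u j \<cdot> \<psi> j)"
proof -
  obtain e where e: "fam (P n) (\<lambda>j. cx S (j + 1)) e"
    "\<forall>\<^sub>F j in F. \<phi> j = \<psi> j \<boxplus> (e (j - 1) \<cdot> \<partial> n j \<boxplus> diff S (j + 1) \<cdot> e j)"
    using e unfolding homotopic_def by blast
  note [simp] = S liftsD(2-4)[OF u] chainD(2-4)[OF \<phi>] chainD(2-4)[OF \<psi>] famD[OF e(1)]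
  have "\<forall>\<^sub>F j in F. u j \<cdot> \<phi> j = u j \<cdot> \<psi> j \<boxplus>
    ((u (j - 1 + 1) \<cdot> e (j - 1)) \<cdot> \<partial> n j \<boxplus> diff S' (j + 1) \<cdot> (u (j + 1) \<cdot> e j))"
    using e(2)
  proof eventually_elim
    case (elim j)
    have "diff S' (j + 1) \<cdot> (u (j + 1) \<cdot> e j) = (diff S' (j + 1) \<cdot> u (j + 1)) \<cdot> e j" by simp
    also have "\<dots> = u j \<cdot> (diff S (j + 1) \<cdot> e j)" unfolding liftsD(5)[OF u] by simp
    finally show ?case unfolding elim by (simp add: add_diff_eq)
  qed
  moreover have "fam (P n) (\<lambda>j. cx S' (j + 1)) (\<lambda>j. u (j + 1) \<cdot> e j)" by (simp add: fam_def)
  \<comment> \<open>The index \<open>j - 1 + 1\<close> in the formula stays unsimplified so that it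
    is an instance of this witness.\<close>
  ultimately show ?thesis unfolding homotopic_def by (intro exI[of _ "\<lambda>j. u (j + 1) \<cdot> e j"]) simp
qed

text \<open>The homotopy between the lifts is composed with \<open>\<phi>\<close>; the chain
  condition of \<open>\<phi>\<close> moves the differential across, so the formula holds in every
  degree in which that condition does.\<close>

lemma homotopic_lifts:
  assumes S: "is_res S" "is_res S'" and u: "lifts C S S' f u" and v: "lifts C S S' f v" and \<phi>: "chain F n S \<phi>"
  shows "homotopic F n S' (\<lambda>j. u j \<cdot> \<phi> j) (\<lambda>j. v j \<cdot> \<phi> j)"
proof -
  obtain e where e: "fam (cx S) (\<lambda>j. cx S' (j + 1)) e"
    "\<And>j. u j = v j \<boxplus> (e (j - 1) \<cdot> diff S j \<boxplus> diff S' (j + 1) \<cdot> e j)"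
    using lifts_homotopy[OF S u v] by blast
  note [simp] = S liftsD(2-4)[OF u] liftsD(2-4)[OF v] chainD(2-4)[OF \<phi>] famD[OF e(1)]
  have "\<forall>\<^sub>F j in F. u j \<cdot> \<phi> j = v j \<cdot> \<phi> j \<boxplus>
    ((e (j - 1) \<cdot> \<phi> (j - 1)) \<cdot> \<partial> n j \<boxplus> diff S' (j + 1) \<cdot> (e j \<cdot> \<phi> j))"
    using chainD(5)[OF \<phi>]
  proof eventually_elim
    case (elim j)
    have "u j \<cdot> \<phi> j = v j \<cdot> \<phi> j \<boxplus> (e (j - 1) \<cdot> (diff S j \<cdot> \<phi> j) \<boxplus> diff S' (j + 1) \<cdot> (e j \<cdot> \<phi> j))"
      unfolding e(2)[of j] by simp
    thus ?case unfolding elim by (simp add: add_diff_eq)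
  qed
  moreover have "fam (P n) (\<lambda>j. cx S' (j + 1)) (\<lambda>j. e j \<cdot> \<phi> j)" by (simp add: fam_def)
  ultimately show ?thesis unfolding homotopic_def by (intro exI[of _ "\<lambda>j. e j \<cdot> \<phi> j"]) simp
qed

text \<open>Evaluation on any representative with any lift. A second choice is reached in two moves:
  \<open>homotopic_comp\<close> replaces the representative and \<open>homotopic_lifts\<close>
  replaces the lift.\<close>

lemma hyper_map_cls:
  assumes S: "is_res S" "is_res S'" and F: "shiftable F" and u: "lifts C S S' f u" and \<phi>: "chain F n S \<phi>"
  shows "hyper_map C F n R S S' f (cls F n S \<phi>) = cls F n S' (\<lambda>j. u j \<cdot> \<phi> j)"
  unfolding hyper_map_def
proof (rule the_elem_eqI)
  show "cls F n S' (\<lambda>j. u j \<cdot> \<phi> j) \<in> {cls F n S' (\<lambda>j. u j \<cdot> \<phi>' j) |u \<phi>'. lifts C S S' f u \<and> \<phi>' \<in> cls F n S \<phi>}"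
    using u \<phi> cls_mem[OF S(1) F \<phi>, of \<phi>] by blast
  fix y assume "y \<in> {cls F n S' (\<lambda>j. u j \<cdot> \<phi>' j) |u \<phi>'. lifts C S S' f u \<and> \<phi>' \<in> cls F n S \<phi>}"
  then obtain v \<psi> where v: "lifts C S S' f v" and "\<psi> \<in> cls F n S \<phi>" and y: "y = cls F n S' (\<lambda>j. v j \<cdot> \<psi> j)" by blast
  hence \<psi>: "chain F n S \<psi>" "cls F n S \<psi> = cls F n S \<phi>" using cls_mem[OF S(1) F \<phi>] by auto
  hence "homotopic F n S \<psi> \<phi>" using cls_eq[OF S(1) F \<psi>(1) \<phi>] by simp
  hence "cls F n S' (\<lambda>j. v j \<cdot> \<psi> j) = cls F n S' (\<lambda>j. v j \<cdot> \<phi> j)"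
    using homotopic_comp[OF S v \<psi>(1) \<phi>] cls_eq[OF S(2) F chain_comp[OF S v \<psi>(1)] chain_comp[OF S v \<phi>]] by blast
  also have "\<dots> = cls F n S' (\<lambda>j. u j \<cdot> \<phi> j)"
    using homotopic_lifts[OF S v u \<phi>] cls_eq[OF S(2) F chain_comp[OF S v \<phi>] chain_comp[OF S u \<phi>]] by blast
  finally show "y = cls F n S' (\<lambda>j. u j \<cdot> \<phi> j)" unfolding y .
qed

lemma hyperE:
  assumes "is_res S" "shiftable F" "X \<in> carrier (hyper_grp C F n R S)"
  obtains \<phi> where "chain F n S \<phi>" "X = cls F n S \<phi>"
  using assms hyper_carrier by auto

lemma cls_in: "is_res S \<Longrightarrow> shiftable F \<Longrightarrow> chain F n S \<phi> \<Longrightarrow> cls F n S \<phi> \<in> carrier (hyper_grp C F n R S)"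
  using hyper_carrier by auto

lemma hyper_map_hom:
  assumes S: "is_res S" "is_res S'" and F: "shiftable F" and f: "f \<in> Arr C" "Dom C f = syz S 0" "Cod C f = syz S' 0"
  shows "hyper_map C F n R S S' f \<in> hom (hyper_grp C F n R S) (hyper_grp C F n R S')"
proof -
  obtain u where u: "lifts C S S' f u" using lifts_exist[OF S f] .
  note [simp] = S liftsD(2-4)[OF u]
  show ?thesis
  proof (rule homI)
    fix X assume "X \<in> carrier (hyper_grp C F n R S)"
    then obtain \<phi> where \<phi>: "chain F n S \<phi>" "X = cls F n S \<phi>" by (rule hyperE[OF S(1) F])
    show "hyper_map C F n R S S' f X \<in> carrier (hyper_grp C F n R S')"
      unfolding \<phi>(2) hyper_map_cls[OF S F u \<phi>(1)] by (rule cls_in[OF S(2) F chain_comp[OF S u \<phi>(1)]])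
    fix Y assume "Y \<in> carrier (hyper_grp C F n R S)"
    then obtain \<psi> where \<psi>: "chain F n S \<psi>" "Y = cls F n S \<psi>" by (rule hyperE[OF S(1) F])
    have "(\<lambda>j. u j \<cdot> (\<phi> j \<boxplus> \<psi> j)) = (\<lambda>j. u j \<cdot> \<phi> j \<boxplus> u j \<cdot> \<psi> j)"
      using chainD(2-4)[OF \<phi>(1)] chainD(2-4)[OF \<psi>(1)] by (auto simp: fun_eq_iff)
    thus "hyper_map C F n R S S' f (X \<otimes>\<^bsub>hyper_grp C F n R S\<^esub> Y) =
       hyper_map C F n R S S' f X \<otimes>\<^bsub>hyper_grp C F n R S'\<^esub> hyper_map C F n R S S' f Y"
      using \<phi> \<psi> by (simp add: hyper_mult[OF S(1) F] hyper_mult[OF S(2) F] hyper_map_cls[OF S F u]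
          chain_comp[OF S u] chain_add[OF S(1) F])
  qed
qed

lemma hyper_map_ident:
  assumes S: "is_res S" and F: "shiftable F" and X: "X \<in> carrier (hyper_grp C F n R S)"
  shows "hyper_map C F n R S S (ident C (syz S 0)) X = X"
proof -
  obtain \<phi> where \<phi>: "chain F n S \<phi>" "X = cls F n S \<phi>" using X by (rule hyperE[OF S F])
  note [simp] = S chainD(2-4)[OF \<phi>(1)]
  show ?thesis unfolding \<phi>(2) hyper_map_cls[OF S S F lifts_ident[OF S] \<phi>(1)] by simp
qed

lemma hyper_map_comp:
  assumes S: "is_res S" "is_res S'" "is_res S''" and F: "shiftable F"
    and f: "f \<in> Arr C" "Dom C f = syz S 0" "Cod C f = syz S' 0"
    and g: "g \<in> Arr C" "Dom C g = syz S' 0" "Cod C g = syz S'' 0"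
    and X: "X \<in> carrier (hyper_grp C F n R S)"
  shows "hyper_map C F n R S S'' (g \<cdot> f) X = hyper_map C F n R S' S'' g (hyper_map C F n R S S' f X)"
proof -
  obtain \<phi> where \<phi>: "chain F n S \<phi>" "X = cls F n S \<phi>" using X by (rule hyperE[OF S(1) F])
  obtain u where u: "lifts C S S' f u" using lifts_exist[OF S(1,2) f] .
  obtain v where v: "lifts C S' S'' g v" using lifts_exist[OF S(2,3) g] .
  note [simp] = S chainD(2-4)[OF \<phi>(1)] liftsD(2-4)[OF u] liftsD(2-4)[OF v]
  have vu: "lifts C S S'' (g \<cdot> f) (\<lambda>j. v j \<cdot> u j)" by (rule lifts_comp[OF S u v]) (use f g in auto)
  show ?thesis unfolding \<phi>(2) hyper_map_cls[OF S(1,2) F u \<phi>(1)]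
      hyper_map_cls[OF S(2,3) F v chain_comp[OF S(1,2) u \<phi>(1)]] hyper_map_cls[OF S(1,3) F vu \<phi>(1)]
    by simp
qed

lemma hyper_map_add:
  assumes S: "is_res S" "is_res S'" and F: "shiftable F"
    and f: "f \<in> Arr C" "Dom C f = syz S 0" "Cod C f = syz S' 0"
    and g: "g \<in> Arr C" "Dom C g = syz S 0" "Cod C g = syz S' 0"
    and X: "X \<in> carrier (hyper_grp C F n R S)"
  shows "hyper_map C F n R S S' (f \<boxplus> g) X =
    hyper_map C F n R S S' f X \<otimes>\<^bsub>hyper_grp C F n R S'\<^esub> hyper_map C F n R S S' g X"
proof -
  obtain \<phi> where \<phi>: "chain F n S \<phi>" "X = cls F n S \<phi>" using X by (rule hyperE[OF S(1) F])
  obtain u where u: "lifts C S S' f u" using lifts_exist[OF S f] .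
  obtain v where v: "lifts C S S' g v" using lifts_exist[OF S g] .
  note [simp] = S chainD(2-4)[OF \<phi>(1)] liftsD(2-4)[OF u] liftsD(2-4)[OF v]
  have vu: "lifts C S S' (f \<boxplus> g) (\<lambda>j. u j \<boxplus> v j)" by (rule lifts_add[OF S u v]) (use f g in auto)
  show ?thesis unfolding \<phi>(2) hyper_map_cls[OF S F u \<phi>(1)] hyper_map_cls[OF S F v \<phi>(1)]
     hyper_map_cls[OF S F vu \<phi>(1)] hyper_mult[OF S(2) F chain_comp[OF S u \<phi>(1)] chain_comp[OF S v \<phi>(1)]]
    by simp
qed

end

section \<open>Connecting homomorphisms\<close>

context abelian_category
begin

lemma shift_liftsD:
  assumes u: "lifts C (shift_res C 1 Q) S h1 hs"
  shows "hs j \<in> Arr C" "Cod C (hs j) = cx S j" "j \<ge> 0 \<Longrightarrow> Dom C (hs j) = cx Q (j + 1)"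
    "j \<ge> 1 \<Longrightarrow> diff S j \<cdot> hs j = hs (j - 1) \<cdot> diff Q (j + 1)"
    "syz_pr S 0 \<cdot> hs 0 = h1 \<cdot> syz_pr Q 1"
  using liftsD[OF u] by (auto simp: shift_simps)

text \<open>Bundles the auxiliary choices of which the connecting map is the common value.\<close>

definition conn_data where
  "conn_data S Q f g h h1 hs \<longleftrightarrow>
     h \<in> Hom C (cx Q 0) (Dom C g) \<and> g \<cdot> h = syz_pr Q 0 \<and>
     h1 \<in> Hom C (syz Q 1) (Dom C f) \<and> f \<cdot> h1 = h \<cdot> syz_in Q 0 \<and>
     lifts C (shift_res C 1 Q) S h1 hs"

lemma conn_dataD:
  assumes "conn_data S Q f g h h1 hs"
  shows "h \<in> Arr C" "Dom C h = cx Q 0" "Cod C h = Dom C g" "g \<cdot> h = syz_pr Q 0"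
    "h1 \<in> Arr C" "Dom C h1 = syz Q 1" "Cod C h1 = Dom C f" "f \<cdot> h1 = h \<cdot> syz_in Q 0"
    "lifts C (shift_res C 1 Q) S h1 hs"
  using assms by (auto simp: conn_data_def Hom_def)

lemma conn_data_exists:
  assumes S: "is_res S" "is_res Q" and fg: "short_exact C f g" "Dom C f = syz S 0" "Cod C g = syz Q 0"
  obtains h h1 hs where "conn_data S Q f g h h1 hs"
proof -
  note [simp] = S short_exactD[OF fg(1)] fg(2,3)
  obtain h where h: "h \<in> Arr C" "Dom C h = cx Q 0" "Cod C h = Dom C g" "g \<cdot> h = syz_pr Q 0"
    by (rule projective_lift[OF res_proj[OF S(2), of 0] short_exact_epic[OF fg(1)], of "syz_pr Q 0"]) auto
  note [simp] = h(1-3)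
  have "g \<cdot> (h \<cdot> syz_in Q 0) = (g \<cdot> h) \<cdot> syz_in Q 0" by simp
  also have "\<dots> = mzero C (syz Q 1) (Cod C g)" unfolding h(4) by simp
  finally have z: "g \<cdot> (h \<cdot> syz_in Q 0) = mzero C (Dom C (h \<cdot> syz_in Q 0)) (Cod C g)" by simp
  obtain h1 where h1: "h1 \<in> Arr C" "Dom C h1 = Dom C (h \<cdot> syz_in Q 0)" "Cod C h1 = Dom C f" "f \<cdot> h1 = h \<cdot> syz_in Q 0"
    by (rule is_kernel_factor[OF short_exact_kernel[OF fg(1)] z]) auto
  have h1': "Dom C h1 = syz (shift_res C 1 Q) 0" "Cod C h1 = syz S 0" using h1 by (auto simp: shift_simps)
  obtain hs where "lifts C (shift_res C 1 Q) S h1 hs"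
    using lifts_exist[OF is_res_shift[OF S(2)] S(1) h1(1) h1'] .
  hence "conn_data S Q f g h h1 hs"
    unfolding conn_data_def using h h1 by (intro conjI) (auto simp: Hom_def)
  thus ?thesis by (rule that)
qed

end

section \<open>The connecting map on homotopy classes\<close>

context resolved_object
begin

definition conn_fam :: "int \<Rightarrow> ('o, 'm) resolution \<Rightarrow> (int \<Rightarrow> 'm) \<Rightarrow> (int \<Rightarrow> 'm) \<Rightarrow> int \<Rightarrow> 'm" where
  "conn_fam n S hs \<phi> = (\<lambda>m. if m \<ge> 0 then msign C (n + m) (hs m \<cdot> \<phi> (m + 1))
                           else mzero C (cx R (n + 1 + m)) (cx S m))"

lemma conn_fam_fam:
  assumes S: "is_res S" "is_res Q" and hs: "lifts C (shift_res C 1 Q) S h1 hs" and \<phi>: "fam (P n) (cx Q) \<phi>"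
  shows "fam (P (n + 1)) (cx S) (conn_fam n S hs \<phi>)"
  using S shift_liftsD(1-3)[OF hs] famD[OF \<phi>] by (auto simp: fam_def conn_fam_def algebra_simps)

text \<open>The family \<open>hs\<close> commutes with the differentials from degree 1 on, and below
  that the equation has a zero object as its target. The factor \<open>(-1)^(n+m)\<close> alternates
  with the degree and absorbs the sign from \<open>sd_Suc\<close>.\<close>

lemma chain_conn:
  assumes S: "is_res S" "is_res Q" and F: "shiftable F" and hs: "lifts C (shift_res C 1 Q) S h1 hs"
    and \<phi>: "chain F n Q \<phi>"
  shows "chain F (n + 1) S (conn_fam n S hs \<phi>)"
proof -
  note [simp] = S shift_liftsD(1-3)[OF hs] chainD(2-4)[OF \<phi>]
  have f: "fam (P (n + 1)) (cx S) (conn_fam n S hs \<phi>)" by (rule conn_fam_fam[OF S hs chainD(1)[OF \<phi>]])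
  have "\<forall>\<^sub>F j in F. diff S j \<cdot> conn_fam n S hs \<phi> j = conn_fam n S hs \<phi> (j - 1) \<cdot> \<partial> (n + 1) j"
    using eventually_succ[OF F chainD(5)[OF \<phi>]]
  proof eventually_elim
    case (elim j)
    show ?case
    proof (cases "j \<ge> 1")
      case True
      have "diff S j \<cdot> (hs j \<cdot> \<phi> (j + 1)) = (diff S j \<cdot> hs j) \<cdot> \<phi> (j + 1)" using True by simp
      also have "\<dots> = hs (j - 1) \<cdot> (diff Q (j + 1) \<cdot> \<phi> (j + 1))"
        using True by (simp add: shift_liftsD(4)[OF hs])
      also have "\<dots> = hs (j - 1) \<cdot> (\<phi> j \<cdot> \<partial> n (j + 1))" unfolding elim by simp
      finally show ?thesis using True
        by (simp add: conn_fam_def sd_Suc msign_eq add_diff_eq add.assoc)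
    next
      case False
      show ?thesis
        by (rule res_cx_unique[OF S(1), where j = "j - 1"])
          (use False in \<open>auto simp: famD[OF f] add_diff_eq\<close>)
    qed
  qed
  thus ?thesis using f by (simp add: chain_def)
qed

text \<open>The homotopy \<open>e\<close> may have a component in degree -1, that is, an arrow from
  \<open>cx Q 0\<close> to \<open>cx S 0\<close>. This is weaker than a homotopy of chain maps on
  the shifted resolution, and the extra freedom is what naturality of the connecting map
  uses.\<close>

lemma conn_null:
  assumes S: "is_res S" "is_res Q" and F: "shiftable F" and \<phi>: "chain F n Q \<phi>"
    and v: "\<And>j. j \<ge> 0 \<Longrightarrow> v j \<in> Arr C \<and> Dom C (v j) = cx Q (j + 1) \<and> Cod C (v j) = cx S j"
    and w: "\<And>j. j \<ge> 0 \<Longrightarrow> w j \<in> Arr C \<and> Dom C (w j) = cx Q (j + 1) \<and> Cod C (w j) = cx S j"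
    and e: "fam (\<lambda>j. cx Q (j + 1)) (\<lambda>j. cx S (j + 1)) e"
    and eq: "\<And>j. j \<ge> 0 \<Longrightarrow> v j = w j \<boxplus> (e (j - 1) \<cdot> diff Q (j + 1) \<boxplus> diff S (j + 1) \<cdot> e j)"
  shows "homotopic F (n + 1) S (conn_fam n S v \<phi>) (conn_fam n S w \<phi>)"
proof -
  note [simp] = S chainD(2-4)[OF \<phi>] famD[OF e]
  define k where "k m = msign C (n + m) (e m \<cdot> \<phi> (m + 1))" for m
  have k: "fam (P (n + 1)) (\<lambda>j. cx S (j + 1)) k" by (auto simp: k_def fam_def algebra_simps)
  have vf: "conn_fam n S v \<phi> j \<in> Arr C" "Dom C (conn_fam n S v \<phi> j) = cx R (n + 1 + j)" "Cod C (conn_fam n S v \<phi> j) = cx S j" for j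
    using v[of j] by (auto simp: conn_fam_def algebra_simps)
  have wf: "conn_fam n S w \<phi> j \<in> Arr C" "Dom C (conn_fam n S w \<phi> j) = cx R (n + 1 + j)" "Cod C (conn_fam n S w \<phi> j) = cx S j" for j
    using w[of j] by (auto simp: conn_fam_def algebra_simps)
  have "\<forall>\<^sub>F j in F. conn_fam n S v \<phi> j = conn_fam n S w \<phi> j \<boxplus> (k (j - 1) \<cdot> \<partial> (n + 1) j \<boxplus> diff S (j + 1) \<cdot> k j)"
    using eventually_succ[OF F chainD(5)[OF \<phi>]]
  proof eventually_elim
    case (elim j)
    show ?case
    proof (cases "j \<ge> 0")
      case True
      note [simp] = w[OF True]
      have "v j \<cdot> \<phi> (j + 1) = w j \<cdot> \<phi> (j + 1) \<boxplus>
        (e (j - 1) \<cdot> (diff Q (j + 1) \<cdot> \<phi> (j + 1)) \<boxplus> diff S (j + 1) \<cdot> (e j \<cdot> \<phi> (j + 1)))"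
        unfolding eq[OF True] by simp
      also have "diff Q (j + 1) \<cdot> \<phi> (j + 1) = \<phi> j \<cdot> \<partial> n (j + 1)" unfolding elim by simp
      finally have 1: "v j \<cdot> \<phi> (j + 1) = w j \<cdot> \<phi> (j + 1) \<boxplus>
        (e (j - 1) \<cdot> (\<phi> j \<cdot> \<partial> n (j + 1)) \<boxplus> diff S (j + 1) \<cdot> (e j \<cdot> \<phi> (j + 1)))" .
      have 2: "k (j - 1) \<cdot> \<partial> (n + 1) j = msign C (n + j) (e (j - 1) \<cdot> (\<phi> j \<cdot> \<partial> n (j + 1)))"
        by (simp add: k_def sd_Suc msign_eq add_diff_eq add.assoc)
      show ?thesis using True unfolding 2 by (simp add: conn_fam_def 1 k_def add.assoc)
    next
      case False
      show ?thesis
        by (rule res_cx_unique[OF S(1), where j = j])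
          (use False in \<open>auto simp: vf wf famD[OF k] add_diff_eq\<close>)
    qed
  qed
  thus ?thesis unfolding homotopic_def using k by blast
qed

lemma homotopic_conn:
  assumes S: "is_res S" "is_res Q" and F: "shiftable F" and hs: "lifts C (shift_res C 1 Q) S h1 hs"
    and \<phi>: "chain F n Q \<phi>" and \<psi>: "chain F n Q \<psi>" and e: "homotopic F n Q \<phi> \<psi>"
  shows "homotopic F (n + 1) S (conn_fam n S hs \<phi>) (conn_fam n S hs \<psi>)"
proof -
  obtain e where e: "fam (P n) (\<lambda>j. cx Q (j + 1)) e"
    "\<forall>\<^sub>F j in F. \<phi> j = \<psi> j \<boxplus> (e (j - 1) \<cdot> \<partial> n j \<boxplus> diff Q (j + 1) \<cdot> e j)"
    using e unfolding homotopic_def by blast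
  note [simp] = S shift_liftsD(1-3)[OF hs] chainD(2-4)[OF \<phi>] chainD(2-4)[OF \<psi>] famD[OF e(1)]
  \<comment> \<open>Degree -1 is included because the formula in degree 0 involves
    \<open>hs 0\<close> composed with \<open>e 0\<close>, which sits there.\<close>
  define k where "k m = (if m \<ge> - 1 then msign C (n + m) (hs (m + 1) \<cdot> e (m + 1))
      else mzero C (cx R (n + 1 + m)) (cx S (m + 1)))" for m
  have k: "fam (P (n + 1)) (\<lambda>j. cx S (j + 1)) k" by (auto simp: k_def fam_def algebra_simps)
  have f: "fam (P (n + 1)) (cx S) (conn_fam n S hs \<phi>)" "fam (P (n + 1)) (cx S) (conn_fam n S hs \<psi>)"
    using conn_fam_fam[OF S hs] chainD(1)[OF \<phi>] chainD(1)[OF \<psi>] by auto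
  have "\<forall>\<^sub>F j in F. conn_fam n S hs \<phi> j = conn_fam n S hs \<psi> j \<boxplus> (k (j - 1) \<cdot> \<partial> (n + 1) j \<boxplus> diff S (j + 1) \<cdot> k j)"
    using eventually_succ[OF F e(2)]
  proof eventually_elim
    case (elim j)
    show ?case
    proof (cases "j \<ge> 0")
      case True
      have "hs (i - 1) \<cdot> (diff Q (i + 1) \<cdot> e i) = diff S i \<cdot> (hs i \<cdot> e i)" if "i \<ge> 1" for i
      proof -
        have "hs (i - 1) \<cdot> (diff Q (i + 1) \<cdot> e i) = (hs (i - 1) \<cdot> diff Q (i + 1)) \<cdot> e i" using that by simp
        also have "\<dots> = diff S i \<cdot> (hs i \<cdot> e i)" unfolding shift_liftsD(4)[OF hs that, symmetric] using that by simp
        finally show ?thesis .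
      qed
      from this[of "j + 1"] have 1: "hs j \<cdot> (diff Q (j + 1 + 1) \<cdot> e (j + 1)) = diff S (j + 1) \<cdot> (hs (j + 1) \<cdot> e (j + 1))"
        using True by simp
      have "hs j \<cdot> \<phi> (j + 1) = hs j \<cdot> \<psi> (j + 1) \<boxplus>
        (hs j \<cdot> (e j \<cdot> \<partial> n (j + 1)) \<boxplus> hs j \<cdot> (diff Q (j + 1 + 1) \<cdot> e (j + 1)))"
      proof -
        have "hs (i - 1) \<cdot> (\<psi> i \<boxplus> (e (i - 1) \<cdot> \<partial> n i \<boxplus> diff Q (i + 1) \<cdot> e i)) = hs (i - 1) \<cdot> \<psi> i \<boxplus>
            (hs (i - 1) \<cdot> (e (i - 1) \<cdot> \<partial> n i) \<boxplus> hs (i - 1) \<cdot> (diff Q (i + 1) \<cdot> e i))" if "i \<ge> 1" for i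
          using that by (simp add: add_diff_eq)
        from this[of "j + 1"] show ?thesis unfolding elim using True by simp
      qed
      hence 3: "hs j \<cdot> \<phi> (j + 1) = hs j \<cdot> \<psi> (j + 1) \<boxplus>
        (hs j \<cdot> (e j \<cdot> \<partial> n (j + 1)) \<boxplus> diff S (j + 1) \<cdot> (hs (j + 1) \<cdot> e (j + 1)))"
        unfolding 1 .
      have 2: "k (j - 1) \<cdot> \<partial> (n + 1) j = msign C (n + j) (hs j \<cdot> (e j \<cdot> \<partial> n (j + 1)))"
        using True by (simp add: k_def sd_Suc msign_eq add_diff_eq add.assoc)
      show ?thesis using True unfolding 2 by (simp add: conn_fam_def 3 k_def add.assoc)
    next
      case False
      show ?thesis
        by (rule res_cx_unique[OF S(1), where j = j])
          (use False in \<open>auto simp: famD[OF f(1)] famD[OF f(2)] famD[OF k] add_diff_eq\<close>)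
    qed
  qed
  thus ?thesis unfolding homotopic_def using k by blast
qed

text \<open>The two composites lift maps on the first syzygy that differ by a map \<open>t \<circ> syz_in Q 0\<close>
  extending to \<open>cx Q 0\<close>; such a difference is null homotopic by a homotopy starting with \<open>t\<close>.\<close>

lemma conn_natural:
  assumes S: "is_res S" "is_res Q" "is_res S'" "is_res Q'" and F: "shiftable F"
    and fg: "short_exact C f g" "Dom C f = syz S 0" "Cod C g = syz Q 0"
    and fg': "short_exact C f' g'" "Dom C f' = syz S' 0" "Cod C g' = syz Q' 0"
    and d: "conn_data S Q f g h h1 hs" and d': "conn_data S' Q' f' g' h' h1' hs'"
    and abc: "a \<in> Hom C (Dom C f) (Dom C f')" "b \<in> Hom C (Cod C f) (Cod C f')" "c \<in> Hom C (Cod C g) (Cod C g')"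
    and comm: "b \<cdot> f = f' \<cdot> a" "c \<cdot> g = g' \<cdot> b"
    and \<alpha>: "lifts C S S' a \<alpha>" and \<kappa>: "lifts C Q Q' c \<kappa>" and \<phi>: "chain F n Q \<phi>"
  shows "homotopic F (n + 1) S' (\<lambda>j. \<alpha> j \<cdot> conn_fam n S hs \<phi> j) (conn_fam n S' hs' (\<lambda>j. \<kappa> j \<cdot> \<phi> j))"
proof -
  note abc' = abc[unfolded Hom_def, simplified]
  note hs = conn_dataD(9)[OF d] and hs' = conn_dataD(9)[OF d']
  note [simp] = S short_exactD(1-3)[OF fg(1)] short_exactD(1-3)[OF fg'(1)] fg(2,3) fg'(2,3)
    abc' liftsD(2-4)[OF \<alpha>] liftsD(2-4)[OF \<kappa>] chainD(2-4)[OF \<phi>]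
    conn_dataD(1-3,5-7)[OF d] conn_dataD(1-3,5-7)[OF d'] shift_liftsD(1-3)[OF hs] shift_liftsD(1-3)[OF hs']
  have "g' \<cdot> (b \<cdot> h) = (g' \<cdot> b) \<cdot> h" by simp
  also have "\<dots> = c \<cdot> (g \<cdot> h)" unfolding comm(2)[symmetric] by simp
  also have "\<dots> = g' \<cdot> (h' \<cdot> \<kappa> 0)"
  proof -
    have "g' \<cdot> (h' \<cdot> \<kappa> 0) = (g' \<cdot> h') \<cdot> \<kappa> 0" by simp
    thus ?thesis unfolding conn_dataD(4)[OF d] conn_dataD(4)[OF d'] liftsD(6)[OF \<kappa>] by simp
  qed
  finally have 1: "g' \<cdot> (b \<cdot> h) = g' \<cdot> (h' \<cdot> \<kappa> 0)" .
  obtain t where t: "t \<in> Arr C" "Dom C t = Dom C (h' \<cdot> \<kappa> 0)" "Cod C t = Dom C f'" "b \<cdot> h = h' \<cdot> \<kappa> 0 \<boxplus> f' \<cdot> t"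
    by (rule is_kernel_diff[OF short_exact_kernel[OF fg'(1)] 1]) auto
  have t': "Dom C t = cx Q 0" "Cod C t = syz S' 0" using t by auto
  note [simp] = t(1) t'
  \<comment> \<open>Both composites are regarded as families on \<open>Q\<close> moved down by one
    degree, without the truncation in \<open>shift_res\<close>: the term in degree -1 is then
    \<open>cx Q 0\<close>, the domain of \<open>t\<close>, and not a zero object.\<close>
  define v where "v j = (if j \<ge> 0 then \<alpha> j \<cdot> hs j else mzero C (cx Q (j + 1)) (cx S' j))" for j
  define w where "w j = (if j \<ge> 0 then hs' j \<cdot> \<kappa> (j + 1) else mzero C (cx Q (j + 1)) (cx S' j))" for j
  have v: "fam (\<lambda>j. cx Q (j + 1)) (cx S') v" and w: "fam (\<lambda>j. cx Q (j + 1)) (cx S') w"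
    by (auto simp: fam_def v_def w_def)
  have cx: "cpx (\<lambda>j. cx Q (j + 1)) (\<lambda>j. diff Q (j + 1))"
    using res_dd[OF S(2), of "j + 1" for j] by (auto simp: cpx_def)
  have cv: "diff S' j \<cdot> v j = v (j - 1) \<cdot> diff Q (j + 1)" if j: "j \<ge> 1" for j
  proof -
    have "diff S' j \<cdot> v j = (diff S' j \<cdot> \<alpha> j) \<cdot> hs j" using j by (simp add: v_def)
    also have "\<dots> = \<alpha> (j - 1) \<cdot> (diff S j \<cdot> hs j)" unfolding liftsD(5)[OF \<alpha>] using j by simp
    also have "\<dots> = v (j - 1) \<cdot> diff Q (j + 1)" unfolding shift_liftsD(4)[OF hs j] using j by (simp add: v_def)
    finally show ?thesis .
  qed
  have cw: "diff S' j \<cdot> w j = w (j - 1) \<cdot> diff Q (j + 1)" if j: "j \<ge> 1" for j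
  proof -
    have "diff S' j \<cdot> w j = (diff S' j \<cdot> hs' j) \<cdot> \<kappa> (j + 1)" using j by (simp add: w_def)
    also have "\<dots> = hs' (j - 1) \<cdot> (diff Q' (j + 1) \<cdot> \<kappa> (j + 1))" unfolding shift_liftsD(4)[OF hs' j] using j by simp
    also have "\<dots> = w (j - 1) \<cdot> diff Q (j + 1)" unfolding liftsD(5)[OF \<kappa>] using j by (simp add: w_def)
    finally show ?thesis .
  qed
  have d1: "diff Q 1 = syz_in Q 0 \<cdot> syz_pr Q 1" "diff Q' 1 = syz_in Q' 0 \<cdot> syz_pr Q' 1"
    using res_diff[of Q 0] res_diff[of Q' 0] by auto
  have "f' \<cdot> (syz_pr S' 0 \<cdot> v 0) = f' \<cdot> ((syz_pr S' 0 \<cdot> \<alpha> 0) \<cdot> hs 0)" by (simp add: v_def)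
  also have "\<dots> = (f' \<cdot> a) \<cdot> (syz_pr S 0 \<cdot> hs 0)" unfolding liftsD(6)[OF \<alpha>] by simp
  also have "\<dots> = b \<cdot> ((f \<cdot> h1) \<cdot> syz_pr Q 1)" unfolding comm(1)[symmetric] shift_liftsD(5)[OF hs] by simp
  also have "\<dots> = (b \<cdot> h) \<cdot> diff Q 1" unfolding conn_dataD(8)[OF d] d1 by simp
  also have "\<dots> = h' \<cdot> (\<kappa> 0 \<cdot> diff Q 1) \<boxplus> f' \<cdot> (t \<cdot> diff Q 1)" unfolding t(4) by simp
  also have "\<kappa> 0 \<cdot> diff Q 1 = diff Q' 1 \<cdot> \<kappa> 1" using liftsD(5)[OF \<kappa>, of 1] by simp
  also have "h' \<cdot> (diff Q' 1 \<cdot> \<kappa> 1) = (h' \<cdot> syz_in Q' 0) \<cdot> (syz_pr Q' 1 \<cdot> \<kappa> 1)" unfolding d1 by simp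
  also have "\<dots> = f' \<cdot> ((h1' \<cdot> syz_pr Q' 1) \<cdot> \<kappa> 1)" unfolding conn_dataD(8)[OF d', symmetric] by simp
  also have "\<dots> = f' \<cdot> (syz_pr S' 0 \<cdot> w 0)" unfolding shift_liftsD(5)[OF hs', symmetric] by (simp add: w_def)
  also have "\<dots> \<boxplus> f' \<cdot> (t \<cdot> diff Q 1) = f' \<cdot> (syz_pr S' 0 \<cdot> w 0 \<boxplus> t \<cdot> diff Q 1)"
    using famD[OF w] by simp
  finally have 2: "f' \<cdot> (syz_pr S' 0 \<cdot> v 0) = f' \<cdot> (syz_pr S' 0 \<cdot> w 0 \<boxplus> t \<cdot> diff Q 1)" .
  have 3: "syz_pr S' 0 \<cdot> v 0 = syz_pr S' 0 \<cdot> w 0 \<boxplus> t \<cdot> diff Q (0 + 1)"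
    unfolding add_0_left
    by (rule is_kernel_mono[OF short_exact_kernel[OF fg'(1)] 2]) (use famD[OF v] famD[OF w] in auto)
  obtain e where e: "fam (\<lambda>j. cx Q (j + 1)) (\<lambda>j. cx S' (j + 1)) e"
    "\<And>j. v j = w j \<boxplus> (e (j - 1) \<cdot> diff Q (j + 1) \<boxplus> diff S' (j + 1) \<cdot> e j)"
    by (rule chain_homotopy[OF S(3) cx v w cv cw t(1) _ t'(2) 3]) auto
  have "homotopic F (n + 1) S' (conn_fam n S' v \<phi>) (conn_fam n S' w \<phi>)"
    by (rule conn_null[OF S(3) S(2) F \<phi> _ _ e]) (use v w in \<open>auto simp: fam_def\<close>)
  moreover have "conn_fam n S' v \<phi> = (\<lambda>j. \<alpha> j \<cdot> conn_fam n S hs \<phi> j)"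
    by (auto simp: fun_eq_iff conn_fam_def v_def algebra_simps)
  moreover have "conn_fam n S' w \<phi> = conn_fam n S' hs' (\<lambda>j. \<kappa> j \<cdot> \<phi> j)"
    by (auto simp: fun_eq_iff conn_fam_def w_def)
  ultimately show ?thesis by simp
qed

text \<open>Evaluation on any representative with any choice of \<open>h\<close>, \<open>h1\<close>
  and \<open>hs\<close>. Naturality for identity maps, with different choices on the two sides,
  shows that the choices do not matter.\<close>

lemma hyper_conn_cls:
  assumes S: "is_res S" "is_res Q" and F: "shiftable F"
    and fg: "short_exact C f g" "Dom C f = syz S 0" "Cod C g = syz Q 0"
    and d: "conn_data S Q f g h h1 hs" and \<phi>: "chain F n Q \<phi>"
  shows "hyper_conn C F n R S Q f g (cls F n Q \<phi>) = cls F (n + 1) S (conn_fam n S hs \<phi>)"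
  unfolding hyper_conn_def conn_fam_def[symmetric]
proof (rule the_elem_eqI)
  let ?A = "{cls F (n + 1) S (conn_fam n S hs \<phi>') | \<phi>' h h1 hs. \<phi>' \<in> cls F n Q \<phi> \<and>
    h \<in> Hom C (cx Q 0) (Dom C g) \<and> g \<cdot> h = syz_pr Q 0 \<and>
     h1 \<in> Hom C (syz Q 1) (Dom C f) \<and> f \<cdot> h1 = h \<cdot> syz_in Q 0 \<and>
     lifts C (shift_res C 1 Q) S h1 hs}"
  show "cls F (n + 1) S (conn_fam n S hs \<phi>) \<in> ?A"
    using d \<phi> cls_mem[OF S(2) F \<phi>, of \<phi>] unfolding conn_data_def by blast
  fix y assume "y \<in> ?A"
  then obtain \<psi> k k1 ks where "\<psi> \<in> cls F n Q \<phi>" and d': "conn_data S Q f g k k1 ks"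
    and y: "y = cls F (n + 1) S (conn_fam n S ks \<psi>)" unfolding conn_data_def by blast
  hence \<psi>: "chain F n Q \<psi>" "cls F n Q \<psi> = cls F n Q \<phi>" using cls_mem[OF S(2) F \<phi>] by auto
  note ks = conn_dataD(9)[OF d'] and hs = conn_dataD(9)[OF d]
  note [simp] = S fg(2,3) short_exactD(1-3)[OF fg(1)]
  have "homotopic F n Q \<psi> \<phi>" using cls_eq[OF S(2) F \<psi>(1) \<phi>] \<psi>(2) by simp
  from homotopic_conn[OF S F ks \<psi>(1) \<phi> this]
  have 1: "y = cls F (n + 1) S (conn_fam n S ks \<phi>)"
    unfolding y using cls_eq[OF S(1) F chain_conn[OF S F ks \<psi>(1)] chain_conn[OF S F ks \<phi>]] by blast
  have l: "lifts C S S (ident C (Dom C f)) (\<lambda>j. ident C (cx S j))"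
    "lifts C Q Q (ident C (Cod C g)) (\<lambda>j. ident C (cx Q j))"
    using lifts_ident[OF S(1)] lifts_ident[OF S(2)] by simp_all
  have "homotopic F (n + 1) S (\<lambda>j. ident C (cx S j) \<cdot> conn_fam n S ks \<phi> j)
      (conn_fam n S hs (\<lambda>j. ident C (cx Q j) \<cdot> \<phi> j))"
    by (rule conn_natural[OF S S F fg fg d' d, where b = "ident C (Cod C f)", OF _ _ _ _ _ l \<phi>]) (auto simp: Hom_def)
  moreover have "(\<lambda>j. ident C (cx S j) \<cdot> conn_fam n S ks \<phi> j) = conn_fam n S ks \<phi>"
    using famD[OF conn_fam_fam[OF S ks chainD(1)[OF \<phi>]]] by simp
  moreover have "(\<lambda>j. ident C (cx Q j) \<cdot> \<phi> j) = \<phi>" using chainD(2-4)[OF \<phi>] by simp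
  ultimately have "homotopic F (n + 1) S (conn_fam n S ks \<phi>) (conn_fam n S hs \<phi>)" by simp
  thus "y = cls F (n + 1) S (conn_fam n S hs \<phi>)"
    unfolding 1 using cls_eq[OF S(1) F chain_conn[OF S F ks \<phi>] chain_conn[OF S F hs \<phi>]] by blast
qed

lemma hyper_conn_hom:
  assumes S: "is_res S" "is_res Q" and F: "shiftable F"
    and fg: "short_exact C f g" "Dom C f = syz S 0" "Cod C g = syz Q 0"
  shows "hyper_conn C F n R S Q f g \<in> hom (hyper_grp C F n R Q) (hyper_grp C F (n + 1) R S)"
proof -
  obtain h h1 hs where d: "conn_data S Q f g h h1 hs" using conn_data_exists[OF S fg] .
  note hs = conn_dataD(9)[OF d]
  note [simp] = S shift_liftsD(1-3)[OF hs]
  show ?thesis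
  proof (rule homI)
    fix X assume "X \<in> carrier (hyper_grp C F n R Q)"
    then obtain \<phi> where \<phi>: "chain F n Q \<phi>" "X = cls F n Q \<phi>" by (rule hyperE[OF S(2) F])
    show "hyper_conn C F n R S Q f g X \<in> carrier (hyper_grp C F (n + 1) R S)"
      unfolding \<phi>(2) hyper_conn_cls[OF S F fg d \<phi>(1)] by (rule cls_in[OF S(1) F chain_conn[OF S F hs \<phi>(1)]])
    fix Y assume "Y \<in> carrier (hyper_grp C F n R Q)"
    then obtain \<psi> where \<psi>: "chain F n Q \<psi>" "Y = cls F n Q \<psi>" by (rule hyperE[OF S(2) F])
    have "conn_fam n S hs (\<lambda>j. \<phi> j \<boxplus> \<psi> j) = (\<lambda>j. conn_fam n S hs \<phi> j \<boxplus> conn_fam n S hs \<psi> j)"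
      using chainD(2-4)[OF \<phi>(1)] chainD(2-4)[OF \<psi>(1)] by (auto simp: fun_eq_iff conn_fam_def)
    thus "hyper_conn C F n R S Q f g (X \<otimes>\<^bsub>hyper_grp C F n R Q\<^esub> Y) =
       hyper_conn C F n R S Q f g X \<otimes>\<^bsub>hyper_grp C F (n + 1) R S\<^esub> hyper_conn C F n R S Q f g Y"
      using \<phi> \<psi> by (simp add: hyper_mult[OF S(1) F] hyper_mult[OF S(2) F] hyper_conn_cls[OF S F fg d]
          chain_conn[OF S F hs] chain_add[OF S(2) F])
  qed
qed

lemma hyper_conn_natural:
  assumes S: "is_res S" "is_res Q" "is_res S'" "is_res Q'" and F: "shiftable F"
    and fg: "short_exact C f g" "Dom C f = syz S 0" "Cod C g = syz Q 0"
    and fg': "short_exact C f' g'" "Dom C f' = syz S' 0" "Cod C g' = syz Q' 0"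
    and abc: "a \<in> Hom C (Dom C f) (Dom C f')" "b \<in> Hom C (Cod C f) (Cod C f')" "c \<in> Hom C (Cod C g) (Cod C g')"
    and comm: "b \<cdot> f = f' \<cdot> a" "c \<cdot> g = g' \<cdot> b"
    and X: "X \<in> carrier (hyper_grp C F n R Q)"
  shows "hyper_map C F (n + 1) R S S' a (hyper_conn C F n R S Q f g X) =
    hyper_conn C F n R S' Q' f' g' (hyper_map C F n R Q Q' c X)"
proof -
  obtain \<phi> where \<phi>: "chain F n Q \<phi>" "X = cls F n Q \<phi>" using X by (rule hyperE[OF S(2) F])
  obtain h h1 hs where d: "conn_data S Q f g h h1 hs" using conn_data_exists[OF S(1,2) fg] .
  obtain h' h1' hs' where d': "conn_data S' Q' f' g' h' h1' hs'" using conn_data_exists[OF S(3,4) fg'] .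
  note [simp] = fg(2,3) fg'(2,3)
  obtain \<alpha> where \<alpha>: "lifts C S S' a \<alpha>" by (rule lifts_exist[OF S(1,3), of a]) (use abc in \<open>auto simp: Hom_def\<close>)
  obtain \<kappa> where \<kappa>: "lifts C Q Q' c \<kappa>" by (rule lifts_exist[OF S(2,4), of c]) (use abc in \<open>auto simp: Hom_def\<close>)
  note c = chain_conn[OF S(1,2) F conn_dataD(9)[OF d] \<phi>(1)] and k = chain_comp[OF S(2,4) \<kappa> \<phi>(1)]
  show ?thesis unfolding \<phi>(2) hyper_conn_cls[OF S(1,2) F fg d \<phi>(1)] hyper_map_cls[OF S(1,3) F \<alpha> c]
      hyper_map_cls[OF S(2,4) F \<kappa> \<phi>(1)] hyper_conn_cls[OF S(3,4) F fg' d' k]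
    using conn_natural[OF S F fg fg' d d' abc comm \<alpha> \<kappa> \<phi>(1)]
      cls_eq[OF S(3) F chain_comp[OF S(1,3) \<alpha> c] chain_conn[OF S(3,4) F conn_dataD(9)[OF d'] k]] by blast
qed

end

section \<open>The Horseshoe Lemma\<close>

context abelian_category
begin

text \<open>The row induced on the kernels of three vertical epimorphisms is again short exact. For
  the epimorphism, an arrow from a projective is lifted to the middle of the upper row; its image
  below comes from the left term, and subtracting a lift of that image moves it into the
  kernel.\<close>

lemma three_by_three:
  assumes ep: "enough_projectives C"
    and S: "short_exact C iS pS" and H: "short_exact C iH pH" and Q: "short_exact C iQ pQ"
    and uw: "short_exact C u w" and ip: "short_exact C i p"
    and D: "Dom C u = Dom C pS" "Cod C u = Dom C pH" "Cod C w = Dom C pQ"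
      "Dom C i = Cod C pS" "Cod C i = Cod C pH" "Cod C p = Cod C pQ"
    and c1: "pH \<cdot> u = i \<cdot> pS" and c2: "pQ \<cdot> w = p \<cdot> pH"
    and i': "i' \<in> Arr C" "Dom C i' = Dom C iS" "Cod C i' = Dom C iH" "iH \<cdot> i' = u \<cdot> iS"
    and p': "p' \<in> Arr C" "Dom C p' = Dom C iH" "Cod C p' = Dom C iQ" "iQ \<cdot> p' = w \<cdot> iH"
  shows "short_exact C i' p'"
proof (rule kernel_epic_short_exact)
  note [simp] = short_exactD(1-2)[OF S] short_exactD(1-2)[OF H] short_exactD(1-2)[OF Q]
    short_exactD(1-2)[OF uw] short_exactD(1-2)[OF ip] i'(1) p'(1)
  have [simp]: "Cod C iS = Dom C pS" "Cod C iH = Dom C pH" "Cod C iQ = Dom C pQ"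
    "Dom C w = Dom C pH" "Dom C p = Cod C pH" "Dom C u = Dom C pS" "Cod C u = Dom C pH" "Cod C w = Dom C pQ"
    "Dom C i = Cod C pS" "Cod C i = Cod C pH" "Cod C p = Cod C pQ"
    "Dom C i' = Dom C iS" "Cod C i' = Dom C iH" "Dom C p' = Dom C iH" "Cod C p' = Dom C iQ"
    using short_exactD(3)[OF S] short_exactD(3)[OF H] short_exactD(3)[OF Q] short_exactD(3)[OF uw]
      short_exactD(3)[OF ip] D i' p' by auto
  have zS: "pS \<cdot> iS = mzero C (Dom C iS) (Cod C pS)" and zH: "pH \<cdot> iH = mzero C (Dom C iH) (Cod C pH)"
    and zQ: "pQ \<cdot> iQ = mzero C (Dom C iQ) (Cod C pQ)" and zu: "w \<cdot> u = mzero C (Dom C pS) (Dom C pQ)"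
    and zi: "p \<cdot> i = mzero C (Cod C pS) (Cod C pQ)"
    using short_exactD(4)[OF S] short_exactD(4)[OF H] short_exactD(4)[OF Q] short_exactD(4)[OF uw]
      short_exactD(4)[OF ip] by simp_all
  show "is_kernel C p' i'" unfolding is_kernel_def
  proof (intro conjI ballI impI)
    have "iQ \<cdot> (p' \<cdot> i') = (iQ \<cdot> p') \<cdot> i'" by simp
    also have "\<dots> = w \<cdot> (iH \<cdot> i')" unfolding p'(4) by simp
    also have "\<dots> = (w \<cdot> u) \<cdot> iS" unfolding i'(4) by simp
    also have "\<dots> = iQ \<cdot> mzero C (Dom C iS) (Dom C iQ)" unfolding zu by simp
    finally have 1: "iQ \<cdot> (p' \<cdot> i') = iQ \<cdot> mzero C (Dom C iS) (Dom C iQ)" .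
    have "p' \<cdot> i' = mzero C (Dom C iS) (Dom C iQ)"
      by (rule is_kernel_mono[OF short_exact_kernel[OF Q] 1]) auto
    thus "p' \<cdot> i' = mzero C (Dom C i') (Cod C p')" by simp
    fix X x assume X: "X \<in> Obj C" and "x \<in> Hom C X (Dom C p')" and px: "p' \<cdot> x = mzero C X (Cod C p')"
    hence x [simp]: "x \<in> Arr C" "Dom C x = X" "Cod C x = Dom C iH" and [simp]: "X \<in> Obj C" by (auto simp: Hom_def)
    have "w \<cdot> (iH \<cdot> x) = (iQ \<cdot> p') \<cdot> x" unfolding p'(4) by simp
    also have "\<dots> = iQ \<cdot> (p' \<cdot> x)" by simp
    also have "\<dots> = mzero C (Dom C (iH \<cdot> x)) (Cod C w)" unfolding px by simp
    finally have 2: "w \<cdot> (iH \<cdot> x) = mzero C (Dom C (iH \<cdot> x)) (Cod C w)" .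
    obtain y where y: "y \<in> Arr C" "Dom C y = Dom C (iH \<cdot> x)" "Cod C y = Dom C u" "u \<cdot> y = iH \<cdot> x"
      by (rule is_kernel_factor[OF short_exact_kernel[OF uw] 2]) auto
    have [simp]: "y \<in> Arr C" "Dom C y = X" "Cod C y = Dom C pS" using y by auto
    have "i \<cdot> (pS \<cdot> y) = (pH \<cdot> u) \<cdot> y" unfolding c1 by simp
    also have "\<dots> = pH \<cdot> (u \<cdot> y)" by simp
    also have "\<dots> = (pH \<cdot> iH) \<cdot> x" unfolding y(4) by simp
    also have "\<dots> = i \<cdot> mzero C X (Cod C pS)" unfolding zH by simp
    finally have 3: "i \<cdot> (pS \<cdot> y) = i \<cdot> mzero C X (Cod C pS)" .
    have "pS \<cdot> y = mzero C X (Cod C pS)"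
      by (rule is_kernel_mono[OF short_exact_kernel[OF ip] 3]) auto
    hence 4: "pS \<cdot> y = mzero C (Dom C y) (Cod C pS)" by simp
    obtain z where z: "z \<in> Arr C" "Dom C z = Dom C y" "Cod C z = Dom C iS" "iS \<cdot> z = y"
      by (rule is_kernel_factor[OF short_exact_kernel[OF S] 4]) auto
    have [simp]: "z \<in> Arr C" "Dom C z = X" "Cod C z = Dom C iS" using z by auto
    have "iH \<cdot> (i' \<cdot> z) = (iH \<cdot> i') \<cdot> z" by simp
    also have "\<dots> = u \<cdot> (iS \<cdot> z)" unfolding i'(4) by simp
    also have "\<dots> = iH \<cdot> x" unfolding z(4) y(4) ..
    finally have 5: "iH \<cdot> (i' \<cdot> z) = iH \<cdot> x" .
    have 6: "i' \<cdot> z = x" by (rule is_kernel_mono[OF short_exact_kernel[OF H] 5]) auto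
    show "\<exists>!z. z \<in> Hom C X (Dom C i') \<and> i' \<cdot> z = x"
    proof (rule ex1I[of _ z])
      show "z \<in> Hom C X (Dom C i') \<and> i' \<cdot> z = x" using 6 by (simp add: Hom_def)
      fix z' assume "z' \<in> Hom C X (Dom C i') \<and> i' \<cdot> z' = x"
      hence [simp]: "z' \<in> Arr C" "Dom C z' = X" "Cod C z' = Dom C iS" and z': "i' \<cdot> z' = x" by (auto simp: Hom_def)
      have "u \<cdot> (iS \<cdot> z') = (u \<cdot> iS) \<cdot> z'" by simp
      also have "\<dots> = iH \<cdot> (i' \<cdot> z')" unfolding i'(4)[symmetric] by simp
      also have "\<dots> = (iH \<cdot> i') \<cdot> z" unfolding z' 6[symmetric] by simp
      also have "\<dots> = u \<cdot> (iS \<cdot> z)" unfolding i'(4) by simp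
      finally have 7: "u \<cdot> (iS \<cdot> z') = u \<cdot> (iS \<cdot> z)" .
      have 8: "iS \<cdot> z' = iS \<cdot> z" by (rule is_kernel_mono[OF short_exact_kernel[OF uw] 7]) auto
      show "z' = z" by (rule is_kernel_mono[OF short_exact_kernel[OF S] 8]) auto
    qed
  qed auto
  show "epic C p'"
  proof (rule epicI_projective[OF ep p'(1)])
    fix X x assume P: "projective C X" and x: "x \<in> Arr C" "Dom C x = X" "Cod C x = Cod C p'"
    have [simp]: "X \<in> Obj C" "x \<in> Arr C" "Dom C x = X" "Cod C x = Dom C iQ" using P x by (auto simp: projective_def)
    obtain z where z: "z \<in> Arr C" "Dom C z = X" "Cod C z = Dom C w" "w \<cdot> z = iQ \<cdot> x"
      by (rule projective_lift[OF P short_exact_epic[OF uw], of "iQ \<cdot> x"]) auto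
    have [simp]: "z \<in> Arr C" "Dom C z = X" "Cod C z = Dom C pH" using z by auto
    have "p \<cdot> (pH \<cdot> z) = (pQ \<cdot> w) \<cdot> z" unfolding c2 by simp
    also have "\<dots> = pQ \<cdot> (w \<cdot> z)" by simp
    also have "\<dots> = (pQ \<cdot> iQ) \<cdot> x" unfolding z(4) by simp
    also have "\<dots> = mzero C (Dom C (pH \<cdot> z)) (Cod C p)" unfolding zQ by simp
    finally have 1: "p \<cdot> (pH \<cdot> z) = mzero C (Dom C (pH \<cdot> z)) (Cod C p)" .
    obtain t where t: "t \<in> Arr C" "Dom C t = Dom C (pH \<cdot> z)" "Cod C t = Dom C i" "i \<cdot> t = pH \<cdot> z"
      by (rule is_kernel_factor[OF short_exact_kernel[OF ip] 1]) auto
    have [simp]: "t \<in> Arr C" "Dom C t = X" "Cod C t = Cod C pS" using t by auto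
    obtain t' where t': "t' \<in> Arr C" "Dom C t' = X" "Cod C t' = Dom C pS" "pS \<cdot> t' = t"
      by (rule projective_lift[OF P short_exact_epic[OF S], of "t"]) auto
    note [simp] = t'(1-3)
    have "pH \<cdot> z = (i \<cdot> pS) \<cdot> t'" unfolding t(4)[symmetric] t'(4)[symmetric] by simp
    also have "\<dots> = pH \<cdot> (u \<cdot> t')" unfolding c1[symmetric] by simp
    finally have 2: "pH \<cdot> z = pH \<cdot> (u \<cdot> t')" .
    obtain y where y: "y \<in> Arr C" "Dom C y = Dom C (u \<cdot> t')" "Cod C y = Dom C iH" "z = u \<cdot> t' \<boxplus> iH \<cdot> y"
      by (rule is_kernel_diff[OF short_exact_kernel[OF H] 2]) auto
    have [simp]: "y \<in> Arr C" "Dom C y = X" "Cod C y = Dom C iH" using y by auto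
    have "iQ \<cdot> (p' \<cdot> y) = (iQ \<cdot> p') \<cdot> y" by simp
    also have "\<dots> = (w \<cdot> u) \<cdot> t' \<boxplus> w \<cdot> (iH \<cdot> y)" unfolding zu p'(4) by simp
    also have "\<dots> = w \<cdot> z" unfolding y(4) by simp
    finally have 3: "iQ \<cdot> (p' \<cdot> y) = iQ \<cdot> x" unfolding z(4) .
    have "p' \<cdot> y = x" by (rule is_kernel_mono[OF short_exact_kernel[OF Q] 3]) auto
    thus "\<exists>y. y \<in> Arr C \<and> Dom C y = X \<and> Cod C y = Dom C p' \<and> p' \<cdot> y = x" by (intro exI[of _ y]) simp
  qed
qed

lemma horseshoe_step:
  assumes ep: "enough_projectives C"
    and S: "short_exact C iS pS" "projective C (Dom C pS)" and Q: "short_exact C iQ pQ" "projective C (Dom C pQ)"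
    and ip: "short_exact C i p" and D: "Dom C i = Cod C pS" "Cod C p = Cod C pQ"
  shows "\<exists>X iH pH u w. projective C X \<and> short_exact C iH pH \<and> short_exact C u w \<and>
    Dom C pH = X \<and> Cod C pH = Cod C i \<and> Dom C u = Dom C pS \<and> Cod C u = X \<and> Cod C w = Dom C pQ \<and>
    pH \<cdot> u = i \<cdot> pS \<and> pQ \<cdot> w = p \<cdot> pH"
proof -
  note [simp] = short_exactD(1-3)[OF S(1)] short_exactD(1-3)[OF Q(1)] short_exactD(1-3)[OF ip] D
  have [simp]: "Cod C pS \<in> Obj C" "Cod C pQ \<in> Obj C" "Dom C pS \<in> Obj C" "Dom C pQ \<in> Obj C" using Dom_Cod_Obj by auto
  obtain X a b c d where X: "X \<in> Obj C" and "a \<in> Hom C (Dom C pS) X" "b \<in> Hom C (Dom C pQ) X"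
    "c \<in> Hom C X (Dom C pS)" "d \<in> Hom C X (Dom C pQ)" and
    ca: "c \<cdot> a = ident C (Dom C pS)" and db: "d \<cdot> b = ident C (Dom C pQ)" and
    cb: "c \<cdot> b = mzero C (Dom C pQ) (Dom C pS)" and da: "d \<cdot> a = mzero C (Dom C pS) (Dom C pQ)" and
    id: "a \<cdot> c \<boxplus> b \<cdot> d = ident C X"
    using ex_biproduct[of "Dom C pS" "Dom C pQ"] by auto
  hence [simp]: "X \<in> Obj C" "a \<in> Arr C" "b \<in> Arr C" "c \<in> Arr C" "d \<in> Arr C" "Dom C a = Dom C pS" "Cod C a = X"
    "Dom C b = Dom C pQ" "Cod C b = X" "Dom C c = X" "Cod C c = Dom C pS" "Dom C d = X" "Cod C d = Dom C pQ"
    by (auto simp: Hom_def)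
  have decomp: "a \<cdot> (c \<cdot> x) \<boxplus> b \<cdot> (d \<cdot> x) = x" if "x \<in> Arr C" "Cod C x = X" for x
  proof -
    have "a \<cdot> (c \<cdot> x) \<boxplus> b \<cdot> (d \<cdot> x) = (a \<cdot> c \<boxplus> b \<cdot> d) \<cdot> x" using that by simp
    thus ?thesis unfolding id using that by simp
  qed
  have ad: "short_exact C a d"
  proof (rule kernel_epic_short_exact)
    show "is_kernel C d a" unfolding is_kernel_def
    proof (intro conjI ballI impI)
      fix Y x assume "Y \<in> Obj C" "x \<in> Hom C Y (Dom C d)" and dx: "d \<cdot> x = mzero C Y (Cod C d)"
      hence [simp]: "Y \<in> Obj C" "x \<in> Arr C" "Dom C x = Y" "Cod C x = X" by (auto simp: Hom_def)
      show "\<exists>!t. t \<in> Hom C Y (Dom C a) \<and> a \<cdot> t = x"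
      proof (rule ex1I[of _ "c \<cdot> x"])
        show "c \<cdot> x \<in> Hom C Y (Dom C a) \<and> a \<cdot> (c \<cdot> x) = x" using decomp[of x] unfolding dx by (simp add: Hom_def)
        fix t assume "t \<in> Hom C Y (Dom C a) \<and> a \<cdot> t = x"
        hence [simp]: "t \<in> Arr C" "Dom C t = Y" "Cod C t = Dom C pS" and t: "x = a \<cdot> t" by (auto simp: Hom_def)
        have "c \<cdot> x = (c \<cdot> a) \<cdot> t" unfolding t by simp
        thus "t = c \<cdot> x" unfolding ca by simp
      qed
    qed (use da in auto)
    show "epic C d"
    proof (rule epicI_projective[OF ep])
      fix Y x assume "projective C Y" and x: "x \<in> Arr C" "Dom C x = Y" "Cod C x = Cod C d"
      have "d \<cdot> (b \<cdot> x) = (d \<cdot> b) \<cdot> x" using x by simp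
      hence "d \<cdot> (b \<cdot> x) = x" unfolding db using x by simp
      thus "\<exists>y. y \<in> Arr C \<and> Dom C y = Y \<and> Cod C y = Dom C d \<and> d \<cdot> y = x" using x by (intro exI[of _ "b \<cdot> x"]) simp
    qed simp
  qed
  obtain \<sigma> where \<sigma>: "\<sigma> \<in> Arr C" "Dom C \<sigma> = Dom C pQ" "Cod C \<sigma> = Dom C p" "p \<cdot> \<sigma> = pQ"
    by (rule projective_lift[OF Q(2) short_exact_epic[OF ip], of pQ]) auto
  have [simp]: "\<sigma> \<in> Arr C" "Dom C \<sigma> = Dom C pQ" "Cod C \<sigma> = Cod C i" using \<sigma> by auto
  \<comment> \<open>On the first summand the arrow is forced by compatibility with \<open>i\<close>;
    on the second any lift \<open>\<sigma>\<close> of \<open>pQ\<close> through \<open>p\<close>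
    serves. The next syzygy of the middle resolution is the kernel of this arrow.\<close>
  define \<pi> where "\<pi> = i \<cdot> (pS \<cdot> c) \<boxplus> \<sigma> \<cdot> d"
  have [simp]: "\<pi> \<in> Arr C" "Dom C \<pi> = X" "Cod C \<pi> = Cod C i" by (auto simp: \<pi>_def)
  have pa: "\<pi> \<cdot> a = i \<cdot> pS" unfolding \<pi>_def by (simp add: ca da)
  have pb: "\<pi> \<cdot> b = \<sigma>" unfolding \<pi>_def by (simp add: cb db)
  have "p \<cdot> \<pi> = (p \<cdot> i) \<cdot> (pS \<cdot> c) \<boxplus> (p \<cdot> \<sigma>) \<cdot> d" unfolding \<pi>_def by simp
  hence pp: "pQ \<cdot> d = p \<cdot> \<pi>" unfolding \<sigma>(4) short_exactD(4)[OF ip] by simp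
  have epi: "epic C \<pi>"
  proof (rule epicI_projective[OF ep])
    fix Y y assume P: "projective C Y" and y: "y \<in> Arr C" "Dom C y = Y" "Cod C y = Cod C \<pi>"
    have [simp]: "Y \<in> Obj C" "y \<in> Arr C" "Dom C y = Y" "Cod C y = Cod C i" using P y by (auto simp: projective_def)
    obtain z where z: "z \<in> Arr C" "Dom C z = Y" "Cod C z = Dom C pQ" "pQ \<cdot> z = p \<cdot> y"
      by (rule projective_lift[OF P short_exact_epic[OF Q(1)], of "p \<cdot> y"]) auto
    note [simp] = z(1-3)
    have "p \<cdot> y = (p \<cdot> \<sigma>) \<cdot> z" unfolding \<sigma>(4) z(4) ..
    hence 1: "p \<cdot> y = p \<cdot> (\<sigma> \<cdot> z)" by simp
    obtain t where t: "t \<in> Arr C" "Dom C t = Dom C (\<sigma> \<cdot> z)" "Cod C t = Dom C i" "y = \<sigma> \<cdot> z \<boxplus> i \<cdot> t"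
      by (rule is_kernel_diff[OF short_exact_kernel[OF ip] 1]) auto
    have [simp]: "t \<in> Arr C" "Dom C t = Y" "Cod C t = Cod C pS" using t by auto
    obtain t' where t': "t' \<in> Arr C" "Dom C t' = Y" "Cod C t' = Dom C pS" "pS \<cdot> t' = t"
      by (rule projective_lift[OF P short_exact_epic[OF S(1)], of "t"]) auto
    note [simp] = t'(1-3)
    have "\<pi> \<cdot> (b \<cdot> z \<boxplus> a \<cdot> t') = (\<pi> \<cdot> b) \<cdot> z \<boxplus> (\<pi> \<cdot> a) \<cdot> t'" by simp
    also have "\<dots> = y" unfolding pa pb t(4) t'(4)[symmetric] by simp
    finally show "\<exists>x. x \<in> Arr C \<and> Dom C x = Y \<and> Cod C x = Dom C \<pi> \<and> \<pi> \<cdot> x = y"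
      by (intro exI[of _ "b \<cdot> z \<boxplus> a \<cdot> t'"]) simp
  qed simp
  have proj: "projective C X" unfolding projective_def
  proof (intro conjI allI impI ballI)
    fix e g assume e: "epic C e" and "g \<in> Hom C X (Cod C e)"
    hence [simp]: "g \<in> Arr C" "Dom C g = X" "Cod C g = Cod C e" "e \<in> Arr C" by (auto simp: Hom_def epic_def)
    obtain k where k: "k \<in> Arr C" "Dom C k = Dom C pS" "Cod C k = Dom C e" "e \<cdot> k = g \<cdot> a"
      by (rule projective_lift[OF S(2) e, of "g \<cdot> a"]) auto
    obtain l where l: "l \<in> Arr C" "Dom C l = Dom C pQ" "Cod C l = Dom C e" "e \<cdot> l = g \<cdot> b"
      by (rule projective_lift[OF Q(2) e, of "g \<cdot> b"]) auto
    note [simp] = k(1-3) l(1-3)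
    have "e \<cdot> (k \<cdot> c \<boxplus> l \<cdot> d) = (e \<cdot> k) \<cdot> c \<boxplus> (e \<cdot> l) \<cdot> d" by simp
    also have "\<dots> = g \<cdot> (a \<cdot> c \<boxplus> b \<cdot> d)" unfolding k(4) l(4) by simp
    finally have "e \<cdot> (k \<cdot> c \<boxplus> l \<cdot> d) = g" unfolding id by simp
    thus "\<exists>h\<in>Hom C X (Dom C e). e \<cdot> h = g" by (intro bexI[of _ "k \<cdot> c \<boxplus> l \<cdot> d"]) (auto simp: Hom_def)
  qed simp
  obtain \<iota> where "is_kernel C \<pi> \<iota>" using ex_kernel[of \<pi>] by auto
  hence "short_exact C \<iota> \<pi>" using epi by (rule kernel_epic_short_exact)
  with proj ad pa pp show ?thesis by (intro exI[of _ X] exI[of _ \<iota>] exI[of _ \<pi>] exI[of _ a] exI[of _ d]) simp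
qed

text \<open>Exposes the middle resolution and the two chain maps that \<open>horseshoe_syz\<close>
  hides behind quantifiers.\<close>

definition horseshoe where
  "horseshoe S H Q f g u w i p \<longleftrightarrow> is_res H \<and> syz H 0 = Cod C f \<and>
     syz_lifts C S H f u i \<and> syz_lifts C H Q g w p \<and> (\<forall>m\<ge>0. short_exact C (u m) (w m))"

lemma horseshoe_syz_iff: "horseshoe_syz C S Q f g i p \<longleftrightarrow> (\<exists>H u w. horseshoe S H Q f g u w i p)"
  by (auto simp: horseshoe_syz_def horseshoe_def proj_resolution_is_res)

lemma syz_liftsD:
  assumes "syz_lifts C S S' f u v"
  shows "lifts C S S' f u" "v 0 = f" "v (Suc k) \<in> Arr C" "Dom C (v (Suc k)) = syz S (Suc k)"
    "Cod C (v (Suc k)) = syz S' (Suc k)" "syz_in S' k \<cdot> v (Suc k) = u (int k) \<cdot> syz_in S k"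
  using assms by (auto simp: syz_lifts_def Hom_def)

lemma syz_lifts_arr:
  assumes v: "syz_lifts C S S' f u v" and f: "f \<in> Arr C" "Dom C f = syz S 0" "Cod C f = syz S' 0"
  shows "v k \<in> Arr C" "Dom C (v k) = syz S k" "Cod C (v k) = syz S' k"
  using f syz_liftsD(2-5)[OF v] by (cases k; auto)+

text \<open>The definition ties \<open>v\<close> to the inclusions only. The square with the
  projections follows from the chain condition by cancelling the monomorphism
  \<open>syz_in\<close>.\<close>

lemma syz_lifts_pr:
  assumes S: "is_res S" "is_res S'" and v: "syz_lifts C S S' f u v"
    and f: "f \<in> Arr C" "Dom C f = syz S 0" "Cod C f = syz S' 0"
  shows "syz_pr S' k \<cdot> u (int k) = v k \<cdot> syz_pr S k"
proof (cases k)
  case 0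
  thus ?thesis using liftsD(6)[OF syz_liftsD(1)[OF v]] syz_liftsD(2)[OF v] by simp
next
  case (Suc l)
  note u = syz_liftsD(1)[OF v]
  note [simp] = S syz_lifts_arr[OF v f] liftsD(2-4)[OF u]
  have "syz_in S' l \<cdot> (syz_pr S' (Suc l) \<cdot> u (int l + 1)) = (syz_in S' l \<cdot> syz_pr S' (Suc l)) \<cdot> u (int l + 1)"
    by (rule comp_assoc[symmetric]) (auto simp: add.commute)
  also have "\<dots> = u (int l) \<cdot> (syz_in S l \<cdot> syz_pr S (Suc l))"
    using liftsD(5)[OF u, of "int l + 1"] unfolding res_diff[OF S(1)] res_diff[OF S(2)] by simp
  also have "\<dots> = (u (int l) \<cdot> syz_in S l) \<cdot> syz_pr S (Suc l)" by simp
  also have "\<dots> = syz_in S' l \<cdot> (v (Suc l) \<cdot> syz_pr S (Suc l))"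
    unfolding syz_liftsD(6)[OF v, symmetric] by simp
  finally have 1: "syz_in S' l \<cdot> (syz_pr S' (Suc l) \<cdot> u (int l + 1)) = syz_in S' l \<cdot> (v (Suc l) \<cdot> syz_pr S (Suc l))" .
  have "syz_pr S' (Suc l) \<cdot> u (int l + 1) = v (Suc l) \<cdot> syz_pr S (Suc l)"
    by (rule syz_in_mono[OF S(2) 1]) (auto simp: add.commute)
  thus ?thesis using Suc by (simp add: add.commute)
qed

text \<open>Each map of syzygies is the one induced on kernels by the previous square with the
  projections; that square is therefore carried along as an invariant.\<close>

lemma syz_lifts_exist:
  assumes S: "is_res S" "is_res S'" and u: "lifts C S S' f u"
    and f: "f \<in> Arr C" "Dom C f = syz S 0" "Cod C f = syz S' 0"
  obtains v where "syz_lifts C S S' f u v"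
proof -
  note [simp] = S liftsD(2-4)[OF u] f
  have "\<exists>v. \<forall>k. (v k \<in> Arr C \<and> Dom C (v k) = syz S k \<and> Cod C (v k) = syz S' k \<and>
     syz_pr S' k \<cdot> u (int k) = v k \<cdot> syz_pr S k \<and> (k = 0 \<longrightarrow> v k = f)) \<and>
     syz_in S' k \<cdot> v (Suc k) = u (int k) \<cdot> syz_in S k"
  proof (rule dependent_nat_choice)
    show "\<exists>x. x \<in> Arr C \<and> Dom C x = syz S 0 \<and> Cod C x = syz S' 0 \<and>
        syz_pr S' 0 \<cdot> u (int 0) = x \<cdot> syz_pr S 0 \<and> (0 = (0::nat) \<longrightarrow> x = f)"
      using liftsD(6)[OF u] by (intro exI[of _ f]) simp
    fix x k assume x: "x \<in> Arr C \<and> Dom C x = syz S k \<and> Cod C x = syz S' k \<and>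
     syz_pr S' k \<cdot> u (int k) = x \<cdot> syz_pr S k \<and> (k = 0 \<longrightarrow> x = f)"
    hence [simp]: "x \<in> Arr C" "Dom C x = syz S k" "Cod C x = syz S' k" by auto
    have "syz_pr S' k \<cdot> (u (int k) \<cdot> syz_in S k) = (syz_pr S' k \<cdot> u (int k)) \<cdot> syz_in S k" by simp
    also have "\<dots> = mzero C (Dom C (u (int k) \<cdot> syz_in S k)) (Cod C (syz_pr S' k))"
      using x by simp
    finally have 1: "syz_pr S' k \<cdot> (u (int k) \<cdot> syz_in S k) = mzero C (Dom C (u (int k) \<cdot> syz_in S k)) (Cod C (syz_pr S' k))" .
    obtain y where y: "y \<in> Arr C" "Dom C y = Dom C (u (int k) \<cdot> syz_in S k)" "Cod C y = Dom C (syz_in S' k)"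
      "syz_in S' k \<cdot> y = u (int k) \<cdot> syz_in S k"
      by (rule is_kernel_factor[OF res_kernel[OF S(2), of k] 1]) auto
    have [simp]: "y \<in> Arr C" "Dom C y = syz S (Suc k)" "Cod C y = syz S' (Suc k)" using y by auto
    have "syz_in S' k \<cdot> (syz_pr S' (Suc k) \<cdot> u (int k + 1)) = (syz_in S' k \<cdot> syz_pr S' (Suc k)) \<cdot> u (int k + 1)"
      by (rule comp_assoc[symmetric]) (auto simp: add.commute)
    also have "\<dots> = u (int k) \<cdot> (syz_in S k \<cdot> syz_pr S (Suc k))"
      using liftsD(5)[OF u, of "int k + 1"] unfolding res_diff[OF S(1)] res_diff[OF S(2)] by simp
    also have "\<dots> = (u (int k) \<cdot> syz_in S k) \<cdot> syz_pr S (Suc k)" by simp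
    also have "\<dots> = syz_in S' k \<cdot> (y \<cdot> syz_pr S (Suc k))" unfolding y(4)[symmetric] by simp
    finally have 2: "syz_in S' k \<cdot> (syz_pr S' (Suc k) \<cdot> u (int k + 1)) = syz_in S' k \<cdot> (y \<cdot> syz_pr S (Suc k))" .
    have "syz_pr S' (Suc k) \<cdot> u (int k + 1) = y \<cdot> syz_pr S (Suc k)"
      by (rule syz_in_mono[OF S(2) 2]) (auto simp: add.commute)
    thus "\<exists>y. (y \<in> Arr C \<and> Dom C y = syz S (Suc k) \<and> Cod C y = syz S' (Suc k) \<and>
     syz_pr S' (Suc k) \<cdot> u (int (Suc k)) = y \<cdot> syz_pr S (Suc k) \<and> (Suc k = 0 \<longrightarrow> y = f)) \<and>
     syz_in S' k \<cdot> y = u (int k) \<cdot> syz_in S k"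
      using y(4) by (intro exI[of _ y]) (simp add: add.commute)
  qed
  then obtain v where v: "\<And>k. v k \<in> Arr C \<and> Dom C (v k) = syz S k \<and> Cod C (v k) = syz S' k \<and>
     syz_pr S' k \<cdot> u (int k) = v k \<cdot> syz_pr S k \<and> (k = 0 \<longrightarrow> v k = f)"
     "\<And>k. syz_in S' k \<cdot> v (Suc k) = u (int k) \<cdot> syz_in S k" by blast
  have "syz_lifts C S S' f u v" unfolding syz_lifts_def Hom_def using u v by simp
  thus ?thesis by (rule that)
qed

text \<open>The old components, moved by \<open>k\<close> degrees, lift the map on
  \<open>k\<close>-th syzygies. This lets a single lift of \<open>f\<close> serve all levels of the
  direct systems at once.\<close>

lemma syz_lifts_shift:
  assumes S: "is_res S" "is_res S'" and v: "syz_lifts C S S' f u v"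
    and f: "f \<in> Arr C" "Dom C f = syz S 0" "Cod C f = syz S' 0"
  shows "syz_lifts C (shift_res C k S) (shift_res C k S') (v k)
    (\<lambda>j. if j \<ge> 0 then u (j + int k) else u j) (\<lambda>l. v (l + k))"
proof -
  note u = syz_liftsD(1)[OF v]
  note [simp] = S syz_lifts_arr[OF v f] liftsD(2-4)[OF u]
  let ?u = "\<lambda>j. if j \<ge> 0 then u (j + int k) else u j"
  have fam: "fam (cx (shift_res C k S)) (cx (shift_res C k S')) ?u" by (auto simp: fam_def shift_simps)
  have "lifts C (shift_res C k S) (shift_res C k S') (v k) ?u"
  proof (rule liftsI[OF fam])
    show "syz_pr (shift_res C k S') 0 \<cdot> ?u 0 = v k \<cdot> syz_pr (shift_res C k S) 0"
      using syz_lifts_pr[OF S v f, of k] by (simp add: shift_simps)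
    fix j
    show "diff (shift_res C k S') j \<cdot> ?u j = ?u (j - 1) \<cdot> diff (shift_res C k S) j"
    proof (cases "j \<ge> 1")
      case True
      thus ?thesis using liftsD(5)[OF u, of "j + int k"] by (simp add: shift_simps algebra_simps)
    next
      case False
      show ?thesis
        by (rule res_cx_unique[of "shift_res C k S'", where j = "j - 1"])
          (use False famD[OF fam, of j] famD[OF fam, of "j - 1"] in auto)
    qed
  qed
  thus ?thesis using syz_liftsD(6)[OF v] by (simp add: syz_lifts_def Hom_def shift_simps)
qed

text \<open>Each row of syzygies is the row of kernels over the previous one, so
  \<open>three_by_three\<close> is the induction step.\<close>

lemma horseshoe_short_exact:
  assumes ep: "enough_projectives C" and S: "is_res S" "is_res Q"
    and fg: "short_exact C f g" "Dom C f = syz S 0" "Cod C g = syz Q 0" and h: "horseshoe S H Q f g u w i p"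
  shows "short_exact C (i k) (p k)"
proof -
  have H: "is_res H" "syz H 0 = Cod C f" and i: "syz_lifts C S H f u i" and p: "syz_lifts C H Q g w p"
    and uw: "m \<ge> 0 \<Longrightarrow> short_exact C (u m) (w m)" for m
    using h by (auto simp: horseshoe_def)
  note ia = syz_lifts_arr[OF i short_exactD(1)[OF fg(1)] fg(2) H(2)[symmetric]]
  note pa = syz_lifts_arr[OF p short_exactD(2)[OF fg(1)] _ fg(3), unfolded H(2), OF short_exactD(3)[OF fg(1)]]
  note ipr = syz_lifts_pr[OF S(1) H(1) i short_exactD(1)[OF fg(1)] fg(2) H(2)[symmetric]]
  note ppr = syz_lifts_pr[OF H(1) S(2) p short_exactD(2)[OF fg(1)] _ fg(3), unfolded H(2), OF short_exactD(3)[OF fg(1)]]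
  note [simp] = S H ia pa liftsD(2-4)[OF syz_liftsD(1)[OF i]] liftsD(2-4)[OF syz_liftsD(1)[OF p]]
  show ?thesis
  proof (induction k)
    case 0
    thus ?case using syz_liftsD(2)[OF i] syz_liftsD(2)[OF p] fg by simp
  next
    case (Suc k)
    show ?case
      by (rule three_by_three[OF ep res_exact[OF S(1), of k] res_exact[OF H(1), of k] res_exact[OF S(2), of k]
          uw[of "int k"] Suc.IH _ _ _ _ _ _ ipr ppr[symmetric, THEN sym] _ _ _ syz_liftsD(6)[OF i] _ _ _ syz_liftsD(6)[OF p]]) auto
  qed
qed

end

section \<open>Existence of horseshoe resolutions\<close>

context abelian_category
begin

lemma horseshoe_exists:
  assumes ep: "enough_projectives C" and S: "is_res S" "is_res Q"
    and fg: "short_exact C f g" "Dom C f = syz S 0" "Cod C g = syz Q 0"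
  obtains H u w i p where "horseshoe S H Q f g u w i p"
proof -
  note [simp] = S
  \<comment> \<open>\<open>I\<close> describes one row of syzygies together with the projective row
    above it, and \<open>J\<close> says that the following row of syzygies is induced on kernels.
    They are the invariant and the step relation of a dependent choice.\<close>
  define I where "I k i p iH pH u w \<longleftrightarrow> short_exact C i p \<and> Dom C i = syz S k \<and> Cod C p = syz Q k \<and>
    projective C (Dom C pH) \<and> short_exact C iH pH \<and> Cod C pH = Cod C i \<and> short_exact C u w \<and>
    Dom C u = cx S (int k) \<and> Cod C u = Dom C pH \<and> Cod C w = cx Q (int k) \<and>
    pH \<cdot> u = i \<cdot> syz_pr S k \<and> syz_pr Q k \<cdot> w = p \<cdot> pH \<and> (k = 0 \<longrightarrow> i = f \<and> p = g)" for k i p iH pH u w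
  define J where "J k iH u w i' p' \<longleftrightarrow> Cod C i' = Dom C iH \<and> iH \<cdot> i' = u \<cdot> syz_in S k \<and> syz_in Q k \<cdot> p' = w \<cdot> iH"
    for k iH u w i' p'
  have step: "\<exists>iH pH u w. I k i p iH pH u w"
    if "short_exact C i p" "Dom C i = syz S k" "Cod C p = syz Q k" "k = 0 \<longrightarrow> i = f \<and> p = g" for k i p
    using horseshoe_step[OF ep res_exact[OF S(1), of k] _ res_exact[OF S(2), of k] _ that(1)] that
    unfolding I_def by (simp; blast)
  have "\<exists>t. \<forall>k. (case t k of (i, p, iH, pH, u, w) \<Rightarrow> I k i p iH pH u w) \<and>
     (case t k of (i, p, iH, pH, u, w) \<Rightarrow> case t (Suc k) of (i', p', _) \<Rightarrow> J k iH u w i' p')"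
  proof (rule dependent_nat_choice)
    show "\<exists>t. case t of (i, p, iH, pH, u, w) \<Rightarrow> I 0 i p iH pH u w"
      using step[OF fg] by simp blast
    fix t k assume t: "case t of (i, p, iH, pH, u, w) \<Rightarrow> I k i p iH pH u w"
    obtain i p iH pH u w where t_eq: "t = (i, p, iH, pH, u, w)" by (cases t)
    hence I: "short_exact C i p" "Dom C i = syz S k" "Cod C p = syz Q k"
      "short_exact C iH pH" "Cod C pH = Cod C i" "short_exact C u w"
      "Dom C u = cx S (int k)" "Cod C u = Dom C pH" "Cod C w = cx Q (int k)"
      "pH \<cdot> u = i \<cdot> syz_pr S k" "syz_pr Q k \<cdot> w = p \<cdot> pH" using t by (auto simp: I_def)
    note [simp] = short_exactD(1,2)[OF I(1)] short_exactD(1,2)[OF I(4)] short_exactD(1,2)[OF I(6)] I(2,3,5,7-9)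
    have [simp]: "Dom C p = Cod C i" "Cod C iH = Dom C pH" "Dom C w = Dom C pH"
      using short_exactD(3)[OF I(1)] short_exactD(3)[OF I(4)] short_exactD(3)[OF I(6)] by auto
    have "pH \<cdot> (u \<cdot> syz_in S k) = (pH \<cdot> u) \<cdot> syz_in S k" by simp
    also have "\<dots> = mzero C (Dom C (u \<cdot> syz_in S k)) (Cod C pH)" unfolding I(10) by simp
    finally have 1: "pH \<cdot> (u \<cdot> syz_in S k) = mzero C (Dom C (u \<cdot> syz_in S k)) (Cod C pH)" .
    obtain i' where i': "i' \<in> Arr C" "Dom C i' = Dom C (u \<cdot> syz_in S k)" "Cod C i' = Dom C iH" "iH \<cdot> i' = u \<cdot> syz_in S k"
      by (rule is_kernel_factor[OF short_exact_kernel[OF I(4)] 1]) auto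
    have "syz_pr Q k \<cdot> (w \<cdot> iH) = (syz_pr Q k \<cdot> w) \<cdot> iH" by simp
    also have "\<dots> = p \<cdot> (pH \<cdot> iH)" unfolding I(11) by simp
    also have "\<dots> = mzero C (Dom C (w \<cdot> iH)) (Cod C (syz_pr Q k))" unfolding short_exactD(4)[OF I(4)] by simp
    finally have 2: "syz_pr Q k \<cdot> (w \<cdot> iH) = mzero C (Dom C (w \<cdot> iH)) (Cod C (syz_pr Q k))" .
    obtain p' where p': "p' \<in> Arr C" "Dom C p' = Dom C (w \<cdot> iH)" "Cod C p' = Dom C (syz_in Q k)" "syz_in Q k \<cdot> p' = w \<cdot> iH"
      by (rule is_kernel_factor[OF res_kernel[OF S(2), of k] 2]) auto
    have "short_exact C i' p'"
      by (rule three_by_three[OF ep res_exact[OF S(1), of k] I(4) res_exact[OF S(2), of k] I(6) I(1)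
          _ _ _ _ _ _ I(10,11) i'(1) _ i'(3,4) p'(1) _ p'(3,4)]) (use i' p' in auto)
    from step[OF this, of "Suc k"] obtain iH' pH' u' w' where "I (Suc k) i' p' iH' pH' u' w'"
      using i' p' by auto
    moreover have "J k iH u w i' p'" using i' p' by (simp add: J_def)
    ultimately show "\<exists>t'. (case t' of (i, p, iH, pH, u, w) \<Rightarrow> I (Suc k) i p iH pH u w) \<and>
      (case t of (i, p, iH, pH, u, w) \<Rightarrow> case t' of (i', p', _) \<Rightarrow> J k iH u w i' p')"
      unfolding t_eq by (intro exI[of _ "(i', p', iH', pH', u', w')"]) simp
  qed
  then obtain t where t: "\<forall>k. (case t k of (i, p, iH, pH, u, w) \<Rightarrow> I k i p iH pH u w) \<and>
     (case t k of (i, p, iH, pH, u, w) \<Rightarrow> case t (Suc k) of (i', p', _) \<Rightarrow> J k iH u w i' p')" ..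
  define i p iH pH u w where "i k = fst (t k)" and "p k = fst (snd (t k))" and "iH k = fst (snd (snd (t k)))"
    and "pH k = fst (snd (snd (snd (t k))))" and "u k = fst (snd (snd (snd (snd (t k)))))"
    and "w k = snd (snd (snd (snd (snd (t k)))))" for k
  have I: "I k (i k) (p k) (iH k) (pH k) (u k) (w k)" and J: "J k (iH k) (u k) (w k) (i (Suc k)) (p (Suc k))" for k
    using spec[OF t, of k] unfolding i_def p_def iH_def pH_def u_def w_def by (auto simp: split_beta)
  have ip: "short_exact C (i k) (p k)" and iHpH: "short_exact C (iH k) (pH k)" and uw: "short_exact C (u k) (w k)"
    and pr: "pH k \<cdot> u k = i k \<cdot> syz_pr S k" "syz_pr Q k \<cdot> w k = p k \<cdot> pH k" and pj: "projective C (Dom C (pH k))"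
    and in': "iH k \<cdot> i (Suc k) = u k \<cdot> syz_in S k" "syz_in Q k \<cdot> p (Suc k) = w k \<cdot> iH k" for k
    using I[of k] J[of k] by (auto simp: I_def J_def)
  have [simp]: "i k \<in> Arr C" "p k \<in> Arr C" "iH k \<in> Arr C" "pH k \<in> Arr C" "u k \<in> Arr C" "w k \<in> Arr C"
    "Dom C (i k) = syz S k" "Dom C (p k) = Cod C (i k)" "Cod C (p k) = syz Q k"
    "Cod C (pH k) = Cod C (i k)" "Cod C (iH k) = Dom C (pH k)" "Dom C (u k) = cx S (int k)"
    "Cod C (u k) = Dom C (pH k)" "Dom C (w k) = Dom C (pH k)" "Cod C (w k) = cx Q (int k)"
    "Dom C (iH k) = Cod C (i (Suc k))" for k
    using I[of k] J[of k] short_exactD(1-3)[OF ip[of k]] short_exactD(1-3)[OF iHpH[of k]] short_exactD(1-3)[OF uw[of k]]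
    by (auto simp: I_def J_def)
  have i0: "i 0 = f" "p 0 = g" using I[of 0] by (auto simp: I_def)
  obtain z where z: "zero_object C z" using ex_zero_object by auto
  hence [simp]: "z \<in> Obj C" by (simp add: zero_object_def)
  define X where "X j = (if j \<ge> 0 then Dom C (pH (nat j)) else z)" for j
  \<comment> \<open>The terms are the projectives chosen row by row, with a zero object in negative
    degrees; the differentials are defined through the syzygies, so exactness is built in.\<close>
  define H where "H = \<lparr>cx = X, diff = \<lambda>j. if j \<ge> 1 then iH (nat (j - 1)) \<cdot> pH (nat j) else mzero C (X j) (X (j - 1)),
     syz = \<lambda>k. Cod C (i k), syz_in = iH, syz_pr = pH\<rparr>"
  have [simp]: "X j \<in> Obj C" for j by (simp add: X_def)
  have nat_pred: "nat j = Suc (nat (j - 1))" if "j \<ge> 1" for j using that by simp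
  have "diff H j \<in> Hom C (X j) (X (j - 1))" for j
    using nat_pred[of j] by (auto simp: Hom_def H_def X_def)
  hence H [simp]: "is_res H" unfolding is_res_def proj_resolution_def
    using z iHpH pj by (auto simp: H_def X_def Hom_def nat_add_distrib)
  define u' where "u' j = (if j \<ge> 0 then u (nat j) else mzero C (cx S j) (X j))" for j
  define w' where "w' j = (if j \<ge> 0 then w (nat j) else mzero C (X j) (cx Q j))" for j
  have cxH: "cx H = X" by (simp add: H_def)
  have u': "fam (cx S) (cx H) u'" and w': "fam (cx H) (cx Q) w'"
    by (auto simp: fam_def u'_def w'_def cxH X_def)
  have "diff H j \<cdot> u' j = u' (j - 1) \<cdot> diff S j" for j
  proof (cases "j \<ge> 1")
    case True
    define k where "k = nat (j - 1)"
    have j: "j = int k + 1" "nat j = Suc k" "nat (int k) = k" using True by (auto simp: k_def)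
    have "iH k \<cdot> (pH (Suc k) \<cdot> u (Suc k)) = (iH k \<cdot> i (Suc k)) \<cdot> syz_pr S (Suc k)" unfolding pr by simp
    also have "\<dots> = u k \<cdot> (syz_in S k \<cdot> syz_pr S (Suc k))" unfolding in' by simp
    finally have 1: "iH k \<cdot> (pH (Suc k) \<cdot> u (Suc k)) = u k \<cdot> diff S j" unfolding j(1) res_diff[OF S(1)] .
    have "diff H j = iH k \<cdot> pH (Suc k)" "u' j = u (Suc k)" "u' (j - 1) = u k"
      using True j by (auto simp: H_def u'_def)
    thus ?thesis using 1 by simp
  next
    case False
    show ?thesis
      by (rule res_cx_unique[OF H, where j = "j - 1"]) (use False famD[OF u', of j] famD[OF u', of "j - 1"] in auto)
  qed
  moreover have "syz_pr H 0 \<cdot> u' 0 = f \<cdot> syz_pr S 0" using pr[of 0] by (simp add: H_def u'_def i0)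
  ultimately have lu: "lifts C S H f u'" using u' by (simp add: liftsI)
  have "diff Q j \<cdot> w' j = w' (j - 1) \<cdot> diff H j" for j
  proof (cases "j \<ge> 1")
    case True
    define k where "k = nat (j - 1)"
    have j: "j = int k + 1" "nat j = Suc k" "nat (int k) = k" using True by (auto simp: k_def)
    have "(syz_in Q k \<cdot> syz_pr Q (Suc k)) \<cdot> w (Suc k) = syz_in Q k \<cdot> (syz_pr Q (Suc k) \<cdot> w (Suc k))"
      by simp
    also have "\<dots> = (syz_in Q k \<cdot> p (Suc k)) \<cdot> pH (Suc k)" unfolding pr by simp
    also have "\<dots> = w k \<cdot> (iH k \<cdot> pH (Suc k))" unfolding in' by simp
    finally have 1: "diff Q j \<cdot> w (Suc k) = w k \<cdot> (iH k \<cdot> pH (Suc k))" unfolding j(1) res_diff[OF S(2)] .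
    have "diff H j = iH k \<cdot> pH (Suc k)" "w' j = w (Suc k)" "w' (j - 1) = w k"
      using True j by (auto simp: H_def w'_def)
    thus ?thesis using 1 by simp
  next
    case False
    show ?thesis
      by (rule res_cx_unique[OF S(2), where j = "j - 1"]) (use False famD[OF w', of j] famD[OF w', of "j - 1"] in auto)
  qed
  moreover have "syz_pr Q 0 \<cdot> w' 0 = g \<cdot> syz_pr H 0" using pr[of 0] by (simp add: H_def w'_def i0)
  ultimately have lw: "lifts C H Q g w'" using w' by (simp add: liftsI)
  have "horseshoe S H Q f g u' w' i p" unfolding horseshoe_def
  proof (intro conjI allI impI)
    show "syz H 0 = Cod C f" by (simp add: H_def i0)
    show "syz_lifts C S H f u' i" unfolding syz_lifts_def
      using lu in' by (auto simp: i0 Hom_def H_def u'_def)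
    show "syz_lifts C H Q g w' p" unfolding syz_lifts_def
      using lw in' by (auto simp: i0 Hom_def H_def w'_def)
    show "short_exact C (u' m) (w' m)" if "m \<ge> 0" for m
      using uw that by (auto simp: u'_def w'_def)
  qed simp
  thus ?thesis by (rule that)
qed

end

section \<open>Degreewise split sequences of resolutions\<close>

text \<open>The splittings \<open>r\<close> and \<open>s\<close> are degreewise and need not commute
  with the differentials. Nothing is asked about augmentations, so the exactness arguments below are
  purely about complexes.\<close>

locale split_resolutions = resolved_object +
  fixes S H Q u w r s
  assumes SHQ [simp]: "is_res S" "is_res H" "is_res Q"
    and u: "fam (cx S) (cx H) u" and w: "fam (cx H) (cx Q) w"
    and r: "fam (cx H) (cx S) r" and s: "fam (cx Q) (cx H) s"
    and uc: "\<And>j. diff H j \<cdot> u j = u (j - 1) \<cdot> diff S j" and wc: "\<And>j. diff Q j \<cdot> w j = w (j - 1) \<cdot> diff H j"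
    and ru: "\<And>j. r j \<cdot> u j = ident C (cx S j)" and ws: "\<And>j. w j \<cdot> s j = ident C (cx Q j)"
    and wu: "\<And>j. w j \<cdot> u j = mzero C (cx S j) (cx Q j)" and rs: "\<And>j. r j \<cdot> s j = mzero C (cx Q j) (cx S j)"
    and dec: "\<And>j. u j \<cdot> r j \<boxplus> s j \<cdot> w j = ident C (cx H j)"
begin

lemmas uwrs [simp] = famD[OF u] famD[OF w] famD[OF r] famD[OF s]

lemma ru_comp [simp]: "x \<in> Arr C \<Longrightarrow> Cod C x = cx S j \<Longrightarrow> r j \<cdot> (u j \<cdot> x) = x"
  using ru[of j] comp_assoc[of x "u j" "r j"] by simp

lemma ws_comp [simp]: "x \<in> Arr C \<Longrightarrow> Cod C x = cx Q j \<Longrightarrow> w j \<cdot> (s j \<cdot> x) = x"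
  using ws[of j] comp_assoc[of x "s j" "w j"] by simp

lemma wu_comp [simp]: "x \<in> Arr C \<Longrightarrow> Cod C x = cx S j \<Longrightarrow> w j \<cdot> (u j \<cdot> x) = mzero C (Dom C x) (cx Q j)"
  using wu[of j] comp_assoc[of x "u j" "w j"] by simp

lemma rs_comp [simp]: "x \<in> Arr C \<Longrightarrow> Cod C x = cx Q j \<Longrightarrow> r j \<cdot> (s j \<cdot> x) = mzero C (Dom C x) (cx S j)"
  using rs[of j] comp_assoc[of x "s j" "r j"] by simp

lemma split_dec: "x \<in> Arr C \<Longrightarrow> Cod C x = cx H j \<Longrightarrow> u j \<cdot> (r j \<cdot> x) \<boxplus> s j \<cdot> (w j \<cdot> x) = x"
  using arg_cong[OF dec[of j], of "\<lambda>y. y \<cdot> x"] by simp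

lemma uc_comp: "x \<in> Arr C \<Longrightarrow> Cod C x = cx S j \<Longrightarrow> diff H j \<cdot> (u j \<cdot> x) = u (j - 1) \<cdot> (diff S j \<cdot> x)"
  using arg_cong[OF uc[of j], of "\<lambda>y. y \<cdot> x"] by simp

lemma wc_comp: "x \<in> Arr C \<Longrightarrow> Cod C x = cx H j \<Longrightarrow> w (j - 1) \<cdot> (diff H j \<cdot> x) = diff Q j \<cdot> (w j \<cdot> x)"
  using arg_cong[OF wc[of j], of "\<lambda>y. y \<cdot> x"] by simp

text \<open>The failure of the splitting to be a chain map; up to sign it represents the connecting homomorphism.\<close>

definition \<theta> where "\<theta> j = r (j - 1) \<cdot> (diff H j \<cdot> s j)"

lemma \<theta>_arr [simp]: "\<theta> j \<in> Arr C" "Dom C (\<theta> j) = cx Q j" "Cod C (\<theta> j) = cx S (j - 1)"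
  by (auto simp: \<theta>_def)

text \<open>Decomposition of the left side along the splitting: its \<open>w\<close> part is what a
  chain map \<open>s\<close> would give, and its \<open>u\<close> part is the defect
  \<open>\<theta>\<close>.\<close>

lemma diff_s:
  assumes [simp]: "x \<in> Arr C" "Cod C x = cx Q j"
  shows "diff H j \<cdot> (s j \<cdot> x) = s (j - 1) \<cdot> (diff Q j \<cdot> x) \<boxplus> u (j - 1) \<cdot> (\<theta> j \<cdot> x)"
proof -
  have "u (j - 1) \<cdot> (r (j - 1) \<cdot> (diff H j \<cdot> (s j \<cdot> x))) \<boxplus> s (j - 1) \<cdot> (w (j - 1) \<cdot> (diff H j \<cdot> (s j \<cdot> x)))
    = diff H j \<cdot> (s j \<cdot> x)" by (rule split_dec) auto
  thus ?thesis by (simp add: \<theta>_def wc_comp madd_comm)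
qed

text \<open>The dual computation: \<open>r\<close> fails to be a chain map by the same
  \<open>\<theta>\<close>, now composed with \<open>w\<close>.\<close>

lemma r_diff:
  assumes [simp]: "x \<in> Arr C" "Cod C x = cx H j"
  shows "r (j - 1) \<cdot> (diff H j \<cdot> x) = diff S j \<cdot> (r j \<cdot> x) \<boxplus> \<theta> j \<cdot> (w j \<cdot> x)"
proof -
  have "r (j - 1) \<cdot> (diff H j \<cdot> x) = r (j - 1) \<cdot> (diff H j \<cdot> (u j \<cdot> (r j \<cdot> x) \<boxplus> s j \<cdot> (w j \<cdot> x)))"
    using split_dec[of x j] by simp
  thus ?thesis by (simp add: uc_comp \<theta>_def)
qed

text \<open>The vanishing square of the differential of \<open>H\<close>, read in the corner from
  \<open>Q\<close> to \<open>S\<close> of the splitting.\<close>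

lemma diff_\<theta>:
  assumes [simp]: "x \<in> Arr C" "Cod C x = cx Q j"
  shows "diff S (j - 1) \<cdot> (\<theta> j \<cdot> x) = neg (\<theta> (j - 1) \<cdot> (diff Q j \<cdot> x))"
proof (rule neg_unique)
  have dd: "diff K (j - 1) \<cdot> (diff K j \<cdot> y) = mzero C (Dom C y) (cx K (j - 2))"
    if "y \<in> Arr C" "Cod C y = cx K j" "is_res K" for K y
  proof -
    have "diff K (j - 1) \<cdot> (diff K j \<cdot> y) = (diff K (j - 1) \<cdot> diff K j) \<cdot> y"
      using that by simp
    thus ?thesis unfolding res_dd[OF that(3)] using that by simp
  qed
  have "mzero C (Dom C x) (cx S (j - 2)) = r (j - 2) \<cdot> (diff H (j - 1) \<cdot> (diff H j \<cdot> (s j \<cdot> x)))"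
    by (simp add: dd)
  also have "\<dots> = r (j - 2) \<cdot> (diff H (j - 1) \<cdot> (s (j - 1) \<cdot> (diff Q j \<cdot> x))) \<boxplus>
      r (j - 2) \<cdot> (diff H (j - 1) \<cdot> (u (j - 1) \<cdot> (\<theta> j \<cdot> x)))"
    unfolding diff_s[OF assms] by simp
  also have "r (j - 2) \<cdot> (diff H (j - 1) \<cdot> (s (j - 1) \<cdot> (diff Q j \<cdot> x))) = \<theta> (j - 1) \<cdot> (diff Q j \<cdot> x)"
    by (simp add: \<theta>_def)
  also have "r (j - 2) \<cdot> (diff H (j - 1) \<cdot> (u (j - 1) \<cdot> (\<theta> j \<cdot> x))) = diff S (j - 1) \<cdot> (\<theta> j \<cdot> x)"
    by (simp add: uc_comp)
  finally show "\<theta> (j - 1) \<cdot> (diff Q j \<cdot> x) \<boxplus> diff S (j - 1) \<cdot> (\<theta> j \<cdot> x) =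
     mzero C (Dom C (diff S (j - 1) \<cdot> (\<theta> j \<cdot> x))) (Cod C (diff S (j - 1) \<cdot> (\<theta> j \<cdot> x)))" by simp
qed auto

text \<open>The sign does not depend on the degree: the alternating sign of the connecting map meets
  the alternating sign by which \<open>\<theta>\<close> is turned into a chain map in
  \<open>hs\<close>, and only \<open>(-1)^(n+1)\<close> is left.\<close>

definition \<Theta> where "\<Theta> n \<phi> = (\<lambda>j. msign C (n + 1) (\<theta> (j + 1) \<cdot> \<phi> (j + 1)))"

section \<open>Exactness for a degreewise split sequence\<close>

lemma madd_cancel4:
  assumes "a \<in> Arr C" "b \<in> Arr C" "c \<in> Arr C" "d \<in> Arr C" "Dom C a = Dom C d" "Dom C b = Dom C d" "Dom C c = Dom C d"
    "Cod C a = Cod C d" "Cod C b = Cod C d" "Cod C c = Cod C d"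
  shows "(a \<boxplus> neg b) \<boxplus> (c \<boxplus> (d \<boxplus> b)) = a \<boxplus> (c \<boxplus> d)"
proof -
  have "(a \<boxplus> neg b) \<boxplus> (c \<boxplus> (d \<boxplus> b)) = a \<boxplus> (neg b \<boxplus> (b \<boxplus> (c \<boxplus> d)))"
    using assms by (simp add: madd_ac del: madd_neg_cancel)
  thus ?thesis using assms by simp
qed

lemma madd_cancel3:
  assumes "a \<in> Arr C" "b \<in> Arr C" "c \<in> Arr C" "Dom C a = Dom C c" "Dom C b = Dom C c"
    "Cod C a = Cod C c" "Cod C b = Cod C c"
  shows "a \<boxplus> (b \<boxplus> c) \<boxplus> neg b = a \<boxplus> c"
proof -
  have "a \<boxplus> (b \<boxplus> c) \<boxplus> neg b = a \<boxplus> (neg b \<boxplus> (b \<boxplus> c))"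
    using assms by (simp add: madd_ac del: madd_neg_cancel)
  thus ?thesis using assms by simp
qed

lemma msign_neg: "f \<in> Arr C \<Longrightarrow> msign C n (neg f) = neg (msign C n f)"
  by (simp add: msign_eq)

lemma exact_mid:
  assumes F: "shiftable F" and \<phi>: "chain F n H \<phi>" and n: "homotopic F n Q (\<lambda>j. w j \<cdot> \<phi> j) (zfam n Q)"
  shows "\<exists>\<psi>. chain F n S \<psi> \<and> homotopic F n H \<phi> (\<lambda>j. u j \<cdot> \<psi> j)"
proof -
  note [simp] = chainD(2-4)[OF \<phi>]
  obtain e where e: "fam (P n) (\<lambda>j. cx Q (j + 1)) e"
    and "\<forall>\<^sub>F j in F. w j \<cdot> \<phi> j = zfam n Q j \<boxplus> (e (j - 1) \<cdot> \<partial> n j \<boxplus> diff Q (j + 1) \<cdot> e j)"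
    using n unfolding homotopic_def by blast
  note [simp] = famD[OF e]
  have ev: "\<forall>\<^sub>F j in F. w j \<cdot> \<phi> j = e (j - 1) \<cdot> \<partial> n j \<boxplus> diff Q (j + 1) \<cdot> e j"
    using \<open>\<forall>\<^sub>F j in F. _\<close> by eventually_elim (simp add: add_diff_eq)
  \<comment> \<open>This is the \<open>S\<close> component of \<open>\<phi>\<close> after
    subtracting the boundary of the homotopy \<open>s e\<close>. The term with
    \<open>\<theta>\<close> is the \<open>u\<close> part of that boundary, by
    \<open>diff_s\<close>.\<close>
  define \<psi> where "\<psi> j = r j \<cdot> \<phi> j \<boxplus> neg (\<theta> (j + 1) \<cdot> e j)" for j
  have \<psi>f [simp]: "\<psi> j \<in> Arr C" "Dom C (\<psi> j) = cx R (n + j)" "Cod C (\<psi> j) = cx S j" for j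
    by (auto simp: \<psi>_def)
  have "\<forall>\<^sub>F j in F. diff S j \<cdot> \<psi> j = \<psi> (j - 1) \<cdot> \<partial> n j"
    using chainD(5)[OF \<phi>] ev
  proof eventually_elim
    case (elim j)
    have 1: "r (j - 1) \<cdot> (\<phi> (j - 1) \<cdot> \<partial> n j) = diff S j \<cdot> (r j \<cdot> \<phi> j) \<boxplus>
        (\<theta> j \<cdot> (e (j - 1) \<cdot> \<partial> n j) \<boxplus> \<theta> j \<cdot> (diff Q (j + 1) \<cdot> e j))"
      using r_diff[of "\<phi> j" j] unfolding elim by (simp add: add_diff_eq)
    have 2: "diff S j \<cdot> (\<theta> (j + 1) \<cdot> e j) = neg (\<theta> j \<cdot> (diff Q (j + 1) \<cdot> e j))"
      using diff_\<theta>[of "e j" "j + 1"] by simp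
    have "\<psi> (j - 1) \<cdot> \<partial> n j = r (j - 1) \<cdot> (\<phi> (j - 1) \<cdot> \<partial> n j) \<boxplus> neg (\<theta> j \<cdot> (e (j - 1) \<cdot> \<partial> n j))"
      by (simp add: \<psi>_def add_diff_eq)
    also have "\<dots> = diff S j \<cdot> (r j \<cdot> \<phi> j) \<boxplus> \<theta> j \<cdot> (diff Q (j + 1) \<cdot> e j)"
      unfolding 1 by (rule madd_cancel3) (auto simp: add_diff_eq)
    also have "\<dots> = diff S j \<cdot> \<psi> j" by (simp add: \<psi>_def 2)
    finally show ?case ..
  qed
  hence c: "chain F n S \<psi>" by (simp add: chain_def fam_def)
  have k: "fam (P n) (\<lambda>j. cx H (j + 1)) (\<lambda>j. s (j + 1) \<cdot> e j)" by (simp add: fam_def)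
  have "\<forall>\<^sub>F j in F. \<phi> j = u j \<cdot> \<psi> j \<boxplus> ((s (j - 1 + 1) \<cdot> e (j - 1)) \<cdot> \<partial> n j \<boxplus> diff H (j + 1) \<cdot> (s (j + 1) \<cdot> e j))"
    using ev
  proof eventually_elim
    case (elim j)
    have 1: "diff H (j + 1) \<cdot> (s (j + 1) \<cdot> e j) = s j \<cdot> (diff Q (j + 1) \<cdot> e j) \<boxplus> u j \<cdot> (\<theta> (j + 1) \<cdot> e j)"
      using diff_s[of "e j" "j + 1"] by simp
    have "\<phi> j = u j \<cdot> (r j \<cdot> \<phi> j) \<boxplus> s j \<cdot> (w j \<cdot> \<phi> j)" by (rule split_dec[symmetric]) auto
    also have "\<dots> = u j \<cdot> (r j \<cdot> \<phi> j) \<boxplus> (s j \<cdot> (e (j - 1) \<cdot> \<partial> n j) \<boxplus> s j \<cdot> (diff Q (j + 1) \<cdot> e j))"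
      unfolding elim by (simp add: add_diff_eq)
    also have "\<dots> = (u j \<cdot> (r j \<cdot> \<phi> j) \<boxplus> neg (u j \<cdot> (\<theta> (j + 1) \<cdot> e j))) \<boxplus> (s j \<cdot> (e (j - 1) \<cdot> \<partial> n j) \<boxplus>
        (s j \<cdot> (diff Q (j + 1) \<cdot> e j) \<boxplus> u j \<cdot> (\<theta> (j + 1) \<cdot> e j)))"
      by (rule madd_cancel4[symmetric]) (auto simp: add_diff_eq)
    finally show ?case unfolding 1 by (simp add: \<psi>_def add_diff_eq)
  qed
  hence "homotopic F n H \<phi> (\<lambda>j. u j \<cdot> \<psi> j)" unfolding homotopic_def using k
    by (intro exI[of _ "\<lambda>j. s (j + 1) \<cdot> e j"]) simp
  with c show ?thesis by blast
qed

lemma exact_right: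
  assumes F: "shiftable F" and \<phi>: "chain F n Q \<phi>" and n: "homotopic F (n + 1) S (\<Theta> n \<phi>) (zfam (n + 1) S)"
  shows "\<exists>\<psi>. chain F n H \<psi> \<and> \<phi> = (\<lambda>j. w j \<cdot> \<psi> j)"
proof -
  note [simp] = chainD(2-4)[OF \<phi>]
  obtain e where e: "fam (P (n + 1)) (\<lambda>j. cx S (j + 1)) e"
    and ev: "\<forall>\<^sub>F j in F. \<Theta> n \<phi> j = zfam (n + 1) S j \<boxplus> (e (j - 1) \<cdot> \<partial> (n + 1) j \<boxplus> diff S (j + 1) \<cdot> e j)"
    using n unfolding homotopic_def by blast
  have [simp]: "e j \<in> Arr C" "Dom C (e j) = cx R (n + (j + 1))" "Cod C (e j) = cx S (j + 1)" for j
    using famD[OF e, of j] by (auto simp: algebra_simps)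
  \<comment> \<open>The family \<open>s \<phi>\<close> maps to \<open>\<phi>\<close> under
    \<open>w\<close> but misses the chain condition by \<open>u (\<theta> \<phi>)\<close>. A
    nullhomotopy \<open>e\<close> of \<open>\<Theta> n \<phi>\<close> provides the correction, and
    it lies in the image of \<open>u\<close>; hence \<open>\<phi>\<close> is hit exactly and not
    only up to homotopy.\<close>
  define \<psi> where "\<psi> j = s j \<cdot> \<phi> j \<boxplus> msign C n (u j \<cdot> e (j - 1))" for j
  have \<psi>f [simp]: "\<psi> j \<in> Arr C" "Dom C (\<psi> j) = cx R (n + j)" "Cod C (\<psi> j) = cx H j" for j
    by (auto simp: \<psi>_def)
  have "\<forall>\<^sub>F j in F. diff H j \<cdot> \<psi> j = \<psi> (j - 1) \<cdot> \<partial> n j"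
    using chainD(5)[OF \<phi>] eventually_pred[OF F ev]
  proof eventually_elim
    case (elim j)
    have "msign C (n + 1) (\<theta> j \<cdot> \<phi> j) = neg (e (j - 2) \<cdot> \<partial> n j) \<boxplus> diff S j \<cdot> e (j - 1)"
      using elim(2) by (simp add: \<Theta>_def sd_Suc add_diff_eq)
    hence 1: "\<theta> j \<cdot> \<phi> j \<boxplus> msign C n (diff S j \<cdot> e (j - 1)) = msign C n (e (j - 2) \<cdot> \<partial> n j)"
    proof (cases "even n")
      case True
      assume "msign C (n + 1) (\<theta> j \<cdot> \<phi> j) = neg (e (j - 2) \<cdot> \<partial> n j) \<boxplus> diff S j \<cdot> e (j - 1)"
      hence "neg (neg (\<theta> j \<cdot> \<phi> j)) = neg (neg (e (j - 2) \<cdot> \<partial> n j) \<boxplus> diff S j \<cdot> e (j - 1))"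
        using True by (simp add: msign_eq)
      hence "\<theta> j \<cdot> \<phi> j = e (j - 2) \<cdot> \<partial> n j \<boxplus> neg (diff S j \<cdot> e (j - 1))" by (simp add: add_diff_eq)
      thus ?thesis using True by (simp add: msign_eq madd_assoc add_diff_eq)
    next
      case False
      assume "msign C (n + 1) (\<theta> j \<cdot> \<phi> j) = neg (e (j - 2) \<cdot> \<partial> n j) \<boxplus> diff S j \<cdot> e (j - 1)"
      thus ?thesis using False by (simp add: msign_eq madd_assoc add_diff_eq)
    qed
    have "diff H j \<cdot> \<psi> j = s (j - 1) \<cdot> (diff Q j \<cdot> \<phi> j) \<boxplus>
       (u (j - 1) \<cdot> (\<theta> j \<cdot> \<phi> j) \<boxplus> msign C n (u (j - 1) \<cdot> (diff S j \<cdot> e (j - 1))))"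
      by (simp add: \<psi>_def diff_s uc_comp madd_assoc)
    also have "u (j - 1) \<cdot> (\<theta> j \<cdot> \<phi> j) \<boxplus> msign C n (u (j - 1) \<cdot> (diff S j \<cdot> e (j - 1))) =
       u (j - 1) \<cdot> (\<theta> j \<cdot> \<phi> j \<boxplus> msign C n (diff S j \<cdot> e (j - 1)))" by simp
    also have "\<dots> = msign C n (u (j - 1) \<cdot> (e (j - 2) \<cdot> \<partial> n j))" unfolding 1 by (simp add: add_diff_eq)
    finally show ?case unfolding elim(1) by (simp add: \<psi>_def add_diff_eq)
  qed
  hence "chain F n H \<psi>" by (simp add: chain_def fam_def)
  moreover have "\<phi> = (\<lambda>j. w j \<cdot> \<psi> j)" by (auto simp: \<psi>_def fun_eq_iff)
  ultimately show ?thesis by blast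
qed

lemma exact_left:
  assumes F: "shiftable F" and \<phi>: "chain F (n + 1) S \<phi>"
    and n: "homotopic F (n + 1) H (\<lambda>j. u j \<cdot> \<phi> j) (zfam (n + 1) H)"
  shows "\<exists>\<psi>. chain F n Q \<psi> \<and> homotopic F (n + 1) S \<phi> (\<Theta> n \<psi>)"
proof -
  note [simp] = chainD(2-4)[OF \<phi>]
  obtain e where e: "fam (P (n + 1)) (\<lambda>j. cx H (j + 1)) e"
    and "\<forall>\<^sub>F j in F. u j \<cdot> \<phi> j = zfam (n + 1) H j \<boxplus> (e (j - 1) \<cdot> \<partial> (n + 1) j \<boxplus> diff H (j + 1) \<cdot> e j)"
    using n unfolding homotopic_def by blast
  note [simp] = famD[OF e]
  have ev: "\<forall>\<^sub>F j in F. u j \<cdot> \<phi> j = e (j - 1) \<cdot> \<partial> (n + 1) j \<boxplus> diff H (j + 1) \<cdot> e j"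
    using \<open>\<forall>\<^sub>F j in F. _\<close> by eventually_elim (simp add: add_diff_eq)
  \<comment> \<open>Applying \<open>w\<close> to the nullhomotopy kills its left side, so
    \<open>w e\<close>, moved by one degree, commutes with the differentials up to sign. Applying
    \<open>r\<close> instead will show that its image under \<open>\<Theta>\<close> is homotopic to
    \<open>\<phi>\<close>.\<close>
  define \<psi> where "\<psi> j = msign C (n + 1) (w j \<cdot> e (j - 1))" for j
  have \<psi>f [simp]: "\<psi> j \<in> Arr C" "Dom C (\<psi> j) = cx R (n + j)" "Cod C (\<psi> j) = cx Q j" for j
    by (auto simp: \<psi>_def)
  have "\<forall>\<^sub>F j in F. diff Q j \<cdot> \<psi> j = \<psi> (j - 1) \<cdot> \<partial> n j"
    using eventually_pred[OF F ev]
  proof eventually_elim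
    case (elim j)
    have "mzero C (cx R (n + j)) (cx Q (j - 1)) = w (j - 1) \<cdot> (u (j - 1) \<cdot> \<phi> (j - 1))" by simp
    also have "\<dots> = neg (w (j - 1) \<cdot> (e (j - 2) \<cdot> \<partial> n j)) \<boxplus> w (j - 1) \<cdot> (diff H j \<cdot> e (j - 1))"
      unfolding elim by (simp add: sd_Suc add_diff_eq)
    finally have "neg (w (j - 1) \<cdot> (e (j - 2) \<cdot> \<partial> n j)) \<boxplus> w (j - 1) \<cdot> (diff H j \<cdot> e (j - 1))
      = mzero C (cx R (n + j)) (cx Q (j - 1))" ..
    hence "w (j - 1) \<cdot> (diff H j \<cdot> e (j - 1)) = neg (neg (w (j - 1) \<cdot> (e (j - 2) \<cdot> \<partial> n j)))"
      by (intro neg_unique) (auto simp: add_diff_eq)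
    hence "diff Q j \<cdot> (w j \<cdot> e (j - 1)) = w (j - 1) \<cdot> (e (j - 2) \<cdot> \<partial> n j)"
      by (simp add: wc_comp add_diff_eq)
    thus ?case by (simp add: \<psi>_def add_diff_eq)
  qed
  hence c: "chain F n Q \<psi>" by (simp add: chain_def fam_def)
  have k: "fam (P (n + 1)) (\<lambda>j. cx S (j + 1)) (\<lambda>j. r (j + 1) \<cdot> e j)" by (simp add: fam_def)
  have "\<forall>\<^sub>F j in F. \<phi> j = \<Theta> n \<psi> j \<boxplus> ((r (j - 1 + 1) \<cdot> e (j - 1)) \<cdot> \<partial> (n + 1) j \<boxplus> diff S (j + 1) \<cdot> (r (j + 1) \<cdot> e j))"
    using ev
  proof eventually_elim
    case (elim j)
    have 1: "r j \<cdot> (diff H (j + 1) \<cdot> e j) = diff S (j + 1) \<cdot> (r (j + 1) \<cdot> e j) \<boxplus> \<theta> (j + 1) \<cdot> (w (j + 1) \<cdot> e j)"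
      using r_diff[of "e j" "j + 1"] by simp
    have "\<phi> j = r j \<cdot> (u j \<cdot> \<phi> j)" by simp
    also have "\<dots> = r j \<cdot> (e (j - 1) \<cdot> \<partial> (n + 1) j) \<boxplus> r j \<cdot> (diff H (j + 1) \<cdot> e j)"
      unfolding elim by (simp add: add_diff_eq)
    also have "\<dots> = \<theta> (j + 1) \<cdot> (w (j + 1) \<cdot> e j) \<boxplus> (r j \<cdot> (e (j - 1) \<cdot> \<partial> (n + 1) j) \<boxplus> diff S (j + 1) \<cdot> (r (j + 1) \<cdot> e j))"
      unfolding 1 by (simp add: madd_ac add_diff_eq)
    finally show ?case by (simp add: \<Theta>_def \<psi>_def msign_eq add_diff_eq)
  qed
  hence "homotopic F (n + 1) S \<phi> (\<Theta> n \<psi>)" unfolding homotopic_def using k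
    by (intro exI[of _ "\<lambda>j. r (j + 1) \<cdot> e j"]) simp
  with c show ?thesis by blast
qed

lemma zero_right:
  assumes F: "shiftable F" and \<phi>: "chain F n H \<phi>"
  shows "homotopic F (n + 1) S (\<Theta> n (\<lambda>j. w j \<cdot> \<phi> j)) (zfam (n + 1) S)"
proof -
  note [simp] = chainD(2-4)[OF \<phi>]
  \<comment> \<open>By \<open>r_diff\<close> the defect of \<open>r \<phi>\<close> as a chain map is
    \<open>\<theta>\<close> applied to \<open>w \<phi>\<close>, so \<open>r \<phi>\<close> with a
    sign is the required nullhomotopy.\<close>
  define k where "k j = msign C n (r (j + 1) \<cdot> \<phi> (j + 1))" for j
  have k: "fam (P (n + 1)) (\<lambda>j. cx S (j + 1)) k" by (simp add: fam_def k_def algebra_simps)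
  have "\<forall>\<^sub>F j in F. \<Theta> n (\<lambda>j. w j \<cdot> \<phi> j) j = zfam (n + 1) S j \<boxplus> (k (j - 1) \<cdot> \<partial> (n + 1) j \<boxplus> diff S (j + 1) \<cdot> k j)"
    using eventually_succ[OF F chainD(5)[OF \<phi>]]
  proof eventually_elim
    case (elim j)
    let ?x = "diff S (j + 1) \<cdot> (r (j + 1) \<cdot> \<phi> (j + 1))" and ?y = "\<theta> (j + 1) \<cdot> (w (j + 1) \<cdot> \<phi> (j + 1))"
    have 1: "r j \<cdot> (\<phi> j \<cdot> \<partial> n (j + 1)) = ?x \<boxplus> ?y"
      using r_diff[of "\<phi> (j + 1)" "j + 1"] unfolding elim by simp
    have "k (j - 1) \<cdot> \<partial> (n + 1) j \<boxplus> diff S (j + 1) \<cdot> k j = msign C n (neg (r j \<cdot> (\<phi> j \<cdot> \<partial> n (j + 1))) \<boxplus> ?x)"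
      by (simp add: k_def sd_Suc add_diff_eq add.assoc msign_neg)
    also have "\<dots> = msign C n (neg ?y)"
      unfolding 1 by (simp add: madd_ac[of "neg ?x"] madd_assoc madd_comm[of "neg ?y" ?x])
    also have "\<dots> = msign C (n + 1) ?y" by (simp add: msign_eq)
    finally show ?case by (simp add: \<Theta>_def algebra_simps)
  qed
  thus ?thesis unfolding homotopic_def using k by blast
qed

lemma zero_left:
  assumes F: "shiftable F" and \<phi>: "chain F n Q \<phi>"
  shows "homotopic F (n + 1) H (\<lambda>j. u j \<cdot> \<Theta> n \<phi> j) (zfam (n + 1) H)"
proof -
  note [simp] = chainD(2-4)[OF \<phi>]
  \<comment> \<open>By \<open>diff_s\<close> the defect of \<open>s \<phi>\<close> as a chain map is
    \<open>u\<close> applied to \<open>\<theta> \<phi>\<close>, so \<open>s \<phi>\<close> with a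
    sign is the required nullhomotopy.\<close>
  define k where "k j = msign C (n + 1) (s (j + 1) \<cdot> \<phi> (j + 1))" for j
  have k: "fam (P (n + 1)) (\<lambda>j. cx H (j + 1)) k" by (simp add: fam_def k_def algebra_simps)
  have "\<forall>\<^sub>F j in F. u j \<cdot> \<Theta> n \<phi> j = zfam (n + 1) H j \<boxplus> (k (j - 1) \<cdot> \<partial> (n + 1) j \<boxplus> diff H (j + 1) \<cdot> k j)"
    using eventually_succ[OF F chainD(5)[OF \<phi>]]
  proof eventually_elim
    case (elim j)
    have 1: "diff H (j + 1) \<cdot> (s (j + 1) \<cdot> \<phi> (j + 1)) = s j \<cdot> (\<phi> j \<cdot> \<partial> n (j + 1)) \<boxplus> u j \<cdot> (\<theta> (j + 1) \<cdot> \<phi> (j + 1))"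
      using diff_s[of "\<phi> (j + 1)" "j + 1"] elim by simp
    have "k (j - 1) \<cdot> \<partial> (n + 1) j \<boxplus> diff H (j + 1) \<cdot> k j =
      msign C (n + 1) (neg (s j \<cdot> (\<phi> j \<cdot> \<partial> n (j + 1))) \<boxplus> diff H (j + 1) \<cdot> (s (j + 1) \<cdot> \<phi> (j + 1)))"
      by (simp add: k_def sd_Suc add_diff_eq add.assoc msign_neg)
    also have "\<dots> = msign C (n + 1) (u j \<cdot> (\<theta> (j + 1) \<cdot> \<phi> (j + 1)))" unfolding 1 by simp
    finally show ?case by (simp add: \<Theta>_def algebra_simps)
  qed
  thus ?thesis unfolding homotopic_def using k by blast
qed

end

section \<open>The splitting defect as a representative of connecting maps\<close>

context split_resolutions
begin

text \<open>The alternating sign turns the anticommutation in \<open>diff_\<theta>\<close> into a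
  chain condition, and the start in degree \<open>k + 1\<close> adapts \<open>\<theta>\<close> to
  the row of \<open>k\<close>-th syzygies.\<close>

definition hs where
  "hs k j = (if j \<ge> 0 then msign C (j + 1) (\<theta> (j + 1 + int k)) else mzero C (cx Q j) (cx S j))"

text \<open>The section \<open>s\<close> followed by the projection of \<open>H\<close> is an
  admissible \<open>h\<close>. Projecting \<open>diff_s\<close> to the syzygies then shows that the
  negative of \<open>\<theta>\<close> covers the induced map \<open>h1\<close>. As the same
  \<open>\<theta>\<close> serves every \<open>k\<close>, the connecting maps of different levels
  become comparable.\<close>

lemma \<theta>_conn_data:
  assumes i: "syz_lifts C S H f u i" and p: "syz_lifts C H Q g w p"
    and f: "f \<in> Arr C" "Dom C f = syz S 0" "Cod C f = syz H 0"
    and g: "g \<in> Arr C" "Dom C g = syz H 0" "Cod C g = syz Q 0"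
    and ip: "short_exact C (i k) (p k)"
  shows "\<exists>h h1. conn_data (shift_res C k S) (shift_res C k Q) (i k) (p k) h h1 (hs k)"
proof -
  note [simp] = syz_lifts_arr[OF i f] syz_lifts_arr[OF p g]
  define h where "h = syz_pr H k \<cdot> s (int k)"
  have h [simp]: "h \<in> Arr C" "Dom C h = cx Q (int k)" "Cod C h = syz H k" by (auto simp: h_def)
  have "p k \<cdot> h = (p k \<cdot> syz_pr H k) \<cdot> s (int k)" by (simp add: h_def)
  also have "\<dots> = syz_pr Q k \<cdot> (w (int k) \<cdot> s (int k))"
    unfolding syz_lifts_pr[OF SHQ(2,3) p g, symmetric] by simp
  finally have ph: "p k \<cdot> h = syz_pr Q k" by (simp add: ws)
  have "p k \<cdot> (h \<cdot> syz_in Q k) = (p k \<cdot> h) \<cdot> syz_in Q k" by simp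
  also have "\<dots> = mzero C (Dom C (h \<cdot> syz_in Q k)) (Cod C (p k))" unfolding ph by simp
  finally have 1: "p k \<cdot> (h \<cdot> syz_in Q k) = mzero C (Dom C (h \<cdot> syz_in Q k)) (Cod C (p k))" .
  obtain h1 where h1: "h1 \<in> Arr C" "Dom C h1 = Dom C (h \<cdot> syz_in Q k)" "Cod C h1 = Dom C (i k)" "i k \<cdot> h1 = h \<cdot> syz_in Q k"
    by (rule is_kernel_factor[OF short_exact_kernel[OF ip] 1]) auto
  have [simp]: "h1 \<in> Arr C" "Dom C h1 = syz Q (Suc k)" "Cod C h1 = syz S k" using h1 by auto
  let ?j = "int k + 1"
  have [simp]: "Cod C (syz_pr Q (Suc k)) = syz Q (Suc k)" "Dom C (syz_pr Q (Suc k)) = cx Q ?j"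
    by (auto simp: add.commute)
  have "mzero C (cx Q ?j) (syz H k) = (syz_pr H k \<cdot> diff H ?j) \<cdot> s ?j" unfolding res_pr_diff[OF SHQ(2)] by simp
  also have "\<dots> = syz_pr H k \<cdot> (diff H ?j \<cdot> (s ?j \<cdot> ident C (cx Q ?j)))"
    by (simp del: res_pr_diff)
  also have "\<dots> = h \<cdot> diff Q ?j \<boxplus> (syz_pr H k \<cdot> u (int k)) \<cdot> \<theta> ?j"
    unfolding diff_s[of "ident C (cx Q ?j)" ?j, simplified] by (simp add: h_def diff_s[of "ident C (cx Q ?j)" ?j, simplified])
  also have "h \<cdot> diff Q ?j = (h \<cdot> syz_in Q k) \<cdot> syz_pr Q (Suc k)" unfolding res_diff[OF SHQ(3)] by simp
  also have "\<dots> = i k \<cdot> (h1 \<cdot> syz_pr Q (Suc k))" unfolding h1(4)[symmetric] by simp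
  also have "(syz_pr H k \<cdot> u (int k)) \<cdot> \<theta> ?j = i k \<cdot> (syz_pr S k \<cdot> \<theta> ?j)"
    unfolding syz_lifts_pr[OF SHQ(1,2) i f] by simp
  also have "i k \<cdot> (h1 \<cdot> syz_pr Q (Suc k)) \<boxplus> i k \<cdot> (syz_pr S k \<cdot> \<theta> ?j) =
     i k \<cdot> (h1 \<cdot> syz_pr Q (Suc k) \<boxplus> syz_pr S k \<cdot> \<theta> ?j)" by simp
  finally have 2: "i k \<cdot> (h1 \<cdot> syz_pr Q (Suc k) \<boxplus> syz_pr S k \<cdot> \<theta> ?j) = i k \<cdot> mzero C (cx Q ?j) (syz S k)" by simp
  have "h1 \<cdot> syz_pr Q (Suc k) \<boxplus> syz_pr S k \<cdot> \<theta> ?j = mzero C (cx Q ?j) (syz S k)"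
    by (rule is_kernel_mono[OF short_exact_kernel[OF ip] 2]) auto
  hence "syz_pr S k \<cdot> \<theta> ?j = neg (h1 \<cdot> syz_pr Q (Suc k))" by (intro neg_unique) auto
  hence pr: "syz_pr S k \<cdot> msign C 1 (\<theta> ?j) = h1 \<cdot> syz_pr Q (Suc k)" by (simp add: msign_eq)
  have fam: "fam (cx (shift_res C (1 + k) Q)) (cx (shift_res C k S)) (hs k)"
    by (auto simp: fam_def hs_def shift_simps algebra_simps)
  have "lifts C (shift_res C (1 + k) Q) (shift_res C k S) h1 (hs k)"
  proof (rule liftsI[OF fam])
    show "syz_pr (shift_res C k S) 0 \<cdot> hs k 0 = h1 \<cdot> syz_pr (shift_res C (1 + k) Q) 0"
      using pr by (simp add: shift_simps hs_def add.commute)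
    fix j
    show "diff (shift_res C k S) j \<cdot> hs k j = hs k (j - 1) \<cdot> diff (shift_res C (1 + k) Q) j"
    proof (cases "j \<ge> 1")
      case True
      have "diff S (l - 1) \<cdot> \<theta> l = neg (\<theta> (l - 1) \<cdot> diff Q l)" for l
        using diff_\<theta>[of "ident C (cx Q l)" l] by simp
      from this[of "j + 1 + int k"] have "diff S (j + int k) \<cdot> \<theta> (j + 1 + int k) = neg (\<theta> (j + int k) \<cdot> diff Q (j + 1 + int k))"
        by (simp add: algebra_simps)
      thus ?thesis using True by (simp add: shift_simps hs_def msign_eq algebra_simps)
    next
      case False
      show ?thesis
        by (rule res_cx_unique[of "shift_res C k S", where j = "j - 1"])
          (use False famD[OF fam, of j] famD[OF fam, of "j - 1"] in auto)
    qed
  qed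
  hence "conn_data (shift_res C k S) (shift_res C k Q) (i k) (p k) h h1 (hs k)"
    unfolding conn_data_def shift_shift[OF SHQ(3)] using ph h1(4) by (simp add: Hom_def shift_simps)
  thus ?thesis by blast
qed

lemma conn_fam_hs:
  assumes \<phi>: "\<And>j. j \<ge> 0 \<Longrightarrow> \<phi> j \<in> Arr C \<and> Cod C (\<phi> j) = cx Q (j + int k)" and j: "j \<ge> 0"
  shows "conn_fam n K (hs k) \<phi> j = msign C (n + 1) (\<theta> (j + 1 + int k) \<cdot> \<phi> (j + 1))"
proof -
  have [simp]: "\<phi> (j + 1) \<in> Arr C" "Cod C (\<phi> (j + 1)) = cx Q (j + 1 + int k)" using \<phi>[of "j + 1"] j by auto
  have "even ((n + j + (j + 1)) - (n + 1))" by simp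
  from msign_cong[OF this] show ?thesis using j by (simp add: conn_fam_def hs_def)
qed

lemma conn_fam_hs0:
  assumes \<phi>: "fam (P n) (cx Q) \<phi>"
  shows "conn_fam n S (hs 0) \<phi> = \<Theta> n \<phi>"
proof
  note [simp] = famD[OF \<phi>]
  fix j
  show "conn_fam n S (hs 0) \<phi> j = \<Theta> n \<phi> j"
  proof (cases "j \<ge> 0")
    case True
    thus ?thesis by (subst conn_fam_hs) (auto simp: \<Theta>_def)
  next
    case False
    show ?thesis
      by (rule res_cx_unique[OF SHQ(1), where j = j]) (use False in \<open>auto simp: conn_fam_def \<Theta>_def algebra_simps\<close>)
  qed
qed

end

context resolved_object
begin

lemma horseshoe_split:
  assumes S: "is_res S" "is_res Q" and h: "horseshoe S H Q f g u w i p"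
  obtains r s where "split_resolutions C R S H Q u w r s"
proof -
  have H: "is_res H" and i: "syz_lifts C S H f u i" and p: "syz_lifts C H Q g w p"
    and uw: "m \<ge> 0 \<Longrightarrow> short_exact C (u m) (w m)" for m
    using h by (auto simp: horseshoe_def)
  note u = syz_liftsD(1)[OF i] and w = syz_liftsD(1)[OF p]
  note [simp] = S H liftsD(2-4)[OF u] liftsD(2-4)[OF w]
  have "\<forall>j. \<exists>y. case y of (r, s) \<Rightarrow> r \<in> Arr C \<and> Dom C r = cx H j \<and> Cod C r = cx S j \<and>
    s \<in> Arr C \<and> Dom C s = cx Q j \<and> Cod C s = cx H j \<and> r \<cdot> u j = ident C (cx S j) \<and> w j \<cdot> s = ident C (cx Q j) \<and>
    w j \<cdot> u j = mzero C (cx S j) (cx Q j) \<and> r \<cdot> s = mzero C (cx Q j) (cx S j) \<and> u j \<cdot> r \<boxplus> s \<cdot> w j = ident C (cx H j)"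
  proof
    fix j
    show "\<exists>y. case y of (r, s) \<Rightarrow> r \<in> Arr C \<and> Dom C r = cx H j \<and> Cod C r = cx S j \<and>
    s \<in> Arr C \<and> Dom C s = cx Q j \<and> Cod C s = cx H j \<and> r \<cdot> u j = ident C (cx S j) \<and> w j \<cdot> s = ident C (cx Q j) \<and>
    w j \<cdot> u j = mzero C (cx S j) (cx Q j) \<and> r \<cdot> s = mzero C (cx Q j) (cx S j) \<and> u j \<cdot> r \<boxplus> s \<cdot> w j = ident C (cx H j)"
    proof (cases "j \<ge> 0")
      case True
      note ex = uw[OF True]
      have z: "w j \<cdot> u j = mzero C (cx S j) (cx Q j)" using short_exactD(4)[OF ex] by simp
      obtain s where s: "s \<in> Arr C" "Dom C s = cx Q j" "Cod C s = Dom C (w j)" "w j \<cdot> s = ident C (cx Q j)"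
        by (rule projective_lift[OF res_proj[OF S(2), of j] short_exact_epic[OF ex], of "ident C (cx Q j)"]) auto
      note [simp] = s(1-3)
      have "w j \<cdot> ident C (cx H j) = (w j \<cdot> s) \<cdot> w j" unfolding s(4) by simp
      hence 1: "w j \<cdot> ident C (cx H j) = w j \<cdot> (s \<cdot> w j)" by simp
      \<comment> \<open>The identity minus \<open>s w\<close> is killed by \<open>w\<close>, so it
        factors through the kernel \<open>u\<close>; the factor is the retraction. The remaining
        equations follow by cancelling the monomorphism \<open>u j\<close>.\<close>
      obtain r where r: "r \<in> Arr C" "Dom C r = Dom C (s \<cdot> w j)" "Cod C r = Dom C (u j)" "ident C (cx H j) = s \<cdot> w j \<boxplus> u j \<cdot> r"
        by (rule is_kernel_diff[OF short_exact_kernel[OF ex] 1]) auto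
      have [simp]: "Dom C r = cx H j" "Cod C r = cx S j" "r \<in> Arr C" using r by auto
      have "u j \<cdot> ident C (cx S j) = ident C (cx H j) \<cdot> u j" by simp
      also have "\<dots> = u j \<cdot> (r \<cdot> u j)" unfolding r(4) by (simp add: z)
      finally have 2: "u j \<cdot> (r \<cdot> u j) = u j \<cdot> ident C (cx S j)" ..
      have ru: "r \<cdot> u j = ident C (cx S j)" by (rule is_kernel_mono[OF short_exact_kernel[OF ex] 2]) auto
      have "s = ident C (cx H j) \<cdot> s" by simp
      also have "\<dots> = s \<boxplus> u j \<cdot> (r \<cdot> s)" unfolding r(4) by (simp add: s(4))
      finally have "s \<boxplus> u j \<cdot> (r \<cdot> s) = s \<boxplus> u j \<cdot> mzero C (cx Q j) (cx S j)" by simp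
      hence 3: "u j \<cdot> (r \<cdot> s) = u j \<cdot> mzero C (cx Q j) (cx S j)"
        by (subst (asm) madd_left_cancel) auto
      have rs: "r \<cdot> s = mzero C (cx Q j) (cx S j)" by (rule is_kernel_mono[OF short_exact_kernel[OF ex] 3]) auto
      have "u j \<cdot> r \<boxplus> s \<cdot> w j = ident C (cx H j)" unfolding r(4) by (rule madd_comm) auto
      thus ?thesis using ru rs z s by (intro exI[of _ "(r, s)"]) simp
    next
      case False
      have e: "x = y" if "x \<in> Arr C" "y \<in> Arr C" "Dom C x = Dom C y" "Cod C x = Cod C y"
        "Cod C y = cx S j \<or> Cod C y = cx Q j \<or> Cod C y = cx H j" for x y
        by (rule zero_object_unique) (use that False res_zero[of S j] res_zero[of Q j] res_zero[of H j] in auto)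
      show ?thesis
        by (intro exI[of _ "(mzero C (cx H j) (cx S j), mzero C (cx Q j) (cx H j))"]) (auto intro!: e)
    qed
  qed
  from choice[OF this] obtain y where y: "\<forall>j. case y j of (r, s) \<Rightarrow> r \<in> Arr C \<and> Dom C r = cx H j \<and> Cod C r = cx S j \<and>
    s \<in> Arr C \<and> Dom C s = cx Q j \<and> Cod C s = cx H j \<and> r \<cdot> u j = ident C (cx S j) \<and> w j \<cdot> s = ident C (cx Q j) \<and>
    w j \<cdot> u j = mzero C (cx S j) (cx Q j) \<and> r \<cdot> s = mzero C (cx Q j) (cx S j) \<and> u j \<cdot> r \<boxplus> s \<cdot> w j = ident C (cx H j)" ..
  have "split_resolutions C R S H Q u w (\<lambda>j. fst (y j)) (\<lambda>j. snd (y j))"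
    by unfold_locales (use y liftsD(1,5)[OF u] liftsD(1,5)[OF w] in \<open>auto simp: fam_def split_beta\<close>)
  thus ?thesis by (rule that)
qed

end

section \<open>Hypercohomology as a cohomological functor\<close>

locale resolved_category = resolved_object +
  fixes res :: "'a \<Rightarrow> ('a, 'b) resolution"
  assumes enough: "enough_projectives C"
    and res: "M \<in> Obj C \<Longrightarrow> proj_resolution C M (res M)"
begin

lemma is_res_res [simp]: "M \<in> Obj C \<Longrightarrow> is_res (res M)" "M \<in> Obj C \<Longrightarrow> syz (res M) 0 = M"
  using res proj_resolution_is_res by auto

text \<open>One functor for each filter: \<open>cofinite\<close> gives the completed one, and
  \<open>every_degree\<close> an auxiliary one with which Ext is identified.\<close>

definition hyper_functor where
  "hyper_functor F = \<lparr>coh_grp = (\<lambda>n B. hyper_grp C F n R (res B)),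
      coh_map = (\<lambda>n f. hyper_map C F n R (res (Dom C f)) (res (Cod C f)) f),
      coh_conn = (\<lambda>n f g. hyper_conn C F n R (res (Dom C f)) (res (Cod C g)) f g)\<rparr>"

text \<open>The Horseshoe Lemma supplies a resolution \<open>H\<close> of the middle object that may
  differ from \<open>T\<close>. Over \<open>H\<close> the connecting map is represented by
  \<open>\<Theta>\<close> and the split sequence applies; the maps \<open>?c\<close> and
  \<open>?d\<close> induced by the identity carry the result over to \<open>T\<close>.\<close>

lemma hyper_exact:
  assumes F: "shiftable F" and ST: "is_res S" "is_res T" "is_res Q"
    and fg: "short_exact C f g" "Dom C f = syz S 0" "Cod C f = syz T 0" "Cod C g = syz Q 0"
  shows "exact_at (hyper_grp C F n R S) (hyper_map C F n R S T f) (hyper_grp C F n R T)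
      (hyper_map C F n R T Q g) (hyper_grp C F n R Q)"
    "exact_at (hyper_grp C F n R T) (hyper_map C F n R T Q g) (hyper_grp C F n R Q)
      (hyper_conn C F n R S Q f g) (hyper_grp C F (n + 1) R S)"
    "exact_at (hyper_grp C F n R Q) (hyper_conn C F n R S Q f g) (hyper_grp C F (n + 1) R S)
      (hyper_map C F (n + 1) R S T f) (hyper_grp C F (n + 1) R T)"
proof -
  note fg' = short_exactD(1,2)[OF fg(1)] and Dg = short_exactD(3)[OF fg(1), unfolded fg(3)]
  obtain H u w i p where h: "horseshoe S H Q f g u w i p"
    using horseshoe_exists[OF enough ST(1,3) fg(1,2,4)] .
  have H: "is_res H" "Cod C f = syz H 0" "syz T 0 = syz H 0" and i: "syz_lifts C S H f u i" and p: "syz_lifts C H Q g w p"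
    using h fg(3) by (auto simp: horseshoe_def)
  note u = syz_liftsD(1)[OF i] and w = syz_liftsD(1)[OF p]
  obtain r s where "split_resolutions C R S H Q u w r s" using horseshoe_split[OF ST(1,3) h] .
  then interpret sp: split_resolutions C R S H Q u w r s .
  have "short_exact C (i 0) (p 0)" using horseshoe_short_exact[OF enough ST(1,3) fg(1,2,4) h] .
  from sp.\<theta>_conn_data[OF i p fg'(1) fg(2) H(2) fg'(2) _ fg(4) this] Dg H(3)
  obtain h0 h1 where d: "conn_data S Q f g h0 h1 (sp.hs 0)"
    using syz_liftsD(2)[OF i] syz_liftsD(2)[OF p] by (auto simp: shift_0 ST)
  have conn: "hyper_conn C F n R S Q f g (cls F n Q \<phi>) = cls F (n + 1) S (sp.\<Theta> n \<phi>)" if "chain F n Q \<phi>" for n \<phi>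
    using hyper_conn_cls[OF ST(1,3) F fg(1,2,4) d that] sp.conn_fam_hs0[OF chainD(1)[OF that]] by simp
  have chain\<Theta>: "chain F (n + 1) S (sp.\<Theta> n \<phi>)" if "chain F n Q \<phi>" for n \<phi>
    using chain_conn[OF ST(1,3) F conn_dataD(9)[OF d] that] sp.conn_fam_hs0[OF chainD(1)[OF that]] by simp
  let ?T = "\<lambda>n. hyper_grp C F n R T" and ?H = "\<lambda>n. hyper_grp C F n R H"
  let ?c = "\<lambda>n. hyper_map C F n R H T (ident C (syz T 0))" and ?d = "\<lambda>n. hyper_map C F n R T H (ident C (syz T 0))"
  have cH: "?c n \<in> hom (?H n) (?T n)" and dH: "?d n \<in> hom (?T n) (?H n)" for n
    by (rule hyper_map_hom; use ST H F in simp)+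
  have cd: "?c n (?d n Y) = Y" if "Y \<in> carrier (?T n)" for n Y
    using hyper_map_comp[OF ST(2) H(1) ST(2) F _ _ _ _ _ _ that, of "ident C (syz T 0)" "ident C (syz T 0)"]
      hyper_map_ident[OF ST(2) F that] H(3)[symmetric] ST by simp
  have fS: "hyper_map C F n R S T f X = ?c n (hyper_map C F n R S H f X)"
    and fS': "hyper_map C F n R S H f X = ?d n (hyper_map C F n R S T f X)"
    if "X \<in> carrier (hyper_grp C F n R S)" for n X
    using hyper_map_comp[OF ST(1) H(1) ST(2) F fg'(1) fg(2) H(2) _ _ _ that, of "ident C (syz T 0)"]
      hyper_map_comp[OF ST(1,2) H(1) F fg'(1) fg(2,3) _ _ _ that, of "ident C (syz T 0)"] H(3)[symmetric] ST fg fg' by simp_all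
  have gH: "hyper_map C F n R H Q g Y = hyper_map C F n R T Q g (?c n Y)" if "Y \<in> carrier (?H n)" for n Y
    using hyper_map_comp[OF H(1) ST(2,3) F _ _ _ fg'(2) Dg fg(4) that, of "ident C (syz T 0)"] H(3)[symmetric] ST fg' Dg by simp
  have gT: "hyper_map C F n R T Q g Y = hyper_map C F n R H Q g (?d n Y)" if "Y \<in> carrier (?T n)" for n Y
    using gH[OF hom_in_carrier[OF dH that]] cd[OF that] by simp
  have one_T: "?c n \<one>\<^bsub>?H n\<^esub> = \<one>\<^bsub>?T n\<^esub>" and one_H: "?d n \<one>\<^bsub>?T n\<^esub> = \<one>\<^bsub>?H n\<^esub>" for n
    using hom_one[OF cH] hom_one[OF dH] hyper_group[OF ST(2) F] hyper_group[OF H(1) F] comm_group.axioms by blast+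
  have fcls: "hyper_map C F n R S H f (cls F n S \<phi>) = cls F n H (\<lambda>j. u j \<cdot> \<phi> j)" if "chain F n S \<phi>" for n \<phi>
    using hyper_map_cls[OF ST(1) H(1) F u that] .
  have gcls: "hyper_map C F n R H Q g (cls F n H \<phi>) = cls F n Q (\<lambda>j. w j \<cdot> \<phi> j)" if "chain F n H \<phi>" for n \<phi>
    using hyper_map_cls[OF H(1) ST(3) F w that] .
  note cls1 = hyper_one[OF ST(1) F] hyper_one[OF H(1) F] hyper_one[OF ST(3) F]
  note zf = chain_zfam[OF ST(1) F] chain_zfam[OF H(1) F] chain_zfam[OF ST(3) F]
  note cu = chain_comp[OF ST(1) H(1) u] and cw = chain_comp[OF H(1) ST(3) w]
  note in_S = cls_in[OF ST(1) F] and in_H = cls_in[OF H(1) F] and in_Q = cls_in[OF ST(3) F]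
  note fT = hom_in_carrier[OF hyper_map_hom[OF ST(1,2) F fg'(1) fg(2,3)]]
  note gQ = hom_in_carrier[OF hyper_map_hom[OF ST(2,3) F fg'(2) Dg fg(4)]]
  note cT = hom_in_carrier[OF cH] and dT = hom_in_carrier[OF dH]

  show "exact_at (hyper_grp C F n R S) (hyper_map C F n R S T f) (?T n)
      (hyper_map C F n R T Q g) (hyper_grp C F n R Q)"
    unfolding exact_at_def
  proof (intro equalityI subsetI)
    fix Y assume "Y \<in> hyper_map C F n R S T f ` carrier (hyper_grp C F n R S)"
    then obtain X where X: "X \<in> carrier (hyper_grp C F n R S)" and Y: "Y = hyper_map C F n R S T f X" by blast
    obtain \<phi> where \<phi>: "chain F n S \<phi>" "X = cls F n S \<phi>" using X by (rule hyperE[OF ST(1) F])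
    have "hyper_map C F n R T Q g Y = hyper_map C F n R H Q g (hyper_map C F n R S H f X)"
      using gT[OF fT[OF X]] fS'[OF X] Y by simp
    also have "\<dots> = cls F n Q (\<lambda>j. w j \<cdot> (u j \<cdot> \<phi> j))" unfolding \<phi>(2) fcls[OF \<phi>(1)] gcls[OF cu[OF \<phi>(1)]] ..
    also have "(\<lambda>j. w j \<cdot> (u j \<cdot> \<phi> j)) = zfam n Q" using chainD(2-4)[OF \<phi>(1)] by simp
    finally show "Y \<in> {y \<in> carrier (?T n). hyper_map C F n R T Q g y = \<one>\<^bsub>hyper_grp C F n R Q\<^esub>}"
      using fT[OF X] Y by (simp add: cls1)
  next
    fix Y assume "Y \<in> {y \<in> carrier (?T n). hyper_map C F n R T Q g y = \<one>\<^bsub>hyper_grp C F n R Q\<^esub>}"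
    hence Y: "Y \<in> carrier (?T n)" "hyper_map C F n R T Q g Y = cls F n Q (zfam n Q)" by (auto simp: cls1)
    obtain \<phi> where \<phi>: "chain F n H \<phi>" "?d n Y = cls F n H \<phi>" using dT[OF Y(1)] by (rule hyperE[OF H(1) F])
    have "cls F n Q (\<lambda>j. w j \<cdot> \<phi> j) = cls F n Q (zfam n Q)"
      using gT[OF Y(1)] Y(2) gcls[OF \<phi>(1)] \<phi>(2) by simp
    hence "homotopic F n Q (\<lambda>j. w j \<cdot> \<phi> j) (zfam n Q)" using cls_eq[OF ST(3) F cw[OF \<phi>(1)] zf(3)] by simp
    from sp.exact_mid[OF F \<phi>(1) this] obtain \<psi> where \<psi>: "chain F n S \<psi>" "homotopic F n H \<phi> (\<lambda>j. u j \<cdot> \<psi> j)" by blast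
    have "?d n Y = hyper_map C F n R S H f (cls F n S \<psi>)"
      unfolding \<phi>(2) fcls[OF \<psi>(1)] using cls_eq[OF H(1) F \<phi>(1) cu[OF \<psi>(1)]] \<psi>(2) by simp
    hence "Y = hyper_map C F n R S T f (cls F n S \<psi>)"
      using fS[OF in_S[OF \<psi>(1)]] cd[OF Y(1)] by simp
    thus "Y \<in> hyper_map C F n R S T f ` carrier (hyper_grp C F n R S)" using in_S[OF \<psi>(1)] by blast
  qed
  show "exact_at (?T n) (hyper_map C F n R T Q g) (hyper_grp C F n R Q)
      (hyper_conn C F n R S Q f g) (hyper_grp C F (n + 1) R S)"
    unfolding exact_at_def
  proof (intro equalityI subsetI)
    fix Z assume "Z \<in> hyper_map C F n R T Q g ` carrier (?T n)"
    then obtain Y where Y: "Y \<in> carrier (?T n)" and Z: "Z = hyper_map C F n R T Q g Y" by blast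
    obtain \<phi> where \<phi>: "chain F n H \<phi>" "?d n Y = cls F n H \<phi>" using dT[OF Y] by (rule hyperE[OF H(1) F])
    have "Z = cls F n Q (\<lambda>j. w j \<cdot> \<phi> j)" using Z gT[OF Y] gcls[OF \<phi>(1)] \<phi>(2) by simp
    hence "hyper_conn C F n R S Q f g Z = cls F (n + 1) S (zfam (n + 1) S)"
      using conn[OF cw[OF \<phi>(1)]] sp.zero_right[OF F \<phi>(1)] cls_eq[OF ST(1) F chain\<Theta>[OF cw[OF \<phi>(1)]] zf(1)] by simp
    thus "Z \<in> {y \<in> carrier (hyper_grp C F n R Q). hyper_conn C F n R S Q f g y = \<one>\<^bsub>hyper_grp C F (n + 1) R S\<^esub>}"
      using gQ[OF Y] Z by (simp add: cls1)
  next
    fix Z assume "Z \<in> {y \<in> carrier (hyper_grp C F n R Q). hyper_conn C F n R S Q f g y = \<one>\<^bsub>hyper_grp C F (n + 1) R S\<^esub>}"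
    hence Z: "Z \<in> carrier (hyper_grp C F n R Q)" "hyper_conn C F n R S Q f g Z = cls F (n + 1) S (zfam (n + 1) S)"
      by (auto simp: cls1)
    obtain \<phi> where \<phi>: "chain F n Q \<phi>" "Z = cls F n Q \<phi>" using Z(1) by (rule hyperE[OF ST(3) F])
    have "homotopic F (n + 1) S (sp.\<Theta> n \<phi>) (zfam (n + 1) S)"
      using Z(2) conn[OF \<phi>(1)] cls_eq[OF ST(1) F chain\<Theta>[OF \<phi>(1)] zf(1)] \<phi>(2) by simp
    from sp.exact_right[OF F \<phi>(1) this] obtain \<psi> where \<psi>: "chain F n H \<psi>" "\<phi> = (\<lambda>j. w j \<cdot> \<psi> j)" by blast
    have "Z = hyper_map C F n R T Q g (?c n (cls F n H \<psi>))"
      using gH[OF in_H[OF \<psi>(1)]] gcls[OF \<psi>(1)] \<phi>(2) \<psi>(2) by simp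
    thus "Z \<in> hyper_map C F n R T Q g ` carrier (?T n)" using cT[OF in_H[OF \<psi>(1)]] by blast
  qed
  show "exact_at (hyper_grp C F n R Q) (hyper_conn C F n R S Q f g) (hyper_grp C F (n + 1) R S)
      (hyper_map C F (n + 1) R S T f) (?T (n + 1))"
    unfolding exact_at_def
  proof (intro equalityI subsetI)
    fix X assume "X \<in> hyper_conn C F n R S Q f g ` carrier (hyper_grp C F n R Q)"
    then obtain Z where Z: "Z \<in> carrier (hyper_grp C F n R Q)" and X: "X = hyper_conn C F n R S Q f g Z" by blast
    obtain \<phi> where \<phi>: "chain F n Q \<phi>" "Z = cls F n Q \<phi>" using Z by (rule hyperE[OF ST(3) F])
    have X': "X = cls F (n + 1) S (sp.\<Theta> n \<phi>)" using X conn[OF \<phi>(1)] \<phi>(2) by simp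
    have X_in: "X \<in> carrier (hyper_grp C F (n + 1) R S)" unfolding X' using in_S[OF chain\<Theta>[OF \<phi>(1)]] .
    have "hyper_map C F (n + 1) R S H f X = \<one>\<^bsub>?H (n + 1)\<^esub>"
      unfolding X' fcls[OF chain\<Theta>[OF \<phi>(1)]] cls1
      using sp.zero_left[OF F \<phi>(1)] cls_eq[OF H(1) F cu[OF chain\<Theta>[OF \<phi>(1)]] zf(2)] by simp
    hence "hyper_map C F (n + 1) R S T f X = \<one>\<^bsub>?T (n + 1)\<^esub>" using fS[OF X_in] one_T by simp
    thus "X \<in> {y \<in> carrier (hyper_grp C F (n + 1) R S). hyper_map C F (n + 1) R S T f y = \<one>\<^bsub>?T (n + 1)\<^esub>}"
      using X_in by simp
  next
    fix X assume "X \<in> {y \<in> carrier (hyper_grp C F (n + 1) R S). hyper_map C F (n + 1) R S T f y = \<one>\<^bsub>?T (n + 1)\<^esub>}"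
    hence X: "X \<in> carrier (hyper_grp C F (n + 1) R S)" "hyper_map C F (n + 1) R S T f X = \<one>\<^bsub>?T (n + 1)\<^esub>" by auto
    obtain \<phi> where \<phi>: "chain F (n + 1) S \<phi>" "X = cls F (n + 1) S \<phi>" using X(1) by (rule hyperE[OF ST(1) F])
    have "hyper_map C F (n + 1) R S H f X = \<one>\<^bsub>?H (n + 1)\<^esub>" using fS'[OF X(1)] X(2) one_H by simp
    hence "homotopic F (n + 1) H (\<lambda>j. u j \<cdot> \<phi> j) (zfam (n + 1) H)"
      unfolding \<phi>(2) fcls[OF \<phi>(1)] cls1 using cls_eq[OF H(1) F cu[OF \<phi>(1)] zf(2)] by simp
    from sp.exact_left[OF F \<phi>(1) this] obtain \<psi> where \<psi>: "chain F n Q \<psi>" "homotopic F (n + 1) S \<phi> (sp.\<Theta> n \<psi>)" by blast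
    have "X = hyper_conn C F n R S Q f g (cls F n Q \<psi>)"
      unfolding conn[OF \<psi>(1)] \<phi>(2) using \<psi>(2) cls_eq[OF ST(1) F \<phi>(1) chain\<Theta>[OF \<psi>(1)]] by simp
    thus "X \<in> hyper_conn C F n R S Q f g ` carrier (hyper_grp C F n R Q)" using in_Q[OF \<psi>(1)] by blast
  qed
qed

theorem hyper_coh_functor:
  assumes F: "shiftable F" shows "coh_functor C (hyper_functor F)"
  unfolding coh_functor_def
proof (intro conjI allI impI ballI)
  fix n
  show "additive_functor C (coh_grp (hyper_functor F) n) (coh_map (hyper_functor F) n)"
    unfolding additive_functor_def hyper_functor_def coh_functor_data.simps
  proof (intro conjI ballI impI)
    fix a assume a: "a \<in> Obj C"
    show "comm_group (hyper_grp C F n R (res a))" using hyper_group[OF _ F] a by simp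
    fix x assume "x \<in> carrier (hyper_grp C F n R (res a))"
    thus "hyper_map C F n R (res (Dom C (ident C a))) (res (Cod C (ident C a))) (ident C a) x = x"
      using hyper_map_ident[OF _ F, of "res a"] a by simp
  next
    fix f assume f: "f \<in> Arr C"
    show "hyper_map C F n R (res (Dom C f)) (res (Cod C f)) f
      \<in> hom (hyper_grp C F n R (res (Dom C f))) (hyper_grp C F n R (res (Cod C f)))"
      using hyper_map_hom[OF _ _ F f, of "res (Dom C f)" "res (Cod C f)"] f by simp
    fix g x assume "g \<in> Arr C" "Dom C g = Cod C f" "x \<in> carrier (hyper_grp C F n R (res (Dom C f)))"
    thus "hyper_map C F n R (res (Dom C (g \<cdot> f))) (res (Cod C (g \<cdot> f))) (g \<cdot> f) x =
      hyper_map C F n R (res (Dom C g)) (res (Cod C g)) g (hyper_map C F n R (res (Dom C f)) (res (Cod C f)) f x)"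
      using hyper_map_comp[of "res (Dom C f)" "res (Cod C f)" "res (Cod C g)" F f g x n] F f by simp
  next
    fix a b f g x assume "a \<in> Obj C" "b \<in> Obj C" "f \<in> Hom C a b" "g \<in> Hom C a b"
      "x \<in> carrier (hyper_grp C F n R (res a))"
    thus "hyper_map C F n R (res (Dom C (f \<boxplus> g))) (res (Cod C (f \<boxplus> g))) (f \<boxplus> g) x =
      hyper_map C F n R (res (Dom C f)) (res (Cod C f)) f x \<otimes>\<^bsub>hyper_grp C F n R (res b)\<^esub>
      hyper_map C F n R (res (Dom C g)) (res (Cod C g)) g x"
      using hyper_map_add[of "res a" "res b" F f g x n] F by (simp add: Hom_def)
  qed
next
  fix n f g assume fg: "short_exact C f g"
  note [simp] = short_exactD(1-3)[OF fg]
  show "coh_conn (hyper_functor F) n f g \<in> hom (coh_grp (hyper_functor F) n (Cod C g)) (coh_grp (hyper_functor F) (n + 1) (Dom C f))"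
    using hyper_conn_hom[OF _ _ F fg, of "res (Dom C f)" "res (Cod C g)"] by (simp add: hyper_functor_def)
  have "is_res (res (Dom C f))" "is_res (res (Cod C f))" "is_res (res (Cod C g))" "Dom C f = syz (res (Dom C f)) 0"
    "Cod C f = syz (res (Cod C f)) 0" "Cod C g = syz (res (Cod C g)) 0" by simp_all
  note ex = hyper_exact[OF F this(1-3) fg this(4-6), of n]
  show "exact_at (coh_grp (hyper_functor F) n (Dom C f)) (coh_map (hyper_functor F) n f)
        (coh_grp (hyper_functor F) n (Cod C f)) (coh_map (hyper_functor F) n g) (coh_grp (hyper_functor F) n (Cod C g))"
    using ex(1) by (simp add: hyper_functor_def)
  show "exact_at (coh_grp (hyper_functor F) n (Cod C f)) (coh_map (hyper_functor F) n g) (coh_grp (hyper_functor F) n (Cod C g))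
        (coh_conn (hyper_functor F) n f g) (coh_grp (hyper_functor F) (n + 1) (Dom C f))"
    using ex(2) by (simp add: hyper_functor_def)
  show "exact_at (coh_grp (hyper_functor F) n (Cod C g)) (coh_conn (hyper_functor F) n f g)
        (coh_grp (hyper_functor F) (n + 1) (Dom C f)) (coh_map (hyper_functor F) (n + 1) f) (coh_grp (hyper_functor F) (n + 1) (Cod C f))"
    using ex(3) by (simp add: hyper_functor_def)
next
  fix n f g f' g' a b c x
  assume A: "short_exact C f g \<and> short_exact C f' g' \<and>
        a \<in> Hom C (Dom C f) (Dom C f') \<and> b \<in> Hom C (Cod C f) (Cod C f') \<and>
        c \<in> Hom C (Cod C g) (Cod C g') \<and> b \<cdot> f = f' \<cdot> a \<and> c \<cdot> g = g' \<cdot> b"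
    and x: "x \<in> carrier (coh_grp (hyper_functor F) n (Cod C g))"
  hence A': "short_exact C f g" "short_exact C f' g'"
    "a \<in> Hom C (Dom C f) (Dom C f')" "b \<in> Hom C (Cod C f) (Cod C f')" "c \<in> Hom C (Cod C g) (Cod C g')"
    "b \<cdot> f = f' \<cdot> a" "c \<cdot> g = g' \<cdot> b" by auto
  note [simp] = short_exactD(1-3)[OF A'(1)] short_exactD(1-3)[OF A'(2)]
  have "Dom C a = Dom C f" "Cod C a = Dom C f'" "Dom C c = Cod C g" "Cod C c = Cod C g'" using A' by (auto simp: Hom_def)
  thus "coh_map (hyper_functor F) (n + 1) a (coh_conn (hyper_functor F) n f g x) =
    coh_conn (hyper_functor F) n f' g' (coh_map (hyper_functor F) n c x)"
    using hyper_conn_natural[OF _ _ _ _ F A'(1) _ _ A'(2) _ _ A'(3-7), of "res (Dom C f)" "res (Cod C g)" "res (Dom C f')" "res (Cod C g')" x n] x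
    by (simp add: hyper_functor_def)
qed

end

section \<open>Transport of cohomological functors\<close>

lemma exact_at_transport:
  assumes ex: "exact_at G' u' H' v' K'" and one: "\<kappa> \<one>\<^bsub>K\<^esub> = \<one>\<^bsub>K'\<^esub>" "\<one>\<^bsub>K\<^esub> \<in> carrier K"
    and bij: "bij_betw \<gamma> (carrier G) (carrier G')" "bij_betw \<eta> (carrier H) (carrier H')" "inj_on \<kappa> (carrier K)"
    and u: "\<And>x. x \<in> carrier G \<Longrightarrow> u x \<in> carrier H \<and> \<eta> (u x) = u' (\<gamma> x)"
    and v: "\<And>x. x \<in> carrier H \<Longrightarrow> v x \<in> carrier K \<and> \<kappa> (v x) = v' (\<eta> x)"
  shows "exact_at G u H v K"
  unfolding exact_at_def
proof (intro equalityI subsetI)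
  fix y assume "y \<in> u ` carrier G"
  then obtain x where x: "x \<in> carrier G" "y = u x" by blast
  have "\<gamma> x \<in> carrier G'" using bij(1) x by (auto simp: bij_betw_def)
  hence "v' (u' (\<gamma> x)) = \<one>\<^bsub>K'\<^esub>" using ex by (auto simp: exact_at_def)
  hence "\<kappa> (v y) = \<kappa> \<one>\<^bsub>K\<^esub>" using u[OF x(1)] v[of y] x one by simp
  hence "v y = \<one>\<^bsub>K\<^esub>" using inj_onD[OF bij(3)] v[of y] u[OF x(1)] x one by auto
  thus "y \<in> {y \<in> carrier H. v y = \<one>\<^bsub>K\<^esub>}" using u[OF x(1)] x by simp
next
  fix y assume y: "y \<in> {y \<in> carrier H. v y = \<one>\<^bsub>K\<^esub>}"
  hence "v' (\<eta> y) = \<one>\<^bsub>K'\<^esub>" using v[of y] one by auto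
  moreover have "\<eta> y \<in> carrier H'" using bij(2) y by (auto simp: bij_betw_def)
  ultimately have "\<eta> y \<in> u' ` carrier G'" using ex by (auto simp: exact_at_def)
  then obtain x' where x': "x' \<in> carrier G'" "\<eta> y = u' x'" by blast
  hence "x' \<in> \<gamma> ` carrier G" using bij(1) by (simp add: bij_betw_def)
  then obtain x where x: "x \<in> carrier G" "\<gamma> x = x'" by blast
  have "\<eta> (u x) = \<eta> y" using u[OF x(1)] x x' by simp
  hence "u x = y" using bij(2) u[OF x(1)] y by (auto simp: bij_betw_def inj_on_def)
  thus "y \<in> u ` carrier G" using x by blast
qed

context abelian_category
begin

lemma coh_functorD:
  assumes "coh_functor C T"
  shows "a \<in> Obj C \<Longrightarrow> comm_group (coh_grp T n a)"
    "f \<in> Arr C \<Longrightarrow> coh_map T n f \<in> hom (coh_grp T n (Dom C f)) (coh_grp T n (Cod C f))"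
    "a \<in> Obj C \<Longrightarrow> x \<in> carrier (coh_grp T n a) \<Longrightarrow> coh_map T n (ident C a) x = x"
    "\<lbrakk>f \<in> Arr C; g \<in> Arr C; Dom C g = Cod C f; x \<in> carrier (coh_grp T n (Dom C f))\<rbrakk> \<Longrightarrow>
      coh_map T n (g \<cdot> f) x = coh_map T n g (coh_map T n f x)"
    "\<lbrakk>a \<in> Obj C; b \<in> Obj C; f \<in> Hom C a b; g \<in> Hom C a b; x \<in> carrier (coh_grp T n a)\<rbrakk> \<Longrightarrow>
      coh_map T n (f \<boxplus> g) x = coh_map T n f x \<otimes>\<^bsub>coh_grp T n b\<^esub> coh_map T n g x"
    "short_exact C f g \<Longrightarrow> coh_conn T n f g \<in> hom (coh_grp T n (Cod C g)) (coh_grp T (n + 1) (Dom C f))"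
    "\<lbrakk>short_exact C f g; short_exact C f' g'; a' \<in> Hom C (Dom C f) (Dom C f'); b' \<in> Hom C (Cod C f) (Cod C f');
      c' \<in> Hom C (Cod C g) (Cod C g'); b' \<cdot> f = f' \<cdot> a'; c' \<cdot> g = g' \<cdot> b'; x \<in> carrier (coh_grp T n (Cod C g))\<rbrakk> \<Longrightarrow>
      coh_map T (n + 1) a' (coh_conn T n f g x) = coh_conn T n f' g' (coh_map T n c' x)"
    "short_exact C f g \<Longrightarrow> exact_at (coh_grp T n (Dom C f)) (coh_map T n f) (coh_grp T n (Cod C f))
                 (coh_map T n g) (coh_grp T n (Cod C g))"
    "short_exact C f g \<Longrightarrow> exact_at (coh_grp T n (Cod C f)) (coh_map T n g) (coh_grp T n (Cod C g))
                 (coh_conn T n f g) (coh_grp T (n + 1) (Dom C f))"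
    "short_exact C f g \<Longrightarrow> exact_at (coh_grp T n (Cod C g)) (coh_conn T n f g) (coh_grp T (n + 1) (Dom C f))
                 (coh_map T (n + 1) f) (coh_grp T (n + 1) (Cod C f))"
proof -
  show "\<lbrakk>short_exact C f g; short_exact C f' g'; a' \<in> Hom C (Dom C f) (Dom C f'); b' \<in> Hom C (Cod C f) (Cod C f');
      c' \<in> Hom C (Cod C g) (Cod C g'); b' \<cdot> f = f' \<cdot> a'; c' \<cdot> g = g' \<cdot> b'; x \<in> carrier (coh_grp T n (Cod C g))\<rbrakk> \<Longrightarrow>
      coh_map T (n + 1) a' (coh_conn T n f g x) = coh_conn T n f' g' (coh_map T n c' x)"
    using assms unfolding coh_functor_def by blast
qed (use assms in \<open>simp_all add: coh_functor_def additive_functor_def\<close>)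

text \<open>\<open>U\<close> is not assumed to be a cohomological functor: functoriality, naturality
  and exactness are all pulled back along the bijections. Ext and both resolution constructions
  obtain their structure this way.\<close>

lemma coh_transport:
  assumes T: "coh_functor C T"
    and grp: "\<And>n a. a \<in> Obj C \<Longrightarrow> comm_group (coh_grp U n a)"
    and bij: "\<And>n a. a \<in> Obj C \<Longrightarrow> bij_betw (\<eta> n a) (carrier (coh_grp U n a)) (carrier (coh_grp T n a))"
    and mult: "\<And>n a x y. \<lbrakk>a \<in> Obj C; x \<in> carrier (coh_grp U n a); y \<in> carrier (coh_grp U n a)\<rbrakk> \<Longrightarrow>
      \<eta> n a (x \<otimes>\<^bsub>coh_grp U n a\<^esub> y) = \<eta> n a x \<otimes>\<^bsub>coh_grp T n a\<^esub> \<eta> n a y"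
    and map: "\<And>n f x. \<lbrakk>f \<in> Arr C; x \<in> carrier (coh_grp U n (Dom C f))\<rbrakk> \<Longrightarrow>
      coh_map U n f x \<in> carrier (coh_grp U n (Cod C f)) \<and>
      \<eta> n (Cod C f) (coh_map U n f x) = coh_map T n f (\<eta> n (Dom C f) x)"
    and conn: "\<And>n f g x. \<lbrakk>short_exact C f g; x \<in> carrier (coh_grp U n (Cod C g))\<rbrakk> \<Longrightarrow>
      coh_conn U n f g x \<in> carrier (coh_grp U (n + 1) (Dom C f)) \<and>
      \<eta> (n + 1) (Dom C f) (coh_conn U n f g x) = coh_conn T n f g (\<eta> n (Cod C g) x)"
  shows "coh_isomorphism C U T \<eta>"
proof -
  note TD = coh_functorD[OF T]
  have \<eta>_in: "\<eta> n a x \<in> carrier (coh_grp T n a)" if "a \<in> Obj C" "x \<in> carrier (coh_grp U n a)" for n a x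
    using bij[OF that(1)] that(2) by (auto simp: bij_betw_def)
  have inj: "x = y" if "\<eta> n a x = \<eta> n a y" "a \<in> Obj C" "x \<in> carrier (coh_grp U n a)" "y \<in> carrier (coh_grp U n a)" for n a x y
    using bij[OF that(2)] that by (auto simp: bij_betw_def inj_on_def)
  have \<eta>_hom: "\<eta> n a \<in> hom (coh_grp U n a) (coh_grp T n a)" if "a \<in> Obj C" for n a
    using \<eta>_in mult that by (intro homI) auto
  have one: "\<eta> n a \<one>\<^bsub>coh_grp U n a\<^esub> = \<one>\<^bsub>coh_grp T n a\<^esub>" if "a \<in> Obj C" for n a
    by (rule hom_one[OF \<eta>_hom[OF that] comm_group.axioms(2)[OF grp[OF that]] comm_group.axioms(2)[OF TD(1)[OF that]]])
  have mon: "monoid (coh_grp U n a)" if "a \<in> Obj C" for n a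
    using comm_group.axioms(2)[OF grp[OF that]] by (rule group.is_monoid)
  have closed: "x \<otimes>\<^bsub>coh_grp U n a\<^esub> y \<in> carrier (coh_grp U n a)"
    if "a \<in> Obj C" "x \<in> carrier (coh_grp U n a)" "y \<in> carrier (coh_grp U n a)" for n a x y
    by (rule monoid.m_closed[OF mon[OF that(1)] that(2,3)])
  have one_in: "\<one>\<^bsub>coh_grp U n a\<^esub> \<in> carrier (coh_grp U n a)" if "a \<in> Obj C" for n a
    by (rule monoid.one_closed[OF mon[OF that]])
  have U: "coh_functor C U" unfolding coh_functor_def
  proof (intro conjI allI impI ballI)
    fix n
    show "additive_functor C (coh_grp U n) (coh_map U n)" unfolding additive_functor_def
    proof (intro conjI ballI impI)
      fix f assume f: "f \<in> Arr C"
      note hT = TD(2)[OF f, of n]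
      show "coh_map U n f \<in> hom (coh_grp U n (Dom C f)) (coh_grp U n (Cod C f))"
      proof (rule homI)
        fix x y assume x: "x \<in> carrier (coh_grp U n (Dom C f))"
        show "coh_map U n f x \<in> carrier (coh_grp U n (Cod C f))" using map[OF f x] by simp
        assume y: "y \<in> carrier (coh_grp U n (Dom C f))"
        show "coh_map U n f (x \<otimes>\<^bsub>coh_grp U n (Dom C f)\<^esub> y) = coh_map U n f x \<otimes>\<^bsub>coh_grp U n (Cod C f)\<^esub> coh_map U n f y"
        proof (rule inj)
          show "\<eta> n (Cod C f) (coh_map U n f (x \<otimes>\<^bsub>coh_grp U n (Dom C f)\<^esub> y)) =
            \<eta> n (Cod C f) (coh_map U n f x \<otimes>\<^bsub>coh_grp U n (Cod C f)\<^esub> coh_map U n f y)"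
            using map[OF f x] map[OF f y] map[OF f closed[OF _ x y]] mult x y f hom_mult[OF hT] \<eta>_in by simp
        qed (use f x y map closed in auto)
      qed
      fix g x assume g: "g \<in> Arr C" "Dom C g = Cod C f" "x \<in> carrier (coh_grp U n (Dom C f))"
      show "coh_map U n (g \<cdot> f) x = coh_map U n g (coh_map U n f x)"
        by (rule inj[where n = n and a = "Cod C g"])
          (use map[of "g \<cdot> f" x n] map[of f x n] map[of g "coh_map U n f x" n] f g TD(4)[OF f g(1,2), of "\<eta> n (Dom C f) x" n] \<eta>_in in simp_all)
    next
      fix a x assume a: "a \<in> Obj C" and x: "x \<in> carrier (coh_grp U n a)"
      show "coh_map U n (ident C a) x = x"
        by (rule inj[where n = n and a = a]) (use map[of "ident C a" x n] a x TD(3)[OF a \<eta>_in[OF a x]] in simp_all)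
    next
      fix a b f g x assume A: "a \<in> Obj C" "b \<in> Obj C" "f \<in> Hom C a b" "g \<in> Hom C a b" and x: "x \<in> carrier (coh_grp U n a)"
      hence [simp]: "f \<in> Arr C" "g \<in> Arr C" "Dom C f = a" "Dom C g = a" "Cod C f = b" "Cod C g = b" by (auto simp: Hom_def)
      show "coh_map U n (f \<boxplus> g) x = coh_map U n f x \<otimes>\<^bsub>coh_grp U n b\<^esub> coh_map U n g x"
        by (rule inj[where n = n and a = b])
          (use map[of "f \<boxplus> g" x n] map[of f x n] map[of g x n] A x TD(5)[OF A \<eta>_in[OF A(1) x]] mult closed in simp_all)
    qed (rule grp)
  next
    fix n f g assume fg: "short_exact C f g"
    note [simp] = short_exactD(1-3)[OF fg]
    show "coh_conn U n f g \<in> hom (coh_grp U n (Cod C g)) (coh_grp U (n + 1) (Dom C f))"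
    proof (rule homI)
      fix x y assume x: "x \<in> carrier (coh_grp U n (Cod C g))"
      show "coh_conn U n f g x \<in> carrier (coh_grp U (n + 1) (Dom C f))" using conn[OF fg x] by simp
      assume y: "y \<in> carrier (coh_grp U n (Cod C g))"
      show "coh_conn U n f g (x \<otimes>\<^bsub>coh_grp U n (Cod C g)\<^esub> y) = coh_conn U n f g x \<otimes>\<^bsub>coh_grp U (n + 1) (Dom C f)\<^esub> coh_conn U n f g y"
        by (rule inj[where n = "n + 1" and a = "Dom C f"])
          (use conn[OF fg x] conn[OF fg y] conn[OF fg closed[OF _ x y]] mult x y hom_mult[OF TD(6)[OF fg, of n]] \<eta>_in closed in simp_all)
    qed
    show "exact_at (coh_grp U n (Dom C f)) (coh_map U n f) (coh_grp U n (Cod C f)) (coh_map U n g) (coh_grp U n (Cod C g))"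
      by (rule exact_at_transport[OF TD(8)[OF fg], where \<kappa> = "\<eta> n (Cod C g)" and \<gamma> = "\<eta> n (Dom C f)" and \<eta> = "\<eta> n (Cod C f)"])
        (use bij one one_in map[of f _ n] map[of g _ n] in \<open>auto simp: bij_betw_def\<close>)
    show "exact_at (coh_grp U n (Cod C f)) (coh_map U n g) (coh_grp U n (Cod C g)) (coh_conn U n f g) (coh_grp U (n + 1) (Dom C f))"
      by (rule exact_at_transport[OF TD(9)[OF fg], where \<kappa> = "\<eta> (n + 1) (Dom C f)" and \<gamma> = "\<eta> n (Cod C f)" and \<eta> = "\<eta> n (Cod C g)"])
        (use bij one one_in conn[OF fg] map[of g _ n] in \<open>auto simp: bij_betw_def\<close>)
    show "exact_at (coh_grp U n (Cod C g)) (coh_conn U n f g) (coh_grp U (n + 1) (Dom C f)) (coh_map U (n + 1) f) (coh_grp U (n + 1) (Cod C f))"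
      by (rule exact_at_transport[OF TD(10)[OF fg], where \<kappa> = "\<eta> (n + 1) (Cod C f)" and \<gamma> = "\<eta> n (Cod C g)" and \<eta> = "\<eta> (n + 1) (Dom C f)"])
        (use bij one one_in conn[OF fg] map[of f _ "n + 1"] in \<open>auto simp: bij_betw_def\<close>)
  next
    fix n f g f' g' a b c x
    assume A: "short_exact C f g \<and> short_exact C f' g' \<and>
        a \<in> Hom C (Dom C f) (Dom C f') \<and> b \<in> Hom C (Cod C f) (Cod C f') \<and>
        c \<in> Hom C (Cod C g) (Cod C g') \<and> b \<cdot> f = f' \<cdot> a \<and> c \<cdot> g = g' \<cdot> b"
      and x: "x \<in> carrier (coh_grp U n (Cod C g))"
    hence fg: "short_exact C f g" "short_exact C f' g'"
      and [simp]: "a \<in> Arr C" "c \<in> Arr C" "Dom C a = Dom C f" "Cod C a = Dom C f'" "Dom C c = Cod C g" "Cod C c = Cod C g'"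
      by (auto simp: Hom_def)
    note [simp] = short_exactD(1-3)[OF fg(1)] short_exactD(1-3)[OF fg(2)]
    have "coh_map T (n + 1) a (coh_conn T n f g (\<eta> n (Cod C g) x)) = coh_conn T n f' g' (coh_map T n c (\<eta> n (Cod C g) x))"
      using TD(7)[of f g f' g' a b c "\<eta> n (Cod C g) x" n] A \<eta>_in x by simp
    thus "coh_map U (n + 1) a (coh_conn U n f g x) = coh_conn U n f' g' (coh_map U n c x)"
      by (intro inj[where n = "n + 1" and a = "Dom C f'"])
        (use conn[OF fg(1) x] map[of a "coh_conn U n f g x" "n + 1"] map[of c x n] conn[OF fg(2), of "coh_map U n c x" n] x in simp_all)
  qed
  have m: "coh_morphism C U T \<eta>" unfolding coh_morphism_def
    using U T \<eta>_hom map conn by simp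
  define \<rho> where "\<rho> n a = inv_into (carrier (coh_grp U n a)) (\<eta> n a)" for n a
  have \<rho>_in: "\<rho> n a y \<in> carrier (coh_grp U n a)" and \<eta>\<rho>: "\<eta> n a (\<rho> n a y) = y"
    if "a \<in> Obj C" "y \<in> carrier (coh_grp T n a)" for n a y
    using bij[OF that(1), of n] that(2) unfolding \<rho>_def bij_betw_def by (auto simp: inv_into_into f_inv_into_f)
  have \<rho>_eq: "\<rho> n a y = x" if "\<eta> n a x = y" "a \<in> Obj C" "x \<in> carrier (coh_grp U n a)" for n a x y
    using bij[OF that(2), of n] that unfolding \<rho>_def bij_betw_def by (auto simp: inv_into_f_f)
  have "coh_morphism C T U \<rho>" unfolding coh_morphism_def
  proof (intro conjI allI impI ballI)
    fix n a assume a: "a \<in> Obj C"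
    show "\<rho> n a \<in> hom (coh_grp T n a) (coh_grp U n a)"
      using \<rho>_in[OF a] \<eta>\<rho>[OF a] a closed mult by (intro homI \<rho>_eq) auto
  next
    fix n f x assume f: "f \<in> Arr C" and x: "x \<in> carrier (coh_grp T n (Dom C f))"
    show "\<rho> n (Cod C f) (coh_map T n f x) = coh_map U n f (\<rho> n (Dom C f) x)"
      using map[OF f \<rho>_in[OF _ x]] \<eta>\<rho>[OF _ x] f by (intro \<rho>_eq) auto
  next
    fix n f g x assume fg: "short_exact C f g" and x: "x \<in> carrier (coh_grp T n (Cod C g))"
    show "\<rho> (n + 1) (Dom C f) (coh_conn T n f g x) = coh_conn U n f g (\<rho> n (Cod C g) x)"
      using conn[OF fg \<rho>_in[OF _ x]] \<eta>\<rho>[OF _ x] short_exactD(1,2)[OF fg] by (intro \<rho>_eq) auto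
  qed (use U T in auto)
  moreover have "coh_eq C U (coh_comp \<rho> \<eta>) (\<lambda>n a x. x)" using \<rho>_eq by (auto simp: coh_eq_def coh_comp_def)
  moreover have "coh_eq C T (coh_comp \<eta> \<rho>) (\<lambda>n a x. x)" using \<eta>\<rho> by (auto simp: coh_eq_def coh_comp_def)
  ultimately show ?thesis unfolding coh_isomorphism_def using m by blast
qed

lemma coh_morphism_comp:
  assumes \<sigma>: "coh_morphism C T U \<sigma>" and \<tau>: "coh_morphism C U V \<tau>"
  shows "coh_morphism C T V (coh_comp \<tau> \<sigma>)"
proof -
  have in_U: "\<sigma> n a x \<in> carrier (coh_grp U n a)" if "a \<in> Obj C" "x \<in> carrier (coh_grp T n a)" for n a x
    using \<sigma> that unfolding coh_morphism_def by (blast dest: hom_in_carrier)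
  show ?thesis unfolding coh_morphism_def
  proof (intro conjI allI impI ballI)
    fix n a assume a: "a \<in> Obj C"
    have "\<sigma> n a \<in> hom (coh_grp T n a) (coh_grp U n a)" "\<tau> n a \<in> hom (coh_grp U n a) (coh_grp V n a)"
      using \<sigma> \<tau> a by (auto simp: coh_morphism_def)
    thus "coh_comp \<tau> \<sigma> n a \<in> hom (coh_grp T n a) (coh_grp V n a)"
      unfolding coh_comp_def using hom_compose by (fastforce simp: o_def)
  next
    fix n f x assume f: "f \<in> Arr C" and x: "x \<in> carrier (coh_grp T n (Dom C f))"
    show "coh_comp \<tau> \<sigma> n (Cod C f) (coh_map T n f x) = coh_map V n f (coh_comp \<tau> \<sigma> n (Dom C f) x)"
      using \<sigma> \<tau> f x in_U[OF Dom_Cod_Obj(1)[OF f] x] unfolding coh_comp_def coh_morphism_def by simp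
  next
    fix n f g x assume fg: "short_exact C f g" and x: "x \<in> carrier (coh_grp T n (Cod C g))"
    show "coh_comp \<tau> \<sigma> (n + 1) (Dom C f) (coh_conn T n f g x) = coh_conn V n f g (coh_comp \<tau> \<sigma> n (Cod C g) x)"
      using \<sigma> \<tau> fg x in_U[OF Dom_Cod_Obj(2)[OF short_exactD(2)[OF fg]] x] unfolding coh_comp_def coh_morphism_def by simp
  qed (use \<sigma> \<tau> in \<open>auto simp: coh_morphism_def\<close>)
qed

text \<open>Morphisms are constrained on carriers only, so \<open>coh_eq\<close> is the best
  available equality and has to be respected explicitly.\<close>

lemma coh_morphism_cong:
  assumes \<sigma>: "coh_morphism C T U \<sigma>" and e: "coh_eq C T \<sigma> \<tau>"
  shows "coh_morphism C T U \<tau>"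
proof -
  have T: "coh_functor C T" using \<sigma> by (simp add: coh_morphism_def)
  have eq: "\<tau> n a x = \<sigma> n a x" if "a \<in> Obj C" "x \<in> carrier (coh_grp T n a)" for n a x
    using e that by (simp add: coh_eq_def)
  have closed: "x \<otimes>\<^bsub>coh_grp T n a\<^esub> y \<in> carrier (coh_grp T n a)"
    if "a \<in> Obj C" "x \<in> carrier (coh_grp T n a)" "y \<in> carrier (coh_grp T n a)" for n a x y
    by (rule monoid.m_closed[OF group.is_monoid[OF comm_group.axioms(2)[OF coh_functorD(1)[OF T that(1)]]] that(2,3)])
  show ?thesis unfolding coh_morphism_def
  proof (intro conjI allI impI ballI)
    fix n a assume a: "a \<in> Obj C"
    have "\<sigma> n a \<in> hom (coh_grp T n a) (coh_grp U n a)" using \<sigma> a by (auto simp: coh_morphism_def)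
    thus "\<tau> n a \<in> hom (coh_grp T n a) (coh_grp U n a)"
      using eq[OF a] closed[OF a] by (auto simp: hom_def)
  next
    fix n f x assume f: "f \<in> Arr C" and x: "x \<in> carrier (coh_grp T n (Dom C f))"
    show "\<tau> n (Cod C f) (coh_map T n f x) = coh_map U n f (\<tau> n (Dom C f) x)"
      using \<sigma> f x hom_in_carrier[OF coh_functorD(2)[OF T f] x] by (simp add: eq coh_morphism_def)
  next
    fix n f g x assume fg: "short_exact C f g" and x: "x \<in> carrier (coh_grp T n (Cod C g))"
    show "\<tau> (n + 1) (Dom C f) (coh_conn T n f g x) = coh_conn U n f g (\<tau> n (Cod C g) x)"
      using \<sigma> fg x hom_in_carrier[OF coh_functorD(6)[OF T fg] x] short_exactD(1,2)[OF fg]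
      by (simp add: eq coh_morphism_def)
  qed (use \<sigma> in \<open>auto simp: coh_morphism_def\<close>)
qed

end

section \<open>Ext and its comparison with chain maps\<close>

context resolved_object
begin

section \<open>Ext as cocycles modulo coboundaries\<close>

lemma Ext_cocycles_iff:
  "\<phi> \<in> Ext_cocycles C R n B \<longleftrightarrow> \<phi> \<in> Arr C \<and> Dom C \<phi> = cx R n \<and> Cod C \<phi> = B \<and>
    \<phi> \<cdot> diff R (n + 1) = mzero C (cx R (n + 1)) B"
  by (auto simp: Ext_cocycles_def Hom_def)

lemma Ext_coboundaries_iff:
  "\<phi> \<in> Ext_coboundaries C R n B \<longleftrightarrow> (\<exists>x. x \<in> Arr C \<and> Dom C x = cx R (n - 1) \<and> Cod C x = B \<and> \<phi> = x \<cdot> diff R n)"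
  by (auto simp: Ext_coboundaries_def Hom_def)

lemma diff_diff_R: "diff R n \<cdot> diff R (n + 1) = mzero C (cx R (n + 1)) (cx R (n - 1))"
  using res_dd[OF R, of "n + 1"] by simp

lemma Ext_subquotient:
  assumes [simp]: "B \<in> Obj C"
  shows "subquotient (Hom_grp C (cx R n) B) (Ext_cocycles C R n B) (Ext_coboundaries C R n B)"
proof -
  interpret G: comm_group "Hom_grp C (cx R n) B" by (rule Hom_comm_group) auto
  have inv: "inv\<^bsub>Hom_grp C (cx R n) B\<^esub> x = neg x" if "x \<in> Arr C" "Dom C x = cx R n" "Cod C x = B" for x
    using that by (simp add: neg_def)
  have 1: "subgroup (Ext_cocycles C R n B) (Hom_grp C (cx R n) B)"
  proof (rule G.subgroupI)
    show "Ext_cocycles C R n B \<subseteq> carrier (Hom_grp C (cx R n) B)" by (auto simp: Ext_cocycles_def)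
    have "mzero C (cx R n) B \<in> Ext_cocycles C R n B" by (simp add: Ext_cocycles_iff)
    thus "Ext_cocycles C R n B \<noteq> {}" by blast
    fix a assume "a \<in> Ext_cocycles C R n B"
    hence a: "a \<in> Arr C" "Dom C a = cx R n" "Cod C a = B" "a \<cdot> diff R (n + 1) = mzero C (cx R (n + 1)) B"
      by (auto simp: Ext_cocycles_iff)
    show "inv\<^bsub>Hom_grp C (cx R n) B\<^esub> a \<in> Ext_cocycles C R n B"
      using a by (simp add: inv Ext_cocycles_iff)
    fix b assume "b \<in> Ext_cocycles C R n B"
    hence b: "b \<in> Arr C" "Dom C b = cx R n" "Cod C b = B" "b \<cdot> diff R (n + 1) = mzero C (cx R (n + 1)) B"
      by (auto simp: Ext_cocycles_iff)
    show "a \<otimes>\<^bsub>Hom_grp C (cx R n) B\<^esub> b \<in> Ext_cocycles C R n B"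
      using a b by (simp add: Ext_cocycles_iff)
  qed
  have 2: "subgroup (Ext_coboundaries C R n B) (Hom_grp C (cx R n) B)"
  proof (rule G.subgroupI)
    show "Ext_coboundaries C R n B \<subseteq> carrier (Hom_grp C (cx R n) B)" by (auto simp: Ext_coboundaries_def Hom_def)
    have "mzero C (cx R (n - 1)) B \<cdot> diff R n \<in> Ext_coboundaries C R n B"
      unfolding Ext_coboundaries_iff by (intro exI[of _ "mzero C (cx R (n - 1)) B"]) auto
    thus "Ext_coboundaries C R n B \<noteq> {}" by blast
    fix a assume "a \<in> Ext_coboundaries C R n B"
    then obtain x where x: "x \<in> Arr C" "Dom C x = cx R (n - 1)" "Cod C x = B" "a = x \<cdot> diff R n"
      unfolding Ext_coboundaries_iff by blast
    show "inv\<^bsub>Hom_grp C (cx R n) B\<^esub> a \<in> Ext_coboundaries C R n B"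
      using x unfolding Ext_coboundaries_iff by (intro exI[of _ "neg x"]) (simp add: inv)
    fix b assume "b \<in> Ext_coboundaries C R n B"
    then obtain y where y: "y \<in> Arr C" "Dom C y = cx R (n - 1)" "Cod C y = B" "b = y \<cdot> diff R n"
      unfolding Ext_coboundaries_iff by blast
    show "a \<otimes>\<^bsub>Hom_grp C (cx R n) B\<^esub> b \<in> Ext_coboundaries C R n B"
      using x y unfolding Ext_coboundaries_iff by (intro exI[of _ "x \<boxplus> y"]) simp
  qed
  have 3: "Ext_coboundaries C R n B \<subseteq> Ext_cocycles C R n B"
    using diff_diff_R[of n] by (auto simp: Ext_coboundaries_iff Ext_cocycles_iff)
  show ?thesis
    by (rule subquotient.intro[OF G.comm_group_axioms subquotient_axioms.intro[OF 1 2 3]])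
qed

context
  fixes B assumes B [simp]: "B \<in> Obj C"
begin

interpretation sq: subquotient "Hom_grp C (cx R n) B" "Ext_cocycles C R n B" "Ext_coboundaries C R n B" for n
  using Ext_subquotient[OF B] .

lemma Ext_group: "comm_group (Ext_grp C R n B)"
  using sq.quot_group[of n] by (simp add: Ext_grp_def)

lemma Ext_carrier: "carrier (Ext_grp C R n B) = Ext_class C R n B ` Ext_cocycles C R n B"
  using sq.quot_carrier[of n] by (simp add: Ext_grp_def Ext_class_def)

lemma Ext_mult: "\<phi> \<in> Ext_cocycles C R n B \<Longrightarrow> \<psi> \<in> Ext_cocycles C R n B \<Longrightarrow>
    Ext_class C R n B \<phi> \<otimes>\<^bsub>Ext_grp C R n B\<^esub> Ext_class C R n B \<psi> = Ext_class C R n B (\<phi> \<boxplus> \<psi>)"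
  using sq.quot_mult[of \<phi> n \<psi>] by (simp add: Ext_grp_def Ext_class_def)

lemma Ext_class_eq: "\<phi> \<in> Ext_cocycles C R n B \<Longrightarrow> \<psi> \<in> Ext_cocycles C R n B \<Longrightarrow>
    Ext_class C R n B \<phi> = Ext_class C R n B \<psi> \<longleftrightarrow>
    (\<exists>x. x \<in> Arr C \<and> Dom C x = cx R (n - 1) \<and> Cod C x = B \<and> \<phi> = \<psi> \<boxplus> x \<cdot> diff R n)"
  using sq.coset_eq[of \<phi> n \<psi>] unfolding Ext_class_def Hom_grp_simps Bex_def Ext_coboundaries_iff by blast

lemma Ext_class_mem: "\<phi> \<in> Ext_cocycles C R n B \<Longrightarrow>
    \<psi> \<in> Ext_class C R n B \<phi> \<longleftrightarrow> \<psi> \<in> Ext_cocycles C R n B \<and> Ext_class C R n B \<psi> = Ext_class C R n B \<phi>"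
  using sq.coset_mem[of \<phi> n \<psi>] by (simp add: Ext_class_def)

end

text \<open>Every Ext class is presented by a chain map whose augmented component in degree 0 is the
  cocycle. Induced and connecting maps of Ext can then be computed by the formulas for chain
  maps.\<close>

abbreviation ecls where "ecls n S \<Phi> \<equiv> Ext_class C R n (syz S 0) (syz_pr S 0 \<cdot> \<Phi> 0)"

abbreviation "achain \<equiv> chain every_degree"
abbreviation "acls \<equiv> cls every_degree"

lemma achainD: "achain n S \<Phi> \<Longrightarrow> diff S j \<cdot> \<Phi> j = \<Phi> (j - 1) \<cdot> \<partial> n j"
  by (auto simp: chain_def)

lemma aug_cocycle:
  assumes S: "is_res S" and \<Phi>: "achain n S \<Phi>"
  shows "syz_pr S 0 \<cdot> \<Phi> 0 \<in> Ext_cocycles C R n (syz S 0)"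
proof -
  note [simp] = S chainD(2-4)[OF \<Phi>]
  have "syz_pr S 0 \<cdot> (\<Phi> 0 \<cdot> \<partial> n 1) = syz_pr S 0 \<cdot> (diff S 1 \<cdot> \<Phi> 1)" using achainD[OF \<Phi>, of 1] by simp
  also have "\<dots> = (syz_pr S 0 \<cdot> diff S 1) \<cdot> \<Phi> 1" by (simp del: res_pr_diff0)
  also have "\<dots> = msign C n (mzero C (cx R (n + 1)) (syz S 0))" by simp
  finally have "msign C n (syz_pr S 0 \<cdot> (\<Phi> 0 \<cdot> diff R (n + 1))) = msign C n (mzero C (cx R (n + 1)) (syz S 0))"
    by (simp add: sd_def)
  hence "syz_pr S 0 \<cdot> (\<Phi> 0 \<cdot> diff R (n + 1)) = mzero C (cx R (n + 1)) (syz S 0)"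
    by (rule msign_inj[rotated 2]) auto
  thus ?thesis by (simp add: Ext_cocycles_iff)
qed

text \<open>A lift of the cocycle to \<open>cx S 0\<close> satisfies the start condition of
  \<open>extend_chain_map\<close> with \<open>R[n]\<close> as the source; the cocycle condition is
  exactly that condition.\<close>

lemma aug_surj:
  assumes S: "is_res S" and \<phi>: "\<phi> \<in> Ext_cocycles C R n (syz S 0)"
  obtains \<Phi> where "achain n S \<Phi>" "syz_pr S 0 \<cdot> \<Phi> 0 = \<phi>"
proof -
  note [simp] = S
  have [simp]: "\<phi> \<in> Arr C" "Dom C \<phi> = cx R n" "Cod C \<phi> = syz S 0" and
    \<phi>d: "\<phi> \<cdot> diff R (n + 1) = mzero C (cx R (n + 1)) (syz S 0)" using \<phi> by (auto simp: Ext_cocycles_iff)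
  obtain x where x: "x \<in> Arr C" "Dom C x = cx R n" "Cod C x = cx S (int 0)" "syz_pr S 0 \<cdot> x = \<phi>"
    by (rule syz_pr_lift[OF S res_proj[OF R, of n], of \<phi> 0]) auto
  note [simp] = x(1-3)
  have "syz_pr S 0 \<cdot> (x \<cdot> \<partial> n 1) = \<phi> \<cdot> \<partial> n 1" unfolding x(4)[symmetric] by simp
  hence xa: "syz_pr S 0 \<cdot> (x \<cdot> \<partial> n 1) = mzero C (P n 1) (syz S 0)" by (simp add: sd_def \<phi>d)
  obtain \<Phi> where "\<Phi> 0 = x" "fam (P n) (cx S) \<Phi>" "\<And>j. diff S j \<cdot> \<Phi> j = \<Phi> (j - 1) \<cdot> \<partial> n j"
    by (rule extend_chain_map[OF S cpx_sd x(1) _ _ xa]) auto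
  thus ?thesis using that[of \<Phi>] x(4) by (simp add: chain_def)
qed

text \<open>Degree -1 of \<open>R[n]\<close> is \<open>cx R (n - 1)\<close>, so a coboundary is
  precisely the correction that \<open>chain_homotopy\<close> tolerates there. Conversely,
  augmenting a homotopy in degree 0 kills the part with the differential of \<open>S\<close> and
  leaves a coboundary.\<close>

lemma ecls_eq:
  assumes S: "is_res S" and \<Phi>: "achain n S \<Phi>" and \<Psi>: "achain n S \<Psi>"
  shows "ecls n S \<Phi> = ecls n S \<Psi> \<longleftrightarrow> acls n S \<Phi> = acls n S \<Psi>"
proof -
  note [simp] = S chainD(2-4)[OF \<Phi>] chainD(2-4)[OF \<Psi>]
  have [simp]: "syz S 0 \<in> Obj C" by simp
  show ?thesis unfolding cls_eq[OF S shiftable_every \<Phi> \<Psi>] Ext_class_eq[OF res_syz[OF S] aug_cocycle[OF S \<Phi>] aug_cocycle[OF S \<Psi>]]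
  proof
    assume "\<exists>x. x \<in> Arr C \<and> Dom C x = cx R (n - 1) \<and> Cod C x = syz S 0 \<and>
        syz_pr S 0 \<cdot> \<Phi> 0 = syz_pr S 0 \<cdot> \<Psi> 0 \<boxplus> x \<cdot> diff R n"
    then obtain x where x: "x \<in> Arr C" "Dom C x = cx R (n - 1)" "Cod C x = syz S 0"
      "syz_pr S 0 \<cdot> \<Phi> 0 = syz_pr S 0 \<cdot> \<Psi> 0 \<boxplus> x \<cdot> diff R n" by blast
    have e: "syz_pr S 0 \<cdot> \<Phi> 0 = syz_pr S 0 \<cdot> \<Psi> 0 \<boxplus> msign C n x \<cdot> \<partial> n 0"
      unfolding x(4) using x(1-3) by (simp add: sd_def msign_eq)
    have x': "msign C n x \<in> Arr C" "Dom C (msign C n x) = P n (- 1)" "Cod C (msign C n x) = syz S 0"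
      using x by auto
    obtain e where "fam (P n) (\<lambda>j. cx S (j + 1)) e" "\<And>j. \<Phi> j = \<Psi> j \<boxplus> (e (j - 1) \<cdot> \<partial> n j \<boxplus> diff S (j + 1) \<cdot> e j)"
      by (rule chain_homotopy[OF S cpx_sd chainD(1)[OF \<Phi>] chainD(1)[OF \<Psi>] achainD[OF \<Phi>] achainD[OF \<Psi>] x' e]) blast
    thus "homotopic every_degree n S \<Phi> \<Psi>" by (auto simp: homotopic_def)
  next
    assume "homotopic every_degree n S \<Phi> \<Psi>"
    then obtain e where e: "fam (P n) (\<lambda>j. cx S (j + 1)) e"
      "\<And>j. \<Phi> j = \<Psi> j \<boxplus> (e (j - 1) \<cdot> \<partial> n j \<boxplus> diff S (j + 1) \<cdot> e j)" unfolding homotopic_def by auto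
    note [simp] = famD[OF e(1)]
    have 1: "syz_pr S 0 \<cdot> (diff S 1 \<cdot> e 0) = mzero C (cx R n) (syz S 0)"
    proof -
      have "syz_pr S 0 \<cdot> (diff S 1 \<cdot> e 0) = (syz_pr S 0 \<cdot> diff S 1) \<cdot> e 0" by (simp del: res_pr_diff0)
      thus ?thesis by simp
    qed
    have "syz_pr S 0 \<cdot> \<Phi> 0 = syz_pr S 0 \<cdot> \<Psi> 0 \<boxplus> msign C n (syz_pr S 0 \<cdot> e (- 1)) \<cdot> diff R n"
      unfolding e(2)[of 0] by (simp add: sd_def 1)
    thus "\<exists>x. x \<in> Arr C \<and> Dom C x = cx R (n - 1) \<and> Cod C x = syz S 0 \<and>
        syz_pr S 0 \<cdot> \<Phi> 0 = syz_pr S 0 \<cdot> \<Psi> 0 \<boxplus> x \<cdot> diff R n"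
      by (intro exI[of _ "msign C n (syz_pr S 0 \<cdot> e (- 1))"]) simp
  qed
qed

lemma ExtE:
  assumes S: "is_res S" and X: "X \<in> carrier (Ext_grp C R n (syz S 0))"
  obtains \<Phi> where "achain n S \<Phi>" "X = ecls n S \<Phi>"
proof -
  obtain \<phi> where \<phi>: "\<phi> \<in> Ext_cocycles C R n (syz S 0)" "X = Ext_class C R n (syz S 0) \<phi>"
    using X unfolding Ext_carrier[OF res_syz[OF S]] by blast
  obtain \<Phi> where "achain n S \<Phi>" "syz_pr S 0 \<cdot> \<Phi> 0 = \<phi>" using aug_surj[OF S \<phi>(1)] .
  thus ?thesis using that \<phi>(2) by simp
qed

lemma ecls_in: "is_res S \<Longrightarrow> achain n S \<Phi> \<Longrightarrow> ecls n S \<Phi> \<in> carrier (Ext_grp C R n (syz S 0))"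
  unfolding Ext_carrier[OF res_syz] using aug_cocycle by blast

text \<open>On presentations by chain maps the comparison map changes nothing. For negative
  \<open>n\<close> the cocycle starts at a zero object, which agrees with the unit prescribed in
  that case.\<close>

lemma zeta_ecls:
  assumes S: "is_res S" and \<Phi>: "achain n S \<Phi>"
  shows "zeta_level C R S n (ecls n S \<Phi>) = acls n S \<Phi>"
proof (cases "n < 0")
  case True
  note [simp] = S chainD(2-4)[OF \<Phi>]
  have z: "achain n S (zfam n S)" by (rule chain_zfam[OF S shiftable_every])
  have "syz_pr S 0 \<cdot> \<Phi> 0 = syz_pr S 0 \<cdot> zfam n S 0"
    by (rule zero_object_unique) (use True res_zero[OF R, of n] in auto)
  hence "ecls n S \<Phi> = ecls n S (zfam n S)" by simp
  hence "acls n S \<Phi> = acls n S (zfam n S)" using ecls_eq[OF S \<Phi> z] by simp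
  thus ?thesis using True by (simp add: zeta_level_def hyper_one[OF S shiftable_every])
next
  case False
  have m: "\<And>\<psi>. \<psi> \<in> ecls n S \<Phi> \<longleftrightarrow> \<psi> \<in> Ext_cocycles C R n (syz S 0) \<and> Ext_class C R n (syz S 0) \<psi> = ecls n S \<Phi>"
    by (rule Ext_class_mem[OF res_syz[OF S] aug_cocycle[OF S \<Phi>]])
  have "the_elem {acls n S \<Psi> |\<Psi>. \<Psi> \<in> chain_maps C every_degree n R S \<and> syz_pr S 0 \<cdot> \<Psi> 0 \<in> ecls n S \<Phi>} = acls n S \<Phi>"
  proof (rule the_elem_eqI)
    show "acls n S \<Phi> \<in> {acls n S \<Psi> |\<Psi>. \<Psi> \<in> chain_maps C every_degree n R S \<and> syz_pr S 0 \<cdot> \<Psi> 0 \<in> ecls n S \<Phi>}"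
      using \<Phi> aug_cocycle[OF S \<Phi>] unfolding chain_maps_chain[OF S] m by blast
    fix Y assume "Y \<in> {acls n S \<Psi> |\<Psi>. \<Psi> \<in> chain_maps C every_degree n R S \<and> syz_pr S 0 \<cdot> \<Psi> 0 \<in> ecls n S \<Phi>}"
    then obtain \<Psi> where "achain n S \<Psi>" "ecls n S \<Psi> = ecls n S \<Phi>" "Y = acls n S \<Psi>"
      unfolding chain_maps_chain[OF S] m by blast
    thus "Y = acls n S \<Phi>" using ecls_eq[OF S _ \<Phi>] by simp
  qed
  thus ?thesis using False by (simp add: zeta_level_def)
qed

text \<open>By \<open>ecls_eq\<close> both groups are quotients of the same set of chain maps by the
  same relation, whatever the integer \<open>n\<close>.\<close>

lemma zeta_level_bij:
  assumes S: "is_res S"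
  shows "bij_betw (zeta_level C R S n) (carrier (Ext_grp C R n (syz S 0))) (carrier (hyper_grp C every_degree n R S))"
proof (rule bij_betw_imageI)
  show "inj_on (zeta_level C R S n) (carrier (Ext_grp C R n (syz S 0)))"
  proof (rule inj_onI)
    fix X Y assume X: "X \<in> carrier (Ext_grp C R n (syz S 0))" and Y: "Y \<in> carrier (Ext_grp C R n (syz S 0))"
      and e: "zeta_level C R S n X = zeta_level C R S n Y"
    obtain \<Phi> where \<Phi>: "achain n S \<Phi>" "X = ecls n S \<Phi>" using ExtE[OF S X] .
    obtain \<Psi> where \<Psi>: "achain n S \<Psi>" "Y = ecls n S \<Psi>" using ExtE[OF S Y] .
    show "X = Y" using e ecls_eq[OF S \<Phi>(1) \<Psi>(1)] by (simp add: \<Phi> \<Psi> zeta_ecls[OF S])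
  qed
  show "zeta_level C R S n ` carrier (Ext_grp C R n (syz S 0)) = carrier (hyper_grp C every_degree n R S)"
  proof (rule equalityI; rule subsetI)
    fix Y assume "Y \<in> zeta_level C R S n ` carrier (Ext_grp C R n (syz S 0))"
    then obtain X where X: "X \<in> carrier (Ext_grp C R n (syz S 0))" "Y = zeta_level C R S n X" by blast
    obtain \<Phi> where \<Phi>: "achain n S \<Phi>" "X = ecls n S \<Phi>" using ExtE[OF S X(1)] .
    show "Y \<in> carrier (hyper_grp C every_degree n R S)"
      using X(2) cls_in[OF S shiftable_every \<Phi>(1)] by (simp add: \<Phi>(2) zeta_ecls[OF S \<Phi>(1)])
  next
    fix Y assume "Y \<in> carrier (hyper_grp C every_degree n R S)"
    then obtain \<Phi> where \<Phi>: "achain n S \<Phi>" "Y = acls n S \<Phi>" by (rule hyperE[OF S shiftable_every])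
    show "Y \<in> zeta_level C R S n ` carrier (Ext_grp C R n (syz S 0))"
      unfolding \<Phi>(2) zeta_ecls[OF S \<Phi>(1), symmetric] by (rule imageI[OF ecls_in[OF S \<Phi>(1)]])
  qed
qed

lemma zeta_level_mult:
  assumes S: "is_res S" and X: "X \<in> carrier (Ext_grp C R n (syz S 0))" and Y: "Y \<in> carrier (Ext_grp C R n (syz S 0))"
  shows "zeta_level C R S n (X \<otimes>\<^bsub>Ext_grp C R n (syz S 0)\<^esub> Y) =
    zeta_level C R S n X \<otimes>\<^bsub>hyper_grp C every_degree n R S\<^esub> zeta_level C R S n Y"
proof -
  obtain \<Phi> where \<Phi>: "achain n S \<Phi>" "X = ecls n S \<Phi>" using ExtE[OF S X] .
  obtain \<Psi> where \<Psi>: "achain n S \<Psi>" "Y = ecls n S \<Psi>" using ExtE[OF S Y] .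
  note [simp] = S chainD(2-4)[OF \<Phi>(1)] chainD(2-4)[OF \<Psi>(1)]
  have "X \<otimes>\<^bsub>Ext_grp C R n (syz S 0)\<^esub> Y = ecls n S (\<lambda>j. \<Phi> j \<boxplus> \<Psi> j)"
    unfolding \<Phi>(2) \<Psi>(2) Ext_mult[OF res_syz[OF S] aug_cocycle[OF S \<Phi>(1)] aug_cocycle[OF S \<Psi>(1)]] by simp
  thus ?thesis using zeta_ecls[OF S chain_add[OF S shiftable_every \<Phi>(1) \<Psi>(1)]]
      hyper_mult[OF S shiftable_every \<Phi>(1) \<Psi>(1)] by (simp add: \<Phi> \<Psi> zeta_ecls[OF S])
qed

lemma Ext_map_ecls:
  assumes S: "is_res S" "is_res S'" and f: "f \<in> Arr C" "Dom C f = syz S 0" "Cod C f = syz S' 0"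
    and u: "lifts C S S' f u" and \<Phi>: "achain n S \<Phi>"
  shows "Ext_map C R n f (ecls n S \<Phi>) = ecls n S' (\<lambda>j. u j \<cdot> \<Phi> j)"
  unfolding Ext_map_def
proof (rule the_elem_eqI)
  note [simp] = S f liftsD(2-4)[OF u] chainD(2-4)[OF \<Phi>]
  note m = Ext_class_mem[OF res_syz[OF S(1)] aug_cocycle[OF S(1) \<Phi>]]
  have "syz_pr S' 0 \<cdot> (u 0 \<cdot> \<Phi> 0) = (syz_pr S' 0 \<cdot> u 0) \<cdot> \<Phi> 0" by simp
  also have "\<dots> = f \<cdot> (syz_pr S 0 \<cdot> \<Phi> 0)" unfolding liftsD(6)[OF u] by simp
  finally have 1: "syz_pr S' 0 \<cdot> (u 0 \<cdot> \<Phi> 0) = f \<cdot> (syz_pr S 0 \<cdot> \<Phi> 0)" .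
  show "ecls n S' (\<lambda>j. u j \<cdot> \<Phi> j) \<in> {Ext_class C R n (Cod C f) (f \<cdot> \<phi>) |\<phi>. \<phi> \<in> ecls n S \<Phi>}"
    unfolding 1 f(3) using aug_cocycle[OF S(1) \<Phi>] by (auto simp: m)
  fix Y assume "Y \<in> {Ext_class C R n (Cod C f) (f \<cdot> \<phi>) |\<phi>. \<phi> \<in> ecls n S \<Phi>}"
  then obtain \<phi> where \<phi>: "\<phi> \<in> Ext_cocycles C R n (syz S 0)" "Ext_class C R n (syz S 0) \<phi> = ecls n S \<Phi>"
    and Y: "Y = Ext_class C R n (Cod C f) (f \<cdot> \<phi>)" using m by blast
  have fc: "f \<cdot> \<psi> \<in> Ext_cocycles C R n (syz S' 0)" if "\<psi> \<in> Ext_cocycles C R n (syz S 0)" for \<psi>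
    using that by (auto simp: Ext_cocycles_iff)
  obtain x where x: "x \<in> Arr C" "Dom C x = cx R (n - 1)" "Cod C x = syz S 0" "\<phi> = syz_pr S 0 \<cdot> \<Phi> 0 \<boxplus> x \<cdot> diff R n"
    using \<phi>(2) unfolding Ext_class_eq[OF res_syz[OF S(1)] \<phi>(1) aug_cocycle[OF S(1) \<Phi>]] by blast
  show "Y = ecls n S' (\<lambda>j. u j \<cdot> \<Phi> j)" unfolding 1 Y f(3)
      Ext_class_eq[OF res_syz[OF S(2)] fc[OF \<phi>(1)] fc[OF aug_cocycle[OF S(1) \<Phi>]]]
    using x by (intro exI[of _ "f \<cdot> x"]) simp
qed

text \<open>The chain map provides one admissible lift, namely \<open>h\<close> composed with
  \<open>\<Phi> 0\<close>, and the corresponding cocycle is the augmented connecting family. Any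
  other admissible choice is then compared with this one.\<close>

lemma Ext_conn_ecls:
  assumes S: "is_res S" "is_res Q"
    and fg: "short_exact C f g" "Dom C f = syz S 0" "Cod C g = syz Q 0"
    and d: "conn_data S Q f g h h1 hs" and \<Phi>: "achain n Q \<Phi>"
  shows "Ext_conn C R n f g (ecls n Q \<Phi>) = ecls (n + 1) S (conn_fam n S hs \<Phi>)"
  unfolding Ext_conn_def
proof (rule the_elem_eqI)
  note hs = conn_dataD(9)[OF d]
  note [simp] = S short_exactD(1-3)[OF fg(1)] fg(2,3) chainD(2-4)[OF \<Phi>] conn_dataD(1-3,5-7)[OF d] shift_liftsD(1-3)[OF hs]
  note m = Ext_class_mem[OF res_syz[OF S(2)] aug_cocycle[OF S(2) \<Phi>]]
  note fam = famD[OF conn_fam_fam[OF S hs chainD(1)[OF \<Phi>]]]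
  have [simp]: "Dom C (conn_fam n S hs \<Phi> 0) = cx R (n + 1)" using fam(2)[of 0] by simp
  note [simp] = fam(1,3)
  let ?\<psi> = "h \<cdot> \<Phi> 0" and ?\<chi> = "syz_pr S 0 \<cdot> conn_fam n S hs \<Phi> 0"
  have g\<psi>: "g \<cdot> ?\<psi> = syz_pr Q 0 \<cdot> \<Phi> 0"
  proof -
    have "g \<cdot> ?\<psi> = (g \<cdot> h) \<cdot> \<Phi> 0" by simp
    thus ?thesis unfolding conn_dataD(4)[OF d] .
  qed
  have d1: "diff Q 1 = syz_in Q 0 \<cdot> syz_pr Q 1" using res_diff[OF S(2), of 0] by simp
  have "f \<cdot> ?\<chi> = msign C n (f \<cdot> ((syz_pr S 0 \<cdot> hs 0) \<cdot> \<Phi> 1))" by (simp add: conn_fam_def)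
  also have "\<dots> = msign C n ((f \<cdot> h1) \<cdot> (syz_pr Q 1 \<cdot> \<Phi> 1))" unfolding shift_liftsD(5)[OF hs] by simp
  also have "\<dots> = msign C n (h \<cdot> (diff Q 1 \<cdot> \<Phi> 1))" unfolding conn_dataD(8)[OF d] d1 by simp
  also have "\<dots> = msign C n (h \<cdot> (\<Phi> 0 \<cdot> \<partial> n 1))" using achainD[OF \<Phi>, of 1] by simp
  \<comment> \<open>The sign of the connecting family in degree 0 and the sign of the differential
    of \<open>R[n]\<close> are both \<open>(-1)^n\<close> and cancel; this fixes the sign convention
    for Ext.\<close>
  also have "\<dots> = ?\<psi> \<cdot> diff R (n + 1)" by (simp add: sd_def msign_eq)
  finally have f\<chi>: "f \<cdot> ?\<chi> = ?\<psi> \<cdot> diff R (n + 1)" .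
  let ?A = "{Ext_class C R (n + 1) (Dom C f) \<chi> | \<chi> \<psi> \<phi>. \<phi> \<in> ecls n Q \<Phi> \<and> \<psi> \<in> Hom C (cx R n) (Dom C g) \<and> g \<cdot> \<psi> = \<phi> \<and>
     \<chi> \<in> Hom C (cx R (n + 1)) (Dom C f) \<and> f \<cdot> \<chi> = \<psi> \<cdot> diff R (n + 1)}"
  have "syz_pr Q 0 \<cdot> \<Phi> 0 \<in> ecls n Q \<Phi>" using aug_cocycle[OF S(2) \<Phi>] by (simp add: m)
  moreover have "?\<psi> \<in> Hom C (cx R n) (Dom C g)" "?\<chi> \<in> Hom C (cx R (n + 1)) (Dom C f)" by (auto simp: Hom_def)
  ultimately show "ecls (n + 1) S (conn_fam n S hs \<Phi>) \<in> ?A" using g\<psi> f\<chi> unfolding fg(2) by blast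
  have \<chi>_coc: "?\<chi> \<in> Ext_cocycles C R (n + 1) (syz S 0)"
    using aug_cocycle[OF S(1) chain_conn[OF S shiftable_every hs \<Phi>]] .
  fix Y assume "Y \<in> ?A"
  then obtain \<chi> \<psi> where "g \<cdot> \<psi> \<in> ecls n Q \<Phi>" and "\<psi> \<in> Hom C (cx R n) (Dom C g)"
    "\<chi> \<in> Hom C (cx R (n + 1)) (Dom C f)" and 1: "f \<cdot> \<chi> = \<psi> \<cdot> diff R (n + 1)"
    and Y: "Y = Ext_class C R (n + 1) (syz S 0) \<chi>" unfolding fg(2) by blast
  hence [simp]: "\<psi> \<in> Arr C" "Dom C \<psi> = cx R n" "Cod C \<psi> = Cod C f" "\<chi> \<in> Arr C" "Dom C \<chi> = cx R (n + 1)" "Cod C \<chi> = syz S 0"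
    and e: "g \<cdot> \<psi> \<in> Ext_cocycles C R n (syz Q 0)" "Ext_class C R n (syz Q 0) (g \<cdot> \<psi>) = ecls n Q \<Phi>"
    by (auto simp: Hom_def m)
  obtain x where x: "x \<in> Arr C" "Dom C x = cx R (n - 1)" "Cod C x = syz Q 0" "g \<cdot> \<psi> = syz_pr Q 0 \<cdot> \<Phi> 0 \<boxplus> x \<cdot> diff R n"
    using e(2) unfolding Ext_class_eq[OF res_syz[OF S(2)] e(1) aug_cocycle[OF S(2) \<Phi>]] by blast
  \<comment> \<open>The coboundary by which two cocycles differ is lifted along \<open>g\<close>;
    this uses that \<open>cx R (n - 1)\<close> is projective for every \<open>n\<close>.\<close>
  obtain x' where x': "x' \<in> Arr C" "Dom C x' = cx R (n - 1)" "Cod C x' = Dom C g" "g \<cdot> x' = x"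
    by (rule projective_lift[OF res_proj[OF R, of "n - 1"] short_exact_epic[OF fg(1)], of x]) (use x in auto)
  note [simp] = x(1-3) x'(1-3)
  have "g \<cdot> \<psi> = g \<cdot> ?\<psi> \<boxplus> (g \<cdot> x') \<cdot> diff R n" unfolding x(4) g\<psi> x'(4) ..
  hence 2: "g \<cdot> \<psi> = g \<cdot> (?\<psi> \<boxplus> x' \<cdot> diff R n)" by simp
  obtain y where y: "y \<in> Arr C" "Dom C y = Dom C (?\<psi> \<boxplus> x' \<cdot> diff R n)" "Cod C y = Dom C f" "\<psi> = (?\<psi> \<boxplus> x' \<cdot> diff R n) \<boxplus> f \<cdot> y"
    by (rule is_kernel_diff[OF short_exact_kernel[OF fg(1)] 2]) auto
  have [simp]: "y \<in> Arr C" "Dom C y = cx R n" "Cod C y = syz S 0" using y by auto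
  have "f \<cdot> \<chi> = ?\<psi> \<cdot> diff R (n + 1) \<boxplus> f \<cdot> (y \<cdot> diff R (n + 1))"
    unfolding 1 y(4) by (simp add: diff_diff_R)
  also have "\<dots> = f \<cdot> (?\<chi> \<boxplus> y \<cdot> diff R (n + 1))" unfolding f\<chi>[symmetric] by simp
  finally have 3: "f \<cdot> \<chi> = f \<cdot> (?\<chi> \<boxplus> y \<cdot> diff R (n + 1))" .
  have \<chi>: "\<chi> = ?\<chi> \<boxplus> y \<cdot> diff R (n + 1)"
    by (rule is_kernel_mono[OF short_exact_kernel[OF fg(1)] 3]) auto
  have "y \<cdot> diff R (n + 1) \<in> Ext_coboundaries C R (n + 1) (syz S 0)"
    unfolding Ext_coboundaries_iff by (intro exI[of _ y]) simp
  hence "\<chi> \<in> Ext_cocycles C R (n + 1) (syz S 0)"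
    using subgroup.m_closed[OF subquotient.K[OF Ext_subquotient[OF res_syz[OF S(1)]]] \<chi>_coc]
      subquotient.NK[OF Ext_subquotient[OF res_syz[OF S(1)]]] unfolding \<chi> by auto
  thus "Y = ecls (n + 1) S (conn_fam n S hs \<Phi>)" unfolding Y Ext_class_eq[OF res_syz[OF S(1)] _ \<chi>_coc]
    using \<chi> by (intro iffD2[OF Ext_class_eq[OF res_syz[OF S(1)] _ \<chi>_coc]] exI[of _ y]) simp_all
qed

lemma zeta_level_map:
  assumes S: "is_res S" "is_res S'" and f: "f \<in> Arr C" "Dom C f = syz S 0" "Cod C f = syz S' 0"
    and X: "X \<in> carrier (Ext_grp C R n (syz S 0))"
  shows "Ext_map C R n f X \<in> carrier (Ext_grp C R n (syz S' 0))"
    "zeta_level C R S' n (Ext_map C R n f X) = hyper_map C every_degree n R S S' f (zeta_level C R S n X)"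
proof -
  obtain u where u: "lifts C S S' f u" using lifts_exist[OF S f] .
  obtain \<Phi> where \<Phi>: "achain n S \<Phi>" "X = ecls n S \<Phi>" using ExtE[OF S(1) X] .
  note c = chain_comp[OF S u \<Phi>(1)]
  show "Ext_map C R n f X \<in> carrier (Ext_grp C R n (syz S' 0))"
    unfolding \<Phi>(2) Ext_map_ecls[OF S f u \<Phi>(1)] by (rule ecls_in[OF S(2) c])
  show "zeta_level C R S' n (Ext_map C R n f X) = hyper_map C every_degree n R S S' f (zeta_level C R S n X)"
    unfolding \<Phi>(2) Ext_map_ecls[OF S f u \<Phi>(1)] zeta_ecls[OF S(1) \<Phi>(1)] zeta_ecls[OF S(2) c]
      hyper_map_cls[OF S shiftable_every u \<Phi>(1)] ..
qed

lemma zeta_level_conn: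
  assumes S: "is_res S" "is_res Q"
    and fg: "short_exact C f g" "Dom C f = syz S 0" "Cod C g = syz Q 0"
    and X: "X \<in> carrier (Ext_grp C R n (syz Q 0))"
  shows "Ext_conn C R n f g X \<in> carrier (Ext_grp C R (n + 1) (syz S 0))"
    "zeta_level C R S (n + 1) (Ext_conn C R n f g X) = hyper_conn C every_degree n R S Q f g (zeta_level C R Q n X)"
proof -
  obtain h h1 hs where d: "conn_data S Q f g h h1 hs" using conn_data_exists[OF S fg] .
  obtain \<Phi> where \<Phi>: "achain n Q \<Phi>" "X = ecls n Q \<Phi>" using ExtE[OF S(2) X] .
  note c = chain_conn[OF S shiftable_every conn_dataD(9)[OF d] \<Phi>(1)]
  show "Ext_conn C R n f g X \<in> carrier (Ext_grp C R (n + 1) (syz S 0))"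
    unfolding \<Phi>(2) Ext_conn_ecls[OF S fg d \<Phi>(1)] by (rule ecls_in[OF S(1) c])
  show "zeta_level C R S (n + 1) (Ext_conn C R n f g X) = hyper_conn C every_degree n R S Q f g (zeta_level C R Q n X)"
    unfolding \<Phi>(2) Ext_conn_ecls[OF S fg d \<Phi>(1)] zeta_ecls[OF S(2) \<Phi>(1)] zeta_ecls[OF S(1) c]
      hyper_conn_cls[OF S shiftable_every fg d \<Phi>(1)] ..
qed

end

context resolved_category
begin

text \<open>The long exact sequences are not derived again from cochain complexes but transported
  from homotopy classes of chain maps.\<close>

lemma Ext_coh_functor:
  assumes A: "R = res A" shows "coh_functor C (Ext_functor C res A)"
proof -
  have "coh_isomorphism C (Ext_functor C res A) (hyper_functor every_degree) (\<lambda>n B. zeta_level C R (res B) n)"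
  proof (rule coh_transport[OF hyper_coh_functor[OF shiftable_every]])
    fix n B assume B: "B \<in> Obj C"
    note S = is_res_res[OF B]
    show "comm_group (coh_grp (Ext_functor C res A) n B)"
      using Ext_group[OF B] by (simp add: Ext_functor_def A[symmetric])
    show "bij_betw (zeta_level C R (res B) n) (carrier (coh_grp (Ext_functor C res A) n B)) (carrier (coh_grp (hyper_functor every_degree) n B))"
      using zeta_level_bij[OF S(1), of n] S(2) by (simp add: Ext_functor_def hyper_functor_def A[symmetric])
    fix x y assume "x \<in> carrier (coh_grp (Ext_functor C res A) n B)" "y \<in> carrier (coh_grp (Ext_functor C res A) n B)"
    thus "zeta_level C R (res B) n (x \<otimes>\<^bsub>coh_grp (Ext_functor C res A) n B\<^esub> y) =
      zeta_level C R (res B) n x \<otimes>\<^bsub>coh_grp (hyper_functor every_degree) n B\<^esub> zeta_level C R (res B) n y"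
      using zeta_level_mult[OF S(1), of x n y] S(2) by (simp add: Ext_functor_def hyper_functor_def A[symmetric])
  next
    fix n f x assume f: "f \<in> Arr C" and x: "x \<in> carrier (coh_grp (Ext_functor C res A) n (Dom C f))"
    have *: "is_res (res (Dom C f))" "is_res (res (Cod C f))" "Dom C f = syz (res (Dom C f)) 0" "Cod C f = syz (res (Cod C f)) 0"
      using f by auto
    show "coh_map (Ext_functor C res A) n f x \<in> carrier (coh_grp (Ext_functor C res A) n (Cod C f)) \<and>
       zeta_level C R (res (Cod C f)) n (coh_map (Ext_functor C res A) n f x) =
       coh_map (hyper_functor every_degree) n f (zeta_level C R (res (Dom C f)) n x)"
      using zeta_level_map[OF *(1,2) f *(3,4), of x n] x f by (simp add: Ext_functor_def hyper_functor_def A[symmetric])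
  next
    fix n f g x assume fg: "short_exact C f g" and x: "x \<in> carrier (coh_grp (Ext_functor C res A) n (Cod C g))"
    have *: "is_res (res (Dom C f))" "is_res (res (Cod C g))" "Dom C f = syz (res (Dom C f)) 0" "Cod C g = syz (res (Cod C g)) 0"
      using short_exactD(1,2)[OF fg] by auto
    show "coh_conn (Ext_functor C res A) n f g x \<in> carrier (coh_grp (Ext_functor C res A) (n + 1) (Dom C f)) \<and>
       zeta_level C R (res (Dom C f)) (n + 1) (coh_conn (Ext_functor C res A) n f g x) =
       coh_conn (hyper_functor every_degree) n f g (zeta_level C R (res (Cod C g)) n x)"
      using zeta_level_conn[OF *(1,2) fg *(3,4), of x n] x short_exactD(1,2)[OF fg] by (simp add: Ext_functor_def hyper_functor_def A[symmetric])
  qed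
  thus ?thesis by (simp add: coh_isomorphism_def coh_morphism_def)
qed

end

section \<open>Direct limits identified by a cone\<close>

text \<open>An intrinsic criterion for \<open>K\<close> to be the direct limit: the maps
  \<open>s\<close> are jointly surjective, and whatever they kill already dies at a finite stage. It
  avoids all computation with equivalence classes of pairs.\<close>

locale limit_cone =
  fixes G :: "nat \<Rightarrow> 'g monoid" and t :: "nat \<Rightarrow> 'g \<Rightarrow> 'g" and K :: "'k monoid" and s :: "nat \<Rightarrow> 'g \<Rightarrow> 'k"
  assumes G: "comm_group (G k)" and K: "comm_group K"
    and t: "t k \<in> hom (G k) (G (Suc k))" and s: "s k \<in> hom (G k) K"
    and st: "x \<in> carrier (G k) \<Longrightarrow> s (Suc k) (t k x) = s k x"
    and surj: "y \<in> carrier K \<Longrightarrow> \<exists>k. \<exists>x\<in>carrier (G k). s k x = y"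
    and inj: "x \<in> carrier (G k) \<Longrightarrow> s k x = \<one>\<^bsub>K\<^esub> \<Longrightarrow> \<exists>l\<ge>k. transition t k l x = \<one>\<^bsub>G l\<^esub>"
begin

lemma G_group: "group (G k)" using comm_group.axioms(2)[OF G] .
lemma K_group: "group K" using comm_group.axioms(2)[OF K] .

lemma transition_refl [simp]: "transition t k k x = x"
  by (simp add: transition_def)

lemma transition_Suc: "k \<le> l \<Longrightarrow> transition t k (Suc l) x = t l (transition t k l x)"
  by (simp add: transition_def)

lemma transition_hom: "k \<le> l \<Longrightarrow> transition t k l \<in> hom (G k) (G l)"
proof (induction l rule: dec_induct)
  case base
  show ?case by (rule homI) auto
next
  case (step l)
  have "transition t k (Suc l) = t l \<circ> transition t k l" using step by (auto simp: transition_Suc)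
  show ?case unfolding \<open>transition t k (Suc l) = _\<close> by (rule hom_compose[OF step.IH t])
qed

lemma transition_in: "k \<le> l \<Longrightarrow> x \<in> carrier (G k) \<Longrightarrow> transition t k l x \<in> carrier (G l)"
  using transition_hom by (blast dest: hom_in_carrier)

lemma transition_trans: "l \<le> m \<Longrightarrow> k \<le> l \<Longrightarrow> transition t l m (transition t k l x) = transition t k m x"
  by (induction m rule: dec_induct) (auto simp: transition_Suc)

lemma s_transition: "k \<le> l \<Longrightarrow> x \<in> carrier (G k) \<Longrightarrow> s l (transition t k l x) = s k x"
  by (induction l rule: dec_induct) (auto simp: transition_Suc st transition_in)

lemma s_in: "x \<in> carrier (G k) \<Longrightarrow> s k x \<in> carrier K"
  using s by (blast dest: hom_in_carrier)

text \<open>For \<open>z\<close> in \<open>K\<close> the fibre over \<open>z\<close> is the germ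
  that corresponds to it in the limit.\<close>

definition fib :: "'k \<Rightarrow> (nat \<times> 'g) set" where
  "fib z = {(j, y). y \<in> carrier (G j) \<and> s j y = z}"

text \<open>Elements with the same image are moved to a common index; their quotient there is killed
  by the cone, hence dies at a later stage, where the two become equal.\<close>

lemma lim_class_fib:
  assumes x: "x \<in> carrier (G i)"
  shows "lim_class G t i x = fib (s i x)"
proof (rule equalityI; rule subrelI)
  fix j y assume "(j, y) \<in> lim_class G t i x"
  then obtain k where "y \<in> carrier (G j)" "k \<ge> i" "k \<ge> j" "transition t i k x = transition t j k y"
    by (auto simp: lim_class_def)
  thus "(j, y) \<in> fib (s i x)" using s_transition[of i k x] s_transition[of j k y] x by (simp add: fib_def)
next
  fix j y assume "(j, y) \<in> fib (s i x)"
  hence y: "y \<in> carrier (G j)" "s j y = s i x" by (auto simp: fib_def)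
  define m where "m = max i j"
  let ?x = "transition t i m x" and ?y = "transition t j m y"
  have m: "i \<le> m" "j \<le> m" by (auto simp: m_def)
  interpret Gm: group "G m" by (rule G_group)
  interpret K: group K by (rule K_group)
  have xy: "?x \<in> carrier (G m)" "?y \<in> carrier (G m)" using transition_in x y m by auto
  have hs: "group_hom (G m) K (s m)" using s by unfold_locales
  have "s m (?x \<otimes>\<^bsub>G m\<^esub> inv\<^bsub>G m\<^esub> ?y) = \<one>\<^bsub>K\<^esub>"
    using xy s_transition[OF m(1) x] s_transition[OF m(2) y(1)] y(2) s_in[OF x]
    by (simp add: group_hom.hom_mult[OF hs] group_hom.hom_inv[OF hs])
  from inj[OF _ this] xy obtain l where l: "l \<ge> m" "transition t m l (?x \<otimes>\<^bsub>G m\<^esub> inv\<^bsub>G m\<^esub> ?y) = \<one>\<^bsub>G l\<^esub>" by auto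
  interpret Gl: group "G l" by (rule G_group)
  have ht: "group_hom (G m) (G l) (transition t m l)" using transition_hom[OF l(1)] by unfold_locales
  have "transition t m l ?x \<otimes>\<^bsub>G l\<^esub> inv\<^bsub>G l\<^esub> (transition t m l ?y) = \<one>\<^bsub>G l\<^esub>"
    using l(2) xy by (simp add: group_hom.hom_mult[OF ht] group_hom.hom_inv[OF ht])
  hence "transition t m l ?x = inv\<^bsub>G l\<^esub> (inv\<^bsub>G l\<^esub> (transition t m l ?y))"
    using xy transition_in[OF l(1)] by (intro Gl.inv_equality[symmetric]) auto
  hence "transition t m l ?x = transition t m l ?y" using xy transition_in[OF l(1)] by simp
  hence "transition t i l x = transition t j l y" using transition_trans m l(1) by simp
  thus "(j, y) \<in> lim_class G t i x" unfolding lim_class_def using y m l(1)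
    by (auto intro!: exI[of _ l])
qed

lemma lim_carrier: "carrier (lim_grp G t) = fib ` carrier K"
proof (rule equalityI; rule subsetI)
  fix X assume "X \<in> carrier (lim_grp G t)"
  thus "X \<in> fib ` carrier K" using lim_class_fib s_in by (auto simp: lim_grp_def)
next
  fix X assume "X \<in> fib ` carrier K"
  then obtain z where z: "z \<in> carrier K" "X = fib z" by blast
  then obtain k x where "x \<in> carrier (G k)" "s k x = z" using surj by blast
  thus "X \<in> carrier (lim_grp G t)" using lim_class_fib[of x k] z by (auto simp: lim_grp_def)
qed

lemma lim_mult:
  assumes z: "z \<in> carrier K" and w: "w \<in> carrier K"
  shows "fib z \<otimes>\<^bsub>lim_grp G t\<^esub> fib w = fib (z \<otimes>\<^bsub>K\<^esub> w)"
proof -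
  have cl: "lim_class G t k (x \<otimes>\<^bsub>G k\<^esub> y) = fib (z \<otimes>\<^bsub>K\<^esub> w)" if "(k, x) \<in> fib z" "(k, y) \<in> fib w" for k x y
  proof -
    have xy: "x \<in> carrier (G k)" "y \<in> carrier (G k)" "s k x = z" "s k y = w" using that by (auto simp: fib_def)
    have "x \<otimes>\<^bsub>G k\<^esub> y \<in> carrier (G k)" using monoid.m_closed[OF group.is_monoid[OF G_group] xy(1,2)] .
    thus ?thesis using lim_class_fib[of "x \<otimes>\<^bsub>G k\<^esub> y" k] hom_mult[OF s xy(1,2)] xy by simp
  qed
  obtain i x j y where x: "x \<in> carrier (G i)" "s i x = z" and y: "y \<in> carrier (G j)" "s j y = w"
    using surj[OF z] surj[OF w] by blast
  let ?m = "max i j"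
  have "(?m, transition t i ?m x) \<in> fib z" "(?m, transition t j ?m y) \<in> fib w"
    using s_transition[of i ?m x] s_transition[of j ?m y] transition_in[of i ?m x] transition_in[of j ?m y] x y
    by (auto simp: fib_def)
  hence "the_elem {lim_class G t k (x \<otimes>\<^bsub>G k\<^esub> y) | k x y. (k, x) \<in> fib z \<and> (k, y) \<in> fib w} = fib (z \<otimes>\<^bsub>K\<^esub> w)"
    using cl by (intro the_elem_eqI) (blast, blast)
  thus ?thesis by (simp add: lim_grp_def)
qed

lemma lim_one: "\<one>\<^bsub>lim_grp G t\<^esub> = fib \<one>\<^bsub>K\<^esub>"
  using lim_class_fib[of "\<one>\<^bsub>G 0\<^esub>" 0] monoid.one_closed[OF group.is_monoid[OF G_group]]
    hom_one[OF s G_group K_group] by (simp add: lim_grp_def)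

lemma lim_comm_group: "comm_group (lim_grp G t)"
proof (rule comm_groupI)
  interpret K: comm_group K by (rule K)
  show "\<one>\<^bsub>lim_grp G t\<^esub> \<in> carrier (lim_grp G t)" by (simp add: lim_one lim_carrier)
  fix x y assume "x \<in> carrier (lim_grp G t)" "y \<in> carrier (lim_grp G t)"
  then obtain a b where ab [simp]: "a \<in> carrier K" "x = fib a" "b \<in> carrier K" "y = fib b" by (auto simp: lim_carrier)
  show "x \<otimes>\<^bsub>lim_grp G t\<^esub> y \<in> carrier (lim_grp G t)" by (simp add: lim_mult lim_carrier)
  show "x \<otimes>\<^bsub>lim_grp G t\<^esub> y = y \<otimes>\<^bsub>lim_grp G t\<^esub> x" by (simp add: lim_mult K.m_comm)
  show "\<one>\<^bsub>lim_grp G t\<^esub> \<otimes>\<^bsub>lim_grp G t\<^esub> x = x" by (simp add: lim_mult lim_one)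
  show "\<exists>y\<in>carrier (lim_grp G t). y \<otimes>\<^bsub>lim_grp G t\<^esub> x = \<one>\<^bsub>lim_grp G t\<^esub>"
    by (rule bexI[of _ "fib (inv\<^bsub>K\<^esub> a)"]) (auto simp: lim_mult lim_one lim_carrier)
  fix z assume "z \<in> carrier (lim_grp G t)"
  then obtain c where [simp]: "c \<in> carrier K" "z = fib c" by (auto simp: lim_carrier)
  show "x \<otimes>\<^bsub>lim_grp G t\<^esub> y \<otimes>\<^bsub>lim_grp G t\<^esub> z = x \<otimes>\<^bsub>lim_grp G t\<^esub> (y \<otimes>\<^bsub>lim_grp G t\<^esub> z)"
    by (simp add: lim_mult K.m_assoc)
qed

text \<open>It suffices to know \<open>\<eta>\<close> on fibres. This suits maps that are defined as
  unique values, since they can be evaluated on fibres only.\<close>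

lemma fib_iso:
  assumes \<eta>: "\<And>z. z \<in> carrier K \<Longrightarrow> \<eta> (fib z) = z"
  shows "bij_betw \<eta> (carrier (lim_grp G t)) (carrier K)"
    "\<And>X Y. \<lbrakk>X \<in> carrier (lim_grp G t); Y \<in> carrier (lim_grp G t)\<rbrakk> \<Longrightarrow>
      \<eta> (X \<otimes>\<^bsub>lim_grp G t\<^esub> Y) = \<eta> X \<otimes>\<^bsub>K\<^esub> \<eta> Y"
proof -
  interpret K: comm_group K by (rule K)
  show "bij_betw \<eta> (carrier (lim_grp G t)) (carrier K)"
    unfolding lim_carrier by (rule bij_betw_byWitness[where f' = fib]) (auto simp: \<eta>)
  show "\<eta> (X \<otimes>\<^bsub>lim_grp G t\<^esub> Y) = \<eta> X \<otimes>\<^bsub>K\<^esub> \<eta> Y"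
    if "X \<in> carrier (lim_grp G t)" "Y \<in> carrier (lim_grp G t)" for X Y
    using that by (auto simp: lim_carrier lim_mult \<eta>)
qed

lemma fib_nonempty: "z \<in> carrier K \<Longrightarrow> \<exists>k x. (k, x) \<in> fib z"
  using surj by (fastforce simp: fib_def)

end

text \<open>A levelwise map over \<open>\<gamma>\<close> acts on fibres as \<open>\<gamma>\<close>.
  The result no longer mentions the levelwise map, so independence of the choices made in it comes
  for free.\<close>

lemma lim_map_fib:
  assumes L: "limit_cone G t K s" and L': "limit_cone G' t' K' s'"
    and r: "\<And>k x. x \<in> carrier (G k) \<Longrightarrow> r k x \<in> carrier (G' k) \<and> s' k (r k x) = \<gamma> (s k x)"
    and z: "z \<in> carrier K"
  shows "lim_map G' t' r (limit_cone.fib G s z) = limit_cone.fib G' s' (\<gamma> z)"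
proof -
  interpret L: limit_cone G t K s by (rule L)
  interpret L': limit_cone G' t' K' s' by (rule L')
  have cl: "lim_class G' t' k (r k x) = L'.fib (\<gamma> z)" if "(k, x) \<in> L.fib z" for k x
    using that L'.lim_class_fib[of "r k x" k] r[of x k] by (auto simp: L.fib_def)
  obtain k x where "(k, x) \<in> L.fib z" using L.fib_nonempty[OF z] by blast
  thus ?thesis unfolding lim_map_def using cl by (intro the_elem_eqI) (blast, blast)
qed

text \<open>Replaces a system by a levelwise isomorphic one; used to pass from chain maps to
  Ext.\<close>

lemma limit_cone_pullback:
  assumes L: "limit_cone G t K s" and G': "\<And>k. comm_group (G' k)"
    and bij: "\<And>k. bij_betw (z k) (carrier (G' k)) (carrier (G k))"
    and mult: "\<And>k x y. \<lbrakk>x \<in> carrier (G' k); y \<in> carrier (G' k)\<rbrakk> \<Longrightarrow> z k (x \<otimes>\<^bsub>G' k\<^esub> y) = z k x \<otimes>\<^bsub>G k\<^esub> z k y"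
    and t: "\<And>k x. x \<in> carrier (G' k) \<Longrightarrow> t' k x \<in> carrier (G' (Suc k)) \<and> z (Suc k) (t' k x) = t k (z k x)"
  shows "limit_cone G' t' K (\<lambda>k x. s k (z k x))"
proof -
  interpret L: limit_cone G t K s by (rule L)
  have z_in: "z k x \<in> carrier (G k)" if "x \<in> carrier (G' k)" for k x using bij[of k] that by (auto simp: bij_betw_def)
  have z_inj: "x = y" if "z k x = z k y" "x \<in> carrier (G' k)" "y \<in> carrier (G' k)" for k x y
    using bij[of k] that by (auto simp: bij_betw_def inj_on_def)
  have z: "z k \<in> hom (G' k) (G k)" for k using z_in mult by (intro homI) auto
  have closed: "x \<otimes>\<^bsub>G' k\<^esub> y \<in> carrier (G' k)" if "x \<in> carrier (G' k)" "y \<in> carrier (G' k)" for k x y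
    by (rule monoid.m_closed[OF group.is_monoid[OF comm_group.axioms(2)[OF G']] that])
  show ?thesis
  proof (rule limit_cone.intro)
    show "comm_group (G' k)" for k by (rule G')
    show "t' k \<in> hom (G' k) (G' (Suc k))" for k
    proof (rule homI)
      fix x y assume x: "x \<in> carrier (G' k)"
      show "t' k x \<in> carrier (G' (Suc k))" using t[OF x] by simp
      assume y: "y \<in> carrier (G' k)"
      show "t' k (x \<otimes>\<^bsub>G' k\<^esub> y) = t' k x \<otimes>\<^bsub>G' (Suc k)\<^esub> t' k y"
        using t[OF x] t[OF y] t[OF closed[OF x y]] mult[OF x y] mult[of "t' k x" "Suc k" "t' k y"]
          hom_mult[OF L.t z_in[OF x] z_in[OF y]] closed by (intro z_inj[where k = "Suc k"]) auto
    qed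
    show "(\<lambda>x. s k (z k x)) \<in> hom (G' k) K" for k
      using hom_compose[OF z L.s] by (simp add: o_def)
    show "s (Suc k) (z (Suc k) (t' k x)) = s k (z k x)" if "x \<in> carrier (G' k)" for k x
      using t[OF that] L.st[OF z_in[OF that]] by simp
    show "\<exists>k. \<exists>x\<in>carrier (G' k). s k (z k x) = y" if y: "y \<in> carrier K" for y
    proof -
      obtain k x where x: "x \<in> carrier (G k)" "s k x = y" using L.surj[OF y] by blast
      moreover obtain x' where "x' \<in> carrier (G' k)" "z k x' = x"
        using bij[of k] x(1) unfolding bij_betw_def by (metis imageE)
      ultimately show ?thesis by blast
    qed
    fix x k assume x: "x \<in> carrier (G' k)" and "s k (z k x) = \<one>\<^bsub>K\<^esub>"
    then obtain l where l: "l \<ge> k" "transition t k l (z k x) = \<one>\<^bsub>G l\<^esub>" using L.inj[OF z_in[OF x]] by blast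
    \<comment> \<open>The levelwise isomorphisms commute with all transitions, so an element that
      dies in one system dies at the same stage in the other.\<close>
    have "k \<le> m \<Longrightarrow> transition t' k m x \<in> carrier (G' m) \<and> z m (transition t' k m x) = transition t k m (z k x)" for m
    proof (induction m rule: dec_induct)
      case base
      thus ?case using x by (simp add: transition_def)
    next
      case (step m)
      thus ?case using t[of "transition t' k m x" m] by (simp add: transition_def)
    qed
    from this[OF l(1)] have "transition t' k l x = \<one>\<^bsub>G' l\<^esub>"
      using l(2) hom_one[OF z comm_group.axioms(2)[OF G'] L.G_group]
      by (intro z_inj[where k = l]) (auto intro: monoid.one_closed[OF group.is_monoid[OF comm_group.axioms(2)[OF G']]])
    thus "\<exists>l\<ge>k. transition t' k l x = \<one>\<^bsub>G' l\<^esub>" using l(1) by blast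
  qed (rule L.K)
qed

section \<open>Almost chain maps as a direct limit of chain maps\<close>

text \<open>In negative degrees equations hold because of zero objects, so only sufficiently high
  degrees ask for an argument; the gap between is finite.\<close>

lemma eventually_cofinite_int:
  assumes "\<And>m. m < 0 \<Longrightarrow> P m" "\<And>m. m > N \<Longrightarrow> P m"
  shows "eventually P (cofinite :: int filter)"
  unfolding eventually_cofinite
  by (rule finite_subset[of _ "{0..N}"]) (use assms in \<open>auto simp: not_less[symmetric]\<close>)

lemma eventually_cofinite_int_bound:
  assumes "eventually P (cofinite :: int filter)"
  obtains k :: nat where "\<And>m. m \<ge> int k \<Longrightarrow> P m"
proof -
  have fin: "finite {m. \<not> P m}" using assms by (simp add: eventually_cofinite)
  then obtain b where b: "\<And>m. m \<in> {m. \<not> P m} \<Longrightarrow> m \<le> b" using bdd_above_finite[OF fin] by (auto simp: bdd_above_def)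
  have "P m" if "m \<ge> int (nat (b + 1))" for m
    by (rule ccontr) (use b[of m] that in \<open>auto split: if_splits\<close>)
  thus ?thesis by (rule that)
qed

context resolved_object
begin

text \<open>\<open>ext n k S\<close> is extension by zero and \<open>trunc n k S\<close> truncation.  The sign makes them compatible
  with the connecting maps of all syzygy sequences; it is trivial for even \<open>k\<close>.\<close>

definition ext :: "int \<Rightarrow> nat \<Rightarrow> ('o, 'm) resolution \<Rightarrow> (int \<Rightarrow> 'm) \<Rightarrow> int \<Rightarrow> 'm" where
  "ext n k S \<phi> = (\<lambda>m. if m \<ge> int k then msign C (int k * (n + m + 1)) (\<phi> (m - int k))
     else mzero C (cx R (n + m)) (cx S m))"

definition trunc :: "int \<Rightarrow> nat \<Rightarrow> ('o, 'm) resolution \<Rightarrow> (int \<Rightarrow> 'm) \<Rightarrow> int \<Rightarrow> 'm" where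
  "trunc n k S \<psi> = (\<lambda>j. if j \<ge> 0 then msign C (int k * (n + j + int k + 1)) (\<psi> (j + int k))
     else mzero C (cx R (n + int k + j)) (cx S j))"

text \<open>The connecting family in the case of a syzygy sequence, where the chain map to be
  composed with is the identity.\<close>

definition conn_id :: "int \<Rightarrow> ('o, 'm) resolution \<Rightarrow> (int \<Rightarrow> 'm) \<Rightarrow> int \<Rightarrow> 'm" where
  "conn_id n S \<phi> = (\<lambda>m. if m \<ge> 0 then msign C (n + m) (\<phi> (m + 1)) else mzero C (cx R (n + 1 + m)) (cx S m))"

lemma sd_shift: "\<partial> (n + int k) j = msign C (int k) (\<partial> n (j + int k))"
  by (auto simp: sd_def algebra_simps)

lemma ext_fam: "is_res S \<Longrightarrow> fam (P (n + int k)) (cx (shift_res C k S)) \<phi> \<Longrightarrow> fam (P n) (cx S) (ext n k S \<phi>)"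
  by (auto simp: fam_def ext_def shift_simps)

lemma trunc_fam: "is_res S \<Longrightarrow> fam (P n) (cx S) \<psi> \<Longrightarrow> fam (P (n + int k)) (cx (shift_res C k S)) (trunc n k S \<psi>)"
  by (auto simp: fam_def trunc_def shift_simps algebra_simps)

text \<open>The zero homotopy suffices. For \<open>cofinite\<close> this allows changing a
  representative in finitely many degrees.\<close>

lemma cls_cong:
  assumes S: "is_res S" and F: "shiftable F" and \<phi>: "chain F n S \<phi>" and \<psi>: "chain F n S \<psi>"
    and e: "\<forall>\<^sub>F j in F. \<phi> j = \<psi> j"
  shows "cls F n S \<phi> = cls F n S \<psi>"
proof -
  note [simp] = S chainD(2-4)[OF \<psi>]
  have "\<forall>\<^sub>F j in F. \<phi> j = \<psi> j \<boxplus> (mzero C (cx R (n + (j - 1))) (cx S (j - 1 + 1)) \<cdot> \<partial> n j \<boxplus>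
     diff S (j + 1) \<cdot> mzero C (cx R (n + j)) (cx S (j + 1)))"
    using e by eventually_elim (simp add: add_diff_eq)
  moreover have "fam (P n) (\<lambda>j. cx S (j + 1)) (\<lambda>j. mzero C (cx R (n + j)) (cx S (j + 1)))" by (simp add: fam_def)
  ultimately have "homotopic F n S \<phi> \<psi>" unfolding homotopic_def
    by (intro exI[of _ "\<lambda>j. mzero C (cx R (n + j)) (cx S (j + 1))"]) simp
  thus ?thesis using cls_eq[OF S F \<phi> \<psi>] by simp
qed

text \<open>The chain condition may fail in degree \<open>k\<close>, where the zero part meets
  \<open>\<phi> 0\<close>, so only an almost chain map results. Above, the sign exponent grows by
  \<open>k\<close> per degree, which matches the sign \<open>(-1)^k\<close> between the
  differentials of \<open>R[n]\<close> and \<open>R[n + k]\<close>.\<close>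

lemma ext_chain:
  assumes S: "is_res S" and \<phi>: "achain (n + int k) (shift_res C k S) \<phi>"
  shows "chain cofinite n S (ext n k S \<phi>)"
proof -
  note [simp] = S
  note f = ext_fam[OF S chainD(1)[OF \<phi>]]
  have a: "\<phi> j \<in> Arr C" "Dom C (\<phi> j) = cx R (n + int k + j)" "j \<ge> 0 \<Longrightarrow> Cod C (\<phi> j) = cx S (j + int k)" for j
    using chainD(2-4)[OF \<phi>, of j] by (auto simp: shift_simps)
  have "\<forall>\<^sub>F j in cofinite. diff S j \<cdot> ext n k S \<phi> j = ext n k S \<phi> (j - 1) \<cdot> \<partial> n j"
  proof (rule eventually_cofinite_int)
    fix m :: int assume "m < 0"
    thus "diff S m \<cdot> ext n k S \<phi> m = ext n k S \<phi> (m - 1) \<cdot> \<partial> n m"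
      by (intro res_cx_unique[OF S, where j = "m - 1"]) (auto simp: famD[OF f] add_diff_eq)
  next
    fix m assume m: "m > int k"
    define j where "j = m - int k"
    have j: "j \<ge> 1" "m = j + int k" using m by (auto simp: j_def)
    have "diff S m \<cdot> \<phi> j = \<phi> (j - 1) \<cdot> msign C (int k) (\<partial> n m)"
      using achainD[OF \<phi>, of j] j by (simp add: shift_simps sd_shift)
    moreover have "\<phi> (j - 1) \<cdot> \<partial> n m = msign C 0 (\<phi> (j - 1) \<cdot> \<partial> n m)" by (simp add: msign_eq)
    moreover have [simp]: "Dom C (\<phi> j) = cx R (n + m)" "Cod C (\<phi> j) = cx S m"
      "Dom C (\<phi> (j - 1)) = cx R (n + m - 1)" "Cod C (\<phi> (j - 1)) = cx S (m - 1)"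
      using a[of j] a[of "j - 1"] j by (auto simp: algebra_simps)
    ultimately show "diff S m \<cdot> ext n k S \<phi> m = ext n k S \<phi> (m - 1) \<cdot> \<partial> n m"
      using j a(1) by (auto simp: ext_def msign_eq algebra_simps)
  qed
  thus ?thesis using f by (simp add: chain_def)
qed

text \<open>Cutting off creates no new condition at the boundary, since the shifted resolution has
  zero objects below degree 0.\<close>

lemma trunc_chain:
  assumes S: "is_res S" and \<psi>: "fam (P n) (cx S) \<psi>"
    and c: "\<And>m. m \<ge> int k \<Longrightarrow> diff S m \<cdot> \<psi> m = \<psi> (m - 1) \<cdot> \<partial> n m"
  shows "achain (n + int k) (shift_res C k S) (trunc n k S \<psi>)"
proof -
  note [simp] = S famD[OF \<psi>]
  note f = trunc_fam[OF S \<psi>, of k]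
  have "diff (shift_res C k S) j \<cdot> trunc n k S \<psi> j = trunc n k S \<psi> (j - 1) \<cdot> \<partial> (n + int k) j" for j
  proof (cases "j \<ge> 1")
    case False
    thus ?thesis
      by (intro res_cx_unique[OF is_res_shift[OF S, of k], where j = "j - 1"]) (auto simp: famD[OF f] add_diff_eq)
  next
    case True
    define m where "m = j + int k"
    have "diff S m \<cdot> \<psi> m = \<psi> (m - 1) \<cdot> \<partial> n m" using c[of m] True by (simp add: m_def)
    thus ?thesis using True unfolding sd_shift m_def by (auto simp: trunc_def shift_simps msign_eq algebra_simps)
  qed
  thus ?thesis using f by (simp add: chain_def)
qed

lemma trunc_null:
  assumes S: "is_res S" and \<psi>: "fam (P n) (cx S) \<psi>" and e: "fam (P n) (\<lambda>j. cx S (j + 1)) e"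
    and c: "\<And>m. m \<ge> int k \<Longrightarrow> \<psi> m = e (m - 1) \<cdot> \<partial> n m \<boxplus> diff S (m + 1) \<cdot> e m"
  shows "homotopic every_degree (n + int k) (shift_res C k S) (trunc n k S \<psi>) (zfam (n + int k) (shift_res C k S))"
proof -
  note [simp] = S famD[OF \<psi>] famD[OF e]
  let ?S = "shift_res C k S"
  \<comment> \<open>Degree -1 is kept because the homotopy formula in degree 0 uses
    \<open>e (int k - 1)\<close>.\<close>
  define e' where "e' j = (if j \<ge> - 1 then msign C (int k * (n + j + int k + 1)) (e (j + int k))
    else mzero C (cx R (n + int k + j)) (cx ?S (j + 1)))" for j
  have f: "fam (P (n + int k)) (\<lambda>j. cx ?S (j + 1)) e'" by (auto simp: fam_def e'_def shift_simps algebra_simps)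
  note ft = trunc_fam[OF S \<psi>, of k]
  have "trunc n k S \<psi> j = zfam (n + int k) ?S j \<boxplus> (e' (j - 1) \<cdot> \<partial> (n + int k) j \<boxplus> diff ?S (j + 1) \<cdot> e' j)" for j
  proof (cases "j \<ge> 0")
    case False
    thus ?thesis
      by (intro res_cx_unique[OF is_res_shift[OF S, of k], where j = j]) (auto simp: famD[OF f] famD[OF ft] add_diff_eq)
  next
    case True
    define m where "m = j + int k"
    have "\<psi> m = e (m - 1) \<cdot> \<partial> n m \<boxplus> diff S (m + 1) \<cdot> e m" using c[of m] True by (simp add: m_def)
    thus ?thesis using True unfolding sd_shift m_def
      by (auto simp: trunc_def e'_def shift_simps msign_eq algebra_simps)
  qed
  thus ?thesis unfolding homotopic_def using f by auto
qed

lemma ext_homotopic: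
  assumes S: "is_res S" and \<phi>: "achain (n + int k) (shift_res C k S) \<phi>" and \<psi>: "achain (n + int k) (shift_res C k S) \<psi>"
    and h: "homotopic every_degree (n + int k) (shift_res C k S) \<phi> \<psi>"
  shows "homotopic cofinite n S (ext n k S \<phi>) (ext n k S \<psi>)"
proof -
  note [simp] = S
  obtain e where e: "fam (P (n + int k)) (\<lambda>j. cx (shift_res C k S) (j + 1)) e"
    and eq: "\<And>j. \<phi> j = \<psi> j \<boxplus> (e (j - 1) \<cdot> \<partial> (n + int k) j \<boxplus> diff (shift_res C k S) (j + 1) \<cdot> e j)"
    using h by (auto simp: homotopic_def)
  \<comment> \<open>Below \<open>k\<close> the homotopy is zero, so the component
    \<open>e (- 1)\<close> is lost and the formula may fail in degree \<open>k\<close>; finitely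
    many exceptions are allowed.\<close>
  define e' where "e' m = (if m \<ge> int k then msign C (int k * (n + m + 1)) (e (m - int k))
    else mzero C (cx R (n + m)) (cx S (m + 1)))" for m
  have f: "fam (P n) (\<lambda>j. cx S (j + 1)) e'"
    using e by (auto simp: fam_def e'_def shift_simps algebra_simps)
  note fe = ext_fam[OF S chainD(1)[OF \<phi>]] ext_fam[OF S chainD(1)[OF \<psi>]]
  have "\<forall>\<^sub>F j in cofinite. ext n k S \<phi> j = ext n k S \<psi> j \<boxplus> (e' (j - 1) \<cdot> \<partial> n j \<boxplus> diff S (j + 1) \<cdot> e' j)"
  proof (rule eventually_cofinite_int)
    fix m :: int assume "m < 0"
    thus "ext n k S \<phi> m = ext n k S \<psi> m \<boxplus> (e' (m - 1) \<cdot> \<partial> n m \<boxplus> diff S (m + 1) \<cdot> e' m)"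
      by (intro res_cx_unique[OF S, where j = m]) (auto simp: famD[OF f] famD[OF fe(1)] famD[OF fe(2)] add_diff_eq)
  next
    fix m assume m: "m > int k"
    define j where "j = m - int k"
    have j: "j \<ge> 1" "m = j + int k" using m by (auto simp: j_def)
    have [simp]: "\<psi> j \<in> Arr C" "Dom C (\<psi> j) = cx R (n + m)" "Cod C (\<psi> j) = cx S m"
      "e j \<in> Arr C" "Dom C (e j) = cx R (n + m)" "Cod C (e j) = cx S (m + 1)"
      "e (j - 1) \<in> Arr C" "Dom C (e (j - 1)) = cx R (n + m - 1)" "Cod C (e (j - 1)) = cx S m"
      using chainD(2-4)[OF \<psi>, of j] famD[OF e, of j] famD[OF e, of "j - 1"] j by (auto simp: shift_simps algebra_simps)
    have "\<phi> j = \<psi> j \<boxplus> (e (j - 1) \<cdot> msign C (int k) (\<partial> n m) \<boxplus> diff S (m + 1) \<cdot> e j)"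
      using eq[of j] j by (simp add: shift_simps sd_shift algebra_simps)
    moreover have "ext n k S \<phi> m = msign C (int k * (n + m + 1)) (\<phi> j)" "ext n k S \<psi> m = msign C (int k * (n + m + 1)) (\<psi> j)"
      "e' m = msign C (int k * (n + m + 1)) (e j)" "e' (m - 1) = msign C (int k * (n + m)) (e (j - 1))"
      using j(1) unfolding j(2) by (simp_all add: ext_def e'_def)
    ultimately show "ext n k S \<phi> m = ext n k S \<psi> m \<boxplus> (e' (m - 1) \<cdot> \<partial> n m \<boxplus> diff S (m + 1) \<cdot> e' m)"
      by (auto simp: msign_eq add_diff_eq)
  qed
  thus ?thesis unfolding homotopic_def using f by blast
qed

text \<open>For a syzygy sequence \<open>h\<close>, \<open>h1\<close> and the chain map can all be
  taken to be identities, so that only reindexing and a sign remain.\<close>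

lemma hyper_conn_syz:
  assumes S: "is_res S" and F: "shiftable F" and \<phi>: "chain F n S \<phi>"
  shows "hyper_conn C F n R (shift_res C 1 S) S (syz_in S 0) (syz_pr S 0) (cls F n S \<phi>) =
      cls F (n + 1) (shift_res C 1 S) (conn_id n S \<phi>)"
    "chain F (n + 1) (shift_res C 1 S) (conn_id n S \<phi>)"
proof -
  note [simp] = S chainD(2-4)[OF \<phi>]
  let ?S = "shift_res C 1 S"
  have l: "lifts C ?S ?S (ident C (syz S 1)) (\<lambda>j. ident C (cx ?S j))"
    using lifts_ident[OF is_res_shift[OF S, of 1]] by (simp add: shift_simps)
  have d: "conn_data ?S S (syz_in S 0) (syz_pr S 0) (ident C (cx S 0)) (ident C (syz S 1)) (\<lambda>j. ident C (cx ?S j))"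
    unfolding conn_data_def using l by (auto simp: Hom_def)
  have "conn_fam n ?S (\<lambda>j. ident C (cx ?S j)) \<phi> = conn_id n S \<phi>"
    by (auto simp: fun_eq_iff conn_fam_def conn_id_def shift_simps)
  thus "hyper_conn C F n R ?S S (syz_in S 0) (syz_pr S 0) (cls F n S \<phi>) = cls F (n + 1) ?S (conn_id n S \<phi>)"
    "chain F (n + 1) ?S (conn_id n S \<phi>)"
    using hyper_conn_cls[OF is_res_shift[OF S] S F res_exact[OF S] _ _ d \<phi>] chain_conn[OF is_res_shift[OF S] S F l \<phi>]
    by (auto simp: shift_simps)
qed

end

section \<open>The cone from chain maps to almost chain maps\<close>

context resolved_object
begin

text \<open>The signed form of the map that \<open>vartheta\<close> uses at even levels. Being
  defined at every level, it makes the whole system into a cone.\<close>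

definition hat :: "int \<Rightarrow> ('o, 'm) resolution \<Rightarrow> nat \<Rightarrow> (int \<Rightarrow> 'm) set \<Rightarrow> (int \<Rightarrow> 'm) set" where
  "hat n S k X = the_elem {cls cofinite n S (ext n k S \<phi>) | \<phi>. \<phi> \<in> X}"

lemma hat_cls:
  assumes S: "is_res S" and \<phi>: "achain (n + int k) (shift_res C k S) \<phi>"
  shows "hat n S k (acls (n + int k) (shift_res C k S) \<phi>) = cls cofinite n S (ext n k S \<phi>)"
  unfolding hat_def
proof (rule the_elem_eqI)
  let ?S = "shift_res C k S" and ?X = "acls (n + int k) (shift_res C k S) \<phi>"
  note S' = is_res_shift[OF S, of k]
  note m = cls_mem[OF S' shiftable_every \<phi>]
  show "cls cofinite n S (ext n k S \<phi>) \<in> {cls cofinite n S (ext n k S \<phi>) | \<phi>. \<phi> \<in> ?X}" using m \<phi> by blast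
  fix y assume "y \<in> {cls cofinite n S (ext n k S \<phi>) | \<phi>. \<phi> \<in> ?X}"
  then obtain \<psi> where \<psi>: "achain (n + int k) ?S \<psi>" "acls (n + int k) ?S \<psi> = ?X" and y: "y = cls cofinite n S (ext n k S \<psi>)"
    using m by blast
  have "homotopic every_degree (n + int k) ?S \<psi> \<phi>" using \<psi>(2) cls_eq[OF S' shiftable_every \<psi>(1) \<phi>] by simp
  from ext_homotopic[OF S \<psi>(1) \<phi> this] show "y = cls cofinite n S (ext n k S \<phi>)"
    unfolding y using cls_eq[OF S shiftable_cofinite ext_chain[OF S \<psi>(1)] ext_chain[OF S \<phi>]] by simp
qed

lemma hyperRes_sysE:
  assumes S: "is_res S" and X: "X \<in> carrier (hyperRes_sys C R n S k)"
  obtains \<phi> where "achain (n + int k) (shift_res C k S) \<phi>" "X = acls (n + int k) (shift_res C k S) \<phi>"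
  using hyperE[OF is_res_shift[OF S] shiftable_every X[unfolded hyperRes_sys_def]] .

lemma hyperRes_trans_cls:
  assumes S: "is_res S" and \<phi>: "achain (n + int k) (shift_res C k S) \<phi>"
  shows "hyperRes_trans C R n S k (acls (n + int k) (shift_res C k S) \<phi>) =
      acls (n + int (Suc k)) (shift_res C (Suc k) S) (conn_id (n + int k) (shift_res C k S) \<phi>)"
    "achain (n + int (Suc k)) (shift_res C (Suc k) S) (conn_id (n + int k) (shift_res C k S) \<phi>)"
proof -
  have e: "n + int (Suc k) = n + int k + 1" "shift_res C 1 (shift_res C k S) = shift_res C (Suc k) S"
    using shift_shift[OF S, of 1 k] by auto
  note h = hyper_conn_syz[OF is_res_shift[OF S, of k] shiftable_every \<phi>, unfolded e(2)]
  show "achain (n + int (Suc k)) (shift_res C (Suc k) S) (conn_id (n + int k) (shift_res C k S) \<phi>)"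
    unfolding e(1) by (rule h(2))
  show "hyperRes_trans C R n S k (acls (n + int k) (shift_res C k S) \<phi>) =
      acls (n + int (Suc k)) (shift_res C (Suc k) S) (conn_id (n + int k) (shift_res C k S) \<phi>)"
    using h(1) unfolding e(1) hyperRes_trans_def by (simp add: shift_simps)
qed

text \<open>Surjectivity truncates an almost chain map beyond the last failure of its chain
  condition. For injectivity, a nullhomotopy of the extension is valid from some degree on, and far
  enough along the system the element has become the truncation to that range.\<close>

lemma hyperRes_cone:
  assumes S: "is_res S"
  shows "limit_cone (hyperRes_sys C R n S) (hyperRes_trans C R n S) (hyper_grp C cofinite n R S) (hat n S)"
proof (rule limit_cone.intro)
  note [simp] = S
  let ?S = "\<lambda>k. shift_res C k S"
  note S' = is_res_shift[OF S]
  show "comm_group (hyperRes_sys C R n S k)" for k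
    unfolding hyperRes_sys_def by (rule hyper_group[OF S' shiftable_every])
  show "comm_group (hyper_grp C cofinite n R S)" by (rule hyper_group[OF S shiftable_cofinite])
  show "hyperRes_trans C R n S k \<in> hom (hyperRes_sys C R n S k) (hyperRes_sys C R n S (Suc k))" for k
  proof -
    have e: "n + int (Suc k) = n + int k + 1" by simp
    show ?thesis unfolding hyperRes_trans_def hyperRes_sys_def e
      using hyper_conn_hom[OF S'[of "Suc k"] S'[of k] shiftable_every res_exact[OF S, of k], of "n + int k"]
      by (simp add: shift_simps)
  qed
  show "hat n S k \<in> hom (hyperRes_sys C R n S k) (hyper_grp C cofinite n R S)" for k
  proof (rule homI)
    fix X assume "X \<in> carrier (hyperRes_sys C R n S k)"
    then obtain \<phi> where \<phi>: "achain (n + int k) (?S k) \<phi>" "X = acls (n + int k) (?S k) \<phi>" by (rule hyperRes_sysE[OF S])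
    show "hat n S k X \<in> carrier (hyper_grp C cofinite n R S)"
      unfolding \<phi>(2) hat_cls[OF S \<phi>(1)] by (rule cls_in[OF S shiftable_cofinite ext_chain[OF S \<phi>(1)]])
    fix Y assume "Y \<in> carrier (hyperRes_sys C R n S k)"
    then obtain \<psi> where \<psi>: "achain (n + int k) (?S k) \<psi>" "Y = acls (n + int k) (?S k) \<psi>" by (rule hyperRes_sysE[OF S])
    have "ext n k S (\<lambda>j. \<phi> j \<boxplus> \<psi> j) = (\<lambda>j. ext n k S \<phi> j \<boxplus> ext n k S \<psi> j)"
      using chainD(2-4)[OF \<phi>(1)] chainD(2-4)[OF \<psi>(1)] by (auto simp: fun_eq_iff ext_def)
    thus "hat n S k (X \<otimes>\<^bsub>hyperRes_sys C R n S k\<^esub> Y) = hat n S k X \<otimes>\<^bsub>hyper_grp C cofinite n R S\<^esub> hat n S k Y"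
      unfolding \<phi>(2) \<psi>(2) hyperRes_sys_def hyper_mult[OF S' shiftable_every \<phi>(1) \<psi>(1)]
        hat_cls[OF S \<phi>(1)] hat_cls[OF S \<psi>(1)] hat_cls[OF S chain_add[OF S' shiftable_every \<phi>(1) \<psi>(1)]]
        hyper_mult[OF S shiftable_cofinite ext_chain[OF S \<phi>(1)] ext_chain[OF S \<psi>(1)]] by simp
  qed
  show "hat n S (Suc k) (hyperRes_trans C R n S k X) = hat n S k X" if X: "X \<in> carrier (hyperRes_sys C R n S k)" for k X
  proof -
    obtain \<phi> where \<phi>: "achain (n + int k) (?S k) \<phi>" "X = acls (n + int k) (?S k) \<phi>" using X by (rule hyperRes_sysE[OF S])
    note t = hyperRes_trans_cls[OF S \<phi>(1)]
    have "\<forall>\<^sub>F j in cofinite. ext n (Suc k) S (conn_id (n + int k) (?S k) \<phi>) j = ext n k S \<phi> j"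
    proof (rule eventually_cofinite_int)
      fix m assume m: "m > int k"
      have [simp]: "\<phi> (m - int k) \<in> Arr C" using chainD(2)[OF \<phi>(1)] .
      \<comment> \<open>The recursion that determines the exponent: the two extensions differ by
        \<open>n + m + 1\<close>, the connecting map adds \<open>n + m - 1\<close>, and the sum is
        even.\<close>
      have "even (int (Suc k) * (n + m + 1) + (n + int k + (m - int (Suc k))) - int k * (n + m + 1))"
        by (simp add: algebra_simps)
      from msign_cong[OF this, of "\<phi> (m - int k)"] m
      show "ext n (Suc k) S (conn_id (n + int k) (?S k) \<phi>) m = ext n k S \<phi> m"
        by (simp add: ext_def conn_id_def)
    qed (auto simp: ext_def)
    from cls_cong[OF S shiftable_cofinite ext_chain[OF S t(2)] ext_chain[OF S \<phi>(1)] this]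
    show ?thesis unfolding \<phi>(2) t(1) hat_cls[OF S t(2)] hat_cls[OF S \<phi>(1)] .
  qed
  fix Y assume "Y \<in> carrier (hyper_grp C cofinite n R S)"
  then obtain \<psi> where \<psi>: "chain cofinite n S \<psi>" "Y = cls cofinite n S \<psi>" by (rule hyperE[OF S shiftable_cofinite])
  obtain k :: nat where k: "\<And>m. m \<ge> int k \<Longrightarrow> diff S m \<cdot> \<psi> m = \<psi> (m - 1) \<cdot> \<partial> n m"
    using eventually_cofinite_int_bound[OF chainD(5)[OF \<psi>(1)]] by blast
  have c: "achain (n + int k) (?S k) (trunc n k S \<psi>)" by (rule trunc_chain[OF S chainD(1)[OF \<psi>(1)]]) (rule k)
  have "\<forall>\<^sub>F j in cofinite. ext n k S (trunc n k S \<psi>) j = \<psi> j"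
  proof (rule eventually_cofinite_int)
    fix m assume "m > int k"
    thus "ext n k S (trunc n k S \<psi>) m = \<psi> m" using chainD(2)[OF \<psi>(1), of m]
      by (simp add: ext_def trunc_def msign_eq)
  next
    fix m :: int assume "m < 0"
    thus "ext n k S (trunc n k S \<psi>) m = \<psi> m"
      by (intro res_cx_unique[OF S, where j = m])
        (auto simp: famD[OF ext_fam[OF S chainD(1)[OF c]]] chainD(2-4)[OF \<psi>(1)])
  qed
  from cls_cong[OF S shiftable_cofinite ext_chain[OF S c] \<psi>(1) this]
  have "hat n S k (acls (n + int k) (?S k) (trunc n k S \<psi>)) = Y" unfolding hat_cls[OF S c] \<psi>(2) .
  moreover have "acls (n + int k) (?S k) (trunc n k S \<psi>) \<in> carrier (hyperRes_sys C R n S k)"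
    unfolding hyperRes_sys_def by (rule cls_in[OF S' shiftable_every c])
  ultimately show "\<exists>k. \<exists>X\<in>carrier (hyperRes_sys C R n S k). hat n S k X = Y" by blast
next
  note [simp] = S
  let ?S = "\<lambda>k. shift_res C k S"
  note S' = is_res_shift[OF S]
  fix X k assume "X \<in> carrier (hyperRes_sys C R n S k)" and h: "hat n S k X = \<one>\<^bsub>hyper_grp C cofinite n R S\<^esub>"
  then obtain \<phi> where \<phi>: "achain (n + int k) (?S k) \<phi>" "X = acls (n + int k) (?S k) \<phi>" by (metis hyperRes_sysE[OF S])
  define \<psi> where "\<psi> = ext n k S \<phi>"
  have \<psi>: "chain cofinite n S \<psi>" unfolding \<psi>_def by (rule ext_chain[OF S \<phi>(1)])
  note [simp] = chainD(2-4)[OF \<psi>]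
  have "homotopic cofinite n S \<psi> (zfam n S)"
    using h hat_cls[OF S \<phi>(1)] cls_eq[OF S shiftable_cofinite \<psi> chain_zfam[OF S shiftable_cofinite]]
    unfolding \<phi>(2) \<psi>_def[symmetric] hyper_one[OF S shiftable_cofinite] by simp
  then obtain e where e: "fam (P n) (\<lambda>j. cx S (j + 1)) e" and
    ev: "\<forall>\<^sub>F j in cofinite. \<psi> j = zfam n S j \<boxplus> (e (j - 1) \<cdot> \<partial> n j \<boxplus> diff S (j + 1) \<cdot> e j)"
    unfolding homotopic_def by blast
  note [simp] = famD[OF e]
  obtain N :: nat where N: "\<And>m. m \<ge> int N \<Longrightarrow> \<psi> m = zfam n S m \<boxplus> (e (m - 1) \<cdot> \<partial> n m \<boxplus> diff S (m + 1) \<cdot> e m)"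
    using eventually_cofinite_int_bound[OF ev] by blast
  \<comment> \<open>Moving \<open>X\<close> along the system amounts to truncating its own extension
    by zero ever further out, with the signs matching at each stage.\<close>
  have t: "k \<le> l \<Longrightarrow> achain (n + int l) (?S l) (trunc n l S \<psi>) \<and>
      transition (hyperRes_trans C R n S) k l X = acls (n + int l) (?S l) (trunc n l S \<psi>)" for l
  proof (induction l rule: dec_induct)
    case base
    have "trunc n k S \<psi> = \<phi>"
    proof
      fix j
      show "trunc n k S \<psi> j = \<phi> j"
      proof (cases "j \<ge> 0")
        case True
        thus ?thesis using chainD(2)[OF \<phi>(1), of j] by (simp add: trunc_def \<psi>_def ext_def msign_eq)
      next
        case False
        thus ?thesis
          by (intro res_cx_unique[OF S'[of k], where j = j])
            (auto simp: chainD(2-4)[OF \<phi>(1)] famD[OF trunc_fam[OF S chainD(1)[OF \<psi>]]])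
      qed
    qed
    thus ?case using \<phi> by (simp add: transition_def)
  next
    case (step l)
    hence IH: "achain (n + int l) (?S l) (trunc n l S \<psi>)"
      "transition (hyperRes_trans C R n S) k l X = acls (n + int l) (?S l) (trunc n l S \<psi>)" by auto
    note tr = hyperRes_trans_cls[OF S IH(1)]
    have "conn_id (n + int l) (?S l) (trunc n l S \<psi>) j = trunc n (Suc l) S \<psi> j" for j
    proof (cases "j \<ge> 0")
      case True
      have "even (n + int l + j + int l * (n + (j + 1) + int l + 1) - int (Suc l) * (n + j + int (Suc l) + 1))"
        by (simp add: algebra_simps)
      from msign_cong[OF this, of "\<psi> (j + 1 + int l)"] True show ?thesis
        by (simp add: conn_id_def trunc_def algebra_simps)
    next
      case False
      thus ?thesis by (simp add: conn_id_def trunc_def shift_simps algebra_simps)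
    qed
    hence "conn_id (n + int l) (?S l) (trunc n l S \<psi>) = trunc n (Suc l) S \<psi>" ..
    with tr IH(2) step(1) show ?case by (simp add: transition_def)
  qed
  define l where "l = max k N"
  have "homotopic every_degree (n + int l) (?S l) (trunc n l S \<psi>) (zfam (n + int l) (?S l))"
    by (rule trunc_null[OF S chainD(1)[OF \<psi>] e]) (use N in \<open>auto simp: l_def add_diff_eq\<close>)
  hence "transition (hyperRes_trans C R n S) k l X = \<one>\<^bsub>hyperRes_sys C R n S l\<^esub>"
    using t[of l] cls_eq[OF S' shiftable_every _ chain_zfam[OF S' shiftable_every], of "n + int l" l "trunc n l S \<psi>"]
    by (simp add: hyperRes_sys_def hyper_one[OF S' shiftable_every] l_def)
  thus "\<exists>l\<ge>k. transition (hyperRes_trans C R n S) k l X = \<one>\<^bsub>hyperRes_sys C R n S l\<^esub>"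
    by (intro exI[of _ l]) (simp add: l_def)
qed

text \<open>The lift at level \<open>k\<close> consists of the components of \<open>u\<close> moved
  by \<open>k\<close> degrees, so extension by zero commutes with composition on the nose.\<close>

lemma hat_map:
  assumes S: "is_res S" "is_res S'" and f: "f \<in> Arr C" "Dom C f = syz S 0" "Cod C f = syz S' 0"
    and v: "syz_lifts C S S' f u v" and X: "X \<in> carrier (hyperRes_sys C R n S k)"
  shows "hyper_map C every_degree (n + int k) R (shift_res C k S) (shift_res C k S') (v k) X \<in> carrier (hyperRes_sys C R n S' k)"
    "hat n S' k (hyper_map C every_degree (n + int k) R (shift_res C k S) (shift_res C k S') (v k) X) =
      hyper_map C cofinite n R S S' f (hat n S k X)"
proof -
  let ?S = "shift_res C k S" and ?S' = "shift_res C k S'" and ?u = "\<lambda>j. if j \<ge> 0 then u (j + int k) else u j"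
  note SS = is_res_shift[OF S(1), of k] is_res_shift[OF S(2), of k]
  note u = syz_liftsD(1)[OF v] and u' = syz_liftsD(1)[OF syz_lifts_shift[OF S v f, of k]]
  obtain \<phi> where \<phi>: "achain (n + int k) ?S \<phi>" "X = acls (n + int k) ?S \<phi>" using X by (rule hyperRes_sysE[OF S(1)])
  note c = chain_comp[OF SS u' \<phi>(1)]
  note [simp] = S chainD(2)[OF \<phi>(1)] chainD(3)[OF \<phi>(1)] liftsD(2-4)[OF u]
  have [simp]: "Cod C (\<phi> (m - int k)) = cx S m" if "m \<ge> int k" for m
    using chainD(4)[OF \<phi>(1), of "m - int k"] that by (simp add: shift_simps)
  show "hyper_map C every_degree (n + int k) R ?S ?S' (v k) X \<in> carrier (hyperRes_sys C R n S' k)"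
    unfolding \<phi>(2) hyper_map_cls[OF SS shiftable_every u' \<phi>(1)] hyperRes_sys_def by (rule cls_in[OF SS(2) shiftable_every c])
  have "ext n k S' (\<lambda>j. ?u j \<cdot> \<phi> j) = (\<lambda>j. u j \<cdot> ext n k S \<phi> j)" by (auto simp: fun_eq_iff ext_def)
  thus "hat n S' k (hyper_map C every_degree (n + int k) R ?S ?S' (v k) X) = hyper_map C cofinite n R S S' f (hat n S k X)"
    unfolding \<phi>(2) hyper_map_cls[OF SS shiftable_every u' \<phi>(1)] hat_cls[OF S(2) c] hat_cls[OF S(1) \<phi>(1)]
      hyper_map_cls[OF S shiftable_cofinite u ext_chain[OF S(1) \<phi>(1)]] by simp
qed

lemma gsign_cls:
  assumes S: "is_res S" and F: "shiftable F" and \<phi>: "chain F n S \<phi>"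
  shows "gsign (hyper_grp C F n R S) k (cls F n S \<phi>) = cls F n S (\<lambda>j. msign C (int k) (\<phi> j))"
    "chain F n S (\<lambda>j. msign C (int k) (\<phi> j))"
proof -
  note [simp] = S chainD(2-4)[OF \<phi>]
  interpret G: comm_group "hyper_grp C F n R S" by (rule hyper_group[OF S F])
  have neg: "chain F n S (\<lambda>j. neg (\<phi> j))"
    using subgroup.m_inv_closed[OF subquotient.K[OF hyper_subquotient[OF S F]], of \<phi> n] \<phi>
    by (simp add: chain_maps_chain[OF S] degree_inv[OF S chainD(1)[OF \<phi>]])
  have "inv\<^bsub>hyper_grp C F n R S\<^esub> (cls F n S \<phi>) = cls F n S (\<lambda>j. neg (\<phi> j))"
    by (rule G.inv_equality) (simp_all add: hyper_mult[OF S F neg \<phi>] hyper_one[OF S F] cls_in[OF S F] neg \<phi>)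
  thus "gsign (hyper_grp C F n R S) k (cls F n S \<phi>) = cls F n S (\<lambda>j. msign C (int k) (\<phi> j))"
    "chain F n S (\<lambda>j. msign C (int k) (\<phi> j))"
    using neg \<phi> by (cases "even k"; simp add: gsign_def msign_eq)+
qed

text \<open>All rows of a horseshoe have connecting maps represented by the same
  \<open>\<theta>\<close>, so level \<open>k\<close> and level 0 differ by a sign only. The sign
  \<open>(-1)^k\<close> in the connecting maps of the limits is exactly what makes them
  agree.\<close>

lemma hat_conn:
  assumes S: "is_res S" "is_res Q" and ep: "enough_projectives C"
    and fg: "short_exact C f g" "Dom C f = syz S 0" "Cod C g = syz Q 0"
    and h: "horseshoe S H Q f g u w i p" and X: "X \<in> carrier (hyperRes_sys C R n Q k)"
  defines "Y \<equiv> gsign (hyperRes_sys C R (n + 1) S k) k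
     (hyper_conn C every_degree (n + int k) R (shift_res C k S) (shift_res C k Q) (i k) (p k) X)"
  shows "Y \<in> carrier (hyperRes_sys C R (n + 1) S k)"
    "hat (n + 1) S k Y = hyper_conn C cofinite n R S Q f g (hat n Q k X)"
proof -
  let ?S = "shift_res C k S" and ?Q = "shift_res C k Q"
  note SS = is_res_shift[OF S(1), of k] is_res_shift[OF S(2), of k]
  have H: "is_res H" "Cod C f = syz H 0" and i: "syz_lifts C S H f u i" and p: "syz_lifts C H Q g w p"
    using h by (auto simp: horseshoe_def)
  note fg' = short_exactD(1,2)[OF fg(1)] and Dg = short_exactD(3)[OF fg(1), unfolded H(2)]
  note ia = syz_lifts_arr[OF i fg'(1) fg(2) H(2)] and pa = syz_lifts_arr[OF p fg'(2) Dg fg(3)]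
  obtain r s where "split_resolutions C R S H Q u w r s" using horseshoe_split[OF S h] .
  then interpret sp: split_resolutions C R S H Q u w r s .
  note ip = horseshoe_short_exact[OF ep S fg h]
  note d' = sp.\<theta>_conn_data[OF i p fg'(1) fg(2) H(2) fg'(2) Dg fg(3) ip]
  obtain a b where d: "conn_data ?S ?Q (i k) (p k) a b (sp.hs k)" using d'[of k] by blast
  obtain a0 b0 where d0: "conn_data S Q f g a0 b0 (sp.hs 0)"
    using d'[of 0] syz_liftsD(2)[OF i] syz_liftsD(2)[OF p] by (auto simp: shift_0 S)
  obtain \<phi> where \<phi>: "achain (n + int k) ?Q \<phi>" "X = acls (n + int k) ?Q \<phi>" using X by (rule hyperRes_sysE[OF S(2)])
  have e: "n + 1 + int k = n + int k + 1" by simp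
  define \<chi> where "\<chi> = conn_fam (n + int k) ?S (sp.hs k) \<phi>"
  have \<chi>: "achain (n + 1 + int k) ?S \<chi>" unfolding \<chi>_def e by (rule chain_conn[OF SS shiftable_every conn_dataD(9)[OF d] \<phi>(1)])
  have "hyper_conn C every_degree (n + int k) R ?S ?Q (i k) (p k) X = acls (n + 1 + int k) ?S \<chi>"
    unfolding \<phi>(2) \<chi>_def e by (rule hyper_conn_cls[OF SS shiftable_every ip _ _ d \<phi>(1)]) (auto simp: shift_simps ia pa)
  hence Y: "Y = acls (n + 1 + int k) ?S (\<lambda>j. msign C (int k) (\<chi> j))"
    unfolding Y_def hyperRes_sys_def using gsign_cls(1)[OF SS(1) shiftable_every \<chi>] by simp
  note c = gsign_cls(2)[OF SS(1) shiftable_every \<chi>, of k]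
  show "Y \<in> carrier (hyperRes_sys C R (n + 1) S k)"
    unfolding Y hyperRes_sys_def by (rule cls_in[OF SS(1) shiftable_every c])
  note ec = ext_chain[OF S(2) \<phi>(1)]
  note cc = chain_conn[OF S shiftable_cofinite conn_dataD(9)[OF d0] ec]
  have \<phi>': "\<phi> j \<in> Arr C \<and> Cod C (\<phi> j) = cx Q (j + int k)" if "j \<ge> 0" for j
    using chainD(2,4)[OF \<phi>(1), of j] that by (simp add: shift_simps)
  have "\<forall>\<^sub>F j in cofinite. ext (n + 1) k S (\<lambda>j. msign C (int k) (\<chi> j)) j = conn_fam n S (sp.hs 0) (ext n k Q \<phi>) j"
  proof (rule eventually_cofinite_int)
    fix m assume m: "m > int k"
    have 1: "\<chi> (m - int k) = msign C (n + int k + 1) (sp.\<theta> (m + 1) \<cdot> \<phi> (m + 1 - int k))"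
      unfolding \<chi>_def using sp.conn_fam_hs[OF \<phi>', of "m - int k" "n + int k" ?S] m by (simp add: algebra_simps)
    have 2: "conn_fam n S (sp.hs 0) (ext n k Q \<phi>) m = msign C (n + 1) (sp.\<theta> (m + 1) \<cdot> msign C (int k * (n + (m + 1) + 1)) (\<phi> (m + 1 - int k)))"
      unfolding sp.conn_fam_hs0[OF chainD(1)[OF ec]] sp.\<Theta>_def using m by (simp add: ext_def)
    have [simp]: "\<phi> (m + 1 - int k) \<in> Arr C" "Cod C (\<phi> (m + 1 - int k)) = cx Q (m + 1)" using \<phi>'[of "m + 1 - int k"] m by auto
    \<comment> \<open>One \<open>k\<close> comes from \<open>gsign\<close> and another from applying
      the connecting map in degree \<open>n + int k\<close> instead of \<open>n\<close>; together
      they are even, and the two extension signs coincide.\<close>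
    have "even (int k * (n + 1 + m + 1) + (int k + (n + int k + 1)) - (n + 1 + int k * (n + (m + 1) + 1)))"
      by (simp add: algebra_simps)
    from msign_cong[OF this, of "sp.\<theta> (m + 1) \<cdot> \<phi> (m + 1 - int k)"] m
    show "ext (n + 1) k S (\<lambda>j. msign C (int k) (\<chi> j)) m = conn_fam n S (sp.hs 0) (ext n k Q \<phi>) m"
      unfolding 2 unfolding ext_def 1 by simp
  next
    fix m :: int assume "m < 0"
    thus "ext (n + 1) k S (\<lambda>j. msign C (int k) (\<chi> j)) m = conn_fam n S (sp.hs 0) (ext n k Q \<phi>) m"
      by (intro res_cx_unique[OF S(1), where j = m])
        (auto simp: chainD(2-4)[OF cc] chainD(2-4)[OF ext_chain[OF S(1) c]])
  qed
  from cls_cong[OF S(1) shiftable_cofinite ext_chain[OF S(1) c] cc this]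
  show "hat (n + 1) S k Y = hyper_conn C cofinite n R S Q f g (hat n Q k X)"
    unfolding Y hat_cls[OF S(1) c] \<phi>(2) hat_cls[OF S(2) \<phi>(1)] hyper_conn_cls[OF S shiftable_cofinite fg d0 ec] .
qed

end

section \<open>The resolution constructions\<close>

context abelian_category
begin

text \<open>Packages the transport for a functor of direct limits: once its maps are known on
  fibres, the cone supplies groups, bijections and exactness, and any \<open>\<eta>\<close> that
  undoes \<open>fib\<close> is an isomorphism.\<close>

lemma cone_isomorphism:
  assumes T: "coh_functor C T"
    and cone: "\<And>n a. a \<in> Obj C \<Longrightarrow> limit_cone (G n a) (t n a) (coh_grp T n a) (s n a)"
    and grp: "\<And>n a. coh_grp U n a = lim_grp (G n a) (t n a)"
    and map: "\<And>n f z. \<lbrakk>f \<in> Arr C; z \<in> carrier (coh_grp T n (Dom C f))\<rbrakk> \<Longrightarrow>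
      coh_map U n f (limit_cone.fib (G n (Dom C f)) (s n (Dom C f)) z) =
      limit_cone.fib (G n (Cod C f)) (s n (Cod C f)) (coh_map T n f z)"
    and conn: "\<And>n f g z. \<lbrakk>short_exact C f g; z \<in> carrier (coh_grp T n (Cod C g))\<rbrakk> \<Longrightarrow>
      coh_conn U n f g (limit_cone.fib (G n (Cod C g)) (s n (Cod C g)) z) =
      limit_cone.fib (G (n + 1) (Dom C f)) (s (n + 1) (Dom C f)) (coh_conn T n f g z)"
    and \<eta>: "\<And>n a z. \<lbrakk>a \<in> Obj C; z \<in> carrier (coh_grp T n a)\<rbrakk> \<Longrightarrow> \<eta> n a (limit_cone.fib (G n a) (s n a) z) = z"
  shows "coh_isomorphism C U T \<eta>"
proof (rule coh_transport[OF T])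
  fix n a assume a: "a \<in> Obj C"
  note L = cone[OF a, of n]
  show "comm_group (coh_grp U n a)" unfolding grp by (rule limit_cone.lim_comm_group[OF L])
  show "bij_betw (\<eta> n a) (carrier (coh_grp U n a)) (carrier (coh_grp T n a))"
    unfolding grp by (rule limit_cone.fib_iso(1)[OF L \<eta>[OF a]])
  fix x y assume "x \<in> carrier (coh_grp U n a)" "y \<in> carrier (coh_grp U n a)"
  thus "\<eta> n a (x \<otimes>\<^bsub>coh_grp U n a\<^esub> y) = \<eta> n a x \<otimes>\<^bsub>coh_grp T n a\<^esub> \<eta> n a y"
    unfolding grp by (intro limit_cone.fib_iso(2)[OF L]) (use \<eta>[OF a] in auto)
next
  fix n f x assume f: "f \<in> Arr C" and x: "x \<in> carrier (coh_grp U n (Dom C f))"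
  note L = cone[OF Dom_Obj[OF f], of n] and L' = cone[OF Cod_Obj[OF f], of n]
  obtain z where z: "z \<in> carrier (coh_grp T n (Dom C f))" "x = limit_cone.fib (G n (Dom C f)) (s n (Dom C f)) z"
    using x unfolding grp limit_cone.lim_carrier[OF L] by blast
  have fz: "coh_map T n f z \<in> carrier (coh_grp T n (Cod C f))" using hom_in_carrier[OF coh_functorD(2)[OF T f] z(1)] .
  show "coh_map U n f x \<in> carrier (coh_grp U n (Cod C f)) \<and> \<eta> n (Cod C f) (coh_map U n f x) = coh_map T n f (\<eta> n (Dom C f) x)"
    unfolding z(2) map[OF f z(1)] \<eta>[OF Dom_Obj[OF f] z(1)] \<eta>[OF Cod_Obj[OF f] fz] grp limit_cone.lim_carrier[OF L']
    using fz by simp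
next
  fix n f g x assume fg: "short_exact C f g" and x: "x \<in> carrier (coh_grp U n (Cod C g))"
  note fgA = short_exactD(1,2)[OF fg]
  note L = cone[OF Cod_Obj[OF fgA(2)], of n] and L' = cone[OF Dom_Obj[OF fgA(1)], of "n + 1"]
  obtain z where z: "z \<in> carrier (coh_grp T n (Cod C g))" "x = limit_cone.fib (G n (Cod C g)) (s n (Cod C g)) z"
    using x unfolding grp limit_cone.lim_carrier[OF L] by blast
  have fz: "coh_conn T n f g z \<in> carrier (coh_grp T (n + 1) (Dom C f))" using hom_in_carrier[OF coh_functorD(6)[OF T fg] z(1)] .
  show "coh_conn U n f g x \<in> carrier (coh_grp U (n + 1) (Dom C f)) \<and>
    \<eta> (n + 1) (Dom C f) (coh_conn U n f g x) = coh_conn T n f g (\<eta> n (Cod C g) x)"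
    unfolding z(2) conn[OF fg z(1)] \<eta>[OF Cod_Obj[OF fgA(2)] z(1)] \<eta>[OF Dom_Obj[OF fgA(1)] fz] grp limit_cone.lim_carrier[OF L']
    using fz by simp
qed

end

section \<open>The cone on the system of Ext groups\<close>

context resolved_object
begin

abbreviation "sig n S k \<equiv> \<lambda>x. hat n S k (zeta_level C R (shift_res C k S) (n + int k) x)"

lemma zeta_in: "is_res S \<Longrightarrow> X \<in> carrier (Ext_grp C R n (syz S 0)) \<Longrightarrow> zeta_level C R S n X \<in> carrier (hyper_grp C every_degree n R S)"
  using zeta_level_bij[of S n] by (auto simp: bij_betw_def)

lemma zeta_gsign:
  assumes S: "is_res S" and X: "X \<in> carrier (Ext_grp C R n (syz S 0))"
  shows "gsign (Ext_grp C R n (syz S 0)) k X \<in> carrier (Ext_grp C R n (syz S 0))"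
    "zeta_level C R S n (gsign (Ext_grp C R n (syz S 0)) k X) = gsign (hyper_grp C every_degree n R S) k (zeta_level C R S n X)"
proof -
  have "group_hom (Ext_grp C R n (syz S 0)) (hyper_grp C every_degree n R S) (zeta_level C R S n)"
    by (intro group_hom.intro group_hom_axioms.intro comm_group.axioms(2) Ext_group hyper_group homI zeta_in zeta_level_mult)
      (use S in auto)
  thus "zeta_level C R S n (gsign (Ext_grp C R n (syz S 0)) k X) = gsign (hyper_grp C every_degree n R S) k (zeta_level C R S n X)"
    using X by (simp add: gsign_def group_hom.hom_inv)
  show "gsign (Ext_grp C R n (syz S 0)) k X \<in> carrier (Ext_grp C R n (syz S 0))"
    using X group.inv_closed[OF comm_group.axioms(2)[OF Ext_group[OF res_syz[OF S]]]] by (simp add: gsign_def)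
qed

lemma ExtRes_cone:
  assumes S: "is_res S"
  shows "limit_cone (ExtRes_sys C R n S) (ExtRes_trans C R n S) (hyper_grp C cofinite n R S) (sig n S)"
proof (rule limit_cone_pullback[OF hyperRes_cone[OF S, of n]])
  note S' = is_res_shift[OF S]
  have syz: "syz (shift_res C k S) 0 = syz S k" for k by (simp add: shift_simps)
  show "comm_group (ExtRes_sys C R n S k)" for k unfolding ExtRes_sys_def by (rule Ext_group[OF res_syz[OF S]])
  show "bij_betw (zeta_level C R (shift_res C k S) (n + int k)) (carrier (ExtRes_sys C R n S k)) (carrier (hyperRes_sys C R n S k))" for k
    using zeta_level_bij[OF S', of k "n + int k"] by (simp add: syz ExtRes_sys_def hyperRes_sys_def)
  show "zeta_level C R (shift_res C k S) (n + int k) (x \<otimes>\<^bsub>ExtRes_sys C R n S k\<^esub> y) =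
     zeta_level C R (shift_res C k S) (n + int k) x \<otimes>\<^bsub>hyperRes_sys C R n S k\<^esub> zeta_level C R (shift_res C k S) (n + int k) y"
    if "x \<in> carrier (ExtRes_sys C R n S k)" "y \<in> carrier (ExtRes_sys C R n S k)" for k x y
    using zeta_level_mult[OF S', of x "n + int k" k y] that by (simp add: syz ExtRes_sys_def hyperRes_sys_def)
  fix k x assume "x \<in> carrier (ExtRes_sys C R n S k)"
  hence x: "x \<in> carrier (Ext_grp C R (n + int k) (syz (shift_res C k S) 0))" by (simp add: syz ExtRes_sys_def)
  have e: "n + int (Suc k) = n + int k + 1" by simp
  have D: "Dom C (syz_in S k) = syz (shift_res C (Suc k) S) 0" "Cod C (syz_pr S k) = syz (shift_res C k S) 0"
    using S by (auto simp: syz)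
  show "ExtRes_trans C R n S k x \<in> carrier (ExtRes_sys C R n S (Suc k)) \<and>
    zeta_level C R (shift_res C (Suc k) S) (n + int (Suc k)) (ExtRes_trans C R n S k x) =
    hyperRes_trans C R n S k (zeta_level C R (shift_res C k S) (n + int k) x)"
    unfolding e ExtRes_sys_def ExtRes_trans_def hyperRes_trans_def
    using zeta_level_conn[OF S' S' res_exact[OF S, of k] D x] by (simp add: syz)
qed

lemma sig_map:
  assumes S: "is_res S" "is_res S'" and f: "f \<in> Arr C" "Dom C f = syz S 0" "Cod C f = syz S' 0"
    and v: "syz_lifts C S S' f u v" and x: "x \<in> carrier (ExtRes_sys C R n S k)"
  shows "Ext_map C R (n + int k) (v k) x \<in> carrier (ExtRes_sys C R n S' k)"
    "sig n S' k (Ext_map C R (n + int k) (v k) x) = hyper_map C cofinite n R S S' f (sig n S k x)"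
proof -
  note SS = is_res_shift[OF S(1), of k] is_res_shift[OF S(2), of k]
  have syz: "syz (shift_res C k S) 0 = syz S k" "syz (shift_res C k S') 0 = syz S' k" by (auto simp: shift_simps)
  have x': "x \<in> carrier (Ext_grp C R (n + int k) (syz (shift_res C k S) 0))" using x by (simp add: syz ExtRes_sys_def)
  note va = syz_lifts_arr[OF v f, of k, folded syz]
  note z = zeta_level_map[OF SS va x']
  show "Ext_map C R (n + int k) (v k) x \<in> carrier (ExtRes_sys C R n S' k)"
    using z(1) by (simp add: syz ExtRes_sys_def)
  have "zeta_level C R (shift_res C k S) (n + int k) x \<in> carrier (hyperRes_sys C R n S k)"
    using zeta_in[OF SS(1) x'] by (simp add: hyperRes_sys_def)
  thus "sig n S' k (Ext_map C R (n + int k) (v k) x) = hyper_map C cofinite n R S S' f (sig n S k x)"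
    unfolding z(2) by (rule hat_map(2)[OF S f v])
qed

lemma sig_conn:
  assumes S: "is_res S" "is_res Q" and ep: "enough_projectives C"
    and fg: "short_exact C f g" "Dom C f = syz S 0" "Cod C g = syz Q 0"
    and h: "horseshoe S H Q f g u w i p" and x: "x \<in> carrier (ExtRes_sys C R n Q k)"
  defines "y \<equiv> gsign (ExtRes_sys C R (n + 1) S k) k (Ext_conn C R (n + int k) (i k) (p k) x)"
  shows "y \<in> carrier (ExtRes_sys C R (n + 1) S k)"
    "sig (n + 1) S k y = hyper_conn C cofinite n R S Q f g (sig n Q k x)"
proof -
  note SS = is_res_shift[OF S(1), of k] is_res_shift[OF S(2), of k]
  have syz: "syz (shift_res C k S) 0 = syz S k" "syz (shift_res C k Q) 0 = syz Q k" by (auto simp: shift_simps)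
  have H: "is_res H" "Cod C f = syz H 0" and i: "syz_lifts C S H f u i" and p: "syz_lifts C H Q g w p"
    using h by (auto simp: horseshoe_def)
  note fg' = short_exactD(1,2)[OF fg(1)] and Dg = short_exactD(3)[OF fg(1), unfolded H(2)]
  have ip: "short_exact C (i k) (p k)" "Dom C (i k) = syz (shift_res C k S) 0" "Cod C (p k) = syz (shift_res C k Q) 0"
    using horseshoe_short_exact[OF ep S fg h] syz_lifts_arr[OF i fg'(1) fg(2) H(2)] syz_lifts_arr[OF p fg'(2) Dg fg(3)] syz by auto
  have x': "x \<in> carrier (Ext_grp C R (n + int k) (syz (shift_res C k Q) 0))" using x by (simp add: syz ExtRes_sys_def)
  note z = zeta_level_conn[OF SS ip x']
  have e: "n + 1 + int k = n + int k + 1" by simp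
  have y: "y = gsign (Ext_grp C R (n + int k + 1) (syz (shift_res C k S) 0)) k (Ext_conn C R (n + int k) (i k) (p k) x)"
    unfolding y_def ExtRes_sys_def syz e ..
  show "y \<in> carrier (ExtRes_sys C R (n + 1) S k)"
    using zeta_gsign(1)[OF SS(1) z(1)] unfolding y ExtRes_sys_def e syz .
  have "zeta_level C R (shift_res C k Q) (n + int k) x \<in> carrier (hyperRes_sys C R n Q k)"
    using zeta_in[OF SS(2) x'] by (simp add: hyperRes_sys_def)
  from hat_conn(2)[OF S ep fg h this]
  show "sig (n + 1) S k y = hyper_conn C cofinite n R S Q f g (sig n Q k x)"
    unfolding y zeta_gsign(2)[OF SS(1) z(1)] z(2) e hyperRes_sys_def .
qed

text \<open>At an even level the sign of \<open>ext\<close> is trivial, so the unsigned extension in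
  the definition is \<open>hat\<close>. A representative at level \<open>k\<close> reaches an even
  one by moving on to level \<open>2 * k\<close>, so the set of values is not empty.\<close>

lemma vartheta_fib:
  assumes S: "is_res S" and z: "z \<in> carrier (hyper_grp C cofinite n R S)"
  shows "the_elem {cls cofinite n S (\<lambda>m. if m \<ge> 2 * int k then \<phi> (m - 2 * int k) else mzero C (cx R (n + m)) (cx S m)) | k x \<phi>.
      (2 * k, x) \<in> limit_cone.fib (hyperRes_sys C R n S) (hat n S) z \<and> \<phi> \<in> x} = z"
proof -
  interpret L: limit_cone "hyperRes_sys C R n S" "hyperRes_trans C R n S" "hyper_grp C cofinite n R S" "hat n S"
    by (rule hyperRes_cone[OF S])
  have *: "cls cofinite n S (\<lambda>m. if m \<ge> 2 * int k then \<phi> (m - 2 * int k) else mzero C (cx R (n + m)) (cx S m)) = z"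
    if kx: "(2 * k, x) \<in> L.fib z" and \<phi>: "\<phi> \<in> x" for k x \<phi>
  proof -
    have x: "x \<in> carrier (hyperRes_sys C R n S (2 * k))" "hat n S (2 * k) x = z" using kx by (auto simp: L.fib_def)
    obtain \<psi> where \<psi>: "achain (n + int (2 * k)) (shift_res C (2 * k) S) \<psi>" "x = acls (n + int (2 * k)) (shift_res C (2 * k) S) \<psi>"
      using x(1) by (rule hyperRes_sysE[OF S])
    have \<phi>': "achain (n + int (2 * k)) (shift_res C (2 * k) S) \<phi>" "x = acls (n + int (2 * k)) (shift_res C (2 * k) S) \<phi>"
      using \<phi> \<psi>(2) cls_mem[OF is_res_shift[OF S] shiftable_every \<psi>(1)] by auto
    have "ext n (2 * k) S \<phi> = (\<lambda>m. if m \<ge> 2 * int k then \<phi> (m - 2 * int k) else mzero C (cx R (n + m)) (cx S m))"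
      by (auto simp: fun_eq_iff ext_def msign_eq)
    thus ?thesis using x(2) hat_cls[OF S \<phi>'(1)] \<phi>'(2) by simp
  qed
  obtain k x where x: "x \<in> carrier (hyperRes_sys C R n S k)" "hat n S k x = z" using L.surj[OF z] by blast
  let ?y = "transition (hyperRes_trans C R n S) k (2 * k) x"
  have y: "?y \<in> carrier (hyperRes_sys C R n S (2 * k))" by (rule L.transition_in) (use x in auto)
  hence "(2 * k, ?y) \<in> L.fib z" using L.s_transition[of k "2 * k" x] x by (simp add: L.fib_def)
  moreover obtain \<phi> where "\<phi> \<in> ?y"
  proof -
    obtain \<psi> where "achain (n + int (2 * k)) (shift_res C (2 * k) S) \<psi>" "?y = acls (n + int (2 * k)) (shift_res C (2 * k) S) \<psi>"
      using y by (rule hyperRes_sysE[OF S])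
    thus ?thesis using that cls_mem[OF is_res_shift[OF S] shiftable_every] by blast
  qed
  ultimately show ?thesis using * by (intro the_elem_eqI) (blast, blast)
qed

end

section \<open>The comparison morphisms on fibres\<close>

context resolved_category
begin

lemma syz_lifts_ex:
  assumes "f \<in> Arr C" obtains u v where "syz_lifts C (res (Dom C f)) (res (Cod C f)) f u v"
proof -
  have S: "is_res (res (Dom C f))" "is_res (res (Cod C f))"
    and f: "f \<in> Arr C" "Dom C f = syz (res (Dom C f)) 0" "Cod C f = syz (res (Cod C f)) 0" using assms by auto
  obtain u where u: "lifts C (res (Dom C f)) (res (Cod C f)) f u" using lifts_exist[OF S f] .
  show ?thesis using syz_lifts_exist[OF S u f] that by blast
qed

context
  fixes A assumes A: "R = res A"
begin

lemma completed_hyper: "completed_hyper_functor C res A = hyper_functor cofinite"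
  by (simp add: completed_hyper_functor_def hyper_functor_def A[symmetric])

abbreviation "hfib n B \<equiv> limit_cone.fib (hyperRes_sys C R n (res B)) (hat n (res B))"
abbreviation "efib n B \<equiv> limit_cone.fib (ExtRes_sys C R n (res B)) (sig n (res B))"

text \<open>The right side mentions no lift, so every admissible choice gives this value, and
  existence of one choice makes it the unique value. The remaining three computations on fibres
  follow the same pattern, with horseshoes in place of lifts for the connecting maps.\<close>

lemma hyperRes_map_fib:
  assumes f: "f \<in> Arr C" and z: "z \<in> carrier (hyper_grp C cofinite n R (res (Dom C f)))"
  shows "coh_map (hyperRes_functor C res A) n f (hfib n (Dom C f) z) =
    hfib n (Cod C f) (hyper_map C cofinite n R (res (Dom C f)) (res (Cod C f)) f z)"
proof -
  let ?S = "res (Dom C f)" and ?S' = "res (Cod C f)"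
  have S: "is_res ?S" "is_res ?S'" and f': "f \<in> Arr C" "Dom C f = syz ?S 0" "Cod C f = syz ?S' 0" using f by auto
  have *: "lim_map (hyperRes_sys C R n ?S') (hyperRes_trans C R n ?S')
      (\<lambda>k. hyper_map C every_degree (n + int k) R (shift_res C k ?S) (shift_res C k ?S') (v k)) (hfib n (Dom C f) z) =
    hfib n (Cod C f) (hyper_map C cofinite n R ?S ?S' f z)" if "syz_lifts C ?S ?S' f u v" for u v
    by (rule lim_map_fib[OF hyperRes_cone[OF S(1)] hyperRes_cone[OF S(2)] _ z]) (use hat_map[OF S f' that] in blast)
  obtain u v where "syz_lifts C ?S ?S' f u v" using syz_lifts_ex[OF f] .
  hence "the_elem {lim_map (hyperRes_sys C R n ?S') (hyperRes_trans C R n ?S')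
      (\<lambda>k. hyper_map C every_degree (n + int k) R (shift_res C k ?S) (shift_res C k ?S') (v k)) (hfib n (Dom C f) z)
      | u v. syz_lifts C ?S ?S' f u v} = hfib n (Cod C f) (hyper_map C cofinite n R ?S ?S' f z)"
    using * by (intro the_elem_eqI) (blast, blast)
  thus ?thesis by (simp add: hyperRes_functor_def Let_def A[symmetric])
qed

lemma ExtRes_map_fib:
  assumes f: "f \<in> Arr C" and z: "z \<in> carrier (hyper_grp C cofinite n R (res (Dom C f)))"
  shows "coh_map (ExtRes_functor C res A) n f (efib n (Dom C f) z) =
    efib n (Cod C f) (hyper_map C cofinite n R (res (Dom C f)) (res (Cod C f)) f z)"
proof -
  let ?S = "res (Dom C f)" and ?S' = "res (Cod C f)"
  have S: "is_res ?S" "is_res ?S'" and f': "f \<in> Arr C" "Dom C f = syz ?S 0" "Cod C f = syz ?S' 0" using f by auto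
  have *: "lim_map (ExtRes_sys C R n ?S') (ExtRes_trans C R n ?S')
      (\<lambda>k. Ext_map C R (n + int k) (v k)) (efib n (Dom C f) z) =
    efib n (Cod C f) (hyper_map C cofinite n R ?S ?S' f z)" if "syz_lifts C ?S ?S' f u v" for u v
    by (rule lim_map_fib[OF ExtRes_cone[OF S(1)] ExtRes_cone[OF S(2)] _ z]) (use sig_map[OF S f' that] in blast)
  obtain u v where "syz_lifts C ?S ?S' f u v" using syz_lifts_ex[OF f] .
  hence "the_elem {lim_map (ExtRes_sys C R n ?S') (ExtRes_trans C R n ?S')
      (\<lambda>k. Ext_map C R (n + int k) (v k)) (efib n (Dom C f) z)
      | u v. syz_lifts C ?S ?S' f u v} = efib n (Cod C f) (hyper_map C cofinite n R ?S ?S' f z)"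
    using * by (intro the_elem_eqI) (blast, blast)
  thus ?thesis by (simp add: ExtRes_functor_def Let_def A[symmetric])
qed

lemma hyperRes_conn_fib:
  assumes fg: "short_exact C f g" and z: "z \<in> carrier (hyper_grp C cofinite n R (res (Cod C g)))"
  shows "coh_conn (hyperRes_functor C res A) n f g (hfib n (Cod C g) z) =
    hfib (n + 1) (Dom C f) (hyper_conn C cofinite n R (res (Dom C f)) (res (Cod C g)) f g z)"
proof -
  let ?S = "res (Dom C f)" and ?Q = "res (Cod C g)"
  have S: "is_res ?S" "is_res ?Q" and fg': "short_exact C f g" "Dom C f = syz ?S 0" "Cod C g = syz ?Q 0"
    using short_exactD(1,2)[OF fg] fg by auto
  let ?r = "\<lambda>i p k x. gsign (hyperRes_sys C R (n + 1) ?S k) k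
     (hyper_conn C every_degree (n + int k) R (shift_res C k ?S) (shift_res C k ?Q) (i k) (p k) x)"
  have *: "lim_map (hyperRes_sys C R (n + 1) ?S) (hyperRes_trans C R (n + 1) ?S) (?r i p) (hfib n (Cod C g) z) =
    hfib (n + 1) (Dom C f) (hyper_conn C cofinite n R ?S ?Q f g z)" if "horseshoe_syz C ?S ?Q f g i p" for i p
  proof -
    obtain H u w where h: "horseshoe ?S H ?Q f g u w i p" using \<open>horseshoe_syz C ?S ?Q f g i p\<close> horseshoe_syz_iff by auto
    show ?thesis
      by (rule lim_map_fib[OF hyperRes_cone[OF S(2)] hyperRes_cone[OF S(1)] _ z]) (use hat_conn[OF S enough fg' h] in blast)
  qed
  obtain H u w i p where "horseshoe ?S H ?Q f g u w i p" using horseshoe_exists[OF enough S fg'] .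
  hence "horseshoe_syz C ?S ?Q f g i p" using horseshoe_syz_iff by blast
  hence "the_elem {lim_map (hyperRes_sys C R (n + 1) ?S) (hyperRes_trans C R (n + 1) ?S) (?r i p) (hfib n (Cod C g) z)
      | i p. horseshoe_syz C ?S ?Q f g i p} = hfib (n + 1) (Dom C f) (hyper_conn C cofinite n R ?S ?Q f g z)"
    using * by (intro the_elem_eqI) (blast, blast)
  thus ?thesis by (simp add: hyperRes_functor_def Let_def A[symmetric])
qed

lemma ExtRes_conn_fib:
  assumes fg: "short_exact C f g" and z: "z \<in> carrier (hyper_grp C cofinite n R (res (Cod C g)))"
  shows "coh_conn (ExtRes_functor C res A) n f g (efib n (Cod C g) z) =
    efib (n + 1) (Dom C f) (hyper_conn C cofinite n R (res (Dom C f)) (res (Cod C g)) f g z)"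
proof -
  let ?S = "res (Dom C f)" and ?Q = "res (Cod C g)"
  have S: "is_res ?S" "is_res ?Q" and fg': "short_exact C f g" "Dom C f = syz ?S 0" "Cod C g = syz ?Q 0"
    using short_exactD(1,2)[OF fg] fg by auto
  let ?r = "\<lambda>i p k x. gsign (ExtRes_sys C R (n + 1) ?S k) k (Ext_conn C R (n + int k) (i k) (p k) x)"
  have *: "lim_map (ExtRes_sys C R (n + 1) ?S) (ExtRes_trans C R (n + 1) ?S) (?r i p) (efib n (Cod C g) z) =
    efib (n + 1) (Dom C f) (hyper_conn C cofinite n R ?S ?Q f g z)" if "horseshoe_syz C ?S ?Q f g i p" for i p
  proof -
    obtain H u w where h: "horseshoe ?S H ?Q f g u w i p" using \<open>horseshoe_syz C ?S ?Q f g i p\<close> horseshoe_syz_iff by auto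
    show ?thesis
      by (rule lim_map_fib[OF ExtRes_cone[OF S(2)] ExtRes_cone[OF S(1)] _ z]) (use sig_conn[OF S enough fg' h] in blast)
  qed
  obtain H u w i p where "horseshoe ?S H ?Q f g u w i p" using horseshoe_exists[OF enough S fg'] .
  hence "horseshoe_syz C ?S ?Q f g i p" using horseshoe_syz_iff by blast
  hence "the_elem {lim_map (ExtRes_sys C R (n + 1) ?S) (ExtRes_trans C R (n + 1) ?S) (?r i p) (efib n (Cod C g) z)
      | i p. horseshoe_syz C ?S ?Q f g i p} = efib (n + 1) (Dom C f) (hyper_conn C cofinite n R ?S ?Q f g z)"
    using * by (intro the_elem_eqI) (blast, blast)
  thus ?thesis by (simp add: ExtRes_functor_def Let_def A[symmetric])
qed

lemma vartheta_hfib: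
  assumes "B \<in> Obj C" "z \<in> carrier (hyper_grp C cofinite n R (res B))"
  shows "vartheta C res A n B (hfib n B z) = z"
  unfolding vartheta_def A[symmetric] by (rule vartheta_fib[OF is_res_res(1)[OF assms(1)] assms(2)])

text \<open>The cone on Ext is by construction the cone on chain maps after the levelwise
  comparison, so on fibres the map lies over the identity.\<close>

lemma zeta_efib:
  assumes B: "B \<in> Obj C" and z: "z \<in> carrier (hyper_grp C cofinite n R (res B))"
  shows "zeta C res A n B (efib n B z) = hfib n B z"
proof -
  note S = is_res_res(1)[OF B]
  have syz: "syz (shift_res C k (res B)) 0 = syz (res B) k" for k by (simp add: shift_simps)
  have "lim_map (hyperRes_sys C R n (res B)) (hyperRes_trans C R n (res B))
     (\<lambda>k. zeta_level C R (shift_res C k (res B)) (n + int k)) (efib n B z) = hfib n B (id z)"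
    by (rule lim_map_fib[OF ExtRes_cone[OF S] hyperRes_cone[OF S] _ z])
      (use zeta_in[OF is_res_shift[OF S]] in \<open>simp add: ExtRes_sys_def hyperRes_sys_def syz\<close>)
  thus ?thesis by (simp add: zeta_def A[symmetric])
qed

lemma sigma_efib:
  assumes "B \<in> Obj C" "z \<in> carrier (hyper_grp C cofinite n R (res B))"
  shows "sigma C res A n B (efib n B z) = z"
  using zeta_efib[OF assms] vartheta_hfib[OF assms] by (simp add: sigma_def coh_comp_def)

lemma vartheta_isomorphism: "coh_isomorphism C (hyperRes_functor C res A) (completed_hyper_functor C res A) (vartheta C res A)"
  unfolding completed_hyper
  by (rule cone_isomorphism[OF hyper_coh_functor[OF shiftable_cofinite],
        where G = "\<lambda>n B. hyperRes_sys C R n (res B)" and t = "\<lambda>n B. hyperRes_trans C R n (res B)" and s = "\<lambda>n B. hat n (res B)"])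
    (simp_all add: hyper_functor_def hyperRes_cone hyperRes_map_fib hyperRes_conn_fib vartheta_hfib,
     simp add: hyperRes_functor_def Let_def A)

lemma sigma_isomorphism: "coh_isomorphism C (ExtRes_functor C res A) (completed_hyper_functor C res A) (sigma C res A)"
  unfolding completed_hyper
  by (rule cone_isomorphism[OF hyper_coh_functor[OF shiftable_cofinite],
        where G = "\<lambda>n B. ExtRes_sys C R n (res B)" and t = "\<lambda>n B. ExtRes_trans C R n (res B)" and s = "\<lambda>n B. sig n (res B)"])
    (simp_all add: hyper_functor_def ExtRes_cone ExtRes_map_fib ExtRes_conn_fib sigma_efib,
     simp add: ExtRes_functor_def Let_def A)

text \<open>On carriers it equals the inverse of \<open>vartheta\<close> composed with
  \<open>sigma\<close>, and both of these are already known to be morphisms.\<close>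

lemma zeta_morphism: "coh_morphism C (ExtRes_functor C res A) (hyperRes_functor C res A) (zeta C res A)"
proof -
  obtain \<rho> where \<rho>: "coh_morphism C (completed_hyper_functor C res A) (hyperRes_functor C res A) \<rho>"
    and e: "coh_eq C (hyperRes_functor C res A) (coh_comp \<rho> (vartheta C res A)) (\<lambda>n a x. x)"
    using vartheta_isomorphism unfolding coh_isomorphism_def by blast
  have \<sigma>: "coh_morphism C (ExtRes_functor C res A) (completed_hyper_functor C res A) (sigma C res A)"
    using sigma_isomorphism by (simp add: coh_isomorphism_def)
  have "coh_eq C (ExtRes_functor C res A) (coh_comp \<rho> (sigma C res A)) (zeta C res A)"
    unfolding coh_eq_def
  proof (intro allI ballI)
    fix n B x assume B: "B \<in> Obj C" and x: "x \<in> carrier (coh_grp (ExtRes_functor C res A) n B)"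
    note S = is_res_res(1)[OF B]
    obtain z where z: "z \<in> carrier (hyper_grp C cofinite n R (res B))" "x = efib n B z"
      using x limit_cone.lim_carrier[OF ExtRes_cone[OF S, of n]] by (auto simp: ExtRes_functor_def Let_def A[symmetric])
    have "hfib n B z \<in> carrier (coh_grp (hyperRes_functor C res A) n B)"
      using z(1) limit_cone.lim_carrier[OF hyperRes_cone[OF S, of n]] by (simp add: hyperRes_functor_def Let_def A[symmetric])
    hence "\<rho> n B (vartheta C res A n B (hfib n B z)) = hfib n B z" using e B by (simp add: coh_eq_def coh_comp_def)
    thus "coh_comp \<rho> (sigma C res A) n B x = zeta C res A n B x"
      using z sigma_efib[OF B z(1)] zeta_efib[OF B z(1)] vartheta_hfib[OF B z(1)] by (simp add: coh_comp_def)
  qed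
  with coh_morphism_comp[OF \<sigma> \<rho>] show ?thesis by (rule coh_morphism_cong)
qed

end

end

section \<open>The universal property\<close>

text \<open>Equal images under the cone mean equality at a finite stage, and \<open>h\<close> does
  not change along transitions. This yields well-definedness of maps out of the limit.\<close>

lemma (in limit_cone) cocone_factor:
  assumes h: "\<And>k x. x \<in> carrier (G k) \<Longrightarrow> h (Suc k) (t k x) = h k x"
    and x: "x \<in> carrier (G i)" and y: "y \<in> carrier (G j)" and e: "s i x = s j y"
  shows "h i x = h j y"
proof -
  have tr: "k \<le> l \<Longrightarrow> h l (transition t k l z) = h k z" if "z \<in> carrier (G k)" for k l z
    by (induction l rule: dec_induct) (auto simp: transition_Suc h transition_in that)
  have "(j, y) \<in> lim_class G t i x" using y e by (simp add: lim_class_fib[OF x] fib_def)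
  then obtain k where "k \<ge> i" "k \<ge> j" "transition t i k x = transition t j k y" by (auto simp: lim_class_def)
  thus ?thesis using tr[OF x] tr[OF y] by metis
qed

context abelian_category
begin

text \<open>Dimension shifting: both terms of the long exact sequence adjacent to the connecting map
  belong to the projective middle object and vanish.\<close>

lemma projective_conn_bij:
  assumes U: "coh_functor C U" and van: "vanishes_on_projectives C U"
    and fg: "short_exact C f g" and P: "projective C (Cod C f)"
  shows "bij_betw (coh_conn U n f g) (carrier (coh_grp U n (Cod C g))) (carrier (coh_grp U (n + 1) (Dom C f)))"
proof -
  let ?d = "coh_conn U n f g" and ?G = "coh_grp U n (Cod C g)" and ?H = "coh_grp U (n + 1) (Dom C f)"
  note UD = coh_functorD[OF U]
  note [simp] = short_exactD(1-3)[OF fg]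
  have grp: "group (coh_grp U n a)" if "a \<in> Obj C" for n a using comm_group.axioms(2)[OF UD(1)[OF that]] .
  have hom: "group_hom ?G ?H ?d"
    using UD(6)[OF fg] grp by (intro group_hom.intro group_hom_axioms.intro) auto
  have triv: "carrier (coh_grp U n (Cod C f)) = {\<one>\<^bsub>coh_grp U n (Cod C f)\<^esub>}" for n
    using van P by (auto simp: vanishes_on_projectives_def)
  have g1: "coh_map U n g \<one>\<^bsub>coh_grp U n (Cod C f)\<^esub> = \<one>\<^bsub>?G\<^esub>"
    using hom_one[OF UD(2)[of g n]] grp by simp
  have f_in: "coh_map U (n + 1) f y = \<one>\<^bsub>coh_grp U (n + 1) (Cod C f)\<^esub>" if "y \<in> carrier ?H" for y
    using hom_in_carrier[OF UD(2)[of f "n + 1"] that] triv[of "n + 1"] by simp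
  have ker: "x = \<one>\<^bsub>?G\<^esub>" if "x \<in> carrier ?G" "?d x = \<one>\<^bsub>?H\<^esub>" for x
    using UD(9)[OF fg, of n] that triv[of n] g1 by (auto simp: exact_at_def)
  have "inj_on ?d (carrier ?G)"
    using ker by (intro group_hom.inj_on_one_iff[OF hom, THEN iffD2]) auto
  moreover have "?d ` carrier ?G = carrier ?H"
    using UD(10)[OF fg, of n] f_in by (auto simp: exact_at_def)
  ultimately show ?thesis by (simp add: bij_betw_def)
qed

end

context resolved_object
begin

lemma achain_chain: "achain n S \<Phi> \<Longrightarrow> chain F n S \<Phi>"
  by (simp add: chain_def)

text \<open>Nothing is cut off at level 0, so the morphism out of Ext merely regards a chain map as
  an almost chain map.\<close>

lemma sig_0_ecls:
  assumes S: "is_res S" and \<Phi>: "achain n S \<Phi>"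
  shows "sig n S 0 (ecls n S \<Phi>) = cls cofinite n S \<Phi>"
proof -
  have \<Phi>': "achain (n + int 0) (shift_res C 0 S) \<Phi>" using \<Phi> shift_0[OF S] by simp
  have "ext n 0 S \<Phi> j = \<Phi> j" for j
  proof (cases "j \<ge> 0")
    case True
    thus ?thesis by (simp add: ext_def msign_eq)
  next
    case False
    thus ?thesis using S chainD(2-4)[OF \<Phi>] by (intro res_cx_unique[OF S, where j = j]) (auto simp: ext_def)
  qed
  hence "ext n 0 S \<Phi> = \<Phi>" ..
  thus ?thesis using hat_cls[OF S \<Phi>'] zeta_ecls[OF S \<Phi>] by (simp add: shift_0[OF S])
qed

text \<open>The connecting map of the first syzygy sequence trades one level for one syzygy. The
  inductions over levels in the universal property rest on this exchange.\<close>

lemma hat_conn_syz: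
  assumes S: "is_res S" and X: "X \<in> carrier (hyperRes_sys C R n S (Suc k))"
  shows "hyper_conn C cofinite n R (shift_res C 1 S) S (syz_in S 0) (syz_pr S 0) (hat n S (Suc k) X) =
    hat (n + 1) (shift_res C 1 S) k X"
proof -
  let ?S = "shift_res C 1 S"
  have ss: "shift_res C k ?S = shift_res C (Suc k) S" using shift_shift[OF S, of k 1] by simp
  have e: "n + 1 + int k = n + int (Suc k)" by simp
  obtain \<phi> where \<phi>: "achain (n + int (Suc k)) (shift_res C (Suc k) S) \<phi>" "X = acls (n + int (Suc k)) (shift_res C (Suc k) S) \<phi>"
    using X by (rule hyperRes_sysE[OF S])
  have \<phi>': "achain (n + 1 + int k) (shift_res C k ?S) \<phi>" unfolding ss e by (rule \<phi>(1))
  note ec = ext_chain[OF S \<phi>(1)] and ec' = ext_chain[OF is_res_shift[OF S] \<phi>']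
  note hc = hyper_conn_syz[OF S shiftable_cofinite ec]
  have "\<forall>\<^sub>F j in cofinite. conn_id n S (ext n (Suc k) S \<phi>) j = ext (n + 1) k ?S \<phi> j"
  proof (rule eventually_cofinite_int)
    fix m assume m: "m > int k"
    have [simp]: "\<phi> (m - int k) \<in> Arr C" using chainD(2)[OF \<phi>(1)] .
    have "even ((n + m) + int (Suc k) * (n + (m + 1) + 1) - int k * (n + 1 + m + 1))" by (simp add: algebra_simps)
    from msign_cong[OF this, of "\<phi> (m - int k)"] m
    show "conn_id n S (ext n (Suc k) S \<phi>) m = ext (n + 1) k ?S \<phi> m"
      by (simp add: conn_id_def ext_def)
  next
    fix m :: int assume "m < 0"
    thus "conn_id n S (ext n (Suc k) S \<phi>) m = ext (n + 1) k ?S \<phi> m"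
      by (intro res_cx_unique[OF is_res_shift[OF S, of 1], where j = m])
        (use chainD(2-4)[OF hc(2), of m] chainD(2-4)[OF ec', of m] in auto)
  qed
  from cls_cong[OF is_res_shift[OF S] shiftable_cofinite hc(2) ec' this]
  have "hyper_conn C cofinite n R ?S S (syz_in S 0) (syz_pr S 0) (hat n S (Suc k) X) = cls cofinite (n + 1) ?S (ext (n + 1) k ?S \<phi>)"
    unfolding \<phi>(2) hat_cls[OF S \<phi>(1)] hc(1) .
  also have "\<dots> = hat (n + 1) ?S k X"
    using hat_cls[OF is_res_shift[OF S] \<phi>'] unfolding ss e \<phi>(2) by simp
  finally show ?thesis .
qed

text \<open>The shifted system is equal to the tail of the original one, not just isomorphic to it,
  so an element can be reused at a lower level without any transport.\<close>

lemma ExtRes_shift: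
  assumes S: "is_res S"
  shows "ExtRes_sys C R (n + 1) (shift_res C 1 S) k = ExtRes_sys C R n S (Suc k)"
    "ExtRes_trans C R (n + 1) (shift_res C 1 S) k = ExtRes_trans C R n S (Suc k)"
proof -
  have e: "n + 1 + int k = n + int (Suc k)" by simp
  show "ExtRes_sys C R (n + 1) (shift_res C 1 S) k = ExtRes_sys C R n S (Suc k)"
    unfolding ExtRes_sys_def e by (simp add: shift_simps)
  show "ExtRes_trans C R (n + 1) (shift_res C 1 S) k = ExtRes_trans C R n S (Suc k)"
    unfolding ExtRes_trans_def e by (simp add: shift_simps)
qed

lemma sig_conn_syz:
  assumes S: "is_res S" and x: "x \<in> carrier (ExtRes_sys C R n S (Suc k))"
  shows "hyper_conn C cofinite n R (shift_res C 1 S) S (syz_in S 0) (syz_pr S 0) (sig n S (Suc k) x) =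
    sig (n + 1) (shift_res C 1 S) k x"
proof -
  let ?S = "shift_res C (Suc k) S"
  have ss: "shift_res C k (shift_res C 1 S) = ?S" using shift_shift[OF S, of k 1] by simp
  have e: "n + 1 + int k = n + int (Suc k)" by simp
  have syz: "syz ?S 0 = syz S (Suc k)" by (simp add: shift_simps)
  have "zeta_level C R ?S (n + int (Suc k)) x \<in> carrier (hyperRes_sys C R n S (Suc k))"
    using zeta_in[OF is_res_shift[OF S], of x "n + int (Suc k)" "Suc k"] x
    unfolding hyperRes_sys_def ExtRes_sys_def syz by blast
  from hat_conn_syz[OF S this] show ?thesis unfolding ss e .
qed

text \<open>The augmentation splits, and the identity of the object is then covered by a chain map
  concentrated in degree 0. Composing with it acts as the identity on classes, yet produces a family
  that is zero in almost all degrees.\<close>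

lemma hyper_vanishes:
  assumes S: "is_res S" and P: "projective C (syz S 0)"
  shows "carrier (hyper_grp C cofinite n R S) = {\<one>\<^bsub>hyper_grp C cofinite n R S\<^esub>}"
proof -
  note [simp] = S
  interpret G: comm_group "hyper_grp C cofinite n R S" by (rule hyper_group[OF S shiftable_cofinite])
  obtain \<sigma> where \<sigma>: "\<sigma> \<in> Arr C" "Dom C \<sigma> = syz S 0" "Cod C \<sigma> = cx S (int 0)" "syz_pr S 0 \<cdot> \<sigma> = ident C (syz S 0)"
    by (rule syz_pr_lift[OF S P, of "ident C (syz S 0)" 0]) auto
  note [simp] = \<sigma>(1-3)
  \<comment> \<open>The chain condition in degree 1 holds because the augmentation kills the
    differential; outside the degrees 0 and 1 both sides vanish.\<close>
  define c where "c j = (if j = 0 then \<sigma> \<cdot> syz_pr S 0 else mzero C (cx S j) (cx S j))" for j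
  have fam: "fam (cx S) (cx S) c" by (auto simp: fam_def c_def)
  have c: "lifts C S S (ident C (syz S 0)) c"
  proof (rule liftsI[OF fam])
    have "syz_pr S 0 \<cdot> c 0 = (syz_pr S 0 \<cdot> \<sigma>) \<cdot> syz_pr S 0" by (simp add: c_def)
    thus "syz_pr S 0 \<cdot> c 0 = ident C (syz S 0) \<cdot> syz_pr S 0" unfolding \<sigma>(4) .
    fix j
    show "diff S j \<cdot> c j = c (j - 1) \<cdot> diff S j"
    proof (cases "j \<ge> 1")
      case True
      thus ?thesis by (cases "j = 1") (auto simp: c_def)
    next
      case False
      show ?thesis
        by (rule res_cx_unique[OF S, where j = "j - 1"]) (use False famD[OF fam, of j] famD[OF fam, of "j - 1"] in auto)
    qed
  qed
  have "X = \<one>\<^bsub>hyper_grp C cofinite n R S\<^esub>" if X: "X \<in> carrier (hyper_grp C cofinite n R S)" for X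
  proof -
    obtain \<phi> where \<phi>: "chain cofinite n S \<phi>" "X = cls cofinite n S \<phi>" using X by (rule hyperE[OF S shiftable_cofinite])
    note [simp] = chainD(2-4)[OF \<phi>(1)]
    have "X = cls cofinite n S (\<lambda>j. c j \<cdot> \<phi> j)"
      using hyper_map_ident[OF S shiftable_cofinite X] hyper_map_cls[OF S S shiftable_cofinite c \<phi>(1)] \<phi>(2) by simp
    also have "\<dots> = cls cofinite n S (zfam n S)"
      by (rule cls_cong[OF S shiftable_cofinite chain_comp[OF S S c \<phi>(1)] chain_zfam[OF S shiftable_cofinite]])
        (rule eventually_cofinite_int[of _ 0], auto simp: c_def)
    finally show ?thesis by (simp add: hyper_one[OF S shiftable_cofinite])
  qed
  thus ?thesis by auto
qed

end

section \<open>The morphism from Ext to the completion\<close>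

context resolved_category
begin

context
  fixes A assumes A: "R = res A"
begin

lemma completion_map:
  assumes B: "B \<in> Obj C" and x: "x \<in> carrier (Ext_grp C R n B)"
  shows "coh_comp (sigma C res A) (canonical C res A) n B x = sig n (res B) 0 x"
proof -
  note S = is_res_res[OF B]
  interpret L: limit_cone "ExtRes_sys C R n (res B)" "ExtRes_trans C R n (res B)" "hyper_grp C cofinite n R (res B)" "sig n (res B)"
    by (rule ExtRes_cone[OF S(1)])
  have x': "x \<in> carrier (ExtRes_sys C R n (res B) 0)" using x S(2) by (simp add: ExtRes_sys_def)
  have "canonical C res A n B x = L.fib (sig n (res B) 0 x)"
    unfolding canonical_def A[symmetric] by (rule L.lim_class_fib[OF x'])
  thus ?thesis using sigma_efib[OF A B L.s_in[OF x']] by (simp add: coh_comp_def)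
qed

text \<open>In terms of representatives the morphism is the inclusion of chain maps into almost
  chain maps, and both functors use the same formulas for induced and connecting maps; compatibility
  is then immediate.\<close>

lemma completion_morphism:
  "coh_morphism C (Ext_functor C res A) (completed_hyper_functor C res A) (coh_comp (sigma C res A) (canonical C res A))"
  unfolding coh_morphism_def
proof (intro conjI allI impI ballI)
  let ?\<nu> = "coh_comp (sigma C res A) (canonical C res A)"
  show "coh_functor C (Ext_functor C res A)" by (rule Ext_coh_functor[OF A])
  show "coh_functor C (completed_hyper_functor C res A)"
    unfolding completed_hyper[OF A] by (rule hyper_coh_functor[OF shiftable_cofinite])
  have \<nu>: "?\<nu> n B (ecls n (res B) \<Phi>) = cls cofinite n (res B) \<Phi>" if B: "B \<in> Obj C" and \<Phi>: "achain n (res B) \<Phi>" for n B \<Phi>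
    using completion_map[OF B, of "ecls n (res B) \<Phi>" n] ecls_in[OF is_res_res(1)[OF B] \<Phi>]
      sig_0_ecls[OF is_res_res(1)[OF B] \<Phi>] is_res_res(2)[OF B] by simp
  have ex: "\<exists>\<Phi>. achain n (res B) \<Phi> \<and> x = ecls n (res B) \<Phi>" if "B \<in> Obj C" "x \<in> carrier (coh_grp (Ext_functor C res A) n B)" for n B x
    using ExtE[OF is_res_res(1)[OF that(1)], of x n] that(2) is_res_res(2)[OF that(1)] by (auto simp: Ext_functor_def A[symmetric])
  {
    fix n B assume B: "B \<in> Obj C"
    note S = is_res_res[OF B]
    show "?\<nu> n B \<in> hom (coh_grp (Ext_functor C res A) n B) (coh_grp (completed_hyper_functor C res A) n B)"
    proof (rule homI)
      fix x assume "x \<in> carrier (coh_grp (Ext_functor C res A) n B)"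
      then obtain \<Phi> where \<Phi>: "achain n (res B) \<Phi>" "x = ecls n (res B) \<Phi>" using ex[OF B] by blast
      show "?\<nu> n B x \<in> carrier (coh_grp (completed_hyper_functor C res A) n B)"
        unfolding \<Phi>(2) \<nu>[OF B \<Phi>(1)]
        using cls_in[OF S(1) shiftable_cofinite achain_chain[OF \<Phi>(1)]] by (simp add: completed_hyper_functor_def A[symmetric])
      fix y assume "y \<in> carrier (coh_grp (Ext_functor C res A) n B)"
      then obtain \<Psi> where \<Psi>: "achain n (res B) \<Psi>" "y = ecls n (res B) \<Psi>" using ex[OF B] by blast
      note [simp] = chainD(2-4)[OF \<Phi>(1)] chainD(2-4)[OF \<Psi>(1)]
      have "x \<otimes>\<^bsub>coh_grp (Ext_functor C res A) n B\<^esub> y = ecls n (res B) (\<lambda>j. \<Phi> j \<boxplus> \<Psi> j)"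
        using Ext_mult[OF res_syz[OF S(1)] aug_cocycle[OF S(1) \<Phi>(1)] aug_cocycle[OF S(1) \<Psi>(1)]] S
        unfolding \<Phi>(2) \<Psi>(2) by (simp add: Ext_functor_def A[symmetric])
      thus "?\<nu> n B (x \<otimes>\<^bsub>coh_grp (Ext_functor C res A) n B\<^esub> y) =
        ?\<nu> n B x \<otimes>\<^bsub>coh_grp (completed_hyper_functor C res A) n B\<^esub> ?\<nu> n B y"
        unfolding \<Phi>(2) \<Psi>(2) \<nu>[OF B \<Phi>(1)] \<nu>[OF B \<Psi>(1)]
        using \<nu>[OF B chain_add[OF S(1) shiftable_every \<Phi>(1) \<Psi>(1)]]
          hyper_mult[OF S(1) shiftable_cofinite achain_chain[OF \<Phi>(1)] achain_chain[OF \<Psi>(1)]]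
        by (simp add: completed_hyper_functor_def A[symmetric])
    qed
  next
    fix n f x assume f: "f \<in> Arr C" and "x \<in> carrier (coh_grp (Ext_functor C res A) n (Dom C f))"
    then obtain \<Phi> where \<Phi>: "achain n (res (Dom C f)) \<Phi>" "x = ecls n (res (Dom C f)) \<Phi>" using ex[OF Dom_Obj[OF f]] by blast
    let ?S = "res (Dom C f)" and ?S' = "res (Cod C f)"
    have S: "is_res ?S" "is_res ?S'" and f': "f \<in> Arr C" "Dom C f = syz ?S 0" "Cod C f = syz ?S' 0" using f by auto
    obtain u where u: "lifts C ?S ?S' f u" using lifts_exist[OF S f'] .
    have "coh_map (Ext_functor C res A) n f x = ecls n ?S' (\<lambda>j. u j \<cdot> \<Phi> j)"
      using Ext_map_ecls[OF S f' u \<Phi>(1)] unfolding \<Phi>(2) by (simp add: Ext_functor_def A[symmetric])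
    moreover have "coh_map (completed_hyper_functor C res A) n f (cls cofinite n ?S \<Phi>) = cls cofinite n ?S' (\<lambda>j. u j \<cdot> \<Phi> j)"
      using hyper_map_cls[OF S shiftable_cofinite u achain_chain[OF \<Phi>(1)]] by (simp add: completed_hyper_functor_def A[symmetric])
    ultimately show "?\<nu> n (Cod C f) (coh_map (Ext_functor C res A) n f x) =
      coh_map (completed_hyper_functor C res A) n f (?\<nu> n (Dom C f) x)"
      using \<nu>[OF Dom_Obj[OF f] \<Phi>(1)] \<nu>[OF Cod_Obj[OF f] chain_comp[OF S u \<Phi>(1)]] \<Phi>(2) by simp
  next
    fix n f g x assume fg: "short_exact C f g" and "x \<in> carrier (coh_grp (Ext_functor C res A) n (Cod C g))"
    have fgo: "Dom C f \<in> Obj C" "Cod C g \<in> Obj C" using short_exactD(1,2)[OF fg] by auto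
    obtain \<Phi> where \<Phi>: "achain n (res (Cod C g)) \<Phi>" "x = ecls n (res (Cod C g)) \<Phi>"
      using ex[OF fgo(2) \<open>x \<in> _\<close>] by blast
    let ?S = "res (Dom C f)" and ?Q = "res (Cod C g)"
    have S: "is_res ?S" "is_res ?Q" and fg': "short_exact C f g" "Dom C f = syz ?S 0" "Cod C g = syz ?Q 0"
      using fg fgo by auto
    obtain h h1 hs where d: "conn_data ?S ?Q f g h h1 hs" using conn_data_exists[OF S fg'] .
    note c = chain_conn[OF S shiftable_every conn_dataD(9)[OF d] \<Phi>(1)]
    have "coh_conn (Ext_functor C res A) n f g x = ecls (n + 1) ?S (conn_fam n ?S hs \<Phi>)"
      using Ext_conn_ecls[OF S fg' d \<Phi>(1)] unfolding \<Phi>(2) by (simp add: Ext_functor_def A[symmetric])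
    moreover have "coh_conn (completed_hyper_functor C res A) n f g (cls cofinite n ?Q \<Phi>) = cls cofinite (n + 1) ?S (conn_fam n ?S hs \<Phi>)"
      using hyper_conn_cls[OF S shiftable_cofinite fg' d achain_chain[OF \<Phi>(1)]] by (simp add: completed_hyper_functor_def A[symmetric])
    ultimately show "?\<nu> (n + 1) (Dom C f) (coh_conn (Ext_functor C res A) n f g x) =
      coh_conn (completed_hyper_functor C res A) n f g (?\<nu> n (Cod C g) x)"
      using \<nu>[OF fgo(2) \<Phi>(1)] \<nu>[OF fgo(1) c] \<Phi>(2) by simp
  }
qed

lemma completed_vanishes: "vanishes_on_projectives C (completed_hyper_functor C res A)"
  unfolding vanishes_on_projectives_def
proof (intro allI impI)
  fix n B assume P: "projective C B"
  hence "B \<in> Obj C" by (simp add: projective_def)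
  thus "carrier (coh_grp (completed_hyper_functor C res A) n B) = {\<one>\<^bsub>coh_grp (completed_hyper_functor C res A) n B\<^esub>}"
    using hyper_vanishes[of "res B" n] P by (simp add: completed_hyper_functor_def A[symmetric])
qed

end

end

section \<open>Existence and uniqueness of the factorisation\<close>

locale mislin_test = resolved_category +
  fixes A and U :: "('a, 'b, 'u) coh_functor_data" and \<mu>
  assumes A: "R = res A" and \<mu>: "coh_morphism C (Ext_functor C res A) U \<mu>"
    and van: "vanishes_on_projectives C U"
begin

lemma U: "coh_functor C U" using \<mu> by (simp add: coh_morphism_def)

abbreviation "sconn n S \<equiv> coh_conn U n (syz_in S 0) (syz_pr S 0)"
abbreviation "Ugrp n S \<equiv> carrier (coh_grp U n (syz S 0))"
abbreviation "E n S k \<equiv> carrier (ExtRes_sys C R n S k)"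

lemma sconn_bij: "is_res S \<Longrightarrow> bij_betw (sconn n S) (Ugrp n S) (Ugrp (n + 1) (shift_res C 1 S))"
  using projective_conn_bij[OF U van res_exact[of S 0], of n] by (simp add: shift_simps)

text \<open>Compatibility with connecting maps leaves no other choice: climb \<open>k\<close>
  syzygies, apply \<open>\<mu>\<close> there, and return through the inverses of the connecting
  isomorphisms. The recursion replaces the resolution by its shift, so facts about it need induction
  over all resolutions.\<close>

primrec \<tau>_level where
  "\<tau>_level 0 n S x = \<mu> n (syz S 0) x"
| "\<tau>_level (Suc k) n S x = inv_into (Ugrp n S) (sconn n S) (\<tau>_level k (n + 1) (shift_res C 1 S) x)"

lemma \<tau>_level_in: "is_res S \<Longrightarrow> x \<in> E n S k \<Longrightarrow> \<tau>_level k n S x \<in> Ugrp n S"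
proof (induction k arbitrary: n S)
  case 0
  have "\<mu> n (syz S 0) \<in> hom (coh_grp (Ext_functor C res A) n (syz S 0)) (coh_grp U n (syz S 0))"
    using \<mu> 0(1) by (simp add: coh_morphism_def)
  thus ?case using 0 hom_in_carrier by (fastforce simp: ExtRes_sys_def Ext_functor_def A[symmetric])
next
  case (Suc k)
  have "\<tau>_level k (n + 1) (shift_res C 1 S) x \<in> Ugrp (n + 1) (shift_res C 1 S)"
    using Suc.IH[OF is_res_shift[OF Suc.prems(1)]] Suc.prems ExtRes_shift(1)[OF Suc.prems(1)] by simp
  thus ?case using sconn_bij[OF Suc.prems(1), of n] by (simp add: bij_betw_def inv_into_into)
qed

lemma sconn_\<tau>_level:
  assumes S: "is_res S" and x: "x \<in> E n S (Suc k)"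
  shows "sconn n S (\<tau>_level (Suc k) n S x) = \<tau>_level k (n + 1) (shift_res C 1 S) x"
proof -
  have "\<tau>_level k (n + 1) (shift_res C 1 S) x \<in> Ugrp (n + 1) (shift_res C 1 S)"
    using \<tau>_level_in[OF is_res_shift[OF S]] x ExtRes_shift(1)[OF S] by simp
  thus ?thesis using sconn_bij[OF S, of n] by (simp add: bij_betw_def f_inv_into_f)
qed

lemma sconn_inj: "is_res S \<Longrightarrow> y \<in> Ugrp n S \<Longrightarrow> z \<in> Ugrp n S \<Longrightarrow> sconn n S y = sconn n S z \<Longrightarrow> y = z"
  using sconn_bij[of S n] by (auto simp: bij_betw_def inj_on_def)

lemma ExtRes_trans_in: "is_res S \<Longrightarrow> x \<in> E n S k \<Longrightarrow> ExtRes_trans C R n S k x \<in> E n S (Suc k)"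
  using hom_in_carrier[OF limit_cone.t[OF ExtRes_cone]] by blast

text \<open>These maps form a cocone. At level 0 this is compatibility of \<open>\<mu>\<close> with
  the connecting map of a syzygy sequence, and each higher level is a lower level of the shifted
  resolution.\<close>

lemma \<tau>_level_trans:
  "is_res S \<Longrightarrow> x \<in> E n S k \<Longrightarrow> \<tau>_level (Suc k) n S (ExtRes_trans C R n S k x) = \<tau>_level k n S x"
proof (induction k arbitrary: n S)
  case 0
  note S = 0(1)
  have x: "x \<in> carrier (coh_grp (Ext_functor C res A) n (Cod C (syz_pr S 0)))"
    using 0 by (simp add: ExtRes_sys_def Ext_functor_def A[symmetric])
  have "\<mu> (n + 1) (Dom C (syz_in S 0)) (coh_conn (Ext_functor C res A) n (syz_in S 0) (syz_pr S 0) x) =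
     sconn n S (\<mu> n (Cod C (syz_pr S 0)) x)"
    using \<mu> res_exact[OF S] x unfolding coh_morphism_def by blast
  hence "sconn n S (\<tau>_level 0 n S x) = \<tau>_level 0 (n + 1) (shift_res C 1 S) (ExtRes_trans C R n S 0 x)"
    using S by (simp add: ExtRes_trans_def Ext_functor_def A[symmetric] shift_simps)
  hence "sconn n S (\<tau>_level 0 n S x) = sconn n S (\<tau>_level (Suc 0) n S (ExtRes_trans C R n S 0 x))"
    using sconn_\<tau>_level[OF S ExtRes_trans_in[OF S 0(2)]] by simp
  thus ?case using sconn_inj[OF S] \<tau>_level_in[OF S] ExtRes_trans_in[OF S 0(2)] 0(2) by metis
next
  case (Suc k)
  note S = Suc.prems(1)
  show ?case
    using Suc.IH[OF is_res_shift[OF S, of 1], of "n + 1"] Suc.prems(2) ExtRes_shift[OF S] by simp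
qed

text \<open>In the step both sides are compared after the injective connecting map. Naturality of
  \<open>U\<close> for the morphism of first syzygy sequences with components \<open>v 1\<close>,
  \<open>u 0\<close> and \<open>f\<close> reduces the claim to the shifted resolutions.\<close>

lemma \<tau>_level_natural:
  "\<lbrakk>is_res S; is_res S'; f \<in> Arr C; Dom C f = syz S 0; Cod C f = syz S' 0; syz_lifts C S S' f u v; x \<in> E n S k\<rbrakk> \<Longrightarrow>
    coh_map U n f (\<tau>_level k n S x) = \<tau>_level k n S' (Ext_map C R (n + int k) (v k) x)"
proof (induction k arbitrary: n S S' f u v)
  case 0
  have x: "x \<in> carrier (coh_grp (Ext_functor C res A) n (Dom C f))"
    using 0 by (simp add: ExtRes_sys_def Ext_functor_def A[symmetric])
  have "\<mu> n (Cod C f) (coh_map (Ext_functor C res A) n f x) = coh_map U n f (\<mu> n (Dom C f) x)"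
    using \<mu> 0(3) x unfolding coh_morphism_def by blast
  thus ?case using 0 syz_liftsD(2)[OF 0(6)] by (simp add: Ext_functor_def A[symmetric])
next
  case (Suc k)
  note S = Suc.prems(1,2) and f = Suc.prems(3-5) and v = Suc.prems(6) and x = Suc.prems(7)
  let ?S = "shift_res C 1 S" and ?S' = "shift_res C 1 S'"
  note [simp] = S f
  note u = syz_liftsD(1)[OF v] and va = syz_lifts_arr[OF v f]
  have e: "n + int (Suc k) = n + 1 + int k" by simp
  have x': "x \<in> E (n + 1) ?S k" using x ExtRes_shift(1)[OF S(1)] by simp
  have m: "Ext_map C R (n + int (Suc k)) (v (Suc k)) x \<in> E n S' (Suc k)" by (rule sig_map(1)[OF S f v x])
  note t = \<tau>_level_in[OF S(1) x]
  have "sconn n S' (coh_map U n f (\<tau>_level (Suc k) n S x)) = coh_map U (n + 1) (v 1) (sconn n S (\<tau>_level (Suc k) n S x))"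
  proof (rule coh_functorD(7)[OF U res_exact[OF S(1)] res_exact[OF S(2)], symmetric])
    show "v 1 \<in> Hom C (Dom C (syz_in S 0)) (Dom C (syz_in S' 0))" "u 0 \<in> Hom C (Cod C (syz_in S 0)) (Cod C (syz_in S' 0))"
      "f \<in> Hom C (Cod C (syz_pr S 0)) (Cod C (syz_pr S' 0))"
      using va[of 1] liftsD(2-4)[OF u, of 0] by (auto simp: Hom_def)
    show "u 0 \<cdot> syz_in S 0 = syz_in S' 0 \<cdot> v 1" using syz_liftsD(6)[OF v, of 0] by simp
    show "f \<cdot> syz_pr S 0 = syz_pr S' 0 \<cdot> u 0" using liftsD(6)[OF u] by simp
  qed (use t in simp)
  also have "\<dots> = coh_map U (n + 1) (v 1) (\<tau>_level k (n + 1) ?S x)" unfolding sconn_\<tau>_level[OF S(1) x] ..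
  also have "\<dots> = \<tau>_level k (n + 1) ?S' (Ext_map C R (n + 1 + int k) (v (k + 1)) x)"
    by (rule Suc.IH[OF is_res_shift[OF S(1)] is_res_shift[OF S(2)] va(1) _ _ syz_lifts_shift[OF S v f, of 1] x'])
      (auto simp: shift_simps va)
  also have "\<dots> = sconn n S' (\<tau>_level (Suc k) n S' (Ext_map C R (n + int (Suc k)) (v (Suc k)) x))"
    by (subst sconn_\<tau>_level[OF S(2) m]) (simp add: add.assoc)
  finally have eq: "sconn n S' (coh_map U n f (\<tau>_level (Suc k) n S x)) =
      sconn n S' (\<tau>_level (Suc k) n S' (Ext_map C R (n + int (Suc k)) (v (Suc k)) x))" .
  have "coh_map U n f (\<tau>_level (Suc k) n S x) \<in> Ugrp n S'"
    using hom_in_carrier[OF coh_functorD(2)[OF U f(1), of n]] t f by simp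
  thus ?case using sconn_inj[OF S(2) _ \<tau>_level_in[OF S(2) m] eq] by blast
qed

definition \<tau>_res where
  "\<tau>_res n S z = the_elem {\<tau>_level k n S x | k x. x \<in> E n S k \<and> sig n S k x = z}"

lemma \<tau>_res_sig:
  assumes S: "is_res S" and x: "x \<in> E n S k"
  shows "\<tau>_res n S (sig n S k x) = \<tau>_level k n S x"
  unfolding \<tau>_res_def
proof (rule the_elem_eqI)
  show "\<tau>_level k n S x \<in> {\<tau>_level j n S y | j y. y \<in> E n S j \<and> sig n S j y = sig n S k x}" using x by blast
  fix t assume "t \<in> {\<tau>_level j n S y | j y. y \<in> E n S j \<and> sig n S j y = sig n S k x}"
  then obtain j y where y: "y \<in> E n S j" "sig n S j y = sig n S k x" "t = \<tau>_level j n S y" by blast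
  show "t = \<tau>_level k n S x" unfolding y(3)
    by (rule limit_cone.cocone_factor[OF ExtRes_cone[OF S, of n], where h = "\<lambda>k. \<tau>_level k n S"]) (use \<tau>_level_trans[OF S] x y in auto)
qed

text \<open>One extra transition makes the level positive, so that there is always a connecting map
  to peel off.\<close>

lemma sig_surj:
  assumes S: "is_res S" and z: "z \<in> carrier (hyper_grp C cofinite n R S)"
  obtains k x where "x \<in> E n S (Suc k)" "z = sig n S (Suc k) x"
proof -
  interpret L: limit_cone "ExtRes_sys C R n S" "ExtRes_trans C R n S" "hyper_grp C cofinite n R S" "sig n S"
    by (rule ExtRes_cone[OF S])
  obtain k x where x: "x \<in> E n S k" "sig n S k x = z" using L.surj[OF z] by blast
  show ?thesis by (rule that[of "ExtRes_trans C R n S k x" k]) (use L.st[OF x(1)] ExtRes_trans_in[OF S x(1)] x in auto)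
qed

lemma \<tau>_res_in:
  assumes S: "is_res S" and z: "z \<in> carrier (hyper_grp C cofinite n R S)"
  shows "\<tau>_res n S z \<in> Ugrp n S"
proof -
  obtain k x where x: "x \<in> E n S (Suc k)" "z = sig n S (Suc k) x" using sig_surj[OF S z] .
  show ?thesis unfolding x(2) \<tau>_res_sig[OF S x(1)] by (rule \<tau>_level_in[OF S x(1)])
qed

text \<open>The inverse of a connecting isomorphism is additive as well; this is verified by
  applying that isomorphism to both sides.\<close>

lemma \<tau>_level_mult:
  "\<lbrakk>is_res S; x \<in> E n S k; y \<in> E n S k\<rbrakk> \<Longrightarrow>
    \<tau>_level k n S (x \<otimes>\<^bsub>ExtRes_sys C R n S k\<^esub> y) = \<tau>_level k n S x \<otimes>\<^bsub>coh_grp U n (syz S 0)\<^esub> \<tau>_level k n S y"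
proof (induction k arbitrary: n S)
  case 0
  have "\<mu> n (syz S 0) \<in> hom (coh_grp (Ext_functor C res A) n (syz S 0)) (coh_grp U n (syz S 0))"
    using \<mu> 0(1) by (simp add: coh_morphism_def)
  from hom_mult[OF this, of x y] 0 show ?case by (simp add: ExtRes_sys_def Ext_functor_def A[symmetric])
next
  case (Suc k)
  note S = Suc.prems(1) and x = Suc.prems(2) and y = Suc.prems(3)
  let ?S = "shift_res C 1 S" and ?xy = "x \<otimes>\<^bsub>ExtRes_sys C R n S (Suc k)\<^esub> y"
  have xy: "?xy \<in> E n S (Suc k)"
    by (rule monoid.m_closed[OF group.is_monoid[OF limit_cone.G_group[OF ExtRes_cone[OF S]]] x y])
  note tx = \<tau>_level_in[OF S x] and ty = \<tau>_level_in[OF S y]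
  have t: "\<tau>_level (Suc k) n S x \<otimes>\<^bsub>coh_grp U n (syz S 0)\<^esub> \<tau>_level (Suc k) n S y \<in> Ugrp n S"
    using monoid.m_closed[OF group.is_monoid[OF comm_group.axioms(2)[OF coh_functorD(1)[OF U res_syz[OF S]]]] tx ty] .
  have "sconn n S (\<tau>_level (Suc k) n S ?xy) = \<tau>_level k (n + 1) ?S ?xy" by (rule sconn_\<tau>_level[OF S xy])
  also have "\<dots> = \<tau>_level k (n + 1) ?S x \<otimes>\<^bsub>coh_grp U (n + 1) (syz ?S 0)\<^esub> \<tau>_level k (n + 1) ?S y"
    using Suc.IH[OF is_res_shift[OF S, of 1], of "n + 1"] x y ExtRes_shift(1)[OF S] by simp
  also have "\<dots> = sconn n S (\<tau>_level (Suc k) n S x) \<otimes>\<^bsub>coh_grp U (n + 1) (syz ?S 0)\<^esub> sconn n S (\<tau>_level (Suc k) n S y)"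
    unfolding sconn_\<tau>_level[OF S x] sconn_\<tau>_level[OF S y] ..
  also have "\<dots> = sconn n S (\<tau>_level (Suc k) n S x \<otimes>\<^bsub>coh_grp U n (syz S 0)\<^esub> \<tau>_level (Suc k) n S y)"
    using hom_mult[OF coh_functorD(6)[OF U res_exact[OF S], of n 0]] tx ty S by (simp add: shift_simps del: \<tau>_level.simps)
  finally show ?case using sconn_inj[OF S \<tau>_level_in[OF S xy] t] by blast
qed

lemma \<tau>_res_hom:
  assumes S: "is_res S"
  shows "\<tau>_res n S \<in> hom (hyper_grp C cofinite n R S) (coh_grp U n (syz S 0))"
proof (rule homI)
  interpret L: limit_cone "ExtRes_sys C R n S" "ExtRes_trans C R n S" "hyper_grp C cofinite n R S" "sig n S"
    by (rule ExtRes_cone[OF S])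
  fix z w assume z: "z \<in> carrier (hyper_grp C cofinite n R S)"
  show "\<tau>_res n S z \<in> Ugrp n S" by (rule \<tau>_res_in[OF S z])
  assume w: "w \<in> carrier (hyper_grp C cofinite n R S)"
  obtain i x j y where x: "x \<in> E n S i" "sig n S i x = z" and y: "y \<in> E n S j" "sig n S j y = w"
    using L.surj[OF z] L.surj[OF w] by blast
  let ?m = "max i j"
  let ?x = "transition (ExtRes_trans C R n S) i ?m x" and ?y = "transition (ExtRes_trans C R n S) j ?m y"
  have xy: "?x \<in> E n S ?m" "?y \<in> E n S ?m" "sig n S ?m ?x = z" "sig n S ?m ?y = w"
    using L.transition_in[of i ?m x] L.transition_in[of j ?m y] L.s_transition[of i ?m x] L.s_transition[of j ?m y] x y by auto
  have c: "?x \<otimes>\<^bsub>ExtRes_sys C R n S ?m\<^esub> ?y \<in> E n S ?m"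
    by (rule monoid.m_closed[OF group.is_monoid[OF L.G_group] xy(1,2)])
  have "sig n S ?m (?x \<otimes>\<^bsub>ExtRes_sys C R n S ?m\<^esub> ?y) = z \<otimes>\<^bsub>hyper_grp C cofinite n R S\<^esub> w"
    using hom_mult[OF L.s xy(1,2)] xy(3,4) by simp
  thus "\<tau>_res n S (z \<otimes>\<^bsub>hyper_grp C cofinite n R S\<^esub> w) = \<tau>_res n S z \<otimes>\<^bsub>coh_grp U n (syz S 0)\<^esub> \<tau>_res n S w"
    using \<tau>_res_sig[OF S c] \<tau>_res_sig[OF S xy(1)] \<tau>_res_sig[OF S xy(2)] \<tau>_level_mult[OF S xy(1,2)] xy(3,4) by simp
qed

lemma \<tau>_res_natural:
  assumes S: "is_res S" "is_res S'" and f: "f \<in> Arr C" "Dom C f = syz S 0" "Cod C f = syz S' 0"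
    and z: "z \<in> carrier (hyper_grp C cofinite n R S)"
  shows "\<tau>_res n S' (hyper_map C cofinite n R S S' f z) = coh_map U n f (\<tau>_res n S z)"
proof -
  obtain u where u: "lifts C S S' f u" using lifts_exist[OF S f] .
  obtain v where v: "syz_lifts C S S' f u v" using syz_lifts_exist[OF S u f] .
  obtain k x where x: "x \<in> E n S (Suc k)" "z = sig n S (Suc k) x" using sig_surj[OF S(1) z] .
  note m = sig_map[OF S f v x(1)]
  show ?thesis unfolding x(2) m(2)[symmetric] \<tau>_res_sig[OF S(1) x(1)] \<tau>_res_sig[OF S(2) m(1)]
    by (rule \<tau>_level_natural[OF S f v x(1), symmetric])
qed

text \<open>Every short exact sequence receives a map from the first syzygy sequence of its right end, so
  compatibility with connecting maps need only be checked on syzygy sequences.\<close>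

lemma hyper_conn_from_syz:
  assumes S: "is_res S" "is_res Q" and fg: "short_exact C f g" "Dom C f = syz S 0" "Cod C g = syz Q 0"
  obtains h1 where "h1 \<in> Arr C" "Dom C h1 = syz (shift_res C 1 Q) 0" "Cod C h1 = syz S 0"
    "\<And>n z. z \<in> carrier (hyper_grp C cofinite n R Q) \<Longrightarrow> hyper_conn C cofinite n R S Q f g z =
      hyper_map C cofinite (n + 1) R (shift_res C 1 Q) S h1 (hyper_conn C cofinite n R (shift_res C 1 Q) Q (syz_in Q 0) (syz_pr Q 0) z)"
    "\<And>n y. y \<in> Ugrp n Q \<Longrightarrow> coh_conn U n f g y = coh_map U (n + 1) h1 (sconn n Q y)"
proof -
  obtain h h1 hs where d: "conn_data S Q f g h h1 hs" using conn_data_exists[OF S fg] .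
  note [simp] = S fg(2,3) short_exactD(1-3)[OF fg(1)] conn_dataD(1-3,5-7)[OF d]
  have abc: "h1 \<in> Hom C (Dom C (syz_in Q 0)) (Dom C f)" "h \<in> Hom C (Cod C (syz_in Q 0)) (Cod C f)"
    "ident C (syz Q 0) \<in> Hom C (Cod C (syz_pr Q 0)) (Cod C g)" "h \<cdot> syz_in Q 0 = f \<cdot> h1" "ident C (syz Q 0) \<cdot> syz_pr Q 0 = g \<cdot> h"
    using conn_dataD(4,8)[OF d] by (auto simp: Hom_def)
  have D: "Dom C (syz_in Q 0) = syz (shift_res C 1 Q) 0" "Cod C (syz_pr Q 0) = syz Q 0" by (auto simp: shift_simps)
  show ?thesis
  proof (rule that[of h1])
    fix n z assume z: "z \<in> carrier (hyper_grp C cofinite n R Q)"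
    show "hyper_conn C cofinite n R S Q f g z = hyper_map C cofinite (n + 1) R (shift_res C 1 Q) S h1
      (hyper_conn C cofinite n R (shift_res C 1 Q) Q (syz_in Q 0) (syz_pr Q 0) z)"
      using hyper_conn_natural[OF is_res_shift[OF S(2), of 1] S(2) S shiftable_cofinite res_exact[OF S(2), of 0] D fg abc z]
        hyper_map_ident[OF S(2) shiftable_cofinite z] by simp
  next
    fix n y assume y: "y \<in> Ugrp n Q"
    show "coh_conn U n f g y = coh_map U (n + 1) h1 (sconn n Q y)"
      using coh_functorD(7)[OF U res_exact[OF S(2), of 0] fg(1) abc, of y n] y coh_functorD(3)[OF U _ y] by simp
  qed (auto simp: shift_simps)
qed

text \<open>After the reduction to a syzygy sequence, the connecting map lowers the level of
  \<open>x\<close> by one on the hypercohomology side, while on the side of \<open>U\<close> it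
  cancels the outermost inverse in \<open>\<tau>_level\<close>.\<close>

lemma \<tau>_res_conn:
  assumes S: "is_res S" "is_res Q" and fg: "short_exact C f g" "Dom C f = syz S 0" "Cod C g = syz Q 0"
    and z: "z \<in> carrier (hyper_grp C cofinite n R Q)"
  shows "\<tau>_res (n + 1) S (hyper_conn C cofinite n R S Q f g z) = coh_conn U n f g (\<tau>_res n Q z)"
proof -
  let ?Q = "shift_res C 1 Q"
  obtain h1 where h1: "h1 \<in> Arr C" "Dom C h1 = syz ?Q 0" "Cod C h1 = syz S 0"
    and hz: "hyper_conn C cofinite n R S Q f g z = hyper_map C cofinite (n + 1) R ?Q S h1
      (hyper_conn C cofinite n R ?Q Q (syz_in Q 0) (syz_pr Q 0) z)"
    and Uy: "\<And>y. y \<in> Ugrp n Q \<Longrightarrow> coh_conn U n f g y = coh_map U (n + 1) h1 (sconn n Q y)"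
    using hyper_conn_from_syz[OF S fg] z by metis
  obtain k x where x: "x \<in> E n Q (Suc k)" "z = sig n Q (Suc k) x" using sig_surj[OF S(2) z] .
  have x': "x \<in> E (n + 1) ?Q k" using x(1) ExtRes_shift(1)[OF S(2)] by simp
  note Q' = is_res_shift[OF S(2), of 1]
  have c: "hyper_conn C cofinite n R ?Q Q (syz_in Q 0) (syz_pr Q 0) z = sig (n + 1) ?Q k x"
    unfolding x(2) by (rule sig_conn_syz[OF S(2) x(1)])
  have "sig (n + 1) ?Q k x \<in> carrier (hyper_grp C cofinite (n + 1) R ?Q)"
    by (rule limit_cone.s_in[OF ExtRes_cone[OF Q'] x'])
  hence "\<tau>_res (n + 1) S (hyper_conn C cofinite n R S Q f g z) = coh_map U (n + 1) h1 (\<tau>_level k (n + 1) ?Q x)"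
    unfolding hz c using \<tau>_res_natural[OF Q' S(1) h1] \<tau>_res_sig[OF Q' x'] by simp
  also have "\<dots> = coh_conn U n f g (\<tau>_level (Suc k) n Q x)"
    unfolding Uy[OF \<tau>_level_in[OF S(2) x(1)]] sconn_\<tau>_level[OF S(2) x(1)] ..
  finally show ?thesis unfolding x(2) \<tau>_res_sig[OF S(2) x(1)] .
qed

lemma factorisation:
  "\<exists>\<tau>. coh_morphism C (completed_hyper_functor C res A) U \<tau> \<and>
     coh_eq C (Ext_functor C res A) (coh_comp \<tau> (coh_comp (sigma C res A) (canonical C res A))) \<mu>"
proof (intro exI conjI)
  let ?\<tau> = "\<lambda>n B. \<tau>_res n (res B)"
  show "coh_morphism C (completed_hyper_functor C res A) U ?\<tau>"
    unfolding completed_hyper[OF A] coh_morphism_def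
  proof (intro conjI allI impI ballI)
    fix n B assume "B \<in> Obj C"
    thus "?\<tau> n B \<in> hom (coh_grp (hyper_functor cofinite) n B) (coh_grp U n B)"
      using \<tau>_res_hom[of "res B" n] by (simp add: hyper_functor_def)
  next
    fix n f x assume "f \<in> Arr C" "x \<in> carrier (coh_grp (hyper_functor cofinite) n (Dom C f))"
    thus "?\<tau> n (Cod C f) (coh_map (hyper_functor cofinite) n f x) = coh_map U n f (?\<tau> n (Dom C f) x)"
      using \<tau>_res_natural[of "res (Dom C f)" "res (Cod C f)" f x n] by (simp add: hyper_functor_def)
  next
    fix n f g x assume fg: "short_exact C f g" and x: "x \<in> carrier (coh_grp (hyper_functor cofinite) n (Cod C g))"
    thus "?\<tau> (n + 1) (Dom C f) (coh_conn (hyper_functor cofinite) n f g x) = coh_conn U n f g (?\<tau> n (Cod C g) x)"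
      using \<tau>_res_conn[of "res (Dom C f)" "res (Cod C g)" f g x n] short_exactD(1,2)[OF fg] by (simp add: hyper_functor_def)
  qed (use U hyper_coh_functor in auto)
  show "coh_eq C (Ext_functor C res A) (coh_comp ?\<tau> (coh_comp (sigma C res A) (canonical C res A))) \<mu>"
    unfolding coh_eq_def
  proof (intro allI ballI)
    fix n B x assume B: "B \<in> Obj C" and "x \<in> carrier (coh_grp (Ext_functor C res A) n B)"
    hence x: "x \<in> carrier (Ext_grp C R n B)" by (simp add: Ext_functor_def A[symmetric])
    hence "x \<in> E n (res B) 0" using B by (simp add: ExtRes_sys_def)
    thus "coh_comp ?\<tau> (coh_comp (sigma C res A) (canonical C res A)) n B x = \<mu> n B x"
      using completion_map[OF A B x] \<tau>_res_sig[OF is_res_res(1)[OF B], of x n 0] B by (simp add: coh_comp_def)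
  qed
qed

text \<open>Induction over the level of a representative: at level 0 the class comes from Ext, where
  both morphisms induce \<open>\<mu>\<close>; at higher levels the injective connecting maps of
  \<open>U\<close> reduce the claim to one syzygy further on.\<close>

lemma factorisation_unique:
  assumes \<tau>: "coh_morphism C (completed_hyper_functor C res A) U \<tau>"
      "coh_eq C (Ext_functor C res A) (coh_comp \<tau> (coh_comp (sigma C res A) (canonical C res A))) \<mu>"
    and \<tau>': "coh_morphism C (completed_hyper_functor C res A) U \<tau>'"
      "coh_eq C (Ext_functor C res A) (coh_comp \<tau>' (coh_comp (sigma C res A) (canonical C res A))) \<mu>"
  shows "coh_eq C (completed_hyper_functor C res A) \<tau> \<tau>'"
proof -
  note \<tau>h = \<tau>(1)[unfolded completed_hyper[OF A]] and \<tau>h' = \<tau>'(1)[unfolded completed_hyper[OF A]]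
  \<comment> \<open>The given morphisms are evaluated at the chosen resolutions only, whereas the
    induction meets shifted ones; this comparison map carries a class from \<open>S\<close> to the
    chosen resolution of the same object.\<close>
  let ?c = "\<lambda>n S. hyper_map C cofinite n R S (res (syz S 0)) (ident C (syz S 0))"
  have c_in: "?c n S z \<in> carrier (hyper_grp C cofinite n R (res (syz S 0)))"
    if "is_res S" "z \<in> carrier (hyper_grp C cofinite n R S)" for n S z
    using hom_in_carrier[OF hyper_map_hom[of S "res (syz S 0)" cofinite "ident C (syz S 0)" n] that(2)] that(1) by simp
  have \<tau>_in: "\<sigma> n B z \<in> carrier (coh_grp U n B)"
    if "coh_morphism C (hyper_functor cofinite) U \<sigma>" "B \<in> Obj C" "z \<in> carrier (hyper_grp C cofinite n R (res B))" for \<sigma> n B z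
  proof -
    have "\<sigma> n B \<in> hom (coh_grp (hyper_functor cofinite) n B) (coh_grp U n B)" using that(1,2) by (simp add: coh_morphism_def)
    from hom_in_carrier[OF this, of z] that(3) show ?thesis by (simp add: hyper_functor_def)
  qed
  have key: "is_res S \<Longrightarrow> x \<in> E n S k \<Longrightarrow> \<tau> n (syz S 0) (?c n S (sig n S k x)) = \<tau>' n (syz S 0) (?c n S (sig n S k x))" for k n S x
  proof (induction k arbitrary: n S)
    case 0
    note S = 0(1)
    let ?B = "syz S 0"
    have B: "?B \<in> Obj C" "is_res (res ?B)" "syz (res ?B) 0 = ?B" using S by auto
    have id: "ident C ?B \<in> Arr C" "Dom C (ident C ?B) = syz S 0" "Cod C (ident C ?B) = syz (res ?B) 0" using B by auto
    obtain u where u: "lifts C S (res ?B) (ident C ?B) u" using lifts_exist[OF S B(2) id] .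
    obtain v where v: "syz_lifts C S (res ?B) (ident C ?B) u v" using syz_lifts_exist[OF S B(2) u id] .
    have x: "x \<in> carrier (Ext_grp C R n ?B)" using 0(2) by (simp add: ExtRes_sys_def)
    have "Ext_map C R n (ident C ?B) x = x"
      using coh_functorD(3)[OF Ext_coh_functor[OF A] B(1), of x n] x by (simp add: Ext_functor_def A[symmetric])
    hence "?c n S (sig n S 0 x) = sig n (res ?B) 0 x"
      using sig_map(2)[OF S B(2) id v 0(2)] syz_liftsD(2)[OF v] by simp
    also have "\<dots> = coh_comp (sigma C res A) (canonical C res A) n ?B x" by (rule completion_map[OF A B(1) x, symmetric])
    finally show ?case using \<tau>(2) \<tau>'(2) B(1) x by (simp add: coh_eq_def coh_comp_def Ext_functor_def A[symmetric])
  next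
    case (Suc k)
    note S = Suc.prems(1) and x = Suc.prems(2)
    let ?B = "syz S 0" and ?S = "shift_res C 1 S" and ?z = "sig n S (Suc k) x"
    let ?B1 = "syz ?S 0"
    note S1 = is_res_shift[OF S, of 1]
    have B: "?B \<in> Obj C" "is_res (res ?B)" "syz (res ?B) 0 = ?B" "?B1 \<in> Obj C" "is_res (res ?B1)" "syz (res ?B1) 0 = ?B1"
      using S S1 by (auto simp del: is_res_shift)
    have x1: "x \<in> E (n + 1) ?S k" using x ExtRes_shift(1)[OF S] by simp
    have z: "?z \<in> carrier (hyper_grp C cofinite n R S)" by (rule limit_cone.s_in[OF ExtRes_cone[OF S] x])
    have D: "Dom C (syz_in S 0) = syz ?S 0" "Cod C (syz_pr S 0) = syz S 0" using S by (auto simp: shift_simps)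
    have D': "Dom C (syz_in S 0) = syz (res ?B1) 0" "Cod C (syz_pr S 0) = syz (res ?B) 0" using D B by auto
    \<comment> \<open>Naturality for the identity of the syzygy sequence, whose ends are resolved on
      one side by \<open>S\<close> and its shift and on the other by the chosen resolutions.\<close>
    have "?c (n + 1) ?S (hyper_conn C cofinite n R ?S S (syz_in S 0) (syz_pr S 0) ?z) =
      hyper_conn C cofinite n R (res ?B1) (res ?B) (syz_in S 0) (syz_pr S 0) (?c n S ?z)"
      by (rule hyper_conn_natural[OF S1 S B(5) B(2) shiftable_cofinite res_exact[OF S] D res_exact[OF S] D',
            where b = "ident C (cx S 0)", OF _ _ _ _ _ z]) (use S B D in \<open>auto simp: Hom_def\<close>)
    hence cc: "hyper_conn C cofinite n R (res ?B1) (res ?B) (syz_in S 0) (syz_pr S 0) (?c n S ?z) = ?c (n + 1) ?S (sig (n + 1) ?S k x)"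
      unfolding sig_conn_syz[OF S x] by simp
    have \<sigma>: "sconn n S (\<sigma> n ?B (?c n S ?z)) = \<sigma> (n + 1) ?B1 (?c (n + 1) ?S (sig (n + 1) ?S k x))"
      if \<sigma>: "coh_morphism C (hyper_functor cofinite) U \<sigma>" for \<sigma>
    proof -
      have "?c n S ?z \<in> carrier (coh_grp (hyper_functor cofinite) n (Cod C (syz_pr S 0)))"
        using c_in[OF S z] D by (simp add: hyper_functor_def)
      hence "\<sigma> (n + 1) (Dom C (syz_in S 0)) (coh_conn (hyper_functor cofinite) n (syz_in S 0) (syz_pr S 0) (?c n S ?z)) =
        sconn n S (\<sigma> n (Cod C (syz_pr S 0)) (?c n S ?z))"
        using \<sigma> res_exact[OF S] unfolding coh_morphism_def by blast
      thus ?thesis using cc unfolding D by (simp add: hyper_functor_def D)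
    qed
    have "sconn n S (\<tau> n ?B (?c n S ?z)) = sconn n S (\<tau>' n ?B (?c n S ?z))"
      unfolding \<sigma>[OF \<tau>h] \<sigma>[OF \<tau>h'] by (rule Suc.IH[OF S1 x1])
    from sconn_inj[OF S \<tau>_in[OF \<tau>h B(1) c_in[OF S z]] \<tau>_in[OF \<tau>h' B(1) c_in[OF S z]] this] show ?case .
  qed
  show ?thesis unfolding coh_eq_def
  proof (intro allI ballI)
    fix n B z assume B: "B \<in> Obj C" and "z \<in> carrier (coh_grp (completed_hyper_functor C res A) n B)"
    hence z: "z \<in> carrier (hyper_grp C cofinite n R (res B))" by (simp add: completed_hyper_functor_def A[symmetric])
    note S = is_res_res[OF B]
    obtain k x where x: "x \<in> E n (res B) (Suc k)" "z = sig n (res B) (Suc k) x" using sig_surj[OF S(1) z] .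
    have "?c n (res B) z = z" using hyper_map_ident[OF S(1) shiftable_cofinite z] S(2) by simp
    thus "\<tau> n B z = \<tau>' n B z" using key[OF S(1) x(1)] x(2) S(2) by simp
  qed
qed

end

theorem theorem6p18:
  fixes C :: "('o, 'm) category_data"
    and res :: "'o \<Rightarrow> ('o, 'm) resolution"
    and A :: 'o
  assumes "abelian_category C"
    and "enough_projectives C"
    and "\<And>M. M \<in> Obj C \<Longrightarrow> proj_resolution C M (res M)"
    and "A \<in> Obj C"
  shows "mislin_completion TYPE('u) C (Ext_functor C res A) (completed_hyper_functor C res A)
           (coh_comp (sigma C res A) (canonical C res A)) \<and>
         coh_morphism C (ExtRes_functor C res A) (hyperRes_functor C res A) (zeta C res A) \<and>
         coh_morphism C (hyperRes_functor C res A) (completed_hyper_functor C res A)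
           (vartheta C res A) \<and>
         coh_isomorphism C (ExtRes_functor C res A) (completed_hyper_functor C res A)
           (sigma C res A)"
proof -
  interpret abelian_category C by (rule assms(1))
  have rc: "resolved_category C (res A) res"
    using assms(2-4) proj_resolution_is_res by unfold_locales blast+
  interpret resolved_category C "res A" res by (rule rc)
  have "mislin_completion TYPE('u) C (Ext_functor C res A) (completed_hyper_functor C res A)
      (coh_comp (sigma C res A) (canonical C res A))"
    unfolding mislin_completion_def
  proof (intro conjI allI impI)
    fix U :: "('o, 'm, 'u) coh_functor_data" and \<mu>
    assume "coh_morphism C (Ext_functor C res A) U \<mu> \<and> vanishes_on_projectives C U"
    then interpret mislin_test C "res A" res A U \<mu> by unfold_locales auto
    show "\<exists>\<tau>. coh_morphism C (completed_hyper_functor C res A) U \<tau> \<and>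
      coh_eq C (Ext_functor C res A) (coh_comp \<tau> (coh_comp (sigma C res A) (canonical C res A))) \<mu>"
      by (rule factorisation)
    show "coh_eq C (completed_hyper_functor C res A) \<tau> \<tau>'"
      if "coh_morphism C (completed_hyper_functor C res A) U \<tau> \<and>
        coh_eq C (Ext_functor C res A) (coh_comp \<tau> (coh_comp (sigma C res A) (canonical C res A))) \<mu> \<and>
        coh_morphism C (completed_hyper_functor C res A) U \<tau>' \<and>
        coh_eq C (Ext_functor C res A) (coh_comp \<tau>' (coh_comp (sigma C res A) (canonical C res A))) \<mu>" for \<tau> \<tau>'
      using that factorisation_unique by blast
  qed (rule completion_morphism[OF refl] completed_vanishes[OF refl])+
  thus ?thesis using zeta_morphism[OF refl] vartheta_isomorphism[OF refl] sigma_isomorphism[OF refl]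
    by (simp add: coh_isomorphism_def)
qed

end
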